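(* Let $c>1$ and $p=2\log c$. The parametrization $$L^\infty(0,p/2)\supseteq B(0,1/2)\ni\Psi\mapsto f\in\mathcal{M}_c,\qquad f(z)=\sqrt{z}\exp\left\{\int_{0}^{p/2}\Psi(\lambda)E_{p}(\lambda;z)\,d\lambda\right\},$$ is order-preserving (i.e., if $\Psi_1\le\Psi_2$ a.e. on $(0,p/2)$, then the corresponding $f_1,f_2$ satisfy $f_1(x)\le f_2(x)$ for all $x>0$), and therefore any $f\in\mathcal{M}_c$ lies between the minimal and the maximal elements of $\mathcal{M}_c$: for all $x>0$, $$f_{\min}(x)=\sqrt{x}\,e^{-\frac{1}{2}\int_{0}^{p/2}E_{p}(\lambda;x)d\lambda}\le f(x)\le\sqrt{x}\,e^{\frac{1}{2}\int_{0}^{p/2}E_{p}(\lambda;x)d\lambda}=f_{\max}(x).$$ Moreover, for $x>0$, $$f_{\min}(x)=\frac{\sqrt{x}}{\sqrt{m}+1}\left(\mathrm{dn}\left(\frac{K'(m)\log x}{\pi},m\right)+\sqrt{m}\,\mathrm{cn}\left(\frac{K'(m)\log x}{\pi},m\right)\right),\qquad f_{\min}\in\mathcal{M}_c,$$ $$f_{\max}(x)=\frac{x}{f_{\min}(x)}=\frac{(\sqrt{m}+1)\sqrt{x}}{\mathrm{dn}\left(\frac{K'(m)\log x}{\pi},m\right)+\sqrt{m}\,\mathrm{cn}\left(\frac{K'(m)\log x}{\pi},m\right)},\qquad f_{\max}\in\mathcal{M}_c,$$ where $m\in(0,1)$ is the unique solution of $4\pi K(m)/K'(m)=p=2\log c$.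 Also, for every $x>0$, $$\inf_{f\in\mathcal{M}}f(x)=f_{!}(x),\qquad\sup_{f\in\mathcal{M}}f(x)=f_{\nabla}(x),$$ where $f_{\nabla}(x)=\frac12(1+x)$ and $f_{!}(x)=\frac{2x}{1+x}$.
   Context: $OM_+$ denotes the class of all analytic functions $f:\mathbb{C}\setminus(-\infty,0]\to\mathbb{C}$ with $f(x)\ge 0$ for real $x>0$ and $\operatorname{Im} f(z)\ge 0$ whenever $\operatorname{Im} z>0$. For a positive scalar $c\ne1$, $\mathcal{M}_c$ is the set of all $f\in OM_+$ such that $f(1)=1$, $xf(1/x)=f(x)$ for all $x>0$, and $f(c^2x)=cf(x)$ for all $x>0$; and $\mathcal{M}=\bigcup_{c\in(0,\infty)\setminus\{1\}}\mathcal{M}_c$. $\sqrt{z}=e^{\frac12\log z}$ with $\log$ the principal branch on $\mathbb{C}\setminus(-\infty,0]$. $B(0,1/2)\subseteq L^\infty(0,p/2)$ is the closed ball of radius $1/2$ centered at $0$ in the Banach space of real-valued $L^\infty$ functions on $(0,p/2)$. For $p>0$ and $z\in\mathbb{C}\setminus(-\infty,0]$, $$E_{p}(\lambda;z)=\sum_{n\in\mathbb{Z}}\frac{(z-1)^{2}(e^{\lambda+pn}-1)}{(e^{\lambda+pn}+1)(z+e^{\lambda+pn})(z+e^{-(\lambda+pn)})}.$$ With $p=2\log c$, the displayed map $\Psi\mapsto f$ is a parametrization of $\mathcal{M}_c$, i.e., a bijection of $B(0,1/2)$ onto $\mathcal{M}_c$. $\mathrm{cn}(u,m)$ and $\mathrm{dn}(u,m)$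 are the Jacobi elliptic cosine and delta functions with parameter $m$ (modulus $k=\sqrt m$), $K(m)=\int_0^{\pi/2}(1-m\sin^2\theta)^{-1/2}d\theta$ is the complete elliptic integral of the first kind, and $K'(m)=K(1-m)$. *)

theory Defs
  imports
    "HOL-Complex_Analysis.Complex_Analysis"
    "HOL-Probability.Essential_Supremum"
begin

text \<open>
  Functions on the slit plane are total functions \<^typ>\<open>complex \<Rightarrow> complex\<close> whose values on
  \<^term>\<open>\<real>\<^sub>\<le>\<^sub>0 :: complex set\<close> are irrelevant; two of them represent the same element
  of the classes below iff they agree on \<^term>\<open>- \<real>\<^sub>\<le>\<^sub>0 :: complex set\<close>.
\<close>

definition OM_plus :: "(complex \<Rightarrow> complex) set" where
  "OM_plus = {f. f analytic_on (- \<real>\<^sub>\<le>\<^sub>0) \<and>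
     (\<forall>x::real. x > 0 \<longrightarrow> f (of_real x) \<in> \<real>\<^sub>\<ge>\<^sub>0) \<and>
     (\<forall>z. Im z > 0 \<longrightarrow> Im (f z) \<ge> 0)}"

definition M_class :: "real \<Rightarrow> (complex \<Rightarrow> complex) set" where
  "M_class c = {f \<in> OM_plus. f 1 = 1 \<and>
     (\<forall>x::real. x > 0 \<longrightarrow> of_real x * f (of_real (1 / x)) = f (of_real x)) \<and>
     (\<forall>x::real. x > 0 \<longrightarrow> f (of_real (c\<^sup>2 * x)) = of_real c * f (of_real x))}"

definition M_all :: "(complex \<Rightarrow> complex) set" where
  "M_all = (\<Union>c \<in> {0<..} - {1}. M_class c)"

text \<open>
  Representatives of the closed ball of radius \<open>r\<close> about \<open>0\<close> in the real space
  \<open>L\<^sup>\<infinity>(0, a)\<close>; two representatives give the same element iff they are equal almost everywhere.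
\<close>

definition Linf_ball :: "real \<Rightarrow> real \<Rightarrow> (real \<Rightarrow> real) set" where
  "Linf_ball a r = {\<Psi> \<in> borel_measurable (lebesgue_on {0<..<a}).
     esssup (lebesgue_on {0<..<a}) (\<lambda>x. ereal \<bar>\<Psi> x\<bar>) \<le> ereal r}"

definition E_kernel :: "real \<Rightarrow> real \<Rightarrow> complex \<Rightarrow> complex" where
  "E_kernel p l z = (\<Sum>\<^sub>\<infinity>n::int.
     (z - 1)\<^sup>2 * (exp (of_real (l + p * of_int n)) - 1) /
     ((exp (of_real (l + p * of_int n)) + 1) *
      (z + exp (of_real (l + p * of_int n))) *
      (z + exp (- of_real (l + p * of_int n)))))"

definition M_param :: "real \<Rightarrow> (real \<Rightarrow> real) \<Rightarrow> complex \<Rightarrow> complex" where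
  "M_param p \<Psi> z =
     csqrt z * exp (\<integral>l. of_real (\<Psi> l) * E_kernel p l z \<partial>lebesgue_on {0<..<p / 2})"

definition f_min :: "real \<Rightarrow> complex \<Rightarrow> complex" where
  "f_min p z = csqrt z * exp (- (1 / 2) * (\<integral>l. E_kernel p l z \<partial>lebesgue_on {0<..<p / 2}))"

definition f_max :: "real \<Rightarrow> complex \<Rightarrow> complex" where
  "f_max p z = csqrt z * exp ((1 / 2) * (\<integral>l. E_kernel p l z \<partial>lebesgue_on {0<..<p / 2}))"

text \<open>
  Elliptic integrals and Jacobi functions are given for real argument and parameter
  \<open>0 < m < 1\<close>.  The interval integral is oriented, so the incomplete integral is an odd
  increasing bijection of the reals, and the amplitude is its inverse.
\<close>

definition elliptic_F :: "real \<Rightarrow> real \<Rightarrow> real" where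
  "elliptic_F \<phi> m = (LBINT \<theta>=0..ereal \<phi>. 1 / sqrt (1 - m * (sin \<theta>)\<^sup>2))"

definition elliptic_K :: "real \<Rightarrow> real" where
  "elliptic_K m = elliptic_F (pi / 2) m"

definition elliptic_K' :: "real \<Rightarrow> real" where
  "elliptic_K' m = elliptic_K (1 - m)"

definition jacobi_am :: "real \<Rightarrow> real \<Rightarrow> real" where
  "jacobi_am u m = (THE \<phi>. elliptic_F \<phi> m = u)"

definition jacobi_cn :: "real \<Rightarrow> real \<Rightarrow> real" where
  "jacobi_cn u m = cos (jacobi_am u m)"

definition jacobi_dn :: "real \<Rightarrow> real \<Rightarrow> real" where
  "jacobi_dn u m = sqrt (1 - m * (sin (jacobi_am u m))\<^sup>2)"

end

theory Submission
  imports Defs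
begin

text \<open>
  In the coordinate \<open>z = exp t\<close> the slit plane becomes the strip \<open>\<bar>Im t\<bar> < pi\<close>, and with
  \<open>F t = Ln (f (exp t)) - t / 2\<close> the class becomes the set of all even, \<open>p\<close>-periodic holomorphic
  functions on the strip that are real on the real axis, vanish at \<open>0\<close> and satisfy
  \<open>\<bar>Im F\<bar> \<le> Im t / 2\<close> in the upper half. The kernel becomes
  \<open>S l - (S (l + t) + S (l - t)) / 2\<close>, where \<open>S\<close> is the regularised sum of
  \<open>tanh ((t + p n) / 2)\<close> over all integers \<open>n\<close>.

  Membership: on a horizontal line the imaginary part of \<open>S\<close> is nonnegative and has mean
  \<open>2 Im t / p\<close>. Bijectivity: by contour shifts the Fourier coefficients of the kernel and of \<open>F\<close>
  are explicit, and \<open>\<Psi>\<close> is recovered as the boundary value of \<open>Im F / pi\<close> at height \<open>pi\<close>.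
  This limit exists in \<open>L\<^sup>2\<close> because the squared norm \<open>Y\<close> of \<open>F\<close> on horizontal lines is midpoint
  convex and bounded.

  Extremal functions: let \<open>D\<close> be the sum of \<open>sech ((t + p n) / 2)\<close>. The identity
  \<open>sech a sech b = (tanh a - tanh b) / sinh (a - b)\<close> gives \<open>D\<^sup>2 = 2 S' + const\<close>, so the kernel is
  nonnegative once \<open>D\<close> decreases on \<open>(0, p / 2)\<close>, and its integral over \<open>l\<close> is
  \<open>- 2 ln (D t / D 0)\<close>. Moreover \<open>D\<close> solves the differential equation of \<open>dn + sqrt m cn\<close>. The pole
  of \<open>D\<close> at \<open>\<i> pi\<close> identifies \<open>K'\<close>, and the real period \<open>p\<close> identifies \<open>K\<close>. For \<open>p \<rightarrow> \<infinity>\<close> only the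
  term \<open>n = 0\<close> survives, which gives the infimum and the supremum.
\<close>

section \<open>Hyperbolic lattice sums on a strip\<close>

text \<open>At height \<open>pi\<close> the imaginary part of \<open>S\<close> degenerates to
  \<open>2 * pi\<close> times a unit mass at every point \<open>p n\<close>. For \<open>l\<close>
  and \<open>x\<close> in \<open>(0, p / 2)\<close> the kernel at \<open>t = x + \<i> pi\<close>
  thus has as imaginary part \<open>pi\<close> times a unit mass at \<open>l = x\<close>. This is
  where the division by \<open>pi\<close> comes from, and the radius 1/2 is the bound
  \<open>pi / 2\<close> on \<open>Im F\<close> after that division; evenness of \<open>F\<close> is
  why half a period carries all the information. In Fourier terms the unit masses read
  \<open>saw_coeff * sinh (a * pi) = 2 * pi\<close>.

  The Jacobi functions are defined for real arguments only, while the poles that fix the periods lie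
  off the real axis. So the secant sum is followed along two lines: the real axis, where it is
  compared with \<open>dn + k cn\<close>, and the imaginary axis, where it is compared with the
  quotient predicted by Jacobi's imaginary transformation, each time by uniqueness for a cubic
  second-order equation. The imaginary axis also yields \<open>D (p / 2) < D 0\<close>, although
  this concerns real arguments.\<close>

lemma series_has_field_derivative:
  fixes f :: "int \<Rightarrow> complex \<Rightarrow> complex"
  assumes A: "open A" "z \<in> A"
    and der: "\<And>n w. w \<in> A \<Longrightarrow> (f n has_field_derivative f' n w) (at w)"
    and bound: "\<And>n w. w \<in> A \<Longrightarrow> norm (f n w) \<le> B w * M n"
    and B: "continuous_on A B" and M: "M summable_on UNIV" "\<And>n. M n \<ge> 0"
  shows "((\<lambda>w. \<Sum>\<^sub>\<infinity>n. f n w) has_field_derivative (\<Sum>\<^sub>\<infinity>n. f' n z)) (at z)"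
    and "(\<lambda>n. f' n z) summable_on UNIV"
proof -
  obtain r where r: "r > 0" "cball z r \<subseteq> A"
    using A open_contains_cball by blast
  \<comment> \<open>A bound of the split form \<open>B w * M n\<close> is uniform on a closed ball,
    as the Weierstrass test requires. The derivatives need no estimate of their own, since a locally
    uniform limit of holomorphic functions may be differentiated.\<close>
  have "compact (B ` cball z r)"
    using B r by (intro compact_continuous_image) (auto intro: continuous_on_subset)
  then obtain C where C: "\<And>w. w \<in> cball z r \<Longrightarrow> norm (B w) \<le> C"
    by (meson compact_imp_bounded bounded_iff image_eqI)
  have ul: "uniform_limit (cball z r) (\<lambda>X w. \<Sum>n\<in>X. f n w) (\<lambda>w. \<Sum>\<^sub>\<infinity>n. f n w)
              (finite_subsets_at_top UNIV)"
  proof (rule Weierstrass_m_test_general)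
    show "norm (f n w) \<le> C * M n" if "w \<in> cball z r" for n w
    proof -
      have "B w * M n \<le> C * M n"
        using C[OF that] M(2) by (intro mult_right_mono) auto
      with bound[of w n] r that show ?thesis by force
    qed
    show "(\<lambda>n. C * M n) summable_on UNIV"
      using M(1) by (rule summable_on_cmult_right)
  qed
  have "eventually (\<lambda>X. continuous_on (cball z r) (\<lambda>w. \<Sum>n\<in>X. f n w) \<and>
          (\<forall>w\<in>ball z r. ((\<lambda>w. \<Sum>n\<in>X. f n w) has_field_derivative (\<Sum>n\<in>X. f' n w)) (at w)))
          (finite_subsets_at_top UNIV)"
  proof (intro always_eventually allI conjI ballI)
    fix X :: "int set"
    have *: "((\<lambda>w. \<Sum>n\<in>X. f n w) has_field_derivative (\<Sum>n\<in>X. f' n w)) (at w)"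
      if "w \<in> cball z r" for w
      using der r that by (intro DERIV_sum) auto
    then show "continuous_on (cball z r) (\<lambda>w. \<Sum>n\<in>X. f n w)"
      by (meson DERIV_continuous continuous_at_imp_continuous_on)
    show "((\<lambda>w. \<Sum>n\<in>X. f n w) has_field_derivative (\<Sum>n\<in>X. f' n w)) (at w)"
      if "w \<in> ball z r" for w
      using * that by auto
  qed
  from has_complex_derivative_uniform_limit[OF this ul _ r(1)]
  obtain g' where g': "\<And>w. w \<in> ball z r \<Longrightarrow>
      ((\<lambda>w. \<Sum>\<^sub>\<infinity>n. f n w) has_field_derivative g' w) (at w) \<and>
      ((\<lambda>X. \<Sum>n\<in>X. f' n w) \<longlongrightarrow> g' w) (finite_subsets_at_top UNIV)"
    by auto
  have hs: "((\<lambda>n. f' n z) has_sum g' z) UNIV"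
    using g'[of z] r by (simp add: has_sum_def)
  then show "(\<lambda>n. f' n z) summable_on UNIV"
    by (auto simp: summable_on_def)
  show "((\<lambda>w. \<Sum>\<^sub>\<infinity>n. f n w) has_field_derivative (\<Sum>\<^sub>\<infinity>n. f' n z)) (at z)"
    using g'[of z] r infsumI[OF hs] by simp
qed

lemma geometric_int:
  fixes q :: real
  assumes "0 < q" "q < 1"
  shows "((\<lambda>n::int. q ^ nat \<bar>n\<bar>) has_sum ((1 + q) / (1 - q))) UNIV"
proof -
  have 1: "((\<lambda>n. q ^ n) has_sum (1 / (1 - q))) UNIV"
    using assms geometric_sums[of q] by (intro norm_summable_imp_has_sum) (auto intro: summable_geometric)
  have 2: "((\<lambda>n. q * q ^ n) has_sum (q * (1 / (1 - q)))) UNIV"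
    by (rule has_sum_cmult_right[OF 1])
  have a: "((\<lambda>n::int. q ^ nat \<bar>n\<bar>) has_sum (1 / (1 - q))) {0..}"
    using 1 by (subst (asm) has_sum_reindex_bij_witness[of UNIV nat int "{0..}"]) auto
  have b: "((\<lambda>n::int. q ^ nat \<bar>n\<bar>) has_sum (q * (1 / (1 - q)))) {..<0}"
  proof (rule has_sum_reindex_bij_witness[of UNIV "\<lambda>n. nat (-n - 1)" "\<lambda>n. - int (Suc n)" "{..<0}", THEN iffD1, OF _ _ _ _ _ _ 2])
    fix n :: nat
    have "nat \<bar>- int (Suc n)\<bar> = Suc n" by simp
    then show "q ^ nat \<bar>- int (Suc n)\<bar> = q * q ^ n" by (simp only: power_Suc)
  qed auto
  have "((\<lambda>n::int. q ^ nat \<bar>n\<bar>) has_sum (1 / (1 - q) + q * (1 / (1 - q)))) ({0..} \<union> {..<0})"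
    by (rule has_sum_Un_disjoint[OF a b]) auto
  moreover have "{0..} \<union> {..<0} = (UNIV :: int set)" by auto
  ultimately show ?thesis by (simp add: field_simps add_divide_distrib)
qed

lemma exp_abs_has_sum:
  fixes p :: real
  assumes "p > 0"
  shows "((\<lambda>n::int. exp (- (p * \<bar>real_of_int n\<bar> / 2))) has_sum
           ((1 + exp (- (p / 2))) / (1 - exp (- (p / 2))))) UNIV"
proof -
  have "exp (- (p * \<bar>real_of_int n\<bar> / 2)) = exp (- (p / 2)) ^ nat \<bar>n\<bar>" for n
    by (simp flip: exp_of_nat_mult add: mult.commute)
  then show ?thesis using geometric_int[of "exp (- (p / 2))"] assms by simp
qed

lemma exp_abs_summable: "p > 0 \<Longrightarrow> (\<lambda>n::int. exp (- (p * \<bar>real_of_int n\<bar> / 2))) summable_on UNIV"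
  using exp_abs_has_sum[of p] has_sum_imp_summable by blast

section \<open>The strip and termwise estimates for the two lattice sums\<close>

definition strip :: "complex set" where
  "strip = {z. \<bar>Im z\<bar> < pi}"

text \<open>Subtracting the value at \<open>0\<close> makes the series converge, since the terms
  \<open>tanh\<close> approach 1 and -1 at the two ends. The price is a quasi-period: translation by
  \<open>p\<close> adds 2.\<close>

definition tanh_sum :: "real \<Rightarrow> complex \<Rightarrow> complex" where
  "tanh_sum p z = (\<Sum>\<^sub>\<infinity>n::int. tanh ((z + of_real p * of_int n) / 2) - tanh (of_real p * of_int n / 2))"

definition sech_sum :: "real \<Rightarrow> complex \<Rightarrow> complex" where
  "sech_sum p z = (\<Sum>\<^sub>\<infinity>n::int. 1 / cosh ((z + of_real p * of_int n) / 2))"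

lemma open_strip: "open strip" and convex_strip: "convex strip"
proof -
  have *: "strip = {z. Im z < pi} \<inter> {z. Im z > -pi}"
    by (auto simp: strip_def)
  show "open strip" unfolding * by (intro open_Int open_halfspace_Im_lt open_halfspace_Im_gt)
  show "convex strip" unfolding * by (intro convex_Int convex_halfspace_Im_lt convex_halfspace_Im_gt)
qed

lemma strip_simps [simp]:
  "z + of_real x \<in> strip \<longleftrightarrow> z \<in> strip" "of_real x + z \<in> strip \<longleftrightarrow> z \<in> strip"
  "z - of_real x \<in> strip \<longleftrightarrow> z \<in> strip" "of_real x - z \<in> strip \<longleftrightarrow> z \<in> strip"
  "of_real x \<in> strip" "- z \<in> strip \<longleftrightarrow> z \<in> strip" "cnj z \<in> strip \<longleftrightarrow> z \<in> strip" "0 \<in> strip"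
  by (auto simp: strip_def)

lemma Re_cosh: "Re (cosh z) = cosh (Re z) * cos (Im z)"
  and Im_cosh: "Im (cosh z) = sinh (Re z) * sin (Im z)"
  by (auto simp: cosh_def sinh_def Re_exp Im_exp field_simps)

lemma norm_cosh_ge: "cosh (Re z) * cos (Im z) \<le> norm (cosh z)"
  by (metis Re_cosh complex_Re_le_cmod)

lemma norm_cosh_ge_sinh: "\<bar>sinh (Re z)\<bar> \<le> norm (cosh z)"
proof (rule power2_le_imp_le)
  have "(cosh (Re z))\<^sup>2 = 1 + (sinh (Re z))\<^sup>2" by (simp add: cosh_square_eq)
  then have "(norm (cosh z))\<^sup>2 = (sinh (Re z))\<^sup>2 * ((sin (Im z))\<^sup>2 + (cos (Im z))\<^sup>2) + (cos (Im z))\<^sup>2"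
    unfolding cmod_power2 Re_cosh Im_cosh power_mult_distrib by algebra
  then show "\<bar>sinh (Re z)\<bar>\<^sup>2 \<le> (norm (cosh z))\<^sup>2" by simp
qed simp

lemma cosh_ge_exp_abs: "exp \<bar>x\<bar> / 2 \<le> cosh (x::real)"
proof -
  have "exp \<bar>x\<bar> / 2 \<le> cosh \<bar>x\<bar>" by (simp add: cosh_def)
  then show ?thesis by simp
qed

lemma cos_half_strip: "z \<in> strip \<Longrightarrow> cos (Im z / 2) > 0"
  by (rule cos_gt_zero_pi) (auto simp: strip_def)

lemma cosh_half_nonzero: "z \<in> strip \<Longrightarrow> cosh (z / 2) \<noteq> 0"
proof
  assume z: "z \<in> strip" and "cosh (z / 2) = 0"
  then have "cosh (Re z / 2) * cos (Im z / 2) = 0"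
    using Re_cosh[of "z / 2"] by simp
  then show False using cos_half_strip[OF z] cosh_real_pos[of "Re z / 2"] by auto
qed

lemma strip_shift [simp]:
  "z + of_real x * of_int n \<in> strip \<longleftrightarrow> z \<in> strip" "of_real x * of_int n + z \<in> strip \<longleftrightarrow> z \<in> strip"
  "z - of_real x * of_int n \<in> strip \<longleftrightarrow> z \<in> strip" "of_real x * of_int n \<in> strip"
  "z + of_int n * of_real x \<in> strip \<longleftrightarrow> z \<in> strip" "of_int n * of_real x + z \<in> strip \<longleftrightarrow> z \<in> strip"
  by (auto simp: strip_def)

lemma cosh_half_shift_nonzero: "z \<in> strip \<Longrightarrow> cosh ((z + of_real x * of_int n) / 2) \<noteq> 0"
  by (rule cosh_half_nonzero) simp

text \<open>The part of the termwise bounds that depends on \<open>z\<close>. Its denominator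
  vanishes on the boundary of the strip, where the poles lie.\<close>

definition strip_weight :: "complex \<Rightarrow> real" where
  "strip_weight z = 2 * exp (\<bar>Re z\<bar> / 2) / cos (Im z / 2)"

lemma continuous_strip_weight: "continuous_on strip strip_weight"
proof -
  have "cos (Im z / 2) \<noteq> 0" if "z \<in> strip" for z
    using cos_half_strip[OF that] by simp
  then show ?thesis unfolding strip_weight_def by (intro continuous_intros) auto
qed

lemma strip_weight_pos: "z \<in> strip \<Longrightarrow> strip_weight z > 0"
  by (simp add: strip_weight_def cos_half_strip)

text \<open>The modulus of \<open>cosh\<close> is at least its real part, which is a product of a
  real \<open>cosh\<close> and the cosine of half the height; the former grows exponentially in the
  lattice index.\<close>

lemma norm_sech_le:
  fixes p :: real
  assumes "z \<in> strip" "p > 0"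
  shows "norm (1 / cosh ((z + of_real p * of_int n) / 2))
           \<le> strip_weight z * exp (- (p * \<bar>real_of_int n\<bar> / 2))"
proof -
  let ?a = "(z + of_real p * of_int n) / 2"
  have c: "cos (Im z / 2) > 0" using assms by (simp add: cos_half_strip)
  have "\<bar>p * real_of_int n\<bar> \<le> 2 * \<bar>Re ?a\<bar> + \<bar>Re z\<bar>" by simp
  then have "exp (p * \<bar>real_of_int n\<bar> / 2 - \<bar>Re z\<bar> / 2) \<le> exp \<bar>Re ?a\<bar>"
    using assms by (simp add: abs_mult)
  then have "exp (p * \<bar>real_of_int n\<bar> / 2 - \<bar>Re z\<bar> / 2) / 2 \<le> cosh (Re ?a)"
    using cosh_ge_exp_abs[of "Re ?a"] by linarith
  then have "exp (p * \<bar>real_of_int n\<bar> / 2 - \<bar>Re z\<bar> / 2) / 2 * cos (Im z / 2) \<le> cosh (Re ?a) * cos (Im z / 2)"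
    using c by (intro mult_right_mono) auto
  also have "\<dots> \<le> norm (cosh ?a)"
    using norm_cosh_ge[of ?a] by simp
  finally have *: "exp (p * \<bar>real_of_int n\<bar> / 2 - \<bar>Re z\<bar> / 2) / 2 * cos (Im z / 2) \<le> norm (cosh ?a)" .
  have "norm (1 / cosh ?a) = 1 / norm (cosh ?a)" by (simp add: norm_divide)
  also have "\<dots> \<le> 1 / (exp (p * \<bar>real_of_int n\<bar> / 2 - \<bar>Re z\<bar> / 2) / 2 * cos (Im z / 2))"
    using c by (intro divide_left_mono[OF *] mult_pos_pos) (use cosh_half_shift_nonzero[OF assms(1), of p n] in auto)
  also have "\<dots> = strip_weight z * exp (- (p * \<bar>real_of_int n\<bar> / 2))"
    unfolding exp_diff using c by (simp add: strip_weight_def exp_minus field_simps)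
  finally show ?thesis .
qed

lemma tanh_diff:
  fixes a b :: complex
  assumes "cosh a \<noteq> 0" "cosh b \<noteq> 0"
  shows "tanh a - tanh b = sinh (a - b) / (cosh a * cosh b)"
  using assms by (simp add: tanh_def sinh_diff field_simps)

text \<open>The subtraction formula produces \<open>sinh (z / 2)\<close> times two secants. The one
  at the lattice point is at most 1, so the decay of the other suffices.\<close>

lemma norm_tanh_diff_le:
  fixes p :: real
  assumes "z \<in> strip" "p > 0"
  shows "norm (tanh ((z + of_real p * of_int n) / 2) - tanh (of_real p * of_int n / 2))
           \<le> norm (sinh (z / 2)) * strip_weight z * exp (- (p * \<bar>real_of_int n\<bar> / 2))"
proof -
  let ?a = "(z + of_real p * of_int n) / 2" and ?b = "of_real p * of_int n / 2 :: complex"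
  have "cosh (p * of_int n / 2) \<le> norm (cosh ?b)"
    using norm_cosh_ge[of ?b] by simp
  then have 1: "norm (cosh ?b) \<ge> 1"
    using cosh_real_ge_1[of "p * of_int n / 2"] by linarith
  then have "tanh ?a - tanh ?b = sinh (?a - ?b) / (cosh ?a * cosh ?b)"
    using assms by (intro tanh_diff) (auto simp: cosh_half_shift_nonzero)
  moreover have "?a - ?b = z / 2" by (simp add: field_simps)
  ultimately have "norm (tanh ?a - tanh ?b) = norm (sinh (z / 2)) * norm (1 / cosh ?a) * (1 / norm (cosh ?b))"
    by (simp add: norm_divide norm_mult)
  also have "\<dots> \<le> norm (sinh (z / 2)) * (strip_weight z * exp (- (p * \<bar>real_of_int n\<bar> / 2))) * 1"
    using 1 norm_sech_le[OF assms, of n] strip_weight_pos[OF assms(1)]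
    by (intro mult_mono mult_left_mono) (auto simp: divide_le_eq_1)
  finally show ?thesis by (simp add: mult_ac)
qed

lemma norm_summable_comparison:
  fixes f :: "'a \<Rightarrow> 'b :: banach" and g :: "'a \<Rightarrow> real"
  assumes "g summable_on UNIV" "\<And>x. norm (f x) \<le> g x"
  shows "(\<lambda>x. norm (f x)) summable_on UNIV"
  using assms by (rule Infinite_Sum.abs_summable_on_comparison_test')

lemma abs_summable_sech:
  assumes "z \<in> strip" "p > 0"
  shows "(\<lambda>n::int. norm (1 / cosh ((z + of_real p * of_int n) / 2))) summable_on UNIV"
  using norm_summable_comparison[OF summable_on_cmult_right[OF exp_abs_summable[OF assms(2)]] norm_sech_le[OF assms]] .

lemma abs_summable_tanh_diff:
  assumes "z \<in> strip" "p > 0"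
  shows "(\<lambda>n::int. norm (tanh ((z + of_real p * of_int n) / 2) - tanh (of_real p * of_int n / 2))) summable_on UNIV"
  using norm_summable_comparison[OF summable_on_cmult_right[OF exp_abs_summable[OF assms(2)]] norm_tanh_diff_le[OF assms]] .

lemma sech_sum_has_sum:
  assumes "z \<in> strip" "p > 0"
  shows "((\<lambda>n::int. 1 / cosh ((z + of_real p * of_int n) / 2)) has_sum sech_sum p z) UNIV"
  unfolding sech_sum_def by (rule has_sum_infsum[OF abs_summable_summable[OF abs_summable_sech[OF assms]]])

lemma has_sum_diff:
  fixes f g :: "'a \<Rightarrow> 'b :: real_normed_vector"
  assumes "(f has_sum a) A" "(g has_sum b) A"
  shows "((\<lambda>x. f x - g x) has_sum (a - b)) A"
  using has_sum_add[of f A a "\<lambda>x. - g x" "- b"] assms by (simp add: has_sum_uminus)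

lemma tanh_sum_diff:
  assumes "u \<in> strip" "v \<in> strip" "p > 0"
  shows "((\<lambda>n::int. tanh ((u + of_real p * of_int n) / 2) - tanh ((v + of_real p * of_int n) / 2))
           has_sum (tanh_sum p u - tanh_sum p v)) UNIV"
proof -
  have *: "((\<lambda>n::int. tanh ((z + of_real p * of_int n) / 2) - tanh (of_real p * of_int n / 2)) has_sum tanh_sum p z) UNIV"
    if "z \<in> strip" for z
    unfolding tanh_sum_def by (rule has_sum_infsum[OF abs_summable_summable[OF abs_summable_tanh_diff[OF that assms(3)]]])
  show ?thesis using has_sum_diff[OF *[OF assms(1)] *[OF assms(2)]] by simp
qed

lemma tanh_has_field_derivative:
  fixes z :: complex
  assumes "cosh z \<noteq> 0"
  shows "(tanh has_field_derivative (1 / cosh z) ^ 2) (at z)"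
proof -
  have "((\<lambda>x. sinh x / cosh x) has_field_derivative (cosh z * cosh z - sinh z * sinh z) / (cosh z * cosh z)) (at z)"
    by (rule DERIV_divide) (use assms in \<open>auto intro!: derivative_eq_intros\<close>)
  moreover have "cosh z * cosh z - sinh z * sinh z = 1"
    using cosh_square_eq[of z] by (simp add: power2_eq_square)
  ultimately have "((\<lambda>x. sinh x / cosh x) has_field_derivative (1 / cosh z) ^ 2) (at z)"
    by (simp add: power2_eq_square)
  then show ?thesis by (simp add: tanh_def[abs_def])
qed

lemma tanh_sum_has_field_derivative:
  assumes "z \<in> strip" "p > 0"
  shows "(tanh_sum p has_field_derivative (\<Sum>\<^sub>\<infinity>n::int. (1 / cosh ((z + of_real p * of_int n) / 2)) ^ 2 / 2)) (at z)"
    and "(\<lambda>n::int. (1 / cosh ((z + of_real p * of_int n) / 2)) ^ 2 / 2) summable_on UNIV"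
proof -
  have 1: "((\<lambda>w. tanh ((w + of_real p * of_int n) / 2) - tanh (of_real p * of_int n / 2))
     has_field_derivative (1 / cosh ((w + of_real p * of_int n) / 2)) ^ 2 / 2) (at w)"
    if "w \<in> strip" for n w
  proof -
    have "((\<lambda>w. tanh ((w + of_real p * of_int n) / 2)) has_field_derivative
        (1 / cosh ((w + of_real p * of_int n) / 2)) ^ 2 * (1 / 2)) (at w)"
      by (rule DERIV_chain2[OF tanh_has_field_derivative])
         (use that in \<open>auto intro!: derivative_eq_intros simp: cosh_half_shift_nonzero\<close>)
    from DERIV_diff[OF this DERIV_const] show ?thesis by simp
  qed
  have 2: "continuous_on strip (\<lambda>z. norm (sinh (z / 2)) * strip_weight z)"
    by (intro continuous_intros continuous_strip_weight) auto
  have 3: "(\<lambda>n::int. exp (- (p * \<bar>real_of_int n\<bar> / 2))) summable_on UNIV"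
    using assms(2) by (rule exp_abs_summable)
  note * = series_has_field_derivative[OF open_strip assms(1) 1 norm_tanh_diff_le 2 3, OF _ _ assms(2)]
  show "(tanh_sum p has_field_derivative (\<Sum>\<^sub>\<infinity>n::int. (1 / cosh ((z + of_real p * of_int n) / 2)) ^ 2 / 2)) (at z)"
    unfolding tanh_sum_def[abs_def] by (rule *) auto
  show "(\<lambda>n::int. (1 / cosh ((z + of_real p * of_int n) / 2)) ^ 2 / 2) summable_on UNIV"
    by (rule *) auto
qed

lemma sech_sum_has_field_derivative:
  assumes "z \<in> strip" "p > 0"
  shows "(sech_sum p has_field_derivative (\<Sum>\<^sub>\<infinity>n::int. - (1 / cosh ((z + of_real p * of_int n) / 2) *
            tanh ((z + of_real p * of_int n) / 2) / 2))) (at z)"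
    and "(\<lambda>n::int. - (1 / cosh ((z + of_real p * of_int n) / 2) *
            tanh ((z + of_real p * of_int n) / 2) / 2)) summable_on UNIV"
proof -
  have 1: "((\<lambda>w. 1 / cosh ((w + of_real p * of_int n) / 2))
     has_field_derivative - (1 / cosh ((w + of_real p * of_int n) / 2) *
            tanh ((w + of_real p * of_int n) / 2) / 2)) (at w)"
    if "w \<in> strip" for n w
    using cosh_half_shift_nonzero[OF that, of p n]
    by (auto intro!: derivative_eq_intros simp: tanh_def field_simps)
  have 3: "(\<lambda>n::int. exp (- (p * \<bar>real_of_int n\<bar> / 2))) summable_on UNIV"
    using assms(2) by (rule exp_abs_summable)
  note * = series_has_field_derivative[OF open_strip assms(1) 1 norm_sech_le continuous_strip_weight 3, OF _ _ assms(2)]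
  show "(sech_sum p has_field_derivative (\<Sum>\<^sub>\<infinity>n::int. - (1 / cosh ((z + of_real p * of_int n) / 2) *
            tanh ((z + of_real p * of_int n) / 2) / 2))) (at z)"
    unfolding sech_sum_def[abs_def] by (rule *) auto
  show "(\<lambda>n::int. - (1 / cosh ((z + of_real p * of_int n) / 2) *
            tanh ((z + of_real p * of_int n) / 2) / 2)) summable_on UNIV"
    by (rule *) auto
qed

section \<open>Sums over the integers: telescoping, reflection, translation\<close>

lemma filterlim_int_interval:
  "filterlim (\<lambda>N. {- int N..<int N}) (finite_subsets_at_top UNIV) sequentially"
  unfolding filterlim_def le_filter_def eventually_filtermap
proof (intro allI impI)
  fix P :: "int set \<Rightarrow> bool" assume "eventually P (finite_subsets_at_top UNIV)"
  then obtain X where X: "finite X" "\<And>Y. finite Y \<Longrightarrow> X \<subseteq> Y \<Longrightarrow> P Y"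
    unfolding eventually_finite_subsets_at_top by auto
  obtain B where B: "\<And>x. x \<in> X \<Longrightarrow> \<bar>x\<bar> < int B"
  proof -
    have "\<bar>x\<bar> < int (nat (Max (insert 0 (abs ` X)) + 1))" if "x \<in> X" for x
    proof -
      have "\<bar>x\<bar> \<le> Max (insert 0 (abs ` X))" using X(1) that by (intro Max_ge) auto
      then show ?thesis by linarith
    qed
    then show ?thesis using that by blast
  qed
  show "eventually (\<lambda>N. P {- int N..<int N}) sequentially"
  proof (rule eventually_mono[OF eventually_ge_at_top[of B]])
    fix N assume N: "B \<le> N"
    show "P {- int N..<int N}"
    proof (rule X(2))
      show "X \<subseteq> {- int N..<int N}"
      proof
        fix x assume "x \<in> X"
        with B[OF this] N show "x \<in> {- int N..<int N}" by auto
      qed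
    qed simp
  qed
qed

text \<open>An unordered sum may be evaluated along any exhausting sequence of finite sets. The
  half-open intervals \<open>{- int N..<int N}\<close> leave exactly
  \<open>f (int N) - f (- int N)\<close>.\<close>

lemma has_sum_int_telescope:
  fixes f :: "int \<Rightarrow> 'a :: real_normed_vector"
  assumes "((\<lambda>n. f (n + 1) - f n) has_sum s) UNIV"
    and "(\<lambda>N. f (int N)) \<longlonglongrightarrow> a" "(\<lambda>N. f (- int N)) \<longlonglongrightarrow> b"
  shows "s = a - b"
proof -
  have sum: "(\<Sum>n\<in>{- int N..<int N}. f (n + 1) - f n) = f (int N) - f (- int N)" for N
  proof (induction N)
    case (Suc N)
    have *: "{- int (Suc N)..<int (Suc N)} = insert (- int (Suc N)) (insert (int N) {- int N..<int N})"
      by auto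
    show ?case unfolding * using Suc by (simp add: algebra_simps)
  qed simp
  have "((\<lambda>N. \<Sum>n\<in>{- int N..<int N}. f (n + 1) - f n) \<longlongrightarrow> s) sequentially"
    using assms(1) unfolding has_sum_def by (rule filterlim_compose[OF _ filterlim_int_interval])
  moreover have "((\<lambda>N. \<Sum>n\<in>{- int N..<int N}. f (n + 1) - f n) \<longlongrightarrow> a - b) sequentially"
    unfolding sum by (intro tendsto_diff assms)
  ultimately show ?thesis by (rule LIMSEQ_unique)
qed

lemma infsum_int_uminus: "(\<Sum>\<^sub>\<infinity>n::int. f (- n)) = (\<Sum>\<^sub>\<infinity>n. f n)"
  by (rule infsum_reindex_bij_witness[of _ uminus uminus]) auto

lemma infsum_int_shift: "(\<Sum>\<^sub>\<infinity>n::int. f (n + k)) = (\<Sum>\<^sub>\<infinity>n. f n)"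
  by (rule infsum_reindex_bij_witness[of _ "\<lambda>n. n - k" "\<lambda>n. n + k"]) auto

lemma summable_int_uminus:
  "(\<lambda>n::int. f (- n)) summable_on UNIV \<longleftrightarrow> f summable_on UNIV"
  by (rule summable_on_reindex_bij_witness[of _ uminus uminus]) auto

lemma summable_int_shift:
  "(\<lambda>n::int. f (n + k)) summable_on UNIV \<longleftrightarrow> f summable_on UNIV"
  by (rule summable_on_reindex_bij_witness[of _ "\<lambda>n. n - k" "\<lambda>n. n + k"]) auto

text \<open>Adding the sum to its own reflection cancels all pairs and leaves twice the term at
  \<open>0\<close>. Oddness is asked for away from \<open>0\<close> only, because the term there is
  the one that survives.\<close>

lemma infsum_int_odd:
  fixes f :: "int \<Rightarrow> complex"
  assumes "f summable_on UNIV" "\<And>k. k \<noteq> 0 \<Longrightarrow> f (- k) = - f k"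
  shows "infsum f UNIV = f 0"
proof -
  have "infsum f UNIV + infsum f UNIV = (\<Sum>\<^sub>\<infinity>k. f k) + (\<Sum>\<^sub>\<infinity>k. f (- k))"
    by (simp add: infsum_int_uminus)
  also have "\<dots> = (\<Sum>\<^sub>\<infinity>k. f k + f (- k))"
    using assms by (intro infsum_add[symmetric]) (auto simp: summable_int_uminus)
  also have "\<dots> = (\<Sum>\<^sub>\<infinity>k\<in>{0}. f k + f (- k))"
    using assms(2) by (intro infsum_cong_neutral) auto
  finally show ?thesis by simp
qed

lemma tanh_sum_minus: "tanh_sum p (- z) = - tanh_sum p z"
proof -
  have "tanh_sum p (- z) = (\<Sum>\<^sub>\<infinity>n::int. tanh ((- z + of_real p * of_int (- n)) / 2) - tanh (of_real p * of_int (- n) / 2))"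
    unfolding tanh_sum_def by (rule infsum_int_uminus[symmetric])
  also have "\<dots> = (\<Sum>\<^sub>\<infinity>n::int. - (tanh ((z + of_real p * of_int n) / 2) - tanh (of_real p * of_int n / 2)))"
  proof (rule infsum_cong)
    fix n :: int
    have "(- z + of_real p * of_int (- n)) / 2 = - ((z + of_real p * of_int n) / 2)"
      "of_real p * of_int (- n) / 2 = - (of_real p * of_int n / 2 :: complex)"
      by (simp_all add: field_simps)
    then show "tanh ((- z + of_real p * of_int (- n)) / 2) - tanh (of_real p * of_int (- n) / 2)
      = - (tanh ((z + of_real p * of_int n) / 2) - tanh (of_real p * of_int n / 2))"
      by (simp only: tanh_minus) simp
  qed
  finally show ?thesis unfolding tanh_sum_def infsum_uminus .
qed

lemma tanh_sum_0 [simp]: "tanh_sum p 0 = 0"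
  by (simp add: tanh_sum_def)

lemma sech_sum_minus: "sech_sum p (- z) = sech_sum p z"
proof -
  have "sech_sum p (- z) = (\<Sum>\<^sub>\<infinity>n::int. 1 / cosh ((- z + of_real p * of_int (- n)) / 2))"
    unfolding sech_sum_def by (rule infsum_int_uminus[symmetric])
  also have "\<dots> = sech_sum p z"
    unfolding sech_sum_def
  proof (rule infsum_cong)
    fix n :: int
    have "(- z + of_real p * of_int (- n)) / 2 = - ((z + of_real p * of_int n) / 2)"
      by (simp add: field_simps)
    then show "1 / cosh ((- z + of_real p * of_int (- n)) / 2) = 1 / cosh ((z + of_real p * of_int n) / 2)"
      by (simp only: cosh_minus)
  qed
  finally show ?thesis .
qed

lemma sech_sum_period: "sech_sum p (z + of_real p) = sech_sum p z"
proof -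
  have "sech_sum p (z + of_real p) = (\<Sum>\<^sub>\<infinity>n::int. 1 / cosh ((z + of_real p * of_int (n + 1)) / 2))"
    unfolding sech_sum_def by (intro infsum_cong) (simp add: algebra_simps)
  also have "\<dots> = sech_sum p z"
    unfolding sech_sum_def by (rule infsum_int_shift)
  finally show ?thesis .
qed

lemma sech_sum_half_period: "sech_sum p (z - of_real p / 2) = sech_sum p (z + of_real p / 2)"
  using sech_sum_period[of p "z - of_real p / 2"] by (simp add: field_simps)

lemma cnj_cosh: "cnj (cosh z) = cosh (cnj z)" and cnj_sinh: "cnj (sinh z) = sinh (cnj z)"
  by (simp_all add: cosh_def sinh_def scaleR_conv_of_real exp_cnj)

lemma cnj_tanh: "cnj (tanh z) = tanh (cnj z)"
  by (simp add: tanh_def cnj_cosh cnj_sinh)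

lemma tanh_sum_cnj: "tanh_sum p (cnj z) = cnj (tanh_sum p z)"
  unfolding tanh_sum_def infsum_cnj[symmetric] by (simp add: cnj_tanh)

lemma sech_sum_cnj: "sech_sum p (cnj z) = cnj (sech_sum p z)"
  unfolding sech_sum_def infsum_cnj[symmetric] by (simp add: cnj_cosh)

lemma tanh_complex_of_real: "tanh (complex_of_real x) = complex_of_real (tanh x)"
  by (simp add: tanh_def cosh_def sinh_def scaleR_conv_of_real exp_of_real flip: of_real_minus)

text \<open>A translation by \<open>p\<close> moves every term onto its neighbour, so the difference
  telescopes to the total jump of \<open>tanh\<close> from -1 to 1.\<close>

lemma tanh_sum_period:
  assumes "z \<in> strip" "p > 0"
  shows "tanh_sum p (z + of_real p) = tanh_sum p z + 2"
proof -
  define f where "f n = tanh ((z + of_real p * of_int n) / 2)" for n :: int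
  have "((\<lambda>n. f (n + 1) - f n) has_sum (tanh_sum p (z + of_real p) - tanh_sum p z)) UNIV"
    using tanh_sum_diff[of "z + of_real p" z p] assms by (simp add: f_def algebra_simps)
  moreover have lim: "(\<lambda>N. tanh (of_real p * of_int (int N) / 2) :: complex) \<longlonglongrightarrow> 1"
  proof -
    have "filterlim (\<lambda>N. (p / 2) * real N) at_top sequentially"
      using assms by (intro filterlim_tendsto_pos_mult_at_top[OF tendsto_const] filterlim_real_sequentially) auto
    then have "filterlim (\<lambda>N. p * real N / 2) at_top sequentially"
      by simp
    then have "(\<lambda>N. tanh (p * real N / 2)) \<longlonglongrightarrow> 1"
      by (rule filterlim_compose[OF tanh_real_at_top])
    then have "(\<lambda>N. complex_of_real (tanh (p * real N / 2))) \<longlonglongrightarrow> complex_of_real 1"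
      by (rule tendsto_of_real)
    then show ?thesis by (simp flip: tanh_complex_of_real)
  qed
  \<comment> \<open>The limits along the translated line through \<open>z\<close> are reduced to
    those at the real lattice points: the distance between the two is bounded by a summable, hence
    vanishing, sequence.\<close>
  have bnd: "(\<lambda>N. norm (sinh (z / 2)) * strip_weight z * exp (- (p * \<bar>real_of_int (int N)\<bar> / 2))) \<longlonglongrightarrow> 0"
  proof -
    have "filterlim (\<lambda>N. (p / 2) * real N) at_top sequentially"
      using assms by (intro filterlim_tendsto_pos_mult_at_top[OF tendsto_const] filterlim_real_sequentially) auto
    then have "filterlim (\<lambda>N. - ((p / 2) * real N)) at_bot sequentially"
      by (simp add: filterlim_uminus_at_bot)
    from tendsto_mult_right_zero[OF filterlim_compose[OF exp_at_bot this]]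
    show ?thesis by simp
  qed
  have "(\<lambda>N. f (int N) - tanh (of_real p * of_int (int N) / 2)) \<longlonglongrightarrow> 0"
    by (rule Lim_null_comparison[OF _ bnd], rule always_eventually)
      (use norm_tanh_diff_le[OF assms, of "int N" for N] in \<open>simp add: f_def\<close>)
  from tendsto_add[OF this lim] have "(\<lambda>N. f (int N)) \<longlonglongrightarrow> 1" by simp
  moreover have "(\<lambda>N. f (- int N) - tanh (of_real p * of_int (- int N) / 2)) \<longlonglongrightarrow> 0"
    by (rule Lim_null_comparison[OF _ bnd], rule always_eventually)
      (use norm_tanh_diff_le[OF assms, of "- int N" for N] in \<open>simp add: f_def\<close>)
  from tendsto_add[OF this tendsto_minus[OF lim]] have "(\<lambda>N. f (- int N)) \<longlonglongrightarrow> - 1" by simp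
  ultimately have "tanh_sum p (z + of_real p) - tanh_sum p z = 1 - (- 1)"
    by (rule has_sum_int_telescope)
  then show ?thesis by (simp add: algebra_simps)
qed

lemma tanh_sum_period_int:
  assumes "z \<in> strip" "p > 0"
  shows "tanh_sum p (z + of_real p * of_int k) = tanh_sum p z + 2 * of_int k"
proof (induction k rule: int_induct[where k = 0])
  case (step1 i)
  then show ?case
    using tanh_sum_period[of "z + of_real p * of_int i" p] assms by (simp add: algebra_simps)
next
  case (step2 i)
  then show ?case
    using tanh_sum_period[of "z + of_real p * of_int (i - 1)" p] assms by (simp add: algebra_simps)
qed simp

section \<open>Products of two lattice sums\<close>

lemma summable_product:
  fixes s t :: "int \<Rightarrow> complex"
  assumes s: "(\<lambda>n. norm (s n)) summable_on UNIV" and t: "(\<lambda>n. norm (t n)) summable_on UNIV"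
  shows "(\<lambda>(n, m). s n * t m) summable_on UNIV \<times> UNIV"
proof (rule abs_summable_summable)
  have "(\<lambda>(n, m). norm (s n) * norm (t m)) summable_on UNIV \<times> UNIV"
  proof (rule summable_on_SigmaI)
    show "((\<lambda>m. case (n, m) of (n, m) \<Rightarrow> norm (s n) * norm (t m)) has_sum (norm (s n) * (\<Sum>\<^sub>\<infinity>m. norm (t m)))) UNIV" for n
      unfolding prod.case by (rule has_sum_cmult_right[OF has_sum_infsum[OF t]])
    show "(\<lambda>n. norm (s n) * (\<Sum>\<^sub>\<infinity>m. norm (t m))) summable_on UNIV"
      by (rule summable_on_cmult_left[OF s])
  qed simp
  then show "(\<lambda>x. norm (case x of (n, m) \<Rightarrow> s n * t m)) summable_on UNIV \<times> UNIV"
    by (simp add: case_prod_unfold norm_mult)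
qed

text \<open>The double sum is regrouped by the difference \<open>k\<close> of the indices. On each
  diagonal the arguments differ by a constant, so that an addition formula can evaluate the inner
  sum.\<close>

lemma product_as_shifted_sums:
  fixes s t :: "int \<Rightarrow> complex"
  assumes s: "(\<lambda>n. norm (s n)) summable_on UNIV" and t: "(\<lambda>n. norm (t n)) summable_on UNIV"
  shows "((\<lambda>k. \<Sum>\<^sub>\<infinity>n. s n * t (n + k)) has_sum (infsum s UNIV * infsum t UNIV)) UNIV"
proof -
  note sum = summable_product[OF s t]
  have "(\<lambda>(k, n). s n * t (n + k)) summable_on UNIV \<times> UNIV \<longleftrightarrow> (\<lambda>(n, m). s n * t m) summable_on UNIV \<times> UNIV"
    by (rule summable_on_reindex_bij_witness[of "UNIV \<times> UNIV" "\<lambda>(n, m). (m - n, n)" "\<lambda>(k, n). (n, n + k)"]) auto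
  with sum have sum2: "(\<lambda>(k, n). s n * t (n + k)) summable_on UNIV \<times> UNIV"
    by simp
  have "infsum s UNIV * infsum t UNIV = (\<Sum>\<^sub>\<infinity>n. s n * infsum t UNIV)"
    by (rule infsum_cmult_left[symmetric]) (rule abs_summable_summable[OF s])
  also have "\<dots> = (\<Sum>\<^sub>\<infinity>n. \<Sum>\<^sub>\<infinity>m. s n * t m)"
    by (rule infsum_cong, rule infsum_cmult_right[symmetric]) (rule abs_summable_summable[OF t])
  also have "\<dots> = (\<Sum>\<^sub>\<infinity>(n, m)\<in>UNIV \<times> UNIV. s n * t m)"
    by (rule infsum_Sigma'_banach[OF sum])
  also have "\<dots> = (\<Sum>\<^sub>\<infinity>(k, n)\<in>UNIV \<times> UNIV. s n * t (n + k))"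
    by (rule infsum_reindex_bij_witness[of _ "\<lambda>(k, n). (n, n + k)" "\<lambda>(n, m). (m - n, n)"]) auto
  also have "\<dots> = (\<Sum>\<^sub>\<infinity>k. \<Sum>\<^sub>\<infinity>n. s n * t (n + k))"
    by (rule infsum_Sigma'_banach[OF sum2, symmetric])
  finally have "infsum s UNIV * infsum t UNIV = (\<Sum>\<^sub>\<infinity>k. \<Sum>\<^sub>\<infinity>n. s n * t (n + k))" .
  then show "((\<lambda>k. \<Sum>\<^sub>\<infinity>n. s n * t (n + k)) has_sum (infsum s UNIV * infsum t UNIV)) UNIV"
    using has_sum_infsum[OF summable_on_Sigma_banach[OF sum2]] by metis
qed

lemma summable_shifted_product:
  fixes s t :: "int \<Rightarrow> complex"
  assumes s: "(\<lambda>n. norm (s n)) summable_on UNIV" and t: "(\<lambda>n. norm (t n)) summable_on UNIV"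
  shows "(\<lambda>n. s n * t (n + k)) summable_on UNIV"
proof -
  have bound: "norm (s n) \<le> (\<Sum>\<^sub>\<infinity>n. norm (s n))" for n
  proof -
    have "norm (s n) = (\<Sum>\<^sub>\<infinity>n\<in>{n}. norm (s n))" by simp
    also have "\<dots> \<le> (\<Sum>\<^sub>\<infinity>n. norm (s n))"
      by (rule infsum_mono_neutral[OF _ s]) auto
    finally show ?thesis .
  qed
  have t': "(\<lambda>n. norm (t (n + k))) summable_on UNIV"
    using t summable_int_shift[of "\<lambda>n. norm (t n)" k] by simp
  have "(\<lambda>n. norm (s n * t (n + k))) summable_on UNIV"
    by (rule norm_summable_comparison[OF summable_on_cmult_right[OF t', of "\<Sum>\<^sub>\<infinity>n. norm (s n)"]])
       (simp add: norm_mult mult_right_mono bound)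
  then show ?thesis by (rule abs_summable_summable)
qed

lemma sech_mult_sech:
  fixes a b :: complex
  assumes "cosh a \<noteq> 0" "cosh b \<noteq> 0" "sinh (b - a) \<noteq> 0"
  shows "1 / cosh a * (1 / cosh b) = (tanh b - tanh a) / sinh (b - a)"
  using assms by (simp add: tanh_diff mult.commute)

lemma sinh_real_nonzero:
  assumes "x \<noteq> 0"
  shows "sinh (complex_of_real x) \<noteq> 0"
proof -
  have "sinh (of_real x :: complex) = of_real (sinh x)" for x
    by (simp add: sinh_def scaleR_conv_of_real exp_of_real flip: of_real_minus)
  then show ?thesis using assms by simp
qed

lemma sinh_lattice_nonzero:
  "p > 0 \<Longrightarrow> k \<noteq> 0 \<Longrightarrow> sinh (of_real p * of_int k / 2 :: complex) \<noteq> 0"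
  using sinh_real_nonzero[of "p * of_int k / 2"] by simp

definition sech_sum_const :: "real \<Rightarrow> complex" where
  "sech_sum_const p = infsum (\<lambda>k::int. 2 * of_int k / sinh (of_real p * of_int k / 2 :: complex)) (- {0})"

text \<open>On a diagonal \<open>k\<close> other than \<open>0\<close>, the product of secants is a
  difference of \<open>tanh\<close> terms divided by the fixed number \<open>sinh (p k / 2)\<close>.
  By the quasi-period this sums to \<open>2 k / sinh (p k / 2)\<close>, free of \<open>z\<close>.
  The diagonal \<open>0\<close> is the sum of squares, which is twice the derivative of
  \<open>tanh_sum\<close>.\<close>

lemma sech_sum_square:
  assumes "z \<in> strip" "p > 0"
  shows "(sech_sum p z)\<^sup>2 = 2 * (\<Sum>\<^sub>\<infinity>n::int. (1 / cosh ((z + of_real p * of_int n) / 2)) ^ 2 / 2) + sech_sum_const p"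
proof -
  define s where "s = (\<lambda>n::int. 1 / cosh ((z + of_real p * of_int n) / 2))"
  have abs: "(\<lambda>n. norm (s n)) summable_on UNIV"
    unfolding s_def by (rule abs_summable_sech[OF assms])
  have s0: "(\<lambda>n. s n * s n) summable_on UNIV"
    using summable_shifted_product[OF abs abs, of 0] unfolding add_0_right .
  define g where "g = (\<lambda>k. \<Sum>\<^sub>\<infinity>n. s n * s (n + k))"
  have "sech_sum p z = infsum s UNIV"
    unfolding sech_sum_def s_def ..
  then have g: "(g has_sum (sech_sum p z)\<^sup>2) UNIV"
    using product_as_shifted_sums[OF abs abs] by (simp only: g_def power2_eq_square)
  have gs: "g summable_on A" for A
    by (rule summable_on_subset_banach[OF has_sum_imp_summable[OF g]]) simp
  have "(sech_sum p z)\<^sup>2 = infsum g ({0} \<union> - {0})"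
    using infsumI[OF g] by (simp only: Compl_partition)
  also have "\<dots> = infsum g {0} + infsum g (- {0})"
    by (rule infsum_Un_disjoint[OF gs gs]) simp
  also have "infsum g {0} = g 0" by simp
  also have "infsum g (- {0}) = sech_sum_const p"
    unfolding sech_sum_const_def
  proof (rule infsum_cong)
    fix k :: int assume k: "k \<in> - {0}"
    have nz: "sinh (of_real p * of_int k / 2 :: complex) \<noteq> 0"
      using sinh_lattice_nonzero[of p k] assms k by simp
    have "((\<lambda>n. s n * s (n + k)) has_sum (2 * of_int k / sinh (of_real p * of_int k / 2 :: complex))) UNIV"
    proof -
      have eq: "s n * s (n + k) = (tanh ((z + of_real p * of_int k + of_real p * of_int n) / 2) -
          tanh ((z + of_real p * of_int n) / 2)) / sinh (of_real p * of_int k / 2 :: complex)" for n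
      proof -
        let ?a = "(z + of_real p * of_int n) / 2" and ?b = "(z + of_real p * of_int k + of_real p * of_int n) / 2"
        have 1: "?b - ?a = of_real p * of_int k / 2" by (simp add: field_simps)
        have 2: "(z + of_real p * of_int (n + k)) / 2 = ?b" by (simp add: algebra_simps)
        show ?thesis
          unfolding s_def 2
        proof (rule sech_mult_sech[of ?a ?b, unfolded 1])
          show "cosh ?a \<noteq> 0" by (rule cosh_half_shift_nonzero) (rule assms)
          show "cosh ?b \<noteq> 0" by (rule cosh_half_shift_nonzero) (simp add: assms)
        qed (rule nz)
      qed
      have "((\<lambda>n. (tanh ((z + of_real p * of_int k + of_real p * of_int n) / 2) -
          tanh ((z + of_real p * of_int n) / 2)) * inverse (sinh (of_real p * of_int k / 2 :: complex))) has_sum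
          ((tanh_sum p (z + of_real p * of_int k) - tanh_sum p z) * inverse (sinh (of_real p * of_int k / 2 :: complex)))) UNIV"
        by (intro has_sum_cmult_left tanh_sum_diff) (use assms in auto)
      moreover have "tanh_sum p (z + of_real p * of_int k) - tanh_sum p z = 2 * of_int k"
        by (simp add: tanh_sum_period_int[OF assms])
      ultimately show ?thesis
        unfolding eq by (simp only: divide_inverse)
    qed
    then show "g k = 2 * of_int k / sinh (of_real p * of_int k / 2 :: complex)"
      unfolding g_def by (rule infsumI)
  qed
  also have "g 0 = 2 * (\<Sum>\<^sub>\<infinity>n. (s n) ^ 2 / 2)"
  proof -
    have "(\<Sum>\<^sub>\<infinity>n. s n * s n) = (\<Sum>\<^sub>\<infinity>n. 2 * ((s n) ^ 2 / 2))"
      by (simp add: power2_eq_square)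
    also have "\<dots> = 2 * (\<Sum>\<^sub>\<infinity>n. (s n) ^ 2 / 2)"
      by (rule infsum_cmult_right) (use summable_on_cmult_left[OF s0, of "1/2"] in \<open>simp add: power2_eq_square\<close>)
    finally show ?thesis by (simp only: g_def add_0_right)
  qed
  finally show ?thesis by (simp add: s_def)
qed

lemma sech_sum_period_int: "sech_sum p (z + of_real p * of_int k) = sech_sum p z"
proof (induction k rule: int_induct[where k = 0])
  case (step1 i)
  then show ?case
    using sech_sum_period[of p "z + of_real p * of_int i"] by (simp add: algebra_simps)
next
  case (step2 i)
  then show ?case
    using sech_sum_period[of p "z + of_real p * of_int (i - 1)"] by (simp add: algebra_simps)
qed simp

section \<open>The differential equation of the secant sum\<close>

lemma sech_mult_tanh:
  fixes a b :: complex
  assumes "cosh a \<noteq> 0" "cosh b \<noteq> 0" "sinh (b - a) \<noteq> 0"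
  shows "1 / cosh a * tanh b = cosh (b - a) / sinh (b - a) * (1 / cosh a) - 1 / sinh (b - a) * (1 / cosh b)"
proof -
  have "cosh a = cosh b * cosh (b - a) - sinh b * sinh (b - a)"
    using cosh_diff[of b "b - a"] by simp
  then have "sinh b * sinh (b - a) = cosh (b - a) * cosh b - cosh a"
    by (simp add: algebra_simps)
  then show ?thesis using assms by (simp add: tanh_def divide_simps)
qed

text \<open>With \<open>a\<close> and \<open>b\<close> the secant sums at \<open>z\<close> and
  \<open>z + x\<close>, this is the value of the sum of secants at \<open>z\<close> against
  \<open>tanh\<close> at \<open>z + x\<close>. It is odd in \<open>x\<close>, which later cancels
  opposite diagonals.\<close>

definition coth_csch :: "real \<Rightarrow> complex \<Rightarrow> complex \<Rightarrow> complex" where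
  "coth_csch x a b = cosh (of_real x / 2 :: complex) / sinh (of_real x / 2 :: complex) * a
     - 1 / sinh (of_real x / 2 :: complex) * b"

lemma coth_csch_minus: "coth_csch (- x) a b = - coth_csch x a b"
  by (simp add: coth_csch_def)

lemma sech_tanh_has_sum:
  assumes "z \<in> strip" "p > 0" "x \<noteq> 0" "w = z + of_real x"
  shows "((\<lambda>n::int. 1 / cosh ((z + of_real p * of_int n) / 2) * tanh ((w + of_real p * of_int n) / 2))
    has_sum coth_csch x (sech_sum p z) (sech_sum p w)) UNIV"
proof -
  have w: "w \<in> strip" using assms by simp
  have nz: "sinh (of_real x / 2 :: complex) \<noteq> 0"
    using sinh_real_nonzero[of "x / 2"] assms by simp
  have eq: "1 / cosh ((z + of_real p * of_int n) / 2) * tanh ((w + of_real p * of_int n) / 2)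
    = cosh (of_real x / 2 :: complex) / sinh (of_real x / 2 :: complex) * (1 / cosh ((z + of_real p * of_int n) / 2))
     - 1 / sinh (of_real x / 2 :: complex) * (1 / cosh ((w + of_real p * of_int n) / 2))" for n
  proof -
    have d: "(w + of_real p * of_int n) / 2 - (z + of_real p * of_int n) / 2 = of_real x / 2"
      by (simp add: assms field_simps)
    show ?thesis
      by (rule sech_mult_tanh[of "(z + of_real p * of_int n) / 2" "(w + of_real p * of_int n) / 2", unfolded d])
         (rule cosh_half_shift_nonzero[OF assms(1)] cosh_half_shift_nonzero[OF w] nz)+
  qed
  show ?thesis
    unfolding eq coth_csch_def
    by (intro has_sum_diff has_sum_cmult_right sech_sum_has_sum w assms)
qed

text \<open>Minus twice the logarithmic derivative of the secant sum, as
  \<open>sech_sum_DERIV\<close> shows. The 1 is half the quasi-period; it makes the expression a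
  symmetric difference, see \<open>tanh_gap_alt\<close>.\<close>

definition tanh_gap :: "real \<Rightarrow> complex \<Rightarrow> complex" where
  "tanh_gap p z = tanh_sum p z + 1 - tanh_sum p (z + of_real p / 2)"

lemma strip_half [simp]: "z + of_real x / 2 \<in> strip \<longleftrightarrow> z \<in> strip" "z - of_real x / 2 \<in> strip \<longleftrightarrow> z \<in> strip"
  "of_real x / 2 \<in> strip"
  by (auto simp: strip_def)

lemma half_shift:
  "z - of_real p / 2 + of_real p = z + of_real p / 2" "z + of_real p / 2 + of_real p / 2 = z + of_real p"
  for z :: complex
  by (simp_all add: field_simps)

lemma tanh_gap_alt:
  assumes "z \<in> strip" "p > 0"
  shows "tanh_gap p z = tanh_sum p z - (tanh_sum p (z + of_real p / 2) + tanh_sum p (z - of_real p / 2)) / 2"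
proof -
  have "tanh_sum p (z + of_real p / 2) = tanh_sum p (z - of_real p / 2) + 2"
    using tanh_sum_period[of "z - of_real p / 2" p] assms by (simp add: half_shift)
  then show ?thesis by (simp add: tanh_gap_def add_divide_distrib)
qed

text \<open>The product is regrouped by index differences \<open>k\<close>. Every inner sum with
  \<open>k\<close> other than \<open>0\<close> is a combination of \<open>coth_csch\<close> values
  at \<open>p k\<close> and \<open>p k\<close> plus or minus \<open>p / 2\<close>. Replacing
  \<open>k\<close> by \<open>- k\<close> changes its sign, so only the diagonal \<open>0\<close>
  remains.\<close>

lemma sech_sum_mult_tanh_gap:
  assumes "z \<in> strip" "p > 0"
  shows "sech_sum p z * tanh_gap p z =
    (\<Sum>\<^sub>\<infinity>n::int. 1 / cosh ((z + of_real p * of_int n) / 2) * tanh ((z + of_real p * of_int n) / 2))"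
proof -
  define s where "s = (\<lambda>n::int. 1 / cosh ((z + of_real p * of_int n) / 2))"
  define u where "u = (\<lambda>w (n::int). tanh ((w + of_real p * of_int n) / 2) - tanh (of_real p * of_int n / 2 :: complex))"
  \<comment> \<open>The reference terms \<open>tanh (p n / 2)\<close> cancel in this combination. So
    \<open>r\<close> is absolutely summable and yet consists of three plain \<open>tanh\<close>
    terms, to which the addition formula applies.\<close>
  define r where "r = (\<lambda>n. u z n - (u (z + of_real p / 2) n + u (z - of_real p / 2) n) / 2)"
  have abs: "(\<lambda>n. norm (s n)) summable_on UNIV"
    unfolding s_def by (rule abs_summable_sech[OF assms])
  have u_abs: "(\<lambda>n. norm (u w n)) summable_on UNIV" if "w \<in> strip" for w
    unfolding u_def by (rule abs_summable_tanh_diff[OF that assms(2)])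
  have u_sum: "(u w has_sum tanh_sum p w) UNIV" if "w \<in> strip" for w
    using has_sum_infsum[OF abs_summable_summable[OF u_abs[OF that]]] by (simp only: u_def tanh_sum_def)
  have r_sum: "(r has_sum tanh_gap p z) UNIV"
  proof -
    have "((\<lambda>n. u z n - (u (z + of_real p / 2) n + u (z - of_real p / 2) n) * (1 / 2)) has_sum
       (tanh_sum p z - (tanh_sum p (z + of_real p / 2) + tanh_sum p (z - of_real p / 2)) * (1 / 2))) UNIV"
      by (intro has_sum_diff has_sum_cmult_left has_sum_add u_sum) (use assms in auto)
    then show ?thesis by (simp add: r_def tanh_gap_alt[OF assms])
  qed
  have r_abs: "(\<lambda>n. norm (r n)) summable_on UNIV"
  proof (rule norm_summable_comparison)
    show "(\<lambda>n. norm (u z n) + (norm (u (z + of_real p / 2) n) + norm (u (z - of_real p / 2) n))) summable_on UNIV"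
      by (intro summable_on_add u_abs) (use assms in auto)
    fix n
    have "norm (r n) \<le> norm (u z n) + norm (u (z + of_real p / 2) n + u (z - of_real p / 2) n) / 2"
      unfolding r_def by (rule order.trans[OF norm_triangle_ineq4]) simp
    also have "\<dots> \<le> norm (u z n) + (norm (u (z + of_real p / 2) n) + norm (u (z - of_real p / 2) n))"
      using norm_triangle_ineq[of "u (z + of_real p / 2) n" "u (z - of_real p / 2) n"]
        norm_ge_zero[of "u (z + of_real p / 2) n + u (z - of_real p / 2) n"] by linarith
    finally show "norm (r n) \<le> norm (u z n) + (norm (u (z + of_real p / 2) n) + norm (u (z - of_real p / 2) n))" .
  qed
  define I where "I = (\<lambda>k. \<Sum>\<^sub>\<infinity>n. s n * r (n + k))"
  have I: "(I has_sum (sech_sum p z * tanh_gap p z)) UNIV"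
  proof -
    have "infsum s UNIV = sech_sum p z" by (simp only: s_def sech_sum_def)
    then show ?thesis
      using product_as_shifted_sums[OF abs r_abs] infsumI[OF r_sum] by (simp only: I_def)
  qed
  let ?D = "sech_sum p z" and ?E = "sech_sum p (z + of_real p / 2)"
  have arg: "(w + of_real p * of_int (n + k)) / 2 = (w + of_real p * of_int k + of_real p * of_int n) / 2" for w and n k :: int
    by (simp add: algebra_simps)
  have r: "r (n + k) = tanh ((z + of_real p * of_int k + of_real p * of_int n) / 2)
     - (tanh ((z + of_real p / 2 + of_real p * of_int k + of_real p * of_int n) / 2) +
        tanh ((z - of_real p / 2 + of_real p * of_int k + of_real p * of_int n) / 2)) / 2" for n k
    unfolding r_def u_def arg by (simp add: field_simps)
  have half: "((\<lambda>n. s n * tanh ((w + of_real p * of_int k + of_real p * of_int n) / 2)) has_sum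
       coth_csch x ?D (sech_sum p w)) UNIV"
    if "w + of_real p * of_int k = z + of_real x" "x \<noteq> 0" for w x and k :: int
    using sech_tanh_has_sum[OF assms that(2,1)] unfolding s_def sech_sum_period_int .
  have nz: "p / 2 + p * of_int k \<noteq> 0" "- (p / 2) + p * of_int k \<noteq> 0" for k :: int
  proof -
    have "p / 2 + p * of_int k = p / 2 * of_int (2 * k + 1)" "- (p / 2) + p * of_int k = p / 2 * of_int (2 * k - 1)"
      by (simp_all add: algebra_simps)
    moreover have "2 * k + 1 \<noteq> 0" "2 * k - 1 \<noteq> 0" by presburger+
    ultimately show "p / 2 + p * of_int k \<noteq> 0" "- (p / 2) + p * of_int k \<noteq> 0"
      using assms by (metis divide_eq_0_iff less_irrefl mult_eq_0_iff of_int_eq_0_iff zero_neq_numeral)+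
  qed
  have off: "((\<lambda>n. s n * tanh ((z + of_real p / 2 + of_real p * of_int k + of_real p * of_int n) / 2)) has_sum
       coth_csch (p / 2 + p * of_int k) ?D ?E) UNIV"
    "((\<lambda>n. s n * tanh ((z - of_real p / 2 + of_real p * of_int k + of_real p * of_int n) / 2)) has_sum
       coth_csch (- (p / 2) + p * of_int k) ?D ?E) UNIV" for k
    using half[of "z + of_real p / 2" k "p / 2 + p * of_int k"] half[of "z - of_real p / 2" k "- (p / 2) + p * of_int k"] nz
    by (simp_all add: sech_sum_half_period)
  have main: "I k = A - (coth_csch (p / 2 + p * of_int k) ?D ?E + coth_csch (- (p / 2) + p * of_int k) ?D ?E) / 2"
    if "((\<lambda>n. s n * tanh ((z + of_real p * of_int k + of_real p * of_int n) / 2)) has_sum A) UNIV" for k A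
  proof -
    have "((\<lambda>n. s n * tanh ((z + of_real p * of_int k + of_real p * of_int n) / 2)
      - (s n * tanh ((z + of_real p / 2 + of_real p * of_int k + of_real p * of_int n) / 2)
       + s n * tanh ((z - of_real p / 2 + of_real p * of_int k + of_real p * of_int n) / 2)) * (1 / 2)) has_sum
      A - (coth_csch (p / 2 + p * of_int k) ?D ?E + coth_csch (- (p / 2) + p * of_int k) ?D ?E) * (1 / 2)) UNIV"
      by (intro has_sum_diff has_sum_cmult_left has_sum_add off that)
    then show ?thesis
      unfolding I_def r by (intro infsumI) (simp add: ring_distribs)
  qed
  have Ik: "I k = coth_csch (p * of_int k) ?D ?D
      - (coth_csch (p / 2 + p * of_int k) ?D ?E + coth_csch (- (p / 2) + p * of_int k) ?D ?E) / 2"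
    if "k \<noteq> 0" for k
    by (rule main, rule half) (use that assms in auto)
  have "sech_sum p z * tanh_gap p z = I 0"
    unfolding infsumI[OF I, symmetric]
  proof (rule infsum_int_odd)
    show "I summable_on UNIV" using I by (rule has_sum_imp_summable)
    fix k :: int assume k: "k \<noteq> 0"
    have eqs: "coth_csch (p * of_int (- k)) a b = - coth_csch (p * of_int k) a b"
      "coth_csch (p / 2 + p * of_int (- k)) a b = - coth_csch (- (p / 2) + p * of_int k) a b"
      "coth_csch (- (p / 2) + p * of_int (- k)) a b = - coth_csch (p / 2 + p * of_int k) a b" for a b
      unfolding coth_csch_minus[symmetric] by (simp_all add: algebra_simps)
    have nk: "- k \<noteq> 0" using k by simp
    show "I (- k) = - I k"
      unfolding Ik[OF k] Ik[OF nk] eqs by (simp add: diff_divide_distrib add_divide_distrib)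
  qed
  \<comment> \<open>For \<open>k = 0\<close> the contributions of the two half-period translates are
    opposite, as \<open>coth_csch\<close> is odd in its first argument.\<close>
  also have "I 0 = (\<Sum>\<^sub>\<infinity>n. s n * tanh ((z + of_real p * of_int n) / 2))"
  proof -
    have "(\<lambda>n. s n * tanh ((z + of_real p * of_int n) / 2)) summable_on UNIV"
      using summable_on_cmult_left[OF sech_sum_has_field_derivative(2)[OF assms], of "- 2"]
      by (simp add: s_def)
    from has_sum_infsum[OF this] show ?thesis
      using main[of 0] by (simp add: coth_csch_minus)
  qed
  finally show ?thesis by (simp only: s_def)
qed

lemma sech_sum_DERIV:
  assumes "z \<in> strip" "p > 0"
  shows "(sech_sum p has_field_derivative (- (sech_sum p z * tanh_gap p z) / 2)) (at z)"
proof -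
  have "(\<Sum>\<^sub>\<infinity>n::int. - (1 / cosh ((z + of_real p * of_int n) / 2) * tanh ((z + of_real p * of_int n) / 2) / 2))
    = (\<Sum>\<^sub>\<infinity>n::int. (- 1 / 2) * (1 / cosh ((z + of_real p * of_int n) / 2) * tanh ((z + of_real p * of_int n) / 2)))"
    by (rule infsum_cong) simp
  also have "\<dots> = (- 1 / 2) * (\<Sum>\<^sub>\<infinity>n::int. 1 / cosh ((z + of_real p * of_int n) / 2) * tanh ((z + of_real p * of_int n) / 2))"
    using summable_on_cmult_left[OF sech_sum_has_field_derivative(2)[OF assms], of "- 2"]
    by (intro infsum_cmult_right) simp
  finally show ?thesis
    using sech_sum_has_field_derivative(1)[OF assms] by (simp add: sech_sum_mult_tanh_gap[OF assms])
qed

lemma tanh_sum_DERIV: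
  assumes "z \<in> strip" "p > 0"
  shows "(tanh_sum p has_field_derivative ((sech_sum p z)\<^sup>2 - sech_sum_const p) / 2) (at z)"
  using tanh_sum_has_field_derivative(1)[OF assms] sech_sum_square[OF assms] by simp

lemma tanh_sum_half: "p > 0 \<Longrightarrow> tanh_sum p (of_real p / 2) = 1"
  using tanh_sum_period[of "- (of_real p / 2)" p] tanh_sum_minus[of p "of_real p / 2"]
  by (simp add: field_simps strip_def)

lemma tanh_gap_0: "p > 0 \<Longrightarrow> tanh_gap p 0 = 0"
  by (simp add: tanh_gap_def tanh_sum_half)

lemma tanh_gap_half:
  assumes "z \<in> strip" "p > 0"
  shows "tanh_gap p (z + of_real p / 2) = - tanh_gap p z"
  using tanh_sum_period[of z p] assms by (simp add: tanh_gap_def half_shift)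

lemma tanh_gap_DERIV:
  assumes "z \<in> strip" "p > 0"
  shows "(tanh_gap p has_field_derivative ((sech_sum p z)\<^sup>2 - (sech_sum p (z + of_real p / 2))\<^sup>2) / 2) (at z)"
proof -
  have "((\<lambda>z. tanh_sum p (z + of_real p / 2)) has_field_derivative
      ((sech_sum p (z + of_real p / 2))\<^sup>2 - sech_sum_const p) / 2 * 1) (at z)"
    by (rule DERIV_chain2[OF tanh_sum_DERIV]) (use assms in \<open>auto intro!: derivative_eq_intros\<close>)
  moreover have "((\<lambda>z. tanh_sum p z + 1) has_field_derivative ((sech_sum p z)\<^sup>2 - sech_sum_const p) / 2) (at z)"
    using DERIV_add[OF tanh_sum_DERIV[OF assms] DERIV_const] by simp
  ultimately show ?thesis
    unfolding tanh_gap_def[abs_def] using DERIV_diff by (fastforce simp: diff_divide_distrib)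
qed

lemma strip_const:
  assumes "\<And>z. z \<in> strip \<Longrightarrow> (f has_field_derivative 0) (at z)" "z \<in> strip" "w \<in> strip"
  shows "f z = f w"
  using has_field_derivative_zero_constant[OF convex_strip, of f] assms
  by (metis has_field_derivative_at_within)

text \<open>Translation by half a period reverses the sign of \<open>tanh_gap\<close>, so the three
  derivatives cancel. This conserved quantity eliminates the gap and the translated sum from the
  second derivative of the secant sum and leaves a cubic.\<close>

lemma sech_sum_invariant:
  assumes "z \<in> strip" "p > 0"
  shows "(tanh_gap p z)\<^sup>2 + (sech_sum p z)\<^sup>2 + (sech_sum p (z + of_real p / 2))\<^sup>2
    = (sech_sum p 0)\<^sup>2 + (sech_sum p (of_real p / 2))\<^sup>2"
proof -
  have "(tanh_gap p z)\<^sup>2 + (sech_sum p z)\<^sup>2 + (sech_sum p (z + of_real p / 2))\<^sup>2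
    = (tanh_gap p 0)\<^sup>2 + (sech_sum p 0)\<^sup>2 + (sech_sum p (0 + of_real p / 2))\<^sup>2"
  proof (rule strip_const[where f = "\<lambda>z. (tanh_gap p z)\<^sup>2 + (sech_sum p z)\<^sup>2 + (sech_sum p (z + of_real p / 2))\<^sup>2"])
    fix z :: complex assume z: "z \<in> strip"
    have "((\<lambda>z. sech_sum p (z + of_real p / 2)) has_field_derivative
        - (sech_sum p (z + of_real p / 2) * tanh_gap p (z + of_real p / 2)) / 2 * 1) (at z)"
      by (rule DERIV_chain2[OF sech_sum_DERIV]) (use z assms in \<open>auto intro!: derivative_eq_intros\<close>)
    then have 1: "((\<lambda>z. sech_sum p (z + of_real p / 2)) has_field_derivative
        sech_sum p (z + of_real p / 2) * tanh_gap p z / 2) (at z)"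
      using tanh_gap_half[OF z assms(2)] by simp
    show "((\<lambda>z. (tanh_gap p z)\<^sup>2 + (sech_sum p z)\<^sup>2 + (sech_sum p (z + of_real p / 2))\<^sup>2)
       has_field_derivative 0) (at z)"
      by (rule derivative_eq_intros 1 tanh_gap_DERIV[OF z assms(2)] sech_sum_DERIV[OF z assms(2)] refl)+
         (simp add: field_simps power2_eq_square)
  qed (use assms in auto)
  then show ?thesis using assms by (simp add: tanh_gap_0)
qed

lemma sech_sum_DERIV2:
  assumes "z \<in> strip" "p > 0"
  shows "((\<lambda>z. - (sech_sum p z * tanh_gap p z) / 2) has_field_derivative
     sech_sum p z * ((sech_sum p 0)\<^sup>2 + (sech_sum p (of_real p / 2))\<^sup>2 - 2 * (sech_sum p z)\<^sup>2) / 4) (at z)"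
proof -
  have *: "- (- (D * R) / 2 * R + (D\<^sup>2 - E\<^sup>2) / 2 * D) / 2 = D * (R\<^sup>2 + D\<^sup>2 + E\<^sup>2 - 2 * D\<^sup>2) / 4" for D R E :: complex
    by (simp add: field_simps power2_eq_square)
  show ?thesis
    unfolding sech_sum_invariant[OF assms, symmetric] *[symmetric]
    by (intro DERIV_cdivide DERIV_minus DERIV_mult tanh_gap_DERIV sech_sum_DERIV assms)
qed

section \<open>Jacobi elliptic functions\<close>

lemma one_minus_m_sin_pos:
  fixes m :: real
  assumes "0 < m" "m < 1"
  shows "0 < 1 - m * (sin \<theta>)\<^sup>2" "1 - m * (sin \<theta>)\<^sup>2 \<le> 1"
proof -
  have "m * (sin \<theta>)\<^sup>2 \<le> m * 1"
    using assms by (intro mult_left_mono) (auto simp: abs_square_le_1)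
  then show "0 < 1 - m * (sin \<theta>)\<^sup>2" "1 - m * (sin \<theta>)\<^sup>2 \<le> 1"
    using assms mult_nonneg_nonneg[of m "(sin \<theta>)\<^sup>2"] zero_le_power2[of "sin \<theta>"] by linarith+
qed

lemma elliptic_F_DERIV:
  assumes m: "0 < m" "m < 1"
  shows "((\<lambda>\<phi>. elliptic_F \<phi> m) has_real_derivative 1 / sqrt (1 - m * (sin \<phi>)\<^sup>2)) (at \<phi>)"
proof -
  have nz: "1 - m * (sin \<theta>)\<^sup>2 \<noteq> 0" for \<theta>
    using one_minus_m_sin_pos[OF m, of \<theta>] by simp
  have cont: "continuous_on A (\<lambda>\<theta>. 1 / sqrt (1 - m * (sin \<theta>)\<^sup>2))" for A
    using nz by (intro continuous_intros) force
  define b where "b = \<bar>\<phi>\<bar> + 1"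
  have b: "- b < 0" "0 < b" "- b < \<phi>" "\<phi> < b" by (auto simp: b_def)
  have "((\<lambda>u. LBINT \<theta>=ereal 0..ereal u. 1 / sqrt (1 - m * (sin \<theta>)\<^sup>2)) has_vector_derivative
          1 / sqrt (1 - m * (sin \<phi>)\<^sup>2)) (at \<phi> within {- b..b})"
    by (rule interval_integral_FTC2) (use b cont in auto)
  then have "((\<lambda>u. LBINT \<theta>=ereal 0..ereal u. 1 / sqrt (1 - m * (sin \<theta>)\<^sup>2)) has_real_derivative
          1 / sqrt (1 - m * (sin \<phi>)\<^sup>2)) (at \<phi> within {- b..b})"
    by (simp add: has_real_derivative_iff_has_vector_derivative)
  moreover have "at \<phi> within {- b..b} = at \<phi>"
    by (rule at_within_interior) (use b in auto)
  ultimately show ?thesis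
    by (simp add: elliptic_F_def zero_ereal_def)
qed

lemma elliptic_F_0 [simp]: "elliptic_F 0 m = 0"
  by (simp add: elliptic_F_def zero_ereal_def)

context
  fixes m :: real
  assumes m: "0 < m" "m < 1"
begin

text \<open>The integrand is at least 1. This single inequality supplies strict monotonicity,
  surjectivity and a Lipschitz bound for the inverse.\<close>

lemma elliptic_F_diff_ge:
  assumes "a \<le> b"
  shows "elliptic_F b m - elliptic_F a m \<ge> b - a"
proof -
  have "elliptic_F a m - a \<le> elliptic_F b m - b"
  proof (rule DERIV_nonneg_imp_nondecreasing[OF assms])
    fix x
    have "1 / sqrt (1 - m * (sin x)\<^sup>2) \<ge> 1"
      using one_minus_m_sin_pos[OF m, of x] by simp
    then show "\<exists>y. ((\<lambda>x. elliptic_F x m - x) has_real_derivative y) (at x) \<and> 0 \<le> y"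
      by (intro exI[of _ "1 / sqrt (1 - m * (sin x)\<^sup>2) - 1"] conjI)
         (auto intro!: derivative_eq_intros elliptic_F_DERIV m)
  qed
  then show ?thesis by simp
qed

lemma elliptic_F_less_iff: "elliptic_F a m < elliptic_F b m \<longleftrightarrow> a < b"
  using elliptic_F_diff_ge[of a b] elliptic_F_diff_ge[of b a] by linarith

lemma elliptic_F_eq_iff: "elliptic_F a m = elliptic_F b m \<longleftrightarrow> a = b"
  using elliptic_F_less_iff[of a b] elliptic_F_less_iff[of b a] by linarith

lemma elliptic_F_surj: "\<exists>\<phi>. elliptic_F \<phi> m = u"
proof -
  have cont: "continuous_on A (\<lambda>\<phi>. elliptic_F \<phi> m)" for A
    by (intro continuous_at_imp_continuous_on ballI DERIV_isCont[OF elliptic_F_DERIV[OF m]])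
  have "elliptic_F (- \<bar>u\<bar>) m \<le> u" "u \<le> elliptic_F \<bar>u\<bar> m"
    using elliptic_F_diff_ge[of 0 "\<bar>u\<bar>"] elliptic_F_diff_ge[of "- \<bar>u\<bar>" 0] by auto
  then show ?thesis
    using IVT'[of "\<lambda>\<phi>. elliptic_F \<phi> m" "- \<bar>u\<bar>" u "\<bar>u\<bar>"] cont by auto
qed

lemma elliptic_F_am: "elliptic_F (jacobi_am u m) m = u"
proof -
  have "\<exists>!\<phi>. elliptic_F \<phi> m = u"
    using elliptic_F_surj elliptic_F_eq_iff by (metis)
  then show ?thesis unfolding jacobi_am_def by (rule theI')
qed

lemma am_elliptic_F: "jacobi_am (elliptic_F \<phi> m) m = \<phi>"
  using elliptic_F_am elliptic_F_eq_iff by blast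

lemma jacobi_am_0 [simp]: "jacobi_am 0 m = 0"
  using am_elliptic_F[of 0] by simp

lemma jacobi_am_le_iff: "jacobi_am u m \<le> jacobi_am v m \<longleftrightarrow> u \<le> v"
  using elliptic_F_less_iff[of "jacobi_am v m" "jacobi_am u m"] by (simp add: elliptic_F_am not_less[symmetric])

lemma elliptic_F_minus: "elliptic_F (- \<phi>) m = - elliptic_F \<phi> m"
proof -
  have "elliptic_F (- \<phi>) m + elliptic_F \<phi> m = elliptic_F (- 0) m + elliptic_F 0 m"
  proof (rule DERIV_isconst_all[where f = "\<lambda>\<phi>. elliptic_F (- \<phi>) m + elliptic_F \<phi> m", rule_format])
    fix x
    have "((\<lambda>x. elliptic_F (- x) m) has_real_derivative 1 / sqrt (1 - m * (sin (- x))\<^sup>2) * - 1) (at x)"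
      by (rule DERIV_chain2[OF elliptic_F_DERIV[OF m]]) (auto intro!: derivative_eq_intros)
    from DERIV_add[OF this elliptic_F_DERIV[OF m]]
    show "((\<lambda>x. elliptic_F (- x) m + elliptic_F x m) has_real_derivative 0) (at x)" by simp
  qed
  then show ?thesis by simp
qed

lemma elliptic_F_add_pi: "elliptic_F (\<phi> + pi) m = elliptic_F \<phi> m + 2 * elliptic_K m"
proof -
  \<comment> \<open>The base point \<open>- (pi / 2)\<close> is chosen so that oddness turns the
    constant into \<open>2 * elliptic_K m\<close>.\<close>
  have "elliptic_F (\<phi> + pi) m - elliptic_F \<phi> m = elliptic_F (- (pi / 2) + pi) m - elliptic_F (- (pi / 2)) m"
  proof (rule DERIV_isconst_all[where f = "\<lambda>\<phi>. elliptic_F (\<phi> + pi) m - elliptic_F \<phi> m", rule_format])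
    fix x
    have "((\<lambda>x. elliptic_F (x + pi) m) has_real_derivative 1 / sqrt (1 - m * (sin (x + pi))\<^sup>2) * 1) (at x)"
      by (rule DERIV_chain2[OF elliptic_F_DERIV[OF m]]) (auto intro!: derivative_eq_intros)
    from DERIV_diff[OF this elliptic_F_DERIV[OF m]]
    show "((\<lambda>x. elliptic_F (x + pi) m - elliptic_F x m) has_real_derivative 0) (at x)" by simp
  qed
  also have "- (pi / 2) + pi = pi / 2" by simp
  finally show ?thesis by (simp add: elliptic_F_minus elliptic_K_def)
qed

lemma elliptic_K_pos: "elliptic_K m > 0"
  using elliptic_F_less_iff[of 0 "pi / 2"] by (simp add: elliptic_K_def)

lemma jacobi_am_minus: "jacobi_am (- u) m = - jacobi_am u m"
  using elliptic_F_minus[of "jacobi_am u m"] by (metis elliptic_F_am am_elliptic_F)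

lemma jacobi_am_add_2K: "jacobi_am (u + 2 * elliptic_K m) m = jacobi_am u m + pi"
  using elliptic_F_add_pi[of "jacobi_am u m"] by (metis elliptic_F_am am_elliptic_F)

lemma jacobi_am_2K: "jacobi_am (2 * elliptic_K m) m = pi"
  using jacobi_am_add_2K[of 0] by simp

lemma jacobi_am_K: "jacobi_am (elliptic_K m) m = pi / 2"
  unfolding elliptic_K_def by (rule am_elliptic_F)

lemma jacobi_cn_0 [simp]: "jacobi_cn 0 m = 1" and jacobi_dn_0 [simp]: "jacobi_dn 0 m = 1"
  by (simp_all add: jacobi_cn_def jacobi_dn_def)

lemma jacobi_cn_minus: "jacobi_cn (- u) m = jacobi_cn u m" and jacobi_dn_minus: "jacobi_dn (- u) m = jacobi_dn u m"
  by (simp_all add: jacobi_cn_def jacobi_dn_def jacobi_am_minus)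

lemma jacobi_cn_add_4K: "jacobi_cn (u + 4 * elliptic_K m) m = jacobi_cn u m"
  and jacobi_dn_add_4K: "jacobi_dn (u + 4 * elliptic_K m) m = jacobi_dn u m"
proof -
  have "u + 4 * elliptic_K m = u + 2 * elliptic_K m + 2 * elliptic_K m" by simp
  then have "jacobi_am (u + 4 * elliptic_K m) m = jacobi_am u m + 2 * pi"
    by (simp only: jacobi_am_add_2K)
  then show "jacobi_cn (u + 4 * elliptic_K m) m = jacobi_cn u m" "jacobi_dn (u + 4 * elliptic_K m) m = jacobi_dn u m"
    by (simp_all only: jacobi_cn_def jacobi_dn_def sin_periodic cos_periodic)
qed

lemma jacobi_dn_pos: "jacobi_dn u m > 0"
  using one_minus_m_sin_pos[OF m] by (simp add: jacobi_dn_def)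

lemma jacobi_dn_square: "(jacobi_dn u m)\<^sup>2 = 1 - m * (sin (jacobi_am u m))\<^sup>2"
  using one_minus_m_sin_pos[OF m, of "jacobi_am u m"] by (simp add: jacobi_dn_def)

lemma jacobi_am_DERIV: "((\<lambda>u. jacobi_am u m) has_real_derivative jacobi_dn u m) (at u)"
proof -
  \<comment> \<open>An expanding function has a 1-Lipschitz inverse; the continuity obtained this
    way is what the inverse function rule asks for.\<close>
  have lip: "\<bar>jacobi_am v m - jacobi_am u m\<bar> \<le> \<bar>v - u\<bar>" for v
    using elliptic_F_diff_ge[of "jacobi_am v m" "jacobi_am u m"] elliptic_F_diff_ge[of "jacobi_am u m" "jacobi_am v m"]
    by (cases "jacobi_am u m \<le> jacobi_am v m") (simp_all add: elliptic_F_am)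
  have "((\<lambda>v. jacobi_am v m) \<longlongrightarrow> jacobi_am u m) (at u)"
  proof (rule LIM_I)
    fix r :: real assume "r > 0"
    then show "\<exists>s>0. \<forall>x. x \<noteq> u \<and> norm (x - u) < s \<longrightarrow> norm (jacobi_am x m - jacobi_am u m) < r"
      using lip by (intro exI[of _ r]) (auto intro: le_less_trans)
  qed
  then have "isCont (\<lambda>v. jacobi_am v m) u" by (simp add: isCont_def)
  then have "((\<lambda>u. jacobi_am u m) has_real_derivative inverse (1 / sqrt (1 - m * (sin (jacobi_am u m))\<^sup>2))) (at u)"
    using one_minus_m_sin_pos[OF m, of "jacobi_am u m"]
    by (intro DERIV_inverse_function[where f = "\<lambda>\<phi>. elliptic_F \<phi> m" and a = "u - 1" and b = "u + 1"] elliptic_F_DERIV m)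
       (auto simp: elliptic_F_am)
  then show ?thesis by (simp add: jacobi_dn_def)
qed

lemma jacobi_cn_DERIV:
  "((\<lambda>u. jacobi_cn u m) has_real_derivative - (sin (jacobi_am u m) * jacobi_dn u m)) (at u)"
  unfolding jacobi_cn_def by (auto intro!: derivative_eq_intros jacobi_am_DERIV)

lemma jacobi_sn_DERIV:
  "((\<lambda>u. sin (jacobi_am u m)) has_real_derivative jacobi_cn u m * jacobi_dn u m) (at u)"
  unfolding jacobi_cn_def by (auto intro!: derivative_eq_intros jacobi_am_DERIV)

lemma jacobi_dn_DERIV:
  "((\<lambda>u. jacobi_dn u m) has_real_derivative - (m * sin (jacobi_am u m) * jacobi_cn u m)) (at u)"
proof -
  have "((\<lambda>u. sqrt (1 - m * (sin (jacobi_am u m))\<^sup>2)) has_real_derivative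
     inverse (sqrt (1 - m * (sin (jacobi_am u m))\<^sup>2)) / 2 *
       (- (m * (2 * sin (jacobi_am u m) * (jacobi_cn u m * jacobi_dn u m))))) (at u)"
  proof (rule DERIV_chain2[OF DERIV_real_sqrt], rule one_minus_m_sin_pos[OF m])
    show "((\<lambda>u. 1 - m * (sin (jacobi_am u m))\<^sup>2) has_real_derivative
       - (m * (2 * sin (jacobi_am u m) * (jacobi_cn u m * jacobi_dn u m)))) (at u)"
      using DERIV_diff[OF DERIV_const DERIV_cmult[OF DERIV_power[OF jacobi_sn_DERIV, of 2]], of 1 m u]
      by (simp add: mult_ac)
  qed
  then show ?thesis
    using jacobi_dn_pos[of u] by (simp add: jacobi_dn_def[symmetric] field_simps)
qed

end

lemma elliptic_K_strict_mono:
  assumes "0 < a" "a < b" "b < 1"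
  shows "elliptic_K a < elliptic_K b"
proof -
  let ?g = "\<lambda>x. elliptic_F x b - elliptic_F x a"
  have "?g 0 < ?g (pi / 2)"
  proof (rule DERIV_pos_imp_increasing_open[where f = ?g])
    show "\<exists>y. (?g has_real_derivative y) (at x) \<and> y > 0" if "0 < x" "x < pi / 2" for x
    proof -
      have "sin x > 0" using that by (intro sin_gt_zero) auto
      then have "a * (sin x)\<^sup>2 < b * (sin x)\<^sup>2"
        using assms by simp
      moreover have "0 < 1 - b * (sin x)\<^sup>2" "0 < 1 - a * (sin x)\<^sup>2"
        using one_minus_m_sin_pos assms by auto
      ultimately have "1 / sqrt (1 - b * (sin x)\<^sup>2) - 1 / sqrt (1 - a * (sin x)\<^sup>2) > 0"
        by (simp add: divide_strict_left_mono)
      then show ?thesis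
        using DERIV_diff[OF elliptic_F_DERIV[of b x] elliptic_F_DERIV[of a x]] assms by auto
    qed
    show "continuous_on {0..pi / 2} ?g"
      using assms by (intro continuous_at_imp_continuous_on ballI isCont_diff DERIV_isCont[OF elliptic_F_DERIV]) auto
  qed simp
  then show ?thesis by (simp add: elliptic_K_def)
qed

text \<open>\<open>elliptic_K\<close> increases with the parameter and \<open>elliptic_K'\<close>
  decreases, hence the quotient is strictly increasing.\<close>

lemma elliptic_nome_unique:
  assumes "0 < a" "a < 1" "0 < b" "b < 1"
    and "4 * pi * elliptic_K a / elliptic_K' a = 4 * pi * elliptic_K b / elliptic_K' b"
  shows "a = b"
proof -
  have *: "4 * pi * elliptic_K a / elliptic_K' a < 4 * pi * elliptic_K b / elliptic_K' b"
    if "0 < a" "a < b" "b < 1" for a b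
  proof -
    have "elliptic_K a < elliptic_K b" "elliptic_K' b < elliptic_K' a"
      using that elliptic_K_strict_mono[of "1 - b" "1 - a"] by (auto simp: elliptic_K'_def elliptic_K_strict_mono)
    moreover have "0 < elliptic_K a" "0 < elliptic_K' b"
      using that by (auto simp: elliptic_K'_def intro!: elliptic_K_pos)
    ultimately have "elliptic_K a / elliptic_K' a < elliptic_K b / elliptic_K' b"
      by (intro frac_less) auto
    then have "4 * pi * (elliptic_K a / elliptic_K' a) < 4 * pi * (elliptic_K b / elliptic_K' b)"
      by (intro mult_strict_left_mono) auto
    then show ?thesis by (simp only: times_divide_eq_right)
  qed
  show ?thesis using *[of a b] *[of b a] assms by linarith
qed

section \<open>Uniqueness for second-order equations\<close>

lemma linear_ode_zero:
  fixes e e' w :: "real \<Rightarrow> real"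
  assumes e: "\<And>t. t \<in> {0..T} \<Longrightarrow> (e has_real_derivative e' t) (at t)"
    and e': "\<And>t. t \<in> {0..T} \<Longrightarrow> (e' has_real_derivative w t * e t) (at t)"
    and w: "\<And>t. t \<in> {0..T} \<Longrightarrow> \<bar>w t\<bar> \<le> L" and "e 0 = 0" "e' 0 = 0" and t: "t \<in> {0..T}"
  shows "e t = 0"
proof -
  \<comment> \<open>Gronwall's argument: the energy \<open>e\<^sup>2 + e'\<^sup>2\<close> grows at
    rate at most \<open>1 + L\<close>, since its derivative is \<open>2 e e' (1 + w)\<close>. The
    exponential factor makes it nonincreasing, and it starts at \<open>0\<close>.\<close>
  let ?E = "\<lambda>t. exp (- ((1 + L) * t)) * ((e t)\<^sup>2 + (e' t)\<^sup>2)"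
  have "?E t \<le> ?E 0"
  proof (rule DERIV_nonpos_imp_nonincreasing[where f = ?E])
    show "0 \<le> t" using t by simp
    fix x assume x: "0 \<le> x" "x \<le> t"
    then have xT: "x \<in> {0..T}" using t by auto
    let ?d = "exp (- ((1 + L) * x)) * (2 * e x * e' x * (1 + w x) - (1 + L) * ((e x)\<^sup>2 + (e' x)\<^sup>2))"
    have "(?E has_real_derivative ?d) (at x)"
      by (rule derivative_eq_intros e[OF xT] e'[OF xT] refl)+ (simp add: algebra_simps power2_eq_square)
    moreover have "?d \<le> 0"
    proof -
      have L: "\<bar>1 + w x\<bar> \<le> 1 + L" using w[OF xT] by linarith
      have "2 * e x * e' x * (1 + w x) \<le> \<bar>2 * e x * e' x\<bar> * \<bar>1 + w x\<bar>"
        by (metis abs_ge_self abs_mult)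
      also have "\<dots> \<le> ((e x)\<^sup>2 + (e' x)\<^sup>2) * (1 + L)"
      proof (rule mult_mono[OF _ L])
        have "0 \<le> (\<bar>e x\<bar> - \<bar>e' x\<bar>)\<^sup>2" by simp
        then show "\<bar>2 * e x * e' x\<bar> \<le> (e x)\<^sup>2 + (e' x)\<^sup>2"
          by (simp add: power2_diff abs_mult)
      qed auto
      finally show ?thesis by (simp add: mult_le_0_iff mult.commute)
    qed
    ultimately show "\<exists>y. (?E has_real_derivative y) (at x) \<and> y \<le> 0" by blast
  qed
  then have "(e t)\<^sup>2 + (e' t)\<^sup>2 \<le> 0"
    using assms by (simp add: mult_le_0_iff)
  then show ?thesis
    by (metis add_nonneg_eq_0_iff order_antisym_conv sum_power2_ge_zero zero_eq_power2 zero_le_power2)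
qed

text \<open>The difference of two solutions satisfies a linear equation. Its coefficient comes from
  factoring a difference of cubes and is bounded because the solutions are continuous on a compact
  interval.\<close>

lemma cubic_ode_unique:
  fixes y z y' z' :: "real \<Rightarrow> real"
  assumes y: "\<And>t. t \<in> {0..T} \<Longrightarrow> (y has_real_derivative y' t) (at t)"
    and y': "\<And>t. t \<in> {0..T} \<Longrightarrow> (y' has_real_derivative y t * (a - b * (y t)\<^sup>2)) (at t)"
    and z: "\<And>t. t \<in> {0..T} \<Longrightarrow> (z has_real_derivative z' t) (at t)"
    and z': "\<And>t. t \<in> {0..T} \<Longrightarrow> (z' has_real_derivative z t * (a - b * (z t)\<^sup>2)) (at t)"
    and init: "y 0 = z 0" "y' 0 = z' 0" and t: "t \<in> {0..T}"
  shows "y t = z t"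
proof -
  let ?w = "\<lambda>t. a - b * ((y t)\<^sup>2 + y t * z t + (z t)\<^sup>2)"
  have cont: "continuous_on {0..T} y" "continuous_on {0..T} z"
    by (intro continuous_at_imp_continuous_on ballI DERIV_isCont[OF y] DERIV_isCont[OF z]; assumption)+
  have "compact (?w ` {0..T})"
    by (intro compact_continuous_image continuous_intros cont) auto
  then obtain L where L: "\<And>t. t \<in> {0..T} \<Longrightarrow> norm (?w t) \<le> L"
    by (meson compact_imp_bounded bounded_iff image_eqI)
  have "y t - z t = 0"
  proof (rule linear_ode_zero[where e = "\<lambda>t. y t - z t" and e' = "\<lambda>t. y' t - z' t" and w = ?w and L = L and T = T])
    fix t assume t: "t \<in> {0..T}"
    show "((\<lambda>t. y t - z t) has_real_derivative y' t - z' t) (at t)"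
      by (intro DERIV_diff y z t)
    have "((\<lambda>t. y' t - z' t) has_real_derivative y t * (a - b * (y t)\<^sup>2) - z t * (a - b * (z t)\<^sup>2)) (at t)"
      by (intro DERIV_diff y' z' t)
    then show "((\<lambda>t. y' t - z' t) has_real_derivative ?w t * (y t - z t)) (at t)"
      by (simp add: algebra_simps power2_eq_square)
    show "\<bar>?w t\<bar> \<le> L" using L[OF t] by simp
  qed (use init t in auto)
  then show ?thesis by simp
qed

section \<open>The sum of hyperbolic secants as an elliptic function\<close>

text \<open>Restricts a complex derivative to a line through \<open>0\<close>: the direction
  \<open>c\<close> is 1 for the real axis and \<open>\<i>\<close> for the imaginary axis.\<close>

lemma Re_line_DERIV:
  fixes c :: complex
  assumes "(f has_field_derivative f') (at (c * of_real x))"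
  shows "((\<lambda>x. Re (f (c * of_real x))) has_real_derivative Re (c * f')) (at x)"
proof -
  have "((\<lambda>x. c * of_real x) has_vector_derivative c) (at x)"
    using has_vector_derivative_mult_right[OF has_vector_derivative_of_real[OF DERIV_ident]] by simp
  from field_vector_diff_chain_at[OF this assms]
  have "((\<lambda>x. f (c * of_real x)) has_vector_derivative (c * f')) (at x)"
    by (simp add: o_def)
  then show ?thesis by (rule has_field_derivative_Re)
qed

lemma cubic_first_integral:
  fixes h g :: "real \<Rightarrow> real"
  assumes h: "\<And>x. x \<in> S \<Longrightarrow> (h has_real_derivative g x) (at x)"
    and g: "\<And>x. x \<in> S \<Longrightarrow> (g has_real_derivative h x * (a - b * (h x)\<^sup>2)) (at x)"
    and "convex S" "s \<in> S" "t \<in> S"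
  shows "(g s)\<^sup>2 - (a * (h s)\<^sup>2 - b / 2 * (h s) ^ 4) = (g t)\<^sup>2 - (a * (h t)\<^sup>2 - b / 2 * (h t) ^ 4)"
proof -
  have "\<exists>c. \<forall>x\<in>S. (g x)\<^sup>2 - (a * (h x)\<^sup>2 - b / 2 * (h x) ^ 4) = c"
  proof (rule has_field_derivative_zero_constant[OF \<open>convex S\<close>])
    fix x assume x: "x \<in> S"
    have "((\<lambda>x. (g x)\<^sup>2 - (a * (h x)\<^sup>2 - b / 2 * (h x) ^ 4)) has_real_derivative 0) (at x)"
      by (rule derivative_eq_intros h[OF x] g[OF x] refl)+
         (simp add: algebra_simps power2_eq_square power3_eq_cube)
    then show "((\<lambda>x. (g x)\<^sup>2 - (a * (h x)\<^sup>2 - b / 2 * (h x) ^ 4)) has_real_derivative 0) (at x within S)"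
      by (rule has_field_derivative_at_within)
  qed
  with assms show ?thesis by auto
qed

definition sech_real :: "real \<Rightarrow> real \<Rightarrow> real" where
  "sech_real p t = Re (sech_sum p (of_real t))"

text \<open>Evenness and conjugation symmetry make the secant sum real on the imaginary axis too.
  There it solves the equation with both signs reversed, and its blow-up at \<open>pi\<close> is
  what identifies \<open>elliptic_K'\<close>.\<close>

definition sech_imag :: "real \<Rightarrow> real \<Rightarrow> real" where
  "sech_imag p t = Re (sech_sum p (\<i> * of_real t))"

lemma sech_sum_of_real: "sech_sum p (of_real t) = of_real (sech_real p t)"
proof -
  have "sech_sum p (of_real t) \<in> \<real>"
    unfolding Reals_cnj_iff using sech_sum_cnj[of p "of_real t"] by simp
  then show ?thesis by (simp add: sech_real_def)
qed

lemma sech_sum_imag: "sech_sum p (\<i> * of_real t) = of_real (sech_imag p t)"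
proof -
  have "sech_sum p (\<i> * of_real t) \<in> \<real>"
    unfolding Reals_cnj_iff using sech_sum_cnj[of p "\<i> * of_real t"] sech_sum_minus[of p "\<i> * of_real t"] by simp
  then show ?thesis by (simp add: sech_imag_def)
qed

lemma sech_sum_half_real: "sech_sum p (of_real p / 2) = of_real (sech_real p (p / 2))"
  using sech_sum_of_real[of p "p / 2"] by simp

lemma cosh_complex_of_real: "cosh (complex_of_real x) = complex_of_real (cosh x)"
  by (simp add: cosh_def scaleR_conv_of_real exp_of_real flip: of_real_minus)

context
  fixes p :: real
  assumes p: "p > 0"
begin

lemma sech_real_has_sum: "((\<lambda>n::int. 1 / cosh ((t + p * of_int n) / 2)) has_sum sech_real p t) UNIV"
proof -
  have "1 / cosh ((of_real t + of_real p * of_int n) / 2 :: complex) = complex_of_real (1 / cosh ((t + p * of_int n) / 2))" for n :: int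
  proof -
    have "(of_real t + of_real p * of_int n) / 2 = complex_of_real ((t + p * of_int n) / 2)" by simp
    then show ?thesis by (simp only: cosh_complex_of_real) simp
  qed
  then show ?thesis
    using sech_sum_has_sum[of "of_real t" p] p by (simp only: sech_sum_of_real has_sum_of_real_iff strip_simps)
qed

lemma has_sum_ge_term:
  fixes f :: "int \<Rightarrow> real"
  assumes "(f has_sum s) UNIV" "\<And>n. f n \<ge> 0"
  shows "f n \<le> s"
proof -
  have "(f has_sum f n) {n}" using has_sum_finite[of "{n}" f] by simp
  then show ?thesis by (rule has_sum_mono_neutral[OF _ assms(1)]) (use assms in auto)
qed

lemma sech_real_pos: "sech_real p t > 0"
proof -
  have "1 / cosh ((t + p * of_int 0) / 2) \<le> sech_real p t"
    by (rule has_sum_ge_term[OF sech_real_has_sum]) (simp add: cosh_real_pos less_imp_le)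
  moreover have "1 / cosh ((t + p * of_int 0) / 2) > 0" by (simp add: cosh_real_pos)
  ultimately show ?thesis by linarith
qed

text \<open>All terms have nonnegative real part, so the sum dominates its term
  \<open>n = 0\<close>, which tends to infinity at \<open>pi\<close>.\<close>

lemma sech_imag_ge:
  assumes "\<bar>t\<bar> < pi"
  shows "1 / cos (t / 2) \<le> sech_imag p t"
proof -
  have s: "\<i> * of_real t \<in> strip" using assms by (simp add: strip_def)
  have c: "cos (t / 2) > 0" using cos_half_strip[OF s] by simp
  have sum: "((\<lambda>n::int. Re (1 / cosh ((\<i> * of_real t + of_real p * of_int n) / 2))) has_sum sech_imag p t) UNIV"
    unfolding sech_imag_def by (rule has_sum_Re[OF sech_sum_has_sum[OF s p]])
  have "Re (1 / cosh ((\<i> * of_real t + of_real p * of_int 0) / 2)) \<le> sech_imag p t"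
  proof (rule has_sum_ge_term[OF sum])
    fix n :: int
    have "Re (cosh ((\<i> * of_real t + of_real p * of_int n) / 2)) \<ge> 0"
      using c by (simp add: Re_cosh cosh_real_pos less_imp_le)
    then show "Re (1 / cosh ((\<i> * of_real t + of_real p * of_int n) / 2)) \<ge> 0"
      by (simp add: Re_divide)
  qed
  moreover have "Re (1 / cosh ((\<i> * of_real t + of_real p * of_int 0) / 2)) = 1 / cos (t / 2)"
  proof -
    have "cosh (\<i> * of_real t / 2 :: complex) = of_real (cos (t / 2))"
      by (rule complex_eqI) (simp_all add: Re_cosh Im_cosh)
    then show ?thesis by simp
  qed
  ultimately show ?thesis by simp
qed

lemma sech_imag_unbounded: "\<exists>t. 0 \<le> t \<and> t < pi \<and> sech_imag p t > B"
proof -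
  define B' where "B' = \<bar>B\<bar> + 1"
  have B': "B' \<ge> 1" "B' > B" by (auto simp: B'_def)
  \<comment> \<open>Solves \<open>1 / cos (t / 2) = B'\<close>, so that the lower bound of
    \<open>sech_imag_ge\<close> exceeds \<open>B\<close>.\<close>
  define t where "t = 2 * arccos (1 / B')"
  have r: "0 < 1 / B'" "1 / B' \<le> 1" using B' by auto
  have r': "- 1 \<le> 1 / B'" using r by linarith
  have t: "0 \<le> t" using arccos_lbound[OF r' r(2)] by (simp add: t_def)
  have "arccos (1 / B') < arccos 0" using r by (intro arccos_less_arccos) auto
  then have t': "t < pi" by (simp add: t_def)
  have "cos (t / 2) = 1 / B'" using cos_arccos[OF r' r(2)] by (simp add: t_def)
  then show ?thesis
    using sech_imag_ge[of t] t t' B' by (intro exI[of _ t]) auto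
qed


lemma sech_real_DERIV: "(sech_real p has_real_derivative Re (- (sech_sum p (of_real t) * tanh_gap p (of_real t)) / 2)) (at t)"
  using Re_line_DERIV[of "sech_sum p" "- (sech_sum p (of_real t) * tanh_gap p (of_real t)) / 2" 1 t]
    sech_sum_DERIV[of "of_real t" p] p
  by (simp add: sech_real_def[abs_def])

lemma sech_real_DERIV2:
  "((\<lambda>t. Re (- (sech_sum p (of_real t) * tanh_gap p (of_real t)) / 2)) has_real_derivative
      sech_real p t * (((sech_real p 0)\<^sup>2 + (sech_real p (p / 2))\<^sup>2) / 4 - 1 / 2 * (sech_real p t)\<^sup>2)) (at t)"
proof -
  let ?f' = "sech_sum p (of_real t) * ((sech_sum p 0)\<^sup>2 + (sech_sum p (of_real p / 2))\<^sup>2 - 2 * (sech_sum p (of_real t))\<^sup>2) / 4"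
  have "((\<lambda>t. Re (- (sech_sum p (1 * of_real t) * tanh_gap p (1 * of_real t)) / 2)) has_real_derivative Re (1 * ?f')) (at t)"
    by (rule Re_line_DERIV[of "\<lambda>z. - (sech_sum p z * tanh_gap p z) / 2"])
       (use sech_sum_DERIV2[of "of_real t" p] p in simp)
  moreover have "?f' = of_real (sech_real p t * (((sech_real p 0)\<^sup>2 + (sech_real p (p / 2))\<^sup>2) / 4 - 1 / 2 * (sech_real p t)\<^sup>2))"
    using sech_sum_of_real[of p 0] by (simp add: sech_sum_of_real sech_sum_half_real field_simps)
  ultimately show ?thesis by (simp only: Re_complex_of_real mult_1)
qed

lemma sech_imag_DERIV:
  assumes "\<bar>t\<bar> < pi"
  shows "(sech_imag p has_real_derivative
    Re (\<i> * (- (sech_sum p (\<i> * of_real t) * tanh_gap p (\<i> * of_real t)) / 2))) (at t)"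
  unfolding sech_imag_def[abs_def]
  by (rule Re_line_DERIV, rule sech_sum_DERIV) (use assms p in \<open>auto simp: strip_def\<close>)

lemma sech_imag_DERIV2:
  assumes "\<bar>t\<bar> < pi"
  shows "((\<lambda>t. Re (\<i> * (- (sech_sum p (\<i> * of_real t) * tanh_gap p (\<i> * of_real t)) / 2))) has_real_derivative
      sech_imag p t * (- ((sech_real p 0)\<^sup>2 + (sech_real p (p / 2))\<^sup>2) / 4 - (- 1 / 2) * (sech_imag p t)\<^sup>2)) (at t)"
proof -
  let ?z = "\<i> * complex_of_real t"
  let ?f' = "sech_sum p ?z * ((sech_sum p 0)\<^sup>2 + (sech_sum p (of_real p / 2))\<^sup>2 - 2 * (sech_sum p ?z)\<^sup>2) / 4"
  have z: "?z \<in> strip" using assms by (simp add: strip_def)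
  have "((\<lambda>t. Re (\<i> * (- (sech_sum p (\<i> * of_real t) * tanh_gap p (\<i> * of_real t)) / 2))) has_real_derivative Re (\<i> * (\<i> * ?f'))) (at t)"
    by (rule Re_line_DERIV[of "\<lambda>z. \<i> * (- (sech_sum p z * tanh_gap p z) / 2)"])
       (rule DERIV_cmult[OF sech_sum_DERIV2[OF z p]])
  moreover have "\<i> * (\<i> * ?f') = of_real (sech_imag p t * (- ((sech_real p 0)\<^sup>2 + (sech_real p (p / 2))\<^sup>2) / 4 - (- 1 / 2) * (sech_imag p t)\<^sup>2))"
    using sech_sum_of_real[of p 0] by (simp add: sech_sum_imag sech_sum_half_real field_simps)
  ultimately show ?thesis by (simp only: Re_complex_of_real)
qed

lemma sech_initial:
  "sech_imag p 0 = sech_real p 0"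
  "Re (\<i> * (- (sech_sum p (\<i> * of_real 0) * tanh_gap p (\<i> * of_real 0)) / 2)) = 0"
  "Re (- (sech_sum p (of_real 0) * tanh_gap p (of_real 0)) / 2) = 0"
  by (simp_all add: sech_imag_def sech_real_def tanh_gap_0 p)

text \<open>The velocity vanishes at \<open>0\<close>, so the conserved energy factors, with the
  squares of the real values at \<open>0\<close> and \<open>p / 2\<close> as roots. The left side
  being a square, the trajectory cannot enter the region between the roots.\<close>

lemma sech_imag_first_integral:
  assumes "0 \<le> t" "t < pi"
  shows "(Re (\<i> * (- (sech_sum p (\<i> * of_real t) * tanh_gap p (\<i> * of_real t)) / 2)))\<^sup>2
     = ((sech_imag p t)\<^sup>2 - (sech_real p 0)\<^sup>2) * ((sech_imag p t)\<^sup>2 - (sech_real p (p / 2))\<^sup>2) / 4"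
proof -
  let ?h = "sech_imag p" and ?a = "sech_real p 0" and ?b = "sech_real p (p / 2)"
  let ?g = "\<lambda>t. Re (\<i> * (- (sech_sum p (\<i> * of_real t) * tanh_gap p (\<i> * of_real t)) / 2))"
  have "(?g t)\<^sup>2 - (- (?a\<^sup>2 + ?b\<^sup>2) / 4 * (?h t)\<^sup>2 - (- 1 / 2) / 2 * (?h t) ^ 4)
    = (?g 0)\<^sup>2 - (- (?a\<^sup>2 + ?b\<^sup>2) / 4 * (?h 0)\<^sup>2 - (- 1 / 2) / 2 * (?h 0) ^ 4)"
  proof (rule cubic_first_integral[where S = "{- pi<..<pi}"])
    fix x assume "x \<in> {- pi<..<pi}"
    then have x: "\<bar>x\<bar> < pi" by auto
    show "(?h has_real_derivative ?g x) (at x)"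
      by (rule sech_imag_DERIV[OF x])
    show "(?g has_real_derivative ?h x * (- (?a\<^sup>2 + ?b\<^sup>2) / 4 - (- 1 / 2) * (?h x)\<^sup>2)) (at x)"
      by (rule sech_imag_DERIV2[OF x])
  qed (use assms in auto)
  then have "(?g t)\<^sup>2 = 0\<^sup>2 + (- (?a\<^sup>2 + ?b\<^sup>2) / 4 * (?h t)\<^sup>2 - (- 1 / 2) / 2 * (?h t) ^ 4)
     - (- (?a\<^sup>2 + ?b\<^sup>2) / 4 * ?a\<^sup>2 - (- 1 / 2) / 2 * ?a ^ 4)"
    unfolding sech_initial by linarith
  also have "\<dots> = ((?h t)\<^sup>2 - ?a\<^sup>2) * ((?h t)\<^sup>2 - ?b\<^sup>2) / 4"
    by (simp add: field_simps power2_eq_square power4_eq_xxxx)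
  finally show ?thesis .
qed

text \<open>On the imaginary axis the sum starts at \<open>sech_real p 0\<close> and is unbounded.
  If the two values were equal, a constant would solve the same initial value problem. If the value
  at \<open>p / 2\<close> were larger, the trajectory would pass through the mean \<open>v\<close>
  of the two, where its squared velocity would be negative.\<close>

lemma sech_real_half_less: "sech_real p (p / 2) < sech_real p 0"
proof (rule ccontr)
  let ?h = "sech_imag p" and ?a = "sech_real p 0" and ?b = "sech_real p (p / 2)"
  assume "\<not> ?b < ?a"
  then consider "?b = ?a" | "?b > ?a" by linarith
  then show False
  proof cases
    case 1
    have "?h t = ?a" if "0 \<le> t" "t < pi" for t
    proof (rule cubic_ode_unique[where y = ?h and z = "\<lambda>_. ?a" and T = t and a = "- (?a\<^sup>2 + ?b\<^sup>2) / 4" and b = "- 1 / 2" and z' = "\<lambda>_. 0"])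
      fix s assume "s \<in> {0..t}"
      then have s: "\<bar>s\<bar> < pi" using that by auto
      show "(?h has_real_derivative Re (\<i> * (- (sech_sum p (\<i> * of_real s) * tanh_gap p (\<i> * of_real s)) / 2))) (at s)"
        by (rule sech_imag_DERIV[OF s])
      show "((\<lambda>s. Re (\<i> * (- (sech_sum p (\<i> * of_real s) * tanh_gap p (\<i> * of_real s)) / 2))) has_real_derivative
          ?h s * (- (?a\<^sup>2 + ?b\<^sup>2) / 4 - - 1 / 2 * (?h s)\<^sup>2)) (at s)"
        using sech_imag_DERIV2[OF s] by (simp only: minus_divide_left)
      show "((\<lambda>_. 0) has_real_derivative ?a * (- (?a\<^sup>2 + ?b\<^sup>2) / 4 - - 1 / 2 * ?a\<^sup>2)) (at s)"
        unfolding 1 by simp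
      show "((\<lambda>_. ?a) has_real_derivative 0) (at s)" by simp
    next
      show "?h 0 = ?a" by (rule sech_initial)
      show "Re (\<i> * (- (sech_sum p (\<i> * of_real 0) * tanh_gap p (\<i> * of_real 0)) / 2)) = 0"
        by (rule sech_initial)
      show "t \<in> {0..t}" using that by simp
    qed
    moreover obtain t where "0 \<le> t" "t < pi" "?h t > ?a" using sech_imag_unbounded[of ?a] by (elim exE conjE)
    ultimately show False by (metis order_less_irrefl)
  next
    case 2
    define v where "v = (?a + ?b) / 2"
    have v: "?a < v" "v < ?b" "0 < ?a" using 2 sech_real_pos[of 0] by (simp_all add: v_def)
    obtain t where t: "0 \<le> t" "t < pi" "?h t > v" using sech_imag_unbounded[of v] by (elim exE conjE)
    have "continuous_on {0..t} ?h"
    proof (intro continuous_at_imp_continuous_on ballI)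
      fix x assume "x \<in> {0..t}"
      then have "\<bar>x\<bar> < pi" using t by simp
      then show "isCont ?h x" by (rule DERIV_isCont[OF sech_imag_DERIV])
    qed
    then obtain x where x: "0 \<le> x" "x \<le> t" "?h x = v"
      using IVT'[of ?h 0 v t] t v sech_initial(1) by (metis less_imp_le)
    have "x < pi" using x t by simp
    from ord_le_eq_trans[OF zero_le_power2 sech_imag_first_integral[OF x(1) this]]
    have "0 \<le> (v\<^sup>2 - ?a\<^sup>2) * (v\<^sup>2 - ?b\<^sup>2) / 4"
      unfolding x(3) .
    moreover have "?a\<^sup>2 < v\<^sup>2" "v\<^sup>2 < ?b\<^sup>2"
      by (rule power_strict_mono; use v in simp)+
    then have "(v\<^sup>2 - ?a\<^sup>2) * (v\<^sup>2 - ?b\<^sup>2) < 0"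
      by (simp add: mult_pos_neg)
    ultimately show False by simp
  qed
qed

end

section \<open>Equations satisfied by the combinations of Jacobi functions\<close>

context
  fixes m k \<gamma> :: real
  assumes m: "0 < m" "m < 1" and k: "0 < k" "k < 1"
begin

abbreviation (input) "sn' u \<equiv> sin (jacobi_am u m)"
abbreviation (input) "cn' u \<equiv> jacobi_cn u m"
abbreviation (input) "dn' u \<equiv> jacobi_dn u m"

lemma scaled_jacobi_DERIV:
  "((\<lambda>t. cn' (\<gamma> * t)) has_real_derivative - (sn' (\<gamma> * t) * dn' (\<gamma> * t)) * \<gamma>) (at t)"
  "((\<lambda>t. sn' (\<gamma> * t)) has_real_derivative (cn' (\<gamma> * t) * dn' (\<gamma> * t)) * \<gamma>) (at t)"
  "((\<lambda>t. dn' (\<gamma> * t)) has_real_derivative - (m * sn' (\<gamma> * t) * cn' (\<gamma> * t)) * \<gamma>) (at t)"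
proof -
  have l: "((\<lambda>t. \<gamma> * t) has_real_derivative \<gamma>) (at t)"
    by (auto intro!: derivative_eq_intros)
  show "((\<lambda>t. cn' (\<gamma> * t)) has_real_derivative - (sn' (\<gamma> * t) * dn' (\<gamma> * t)) * \<gamma>) (at t)"
    by (rule DERIV_chain2[OF jacobi_cn_DERIV[OF m] l])
  show "((\<lambda>t. sn' (\<gamma> * t)) has_real_derivative (cn' (\<gamma> * t) * dn' (\<gamma> * t)) * \<gamma>) (at t)"
    by (rule DERIV_chain2[OF jacobi_sn_DERIV[OF m] l])
  show "((\<lambda>t. dn' (\<gamma> * t)) has_real_derivative - (m * sn' (\<gamma> * t) * cn' (\<gamma> * t)) * \<gamma>) (at t)"
    by (rule DERIV_chain2[OF jacobi_dn_DERIV[OF m] l])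
qed

lemma jacobi_squares: "(sn' u)\<^sup>2 = 1 - (cn' u)\<^sup>2" "(dn' u)\<^sup>2 = 1 - m + m * (cn' u)\<^sup>2"
proof -
  show 1: "(sn' u)\<^sup>2 = 1 - (cn' u)\<^sup>2"
    by (simp add: jacobi_cn_def sin_squared_eq)
  show "(dn' u)\<^sup>2 = 1 - m + m * (cn' u)\<^sup>2"
    unfolding jacobi_dn_square[OF m] 1 by (simp add: algebra_simps)
qed

lemma dn_cn_ode:
  assumes "m = k\<^sup>2"
  shows "((\<lambda>t. \<gamma> * (dn' (\<gamma> * t) + k * cn' (\<gamma> * t))) has_real_derivative
      - \<gamma>\<^sup>2 * k * sn' (\<gamma> * t) * (dn' (\<gamma> * t) + k * cn' (\<gamma> * t))) (at t)" (is ?A)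
    and "((\<lambda>t. - \<gamma>\<^sup>2 * k * sn' (\<gamma> * t) * (dn' (\<gamma> * t) + k * cn' (\<gamma> * t))) has_real_derivative
      \<gamma> * (dn' (\<gamma> * t) + k * cn' (\<gamma> * t)) * (\<gamma>\<^sup>2 * (1 + k\<^sup>2) / 2 - 1 / 2 * (\<gamma> * (dn' (\<gamma> * t) + k * cn' (\<gamma> * t)))\<^sup>2)) (at t)" (is ?B)
proof -
  let ?s = "sn' (\<gamma> * t)" and ?c = "cn' (\<gamma> * t)" and ?d = "dn' (\<gamma> * t)"
  have A: "\<gamma> * (- (m * ?s * ?c) * \<gamma> + k * (- (?s * ?d) * \<gamma>)) = - \<gamma>\<^sup>2 * k * ?s * (?d + k * ?c)"
    unfolding assms by (simp add: algebra_simps power2_eq_square)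
  show ?A unfolding A[symmetric]
    by (intro DERIV_cmult DERIV_add scaled_jacobi_DERIV)
  have dd: "?d\<^sup>2 = 1 - k\<^sup>2 * ?s\<^sup>2" and cc: "?c\<^sup>2 = 1 - ?s\<^sup>2"
    using jacobi_dn_square[OF m, of "\<gamma> * t"] jacobi_squares[of "\<gamma> * t"] by (simp_all add: assms)
  have "(?d + k * ?c)\<^sup>2 = ?d\<^sup>2 + 2 * k * ?c * ?d + k\<^sup>2 * ?c\<^sup>2"
    by (simp add: power2_sum power_mult_distrib)
  also have "\<dots> = 1 + k\<^sup>2 - 2 * k\<^sup>2 * ?s\<^sup>2 + 2 * k * ?c * ?d"
    unfolding dd cc by (simp add: algebra_simps)
  finally have sq: "(?d + k * ?c)\<^sup>2 = 1 + k\<^sup>2 - 2 * k\<^sup>2 * ?s\<^sup>2 + 2 * k * ?c * ?d" .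
  have "\<gamma>\<^sup>2 * (1 + k\<^sup>2) / 2 - 1 / 2 * (\<gamma> * (?d + k * ?c))\<^sup>2 = \<gamma>\<^sup>2 * (k\<^sup>2 * ?s\<^sup>2 - k * ?c * ?d)"
    unfolding power_mult_distrib sq by (simp add: field_simps)
  moreover have "\<gamma> * (d + k * c) * (\<gamma>\<^sup>2 * (k\<^sup>2 * s\<^sup>2 - k * c * d))
     = (- \<gamma>\<^sup>2 * k) * ((c * d * \<gamma>) * (d + k * c) + (- (k\<^sup>2 * s * c) * \<gamma> + k * (- (s * d) * \<gamma>)) * s)" for s c d :: real
    by (simp add: algebra_simps power2_eq_square)
  ultimately have B: "\<gamma> * (?d + k * ?c) * (\<gamma>\<^sup>2 * (1 + k\<^sup>2) / 2 - 1 / 2 * (\<gamma> * (?d + k * ?c))\<^sup>2)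
     = (- \<gamma>\<^sup>2 * k) * ((?c * ?d * \<gamma>) * (?d + k * ?c) + (- (m * ?s * ?c) * \<gamma> + k * (- (?s * ?d) * \<gamma>)) * ?s)"
    by (simp only: assms)
  have "((\<lambda>t. (- \<gamma>\<^sup>2 * k) * (sn' (\<gamma> * t) * (dn' (\<gamma> * t) + k * cn' (\<gamma> * t)))) has_real_derivative
    (- \<gamma>\<^sup>2 * k) * ((?c * ?d * \<gamma>) * (?d + k * ?c) + (- (m * ?s * ?c) * \<gamma> + k * (- (?s * ?d) * \<gamma>)) * ?s)) (at t)"
    by (intro DERIV_cmult DERIV_mult DERIV_add scaled_jacobi_DERIV)
  then show ?B unfolding B by (simp only: mult.assoc)
qed

text \<open>This quotient, with the complementary parameter, is what Jacobi's imaginary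
  transformation makes of \<open>dn + k cn\<close> at an imaginary argument. Its equation is checked
  directly, by reducing everything to \<open>cn\<close> and \<open>dn\<close> through the quadratic
  relations.\<close>

lemma dn_over_cn_ode:
  assumes "m = 1 - k\<^sup>2" and c: "cn' (\<gamma> * t) \<noteq> 0"
  shows "((\<lambda>t. \<gamma> * ((dn' (\<gamma> * t) + k) / cn' (\<gamma> * t))) has_real_derivative
      \<gamma>\<^sup>2 * k * (sn' (\<gamma> * t) * (dn' (\<gamma> * t) + k) / (cn' (\<gamma> * t))\<^sup>2)) (at t)" (is ?A)
    and "((\<lambda>t. \<gamma>\<^sup>2 * k * (sn' (\<gamma> * t) * (dn' (\<gamma> * t) + k) / (cn' (\<gamma> * t))\<^sup>2)) has_real_derivative
      \<gamma> * ((dn' (\<gamma> * t) + k) / cn' (\<gamma> * t)) *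
       (- (\<gamma>\<^sup>2 * (1 + k\<^sup>2) / 2) - (- 1 / 2) * (\<gamma> * ((dn' (\<gamma> * t) + k) / cn' (\<gamma> * t)))\<^sup>2)) (at t)" (is ?B)
proof -
  let ?s = "sn' (\<gamma> * t)" and ?c = "cn' (\<gamma> * t)" and ?d = "dn' (\<gamma> * t)"
  have dd: "?d\<^sup>2 = k\<^sup>2 + (1 - k\<^sup>2) * ?c\<^sup>2" and ss: "?s\<^sup>2 = 1 - ?c\<^sup>2"
    using jacobi_squares[of "\<gamma> * t"] by (simp_all add: assms)
  have "- ((1 - k\<^sup>2) * ?s * ?c) * ?c + ?s * ?d * (?d + k) = ?s * (?d\<^sup>2 - (1 - k\<^sup>2) * ?c\<^sup>2 + k * ?d)"
    by (simp add: algebra_simps power2_eq_square)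
  also have "\<dots> = k * ?s * (?d + k)"
    unfolding dd by (simp add: algebra_simps power2_eq_square)
  finally have A: "- ((1 - k\<^sup>2) * ?s * ?c) * ?c + ?s * ?d * (?d + k) = k * ?s * (?d + k)" .
  have "((\<lambda>t. \<gamma> * ((dn' (\<gamma> * t) + k) / cn' (\<gamma> * t))) has_real_derivative
      \<gamma> * (((- (m * ?s * ?c) * \<gamma> + 0) * ?c - (?d + k) * (- (?s * ?d) * \<gamma>)) / (?c * ?c))) (at t)"
    by (intro DERIV_cmult DERIV_divide DERIV_add scaled_jacobi_DERIV DERIV_const c)
  moreover have "\<gamma> * (((- (m * ?s * ?c) * \<gamma> + 0) * ?c - (?d + k) * (- (?s * ?d) * \<gamma>)) / (?c * ?c))
     = \<gamma>\<^sup>2 * ((- ((1 - k\<^sup>2) * ?s * ?c) * ?c + ?s * ?d * (?d + k)) / ?c\<^sup>2)"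
    using c unfolding assms by (simp add: field_simps power2_eq_square)
  moreover have "\<gamma>\<^sup>2 * ((k * ?s * (?d + k)) / ?c\<^sup>2) = \<gamma>\<^sup>2 * k * (?s * (?d + k) / ?c\<^sup>2)"
    by (simp add: mult_ac)
  ultimately show ?A by (simp only: A)
  let ?N = "(?c * ?d * \<gamma>) * (?d + k) + (- (m * ?s * ?c) * \<gamma> + 0) * ?s"
  have "((\<lambda>t. \<gamma>\<^sup>2 * k * (sn' (\<gamma> * t) * (dn' (\<gamma> * t) + k) / (cn' (\<gamma> * t))\<^sup>2)) has_real_derivative
      \<gamma>\<^sup>2 * k * ((?N * ?c\<^sup>2 - ?s * (?d + k) * (of_nat 2 * ((- (?s * ?d) * \<gamma>) * ?c ^ (2 - Suc 0)))) / (?c\<^sup>2 * ?c\<^sup>2))) (at t)"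
    by (intro DERIV_cmult DERIV_divide DERIV_mult DERIV_power DERIV_add scaled_jacobi_DERIV DERIV_const) (use c in simp)
  moreover have "\<gamma>\<^sup>2 * k * ((?N * ?c\<^sup>2 - ?s * (?d + k) * (of_nat 2 * ((- (?s * ?d) * \<gamma>) * ?c ^ (2 - Suc 0)))) / (?c\<^sup>2 * ?c\<^sup>2))
    = \<gamma> ^ 3 / ?c ^ 3 * (k * (?c\<^sup>2 * (?d\<^sup>2 + k * ?d - (1 - k\<^sup>2) * ?s\<^sup>2) + 2 * ?s\<^sup>2 * (?d\<^sup>2 + k * ?d)))"
    using c unfolding assms by (simp add: field_simps power2_eq_square power3_eq_cube)
  moreover have "\<gamma> * ((?d + k) / ?c) * (- (\<gamma>\<^sup>2 * (1 + k\<^sup>2) / 2) - (- 1 / 2) * (\<gamma> * ((?d + k) / ?c))\<^sup>2)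
    = \<gamma> ^ 3 / ?c ^ 3 * ((?d + k) * (?d\<^sup>2 + 2 * k * ?d + k\<^sup>2 - (1 + k\<^sup>2) * ?c\<^sup>2) / 2)"
    using c by (simp add: field_simps power2_eq_square power3_eq_cube)
  moreover have "k * (?c\<^sup>2 * (?d\<^sup>2 + k * ?d - (1 - k\<^sup>2) * ?s\<^sup>2) + 2 * ?s\<^sup>2 * (?d\<^sup>2 + k * ?d))
     = (?d + k) * (?d\<^sup>2 + 2 * k * ?d + k\<^sup>2 - (1 + k\<^sup>2) * ?c\<^sup>2) / 2"
  proof -
    have "(?d + k) * (?d\<^sup>2 + 2 * k * ?d + k\<^sup>2 - (1 + k\<^sup>2) * ?c\<^sup>2) / 2 = k * (?d + k) * (?d + k - k * ?c\<^sup>2)"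
      unfolding dd by (simp add: field_simps power2_eq_square)
    also have "\<dots> = k * (?d\<^sup>2 + 2 * k * ?d + k\<^sup>2 - k * ?d * ?c\<^sup>2 - k\<^sup>2 * ?c\<^sup>2)"
      by (simp add: algebra_simps power2_eq_square)
    also have "\<dots> = k * (?c\<^sup>2 * (?d\<^sup>2 + k * ?d - (1 - k\<^sup>2) * ?s\<^sup>2) + 2 * ?s\<^sup>2 * (?d\<^sup>2 + k * ?d))"
      unfolding dd ss by (simp add: algebra_simps power2_eq_square)
    finally show ?thesis ..
  qed
  ultimately show ?B by (simp only:)
qed

end

lemma sech_real_minus: "sech_real p (- t) = sech_real p t"
  by (simp add: sech_real_def sech_sum_minus)

lemma holomorphic_sech_sum: "p > 0 \<Longrightarrow> sech_sum p holomorphic_on strip"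
  by (auto simp: holomorphic_on_open open_strip intro: sech_sum_DERIV)

lemma strip_identity:
  assumes "f holomorphic_on strip" "g holomorphic_on strip" "\<delta> > 0"
    and "\<And>x::real. 0 < x \<Longrightarrow> x < \<delta> \<Longrightarrow> f (of_real x) = g (of_real x)" "z \<in> strip"
  shows "f z = g z"
proof -
  have "f z - g z = 0"
  proof (rule analytic_continuation[where f = "\<lambda>z. f z - g z" and S = strip and U = "of_real ` {0<..<\<delta>}" and \<xi> = 0])
    show "(\<lambda>z. f z - g z) holomorphic_on strip" by (intro holomorphic_on_diff assms)
    show "connected strip" by (rule convex_connected[OF convex_strip])
    show "0 islimpt (complex_of_real ` {0<..<\<delta>})"
      unfolding islimpt_approachable
    proof (intro allI impI)
      fix e :: real assume e: "e > 0"
      have "complex_of_real (min e \<delta> / 2) \<in> of_real ` {0<..<\<delta>}"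
        using e \<open>\<delta> > 0\<close> by (intro imageI) auto
      moreover have "complex_of_real (min e \<delta> / 2) \<noteq> 0" "dist (complex_of_real (min e \<delta> / 2)) 0 < e"
        using e \<open>\<delta> > 0\<close> by (simp_all only: dist_norm diff_0_right norm_of_real of_real_eq_0_iff)
      ultimately show "\<exists>x'\<in>of_real ` {0<..<\<delta>}. x' \<noteq> 0 \<and> dist x' (0::complex) < e"
        by blast
    qed
    show "of_real ` {0<..<\<delta>} \<subseteq> strip" by auto
    show "0 \<in> strip" by (rule strip_simps)
    show "f w - g w = 0" if w: "w \<in> of_real ` {0<..<\<delta>}" for w
    proof -
      obtain x :: real where "0 < x" "x < \<delta>" "w = of_real x" using w by auto
      then show ?thesis using assms(4) by simp
    qed
  qed (use assms open_strip in auto)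
  then show ?thesis by simp
qed

text \<open>The poles on the edge of the strip have real parts in the lattice of multiples of
  \<open>p\<close>. On a vertical line between two lattice points \<open>\<bar>sinh\<bar>\<close> of
  the real part bounds \<open>cosh\<close> from below uniformly in the height. In contrast, the sum
  is unbounded on the imaginary axis, so \<open>\<tau>\<close> cannot be a period.\<close>

lemma sech_sum_bounded_off_poles:
  assumes p: "p > 0" and \<tau>: "0 < \<tau>" "\<tau> < p"
  shows "\<exists>B. \<forall>t. \<bar>t\<bar> < pi \<longrightarrow> norm (sech_sum p (\<i> * of_real t + of_real \<tau>)) \<le> B"
proof -
  \<comment> \<open>Half the distance of \<open>\<tau>\<close> from the lattice; the half reflects
    that the secants are taken at half the argument.\<close>
  define \<delta> where "\<delta> = min \<tau> (p - \<tau>) / 2"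
  have \<delta>: "\<delta> > 0" using \<tau> by (simp add: \<delta>_def)
  define C where "C = 2 * exp (\<tau> / 2) / (1 - exp (- 2 * \<delta>))"
  define g where "g n = C * exp (- (p * \<bar>real_of_int n\<bar> / 2))" for n :: int
  have g: "g summable_on UNIV"
    unfolding g_def by (rule summable_on_cmult_right[OF exp_abs_summable[OF p]])
  have bound: "norm (1 / cosh ((\<i> * of_real t + of_real \<tau> + of_real p * of_int n) / 2)) \<le> g n" for n :: int and t
  proof -
    let ?x = "(\<tau> + p * of_int n) / 2"
    have big: "\<bar>?x\<bar> \<ge> \<delta>"
    proof (cases "n \<ge> 0")
      case True
      then have "p * of_int n \<ge> 0" using p by simp
      then show ?thesis using \<tau> by (simp add: \<delta>_def)
    next
      case False
      then have "of_int n \<le> (- 1 :: real)" by linarith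
      then have "p * of_int n \<le> p * - 1" using p by (intro mult_left_mono) auto
      then show ?thesis using \<tau> by (simp add: \<delta>_def)
    qed
    have pos: "1 - exp (- 2 * \<delta>) > 0" using \<delta> by simp
    have "exp (- 2 * \<bar>?x\<bar>) \<le> exp (- 2 * \<delta>)" using big by simp
    then have "exp \<bar>?x\<bar> * (1 - exp (- 2 * \<delta>)) \<le> exp \<bar>?x\<bar> * (1 - exp (- 2 * \<bar>?x\<bar>))"
      by (intro mult_left_mono) auto
    also have "\<dots> = 2 * sinh \<bar>?x\<bar>"
      by (simp add: sinh_def right_diff_distrib exp_add[symmetric])
    also have "sinh \<bar>?x\<bar> = \<bar>sinh ?x\<bar>"
      by (simp add: abs_if)
    finally have 1: "exp \<bar>?x\<bar> * (1 - exp (- 2 * \<delta>)) / 2 \<le> \<bar>sinh ?x\<bar>" by simp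
    have "p * \<bar>real_of_int n\<bar> / 2 - \<tau> / 2 \<le> \<bar>?x\<bar>"
    proof -
      have "\<bar>p * real_of_int n\<bar> = p * \<bar>real_of_int n\<bar>" using p by (simp add: abs_mult)
      moreover have "\<bar>y\<bar> / 2 - \<tau> / 2 \<le> \<bar>(\<tau> + y) / 2\<bar>" for y :: real
        using \<tau> by (simp add: abs_if add_divide_distrib)
      ultimately show ?thesis by metis
    qed
    then have "exp (p * \<bar>real_of_int n\<bar> / 2 - \<tau> / 2) \<le> exp \<bar>?x\<bar>"
      by (simp only: exp_le_cancel_iff)
    from mult_right_mono[OF this less_imp_le[OF pos]]
    have "exp (p * \<bar>real_of_int n\<bar> / 2 - \<tau> / 2) * (1 - exp (- 2 * \<delta>)) / 2 \<le> exp \<bar>?x\<bar> * (1 - exp (- 2 * \<delta>)) / 2"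
      by simp
    also note 1
    also have "\<bar>sinh ?x\<bar> \<le> norm (cosh ((\<i> * of_real t + of_real \<tau> + of_real p * of_int n) / 2))"
      using norm_cosh_ge_sinh[of "(\<i> * of_real t + of_real \<tau> + of_real p * of_int n) / 2"] by simp
    finally have 2: "exp (p * \<bar>real_of_int n\<bar> / 2 - \<tau> / 2) * (1 - exp (- 2 * \<delta>)) / 2
      \<le> norm (cosh ((\<i> * of_real t + of_real \<tau> + of_real p * of_int n) / 2))" .
    have 3: "0 < exp (p * \<bar>real_of_int n\<bar> / 2 - \<tau> / 2) * (1 - exp (- 2 * \<delta>)) / 2"
      using pos by simp
    have "norm (1 / cosh ((\<i> * of_real t + of_real \<tau> + of_real p * of_int n) / 2))
      \<le> 1 / (exp (p * \<bar>real_of_int n\<bar> / 2 - \<tau> / 2) * (1 - exp (- 2 * \<delta>)) / 2)"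
      unfolding norm_divide norm_one using 2 3 by (intro divide_left_mono mult_pos_pos) auto
    also have "\<dots> = g n"
      unfolding g_def C_def exp_diff using pos by (simp add: exp_minus field_simps)
    finally show ?thesis .
  qed
  have "norm (sech_sum p (\<i> * of_real t + of_real \<tau>)) \<le> infsum g UNIV" if "\<bar>t\<bar> < pi" for t
  proof -
    have s: "\<i> * of_real t + of_real \<tau> \<in> strip" using that by (simp add: strip_def)
    have "norm (sech_sum p (\<i> * of_real t + of_real \<tau>)) \<le>
      (\<Sum>\<^sub>\<infinity>n::int. norm (1 / cosh ((\<i> * of_real t + of_real \<tau> + of_real p * of_int n) / 2)))"
      unfolding sech_sum_def by (rule norm_infsum_bound[OF abs_summable_sech[OF s p]])
    also have "\<dots> \<le> infsum g UNIV"
      by (rule infsum_mono[OF abs_summable_sech[OF s p] g bound])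
    finally show ?thesis .
  qed
  then show ?thesis by blast
qed

section \<open>Fitting the modulus and identifying both periods\<close>

context
  fixes p \<gamma> k m :: real
  assumes p: "p > 0"
  defines "\<gamma> \<equiv> (sech_real p 0 + sech_real p (p / 2)) / 2"
    and "k \<equiv> (sech_real p 0 - sech_real p (p / 2)) / (sech_real p 0 + sech_real p (p / 2))"
    and "m \<equiv> k\<^sup>2"
begin

text \<open>\<open>\<gamma>\<close> and \<open>k\<close> are fitted so that
  \<open>\<gamma> * (dn + k * cn)\<close> has the right extreme values: \<open>dn + k * cn\<close>
  equals \<open>1 + k\<close> at \<open>0\<close> and \<open>1 - k\<close> at twice the quarter
  period, to be matched with the secant sum at \<open>0\<close> and \<open>p / 2\<close>.\<close>

lemma modulus_facts:
  shows k: "0 < k" "k < 1" and \<gamma>: "\<gamma> > 0" and m: "0 < m" "m < 1" and m': "0 < 1 - k\<^sup>2" "1 - k\<^sup>2 < 1"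
    and ab: "sech_real p 0 = \<gamma> * (1 + k)" "sech_real p (p / 2) = \<gamma> * (1 - k)"
    and abq: "((sech_real p 0)\<^sup>2 + (sech_real p (p / 2))\<^sup>2) / 4 = \<gamma>\<^sup>2 * (1 + k\<^sup>2) / 2"
proof -
  let ?a = "sech_real p 0" and ?b = "sech_real p (p / 2)"
  have pos: "0 < ?b" "?b < ?a" using sech_real_pos[OF p] sech_real_half_less[OF p] by auto
  then have s: "?a + ?b > 0" by simp
  show k: "0 < k" "k < 1" and "\<gamma> > 0" unfolding k_def \<gamma>_def using pos s by (auto simp: field_simps)
  then show "0 < m" "m < 1" unfolding m_def by (auto simp: power_less_one_iff)
  then show "0 < 1 - k\<^sup>2" "1 - k\<^sup>2 < 1" unfolding m_def by auto
  have gk: "\<gamma> * k = (?a - ?b) / 2" unfolding k_def \<gamma>_def using s by (simp add: field_simps)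
  show ab: "?a = \<gamma> * (1 + k)" "?b = \<gamma> * (1 - k)"
    unfolding ring_distribs gk unfolding \<gamma>_def by (simp_all add: field_simps)
  show "(?a\<^sup>2 + ?b\<^sup>2) / 4 = \<gamma>\<^sup>2 * (1 + k\<^sup>2) / 2"
    unfolding ab by (simp add: field_simps power2_eq_square)
qed

lemma sech_real_eq_jacobi:
  "sech_real p t = \<gamma> * (jacobi_dn (\<gamma> * t) m + k * jacobi_cn (\<gamma> * t) m)"
proof -
  have *: "sech_real p t = \<gamma> * (jacobi_dn (\<gamma> * t) m + k * jacobi_cn (\<gamma> * t) m)" if "t \<ge> 0" for t
  proof (rule cubic_ode_unique[where y = "sech_real p" and z = "\<lambda>t. \<gamma> * (jacobi_dn (\<gamma> * t) m + k * jacobi_cn (\<gamma> * t) m)"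
        and T = t and a = "\<gamma>\<^sup>2 * (1 + k\<^sup>2) / 2" and b = "1 / 2"])
    fix s assume "s \<in> {0..t}"
    show "(sech_real p has_real_derivative Re (- (sech_sum p (of_real s) * tanh_gap p (of_real s)) / 2)) (at s)"
      by (rule sech_real_DERIV[OF p])
    show "((\<lambda>s. Re (- (sech_sum p (of_real s) * tanh_gap p (of_real s)) / 2)) has_real_derivative
        sech_real p s * (\<gamma>\<^sup>2 * (1 + k\<^sup>2) / 2 - 1 / 2 * (sech_real p s)\<^sup>2)) (at s)"
      using sech_real_DERIV2[OF p] unfolding abq .
    show "((\<lambda>t. \<gamma> * (jacobi_dn (\<gamma> * t) m + k * jacobi_cn (\<gamma> * t) m)) has_real_derivative
      - \<gamma>\<^sup>2 * k * sin (jacobi_am (\<gamma> * s) m) * (jacobi_dn (\<gamma> * s) m + k * jacobi_cn (\<gamma> * s) m)) (at s)"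
      by (rule dn_cn_ode(1)[OF m]) (simp_all add: m_def k)
    show "((\<lambda>t. - \<gamma>\<^sup>2 * k * sin (jacobi_am (\<gamma> * t) m) * (jacobi_dn (\<gamma> * t) m + k * jacobi_cn (\<gamma> * t) m)) has_real_derivative
      \<gamma> * (jacobi_dn (\<gamma> * s) m + k * jacobi_cn (\<gamma> * s) m) *
       (\<gamma>\<^sup>2 * (1 + k\<^sup>2) / 2 - 1 / 2 * (\<gamma> * (jacobi_dn (\<gamma> * s) m + k * jacobi_cn (\<gamma> * s) m))\<^sup>2)) (at s)"
      by (rule dn_cn_ode(2)[OF m]) (simp_all add: m_def k)
  next
    show "sech_real p 0 = \<gamma> * (jacobi_dn (\<gamma> * 0) m + k * jacobi_cn (\<gamma> * 0) m)"
      using m by (simp add: ab)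
    show "Re (- (sech_sum p (of_real 0) * tanh_gap p (of_real 0)) / 2) =
      - \<gamma>\<^sup>2 * k * sin (jacobi_am (\<gamma> * 0) m) * (jacobi_dn (\<gamma> * 0) m + k * jacobi_cn (\<gamma> * 0) m)"
      using m sech_initial(3)[OF p] by simp
  qed (use that in auto)
  show ?thesis
    using *[of t] *[of "- t"] m by (cases "t \<ge> 0") (simp_all add: sech_real_minus jacobi_cn_minus jacobi_dn_minus)
qed

lemma cn_pos_below_K:
  assumes "0 \<le> u" "u < elliptic_K (1 - k\<^sup>2)"
  shows "jacobi_cn u (1 - k\<^sup>2) > 0"
proof -
  have "jacobi_am 0 (1 - k\<^sup>2) \<le> jacobi_am u (1 - k\<^sup>2)" "\<not> jacobi_am (elliptic_K (1 - k\<^sup>2)) (1 - k\<^sup>2) \<le> jacobi_am u (1 - k\<^sup>2)"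
    unfolding jacobi_am_le_iff[OF m'] using assms by auto
  then have "0 \<le> jacobi_am u (1 - k\<^sup>2)" "jacobi_am u (1 - k\<^sup>2) < pi / 2"
    using m' by (auto simp: jacobi_am_K)
  then show ?thesis unfolding jacobi_cn_def by (intro cos_gt_zero_pi) auto
qed

lemma sech_imag_eq_jacobi:
  assumes "0 \<le> t" "t < pi" "\<gamma> * t < elliptic_K (1 - k\<^sup>2)"
  shows "sech_imag p t = \<gamma> * ((jacobi_dn (\<gamma> * t) (1 - k\<^sup>2) + k) / jacobi_cn (\<gamma> * t) (1 - k\<^sup>2))"
proof (rule cubic_ode_unique[where y = "sech_imag p" and z = "\<lambda>t. \<gamma> * ((jacobi_dn (\<gamma> * t) (1 - k\<^sup>2) + k) / jacobi_cn (\<gamma> * t) (1 - k\<^sup>2))"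
        and T = t and a = "- (\<gamma>\<^sup>2 * (1 + k\<^sup>2) / 2)" and b = "- 1 / 2"])
  fix s assume s: "s \<in> {0..t}"
  have s1: "\<bar>s\<bar> < pi" using s assms by auto
  have "\<gamma> * s \<le> \<gamma> * t" using s \<gamma> by (intro mult_left_mono) auto
  then have "\<gamma> * s < elliptic_K (1 - k\<^sup>2)" using assms(3) by linarith
  moreover have "0 \<le> \<gamma> * s" using s \<gamma> by simp
  ultimately have "jacobi_cn (\<gamma> * s) (1 - k\<^sup>2) > 0" by (intro cn_pos_below_K)
  then have c: "jacobi_cn (\<gamma> * s) (1 - k\<^sup>2) \<noteq> 0" by simp
  show "(sech_imag p has_real_derivative Re (\<i> * (- (sech_sum p (\<i> * of_real s) * tanh_gap p (\<i> * of_real s)) / 2))) (at s)"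
    by (rule sech_imag_DERIV[OF p s1])
  show "((\<lambda>s. Re (\<i> * (- (sech_sum p (\<i> * of_real s) * tanh_gap p (\<i> * of_real s)) / 2))) has_real_derivative
        sech_imag p s * (- (\<gamma>\<^sup>2 * (1 + k\<^sup>2) / 2) - - 1 / 2 * (sech_imag p s)\<^sup>2)) (at s)"
    using sech_imag_DERIV2[OF p s1] unfolding minus_divide_left[of "(sech_real p 0)\<^sup>2 + (sech_real p (p / 2))\<^sup>2", symmetric] abq .
  show "((\<lambda>t. \<gamma> * ((jacobi_dn (\<gamma> * t) (1 - k\<^sup>2) + k) / jacobi_cn (\<gamma> * t) (1 - k\<^sup>2))) has_real_derivative
      \<gamma>\<^sup>2 * k * (sin (jacobi_am (\<gamma> * s) (1 - k\<^sup>2)) * (jacobi_dn (\<gamma> * s) (1 - k\<^sup>2) + k) / (jacobi_cn (\<gamma> * s) (1 - k\<^sup>2))\<^sup>2)) (at s)"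
    by (rule dn_over_cn_ode(1)[OF m' k refl c])
  show "((\<lambda>t. \<gamma>\<^sup>2 * k * (sin (jacobi_am (\<gamma> * t) (1 - k\<^sup>2)) * (jacobi_dn (\<gamma> * t) (1 - k\<^sup>2) + k) / (jacobi_cn (\<gamma> * t) (1 - k\<^sup>2))\<^sup>2)) has_real_derivative
      \<gamma> * ((jacobi_dn (\<gamma> * s) (1 - k\<^sup>2) + k) / jacobi_cn (\<gamma> * s) (1 - k\<^sup>2)) *
       (- (\<gamma>\<^sup>2 * (1 + k\<^sup>2) / 2) - (- 1 / 2) * (\<gamma> * ((jacobi_dn (\<gamma> * s) (1 - k\<^sup>2) + k) / jacobi_cn (\<gamma> * s) (1 - k\<^sup>2)))\<^sup>2)) (at s)"
    by (rule dn_over_cn_ode(2)[OF m' k refl c])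
next
  show "sech_imag p 0 = \<gamma> * ((jacobi_dn (\<gamma> * 0) (1 - k\<^sup>2) + k) / jacobi_cn (\<gamma> * 0) (1 - k\<^sup>2))"
    using m' by (simp add: ab sech_initial(1)[OF p])
  show "Re (\<i> * (- (sech_sum p (\<i> * of_real 0) * tanh_gap p (\<i> * of_real 0)) / 2)) =
     \<gamma>\<^sup>2 * k * (sin (jacobi_am (\<gamma> * 0) (1 - k\<^sup>2)) * (jacobi_dn (\<gamma> * 0) (1 - k\<^sup>2) + k) / (jacobi_cn (\<gamma> * 0) (1 - k\<^sup>2))\<^sup>2)"
    unfolding sech_initial(2)[OF p] using m' by simp
qed (use assms in auto)

text \<open>Two expressions for the same function blow up at the same place:
  \<open>sech_imag\<close> at \<open>pi\<close>, and the Jacobi quotient where \<open>cn\<close>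
  first vanishes. If either point came first, the other expression would still be continuous, hence
  bounded, up to it.\<close>

lemma K'_eq: "elliptic_K (1 - k\<^sup>2) = \<gamma> * pi"
proof (rule antisym)
  let ?m = "1 - k\<^sup>2"
  let ?H = "\<lambda>t. \<gamma> * ((jacobi_dn (\<gamma> * t) ?m + k) / jacobi_cn (\<gamma> * t) ?m)"
  show "elliptic_K ?m \<le> \<gamma> * pi"
  proof (rule ccontr)
    assume less: "\<not> elliptic_K ?m \<le> \<gamma> * pi"
    have below: "\<gamma> * t < elliptic_K ?m" if "t \<le> pi" for t
      using less that \<gamma> mult_left_mono[of t pi \<gamma>] by linarith
    have "continuous_on {0..pi} ?H"
    proof (intro continuous_at_imp_continuous_on ballI)
      fix s assume s: "s \<in> {0..pi}"
      then have "jacobi_cn (\<gamma> * s) ?m \<noteq> 0"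
        using cn_pos_below_K[of "\<gamma> * s"] below[of s] \<gamma> by auto
      then show "isCont ?H s" by (rule DERIV_isCont[OF dn_over_cn_ode(1)[OF m' k refl]])
    qed
    then have "compact (?H ` {0..pi})" by (intro compact_continuous_image) auto
    then obtain B where B: "\<And>t. t \<in> {0..pi} \<Longrightarrow> norm (?H t) \<le> B"
      by (meson compact_imp_bounded bounded_iff image_eqI)
    obtain t where t: "0 \<le> t" "t < pi" "sech_imag p t > B"
      using sech_imag_unbounded[OF p, of B] by (elim exE conjE)
    have "sech_imag p t = ?H t"
      using t by (intro sech_imag_eq_jacobi below) auto
    moreover have "norm (?H t) \<le> B" by (rule B) (use t in simp)
    then have "?H t \<le> B" unfolding real_norm_def by (rule order_trans[OF abs_ge_self])
    ultimately show False using t by linarith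
  qed
  show "\<gamma> * pi \<le> elliptic_K ?m"
  proof (rule ccontr)
    assume less: "\<not> \<gamma> * pi \<le> elliptic_K ?m"
    define T where "T = elliptic_K ?m / \<gamma>"
    have T1: "0 < T" unfolding T_def by (rule divide_pos_pos[OF elliptic_K_pos[OF m'] \<gamma>])
    have "elliptic_K ?m < \<gamma> * pi" using less by simp
    then have T2: "T < pi" unfolding T_def pos_divide_less_eq[OF \<gamma>] by (simp only: mult.commute)
    note T = T1 T2
    have "continuous_on {0..T} (sech_imag p)"
    proof (intro continuous_at_imp_continuous_on ballI)
      fix x assume "x \<in> {0..T}"
      then have "\<bar>x\<bar> < pi" using T by simp
      then show "isCont (sech_imag p) x" by (rule DERIV_isCont[OF sech_imag_DERIV[OF p]])
    qed
    then have "compact (sech_imag p ` {0..T})" by (intro compact_continuous_image) auto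
    then obtain B where B: "\<And>t. t \<in> {0..T} \<Longrightarrow> norm (sech_imag p t) \<le> B"
      by (meson compact_imp_bounded bounded_iff image_eqI)
    have gk: "\<gamma> * k > 0" using \<gamma> k by simp
    \<comment> \<open>Chosen so that \<open>\<gamma> * k / \<epsilon>\<close> equals
      \<open>\<bar>B\<bar> + 1 + \<gamma> * k\<close>. The point \<open>u\<close> below is where
      \<open>cn\<close> takes the value \<open>\<epsilon>\<close>, and there the quotient exceeds
      \<open>B\<close>.\<close>
    define \<epsilon> where "\<epsilon> = \<gamma> * k / (\<bar>B\<bar> + 1 + \<gamma> * k)"
    have \<epsilon>: "0 < \<epsilon>" "\<epsilon> < 1" using gk by (auto simp: \<epsilon>_def field_simps)
    define u where "u = elliptic_F (arccos \<epsilon>) ?m"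
    have arc: "0 < arccos \<epsilon>" "arccos \<epsilon> < pi / 2"
      using arccos_lt_bounded[of \<epsilon>] \<epsilon> arccos_less_arccos[of 0 \<epsilon>] by auto
    have u: "0 < u" "u < elliptic_K ?m"
      using arc elliptic_F_less_iff[OF m', of 0 "arccos \<epsilon>"] elliptic_F_less_iff[OF m', of "arccos \<epsilon>" "pi / 2"]
      by (auto simp: u_def elliptic_K_def)
    have cn: "jacobi_cn u ?m = \<epsilon>"
      using \<epsilon> by (simp add: jacobi_cn_def u_def am_elliptic_F[OF m'] cos_arccos)
    define t where "t = u / \<gamma>"
    have gt: "\<gamma> * t = u" using \<gamma> by (simp add: t_def)
    have t: "0 \<le> t" "t \<le> T" using u \<gamma> by (auto simp: t_def T_def divide_right_mono)
    have "sech_imag p t = \<gamma> * ((jacobi_dn u ?m + k) / \<epsilon>)"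
      using sech_imag_eq_jacobi[of t] t T u unfolding gt cn by simp
    also have "\<dots> > \<gamma> * (k / \<epsilon>)"
      using jacobi_dn_pos[OF m', of u] \<epsilon> \<gamma> by (simp add: divide_strict_right_mono)
    also have "\<gamma> * (k / \<epsilon>) = \<bar>B\<bar> + 1 + \<gamma> * k"
      using gk k \<gamma> by (simp add: \<epsilon>_def)
    finally show False using B[of t] t gk by auto
  qed
qed

text \<open>If \<open>\<tau>\<close> were smaller than \<open>p\<close>, the identity theorem would
  make it a period of the complex sum, carrying the pole at \<open>\<i> pi\<close> to a point near
  which the sum is bounded. Conversely, the value \<open>\<gamma> * (1 - k)\<close> at
  \<open>p / 2\<close> and the quadratic relation between \<open>dn\<close> and \<open>cn\<close>
  force \<open>cn = - 1\<close>. So the amplitude has reached \<open>pi\<close> there, and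
  \<open>\<tau>\<close> is at most \<open>p\<close>.\<close>

lemma period_eq: "4 * elliptic_K m / \<gamma> = p"
proof -
  define \<tau> where "\<tau> = 4 * elliptic_K m / \<gamma>"
  have \<tau>: "\<tau> > 0" "\<gamma> * \<tau> = 4 * elliptic_K m"
    using \<gamma> elliptic_K_pos[OF m] by (auto simp: \<tau>_def)
  have per: "sech_real p (t + \<tau>) = sech_real p t" for t
    unfolding sech_real_eq_jacobi distrib_left[of \<gamma>] \<tau>(2) jacobi_cn_add_4K[OF m] jacobi_dn_add_4K[OF m] ..
  have "\<not> \<tau> < p"
  proof
    assume less: "\<tau> < p"
    obtain B where B: "\<And>t. \<bar>t\<bar> < pi \<Longrightarrow> norm (sech_sum p (\<i> * of_real t + of_real \<tau>)) \<le> B"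
      using sech_sum_bounded_off_poles[OF p \<tau>(1) less] by blast
    have eq: "sech_sum p (z + of_real \<tau>) = sech_sum p z" if "z \<in> strip" for z
    proof (rule strip_identity[where f = "\<lambda>z. sech_sum p (z + of_real \<tau>)" and g = "sech_sum p" and \<delta> = 1])
      have "sech_sum p \<circ> (\<lambda>z. z + of_real \<tau>) holomorphic_on strip"
        by (rule holomorphic_on_compose_gen[OF _ holomorphic_sech_sum[OF p]]) (auto intro!: holomorphic_intros)
      then show "(\<lambda>z. sech_sum p (z + of_real \<tau>)) holomorphic_on strip" by (simp add: o_def)
      show "sech_sum p (of_real x + of_real \<tau>) = sech_sum p (of_real x)" for x
        using per[of x] sech_sum_of_real[of p "x + \<tau>"] sech_sum_of_real[of p x] by simp
    qed (use that holomorphic_sech_sum[OF p] in auto)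
    obtain t where t: "0 \<le> t" "t < pi" "sech_imag p t > B"
      using sech_imag_unbounded[OF p, of B] by (elim exE conjE)
    have "\<i> * of_real t \<in> strip" using t by (simp add: strip_def)
    from eq[OF this] have "norm (of_real (sech_imag p t) :: complex) \<le> B"
      using B[of t] t by (simp add: sech_sum_imag)
    with t show False by simp
  qed
  moreover have "\<tau> \<le> p"
  proof -
    let ?u = "\<gamma> * (p / 2)"
    let ?c = "jacobi_cn ?u m" and ?d = "jacobi_dn ?u m"
    have "?d + k * ?c = 1 - k"
      using sech_real_eq_jacobi[of "p / 2"] ab(2) \<gamma> by simp
    then have d: "?d = 1 - k - k * ?c" by simp
    have "?d\<^sup>2 = 1 - k\<^sup>2 + k\<^sup>2 * ?c\<^sup>2"
      using jacobi_squares(2)[OF m k, of ?u] by (simp add: m_def)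
    then have "(1 - k - k * ?c)\<^sup>2 = 1 - k\<^sup>2 + k\<^sup>2 * ?c\<^sup>2" unfolding d .
    then have "2 * k * (1 - k) * (1 + ?c) = 0"
      by (simp add: power2_eq_square algebra_simps)
    then have "cos (jacobi_am ?u m) = - 1"
      using k by (simp add: jacobi_cn_def)
    moreover have "jacobi_am ?u m \<ge> 0"
      using jacobi_am_le_iff[OF m, of 0 ?u] p \<gamma> m by simp
    ultimately have "jacobi_am ?u m \<ge> pi"
      by (metis cos_monotone_0_pi cos_pi linorder_not_le order_less_irrefl order_refl pi_ge_zero)
    then have "2 * elliptic_K m \<le> ?u"
      using jacobi_am_le_iff[OF m, of "2 * elliptic_K m" ?u] jacobi_am_2K[OF m] by simp
    then show ?thesis using \<gamma> by (simp add: \<tau>_def field_simps)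
  qed
  ultimately show ?thesis unfolding \<tau>_def by simp
qed

end

lemma sech_real_jacobi:
  assumes "p > 0"
  obtains k \<gamma> where "0 < k" "k < 1" "\<gamma> > 0" "elliptic_K (1 - k\<^sup>2) = \<gamma> * pi" "4 * elliptic_K (k\<^sup>2) / \<gamma> = p"
    "\<And>t. sech_real p t = \<gamma> * (jacobi_dn (\<gamma> * t) (k\<^sup>2) + k * jacobi_cn (\<gamma> * t) (k\<^sup>2))"
  by (rule that[OF modulus_facts(1-3)[OF assms] K'_eq[OF assms] period_eq[OF assms] sech_real_eq_jacobi[OF assms]])

theorem sech_real_elliptic:
  assumes "p > 0"
  obtains m where "0 < m" "m < 1" "4 * pi * elliptic_K m / elliptic_K' m = p"
    "\<And>t. sech_real p t = elliptic_K' m / pi * (jacobi_dn (elliptic_K' m * t / pi) m + sqrt m * jacobi_cn (elliptic_K' m * t / pi) m)"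
proof -
  obtain k \<gamma> where k: "0 < k" "k < 1" and \<gamma>: "\<gamma> > 0" and K: "elliptic_K (1 - k\<^sup>2) = \<gamma> * pi" "4 * elliptic_K (k\<^sup>2) / \<gamma> = p"
    and eq: "\<And>t. sech_real p t = \<gamma> * (jacobi_dn (\<gamma> * t) (k\<^sup>2) + k * jacobi_cn (\<gamma> * t) (k\<^sup>2))"
    using sech_real_jacobi[OF assms] by blast
  have K': "elliptic_K' (k\<^sup>2) = \<gamma> * pi"
    unfolding elliptic_K'_def by (rule K)
  show ?thesis
  proof (rule that[of "k\<^sup>2"])
    show "0 < k\<^sup>2" "k\<^sup>2 < 1" using k by (auto simp: power_less_one_iff)
    show "4 * pi * elliptic_K (k\<^sup>2) / elliptic_K' (k\<^sup>2) = p"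
      unfolding K' K(2)[symmetric] by simp
    show "sech_real p t = elliptic_K' (k\<^sup>2) / pi * (jacobi_dn (elliptic_K' (k\<^sup>2) * t / pi) (k\<^sup>2) + sqrt (k\<^sup>2) * jacobi_cn (elliptic_K' (k\<^sup>2) * t / pi) (k\<^sup>2))" for t
      unfolding K' eq using k by simp
  qed
qed

text \<open>In Jacobi form the sign of the derivative is visible: \<open>sn\<close> is nonnegative
  up to twice the quarter period, which corresponds to \<open>p / 2\<close>, and the remaining
  factor is a positive multiple of the sum itself.\<close>

lemma sech_real_antimono:
  assumes p: "p > 0" and "0 \<le> s" "s \<le> t" "t \<le> p / 2"
  shows "sech_real p t \<le> sech_real p s"
proof -
  obtain k \<gamma> where k: "0 < k" "k < 1" and \<gamma>: "\<gamma> > 0" and K: "4 * elliptic_K (k\<^sup>2) / \<gamma> = p"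
    and eq: "\<And>t. sech_real p t = \<gamma> * (jacobi_dn (\<gamma> * t) (k\<^sup>2) + k * jacobi_cn (\<gamma> * t) (k\<^sup>2))"
    using sech_real_jacobi[OF p] by metis
  let ?m = "k\<^sup>2"
  have m: "0 < ?m" "?m < 1" using k by (auto simp: power_less_one_iff)
  let ?f = "\<lambda>t. \<gamma> * (jacobi_dn (\<gamma> * t) ?m + k * jacobi_cn (\<gamma> * t) ?m)"
  have "?f t \<le> ?f s"
  proof (rule DERIV_nonpos_imp_nonincreasing[OF assms(3), where f = ?f], intro exI conjI)
    fix x assume x: "s \<le> x" "x \<le> t"
    show "(?f has_real_derivative
      - \<gamma>\<^sup>2 * k * sin (jacobi_am (\<gamma> * x) ?m) * (jacobi_dn (\<gamma> * x) ?m + k * jacobi_cn (\<gamma> * x) ?m)) (at x)"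
      by (rule dn_cn_ode(1)[OF m k refl])
    have "x \<ge> 0" using x assms by simp
    then have u0: "0 \<le> \<gamma> * x" using \<gamma> by simp
    have "\<gamma> * x \<le> \<gamma> * (p / 2)" using x assms \<gamma> by (intro mult_left_mono) auto
    also have "\<dots> = 2 * elliptic_K ?m"
      using K \<gamma> by (simp add: field_simps)
    finally have "jacobi_am (\<gamma> * x) ?m \<le> pi"
      using jacobi_am_le_iff[OF m] jacobi_am_2K[OF m] by metis
    moreover have "0 \<le> jacobi_am (\<gamma> * x) ?m"
      using jacobi_am_le_iff[OF m, of 0] u0 jacobi_am_0[OF m] by metis
    ultimately have sn: "sin (jacobi_am (\<gamma> * x) ?m) \<ge> 0" by (intro sin_ge_zero)
    have "?f x > 0"
      using sech_real_pos[OF p, of x] unfolding eq .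
    then have "jacobi_dn (\<gamma> * x) ?m + k * jacobi_cn (\<gamma> * x) ?m > 0"
      using \<gamma> by (simp add: zero_less_mult_iff)
    then have "0 \<le> \<gamma>\<^sup>2 * k * sin (jacobi_am (\<gamma> * x) ?m) * (jacobi_dn (\<gamma> * x) ?m + k * jacobi_cn (\<gamma> * x) ?m)"
      using sn k by (intro mult_nonneg_nonneg) auto
    then show "- \<gamma>\<^sup>2 * k * sin (jacobi_am (\<gamma> * x) ?m) * (jacobi_dn (\<gamma> * x) ?m + k * jacobi_cn (\<gamma> * x) ?m) \<le> 0"
      by (simp only: minus_mult_left[symmetric] neg_le_0_iff_le)
  qed
  then show ?thesis unfolding eq .
qed

section \<open>The kernel in exponential coordinates\<close>

definition strip_kernel :: "real \<Rightarrow> real \<Rightarrow> complex \<Rightarrow> complex" where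
  "strip_kernel p l t = tanh_sum p (of_real l) - (tanh_sum p (of_real l + t) + tanh_sum p (of_real l - t)) / 2"

lemma tanh_half_exp:
  fixes x :: complex
  assumes "cosh (x / 2) \<noteq> 0"
  shows "exp x + 1 \<noteq> 0" "tanh (x / 2) = (exp x - 1) / (exp x + 1)"
proof -
  have e: "exp x = exp (x / 2) * exp (x / 2)" by (simp flip: exp_add)
  have i: "exp (x / 2) * exp (- (x / 2)) = 1" by (simp flip: exp_add)
  have c: "2 * cosh (x / 2) = exp (x / 2) + exp (- (x / 2))" "2 * sinh (x / 2) = exp (x / 2) - exp (- (x / 2))"
    by (simp_all add: cosh_def sinh_def scaleR_conv_of_real)
  have 1: "exp x + 1 = exp (x / 2) * (2 * cosh (x / 2))" and 2: "exp x - 1 = exp (x / 2) * (2 * sinh (x / 2))"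
    unfolding c ring_distribs i by (simp_all only: e)
  show "exp x + 1 \<noteq> 0" unfolding 1 using assms by simp
  show "tanh (x / 2) = (exp x - 1) / (exp x + 1)"
    unfolding 1 2 tanh_def by simp
qed

text \<open>Partial fractions. With \<open>w = exp (l + p n)\<close> and \<open>z = exp t\<close>
  the three quotients on the right are \<open>tanh\<close> at half of \<open>l + p n\<close>, of
  \<open>l + p n + t\<close> and of \<open>l + p n - t\<close>.\<close>

lemma kernel_term_identity:
  fixes w z :: complex
  assumes "w \<noteq> 0" "w + 1 \<noteq> 0" "z + w \<noteq> 0" "w * z + 1 \<noteq> 0"
  shows "(z - 1)\<^sup>2 * (w - 1) / ((w + 1) * (z + w) * (z + 1 / w))
    = (w - 1) / (w + 1) - ((w * z - 1) / (w * z + 1) + (w - z) / (w + z)) / 2"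
proof -
  have 1: "z + 1 / w = (w * z + 1) / w" using assms by (simp add: field_simps)
  have 2: "w + z \<noteq> 0" using assms by (simp add: add.commute)
  have "(z - 1)\<^sup>2 * (w - 1) / ((w + 1) * (z + w) * (z + 1 / w))
    = w * ((z - 1)\<^sup>2 * (w - 1)) / ((w + 1) * (w + z) * (w * z + 1))"
    unfolding 1 using assms by (simp add: add.commute[of z w])
  also have "\<dots> = (w - 1) / (w + 1) - ((w * z - 1) / (w * z + 1) + (w - z) / (w + z)) / 2"
    using assms(2,4) 2 by (simp add: divide_simps) (simp add: algebra_simps power2_eq_square)
  finally show ?thesis .
qed

lemma E_kernel_exp:
  assumes "t \<in> strip" "p > 0"
  shows "E_kernel p l (exp t) = strip_kernel p l t"
proof -
  \<comment> \<open>The summand is arranged as half the sum of two differences of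
    \<open>tanh\<close>, because \<open>tanh_sum_diff\<close> sums such differences while the single
    \<open>tanh\<close> series diverges.\<close>
  have summand: "(exp t - 1)\<^sup>2 * (exp (of_real (l + p * of_int n)) - 1) /
     ((exp (of_real (l + p * of_int n)) + 1) * (exp t + exp (of_real (l + p * of_int n))) *
      (exp t + exp (- of_real (l + p * of_int n))))
   = ((tanh ((of_real l + of_real p * of_int n) / 2) - tanh ((of_real l + t + of_real p * of_int n) / 2))
     + (tanh ((of_real l + of_real p * of_int n) / 2) - tanh ((of_real l - t + of_real p * of_int n) / 2))) * (1 / 2)" for n :: int
  proof -
    define \<mu> where "\<mu> = complex_of_real (l + p * of_int n)"
    have \<mu>: "of_real l + of_real p * of_int n = \<mu>" "of_real l + t + of_real p * of_int n = \<mu> + t"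
      "of_real l - t + of_real p * of_int n = \<mu> - t" by (simp_all add: \<mu>_def)
    have s: "\<mu> \<in> strip" "\<mu> + t \<in> strip" "\<mu> - t \<in> strip"
      unfolding \<mu>_def using assms(1) by (simp_all only: strip_simps)
    note th = tanh_half_exp[OF cosh_half_nonzero[OF s(1)]] tanh_half_exp[OF cosh_half_nonzero[OF s(2)]]
      tanh_half_exp[OF cosh_half_nonzero[OF s(3)]]
    have nz: "exp \<mu> \<noteq> 0" "exp t \<noteq> 0" by simp_all
    have a: "exp \<mu> * exp t + 1 \<noteq> 0" using th(3) by (simp add: exp_add)
    have b: "exp (\<mu> - t) + 1 = (exp \<mu> + exp t) / exp t" "exp (\<mu> - t) - 1 = (exp \<mu> - exp t) / exp t"
      by (simp_all add: exp_diff field_simps)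
    have c: "exp t + exp \<mu> \<noteq> 0" using th(5) unfolding b by (simp add: add.commute)
    have t3: "tanh ((\<mu> - t) / 2) = (exp \<mu> - exp t) / (exp \<mu> + exp t)"
      unfolding th(6) b using nz by simp
    have t2: "tanh ((\<mu> + t) / 2) = (exp \<mu> * exp t - 1) / (exp \<mu> * exp t + 1)"
      unfolding th(4) exp_add ..
    have i: "exp (- \<mu>) = 1 / exp \<mu>" by (simp add: exp_minus field_simps)
    show ?thesis
      unfolding \<mu> unfolding \<mu>_def[symmetric] t2 t3 th(2) i
      unfolding kernel_term_identity[OF nz(1) th(1) c a] by (simp add: field_simps)
  qed
  have "((\<lambda>n::int. ((tanh ((of_real l + of_real p * of_int n) / 2) - tanh ((of_real l + t + of_real p * of_int n) / 2))
     + (tanh ((of_real l + of_real p * of_int n) / 2) - tanh ((of_real l - t + of_real p * of_int n) / 2))) * (1 / 2))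
     has_sum ((tanh_sum p (of_real l) - tanh_sum p (of_real l + t)) + (tanh_sum p (of_real l) - tanh_sum p (of_real l - t))) * (1 / 2)) UNIV"
    by (intro has_sum_cmult_left has_sum_add tanh_sum_diff) (use assms in simp_all)
  then have "E_kernel p l (exp t) = ((tanh_sum p (of_real l) - tanh_sum p (of_real l + t)) + (tanh_sum p (of_real l) - tanh_sum p (of_real l - t))) * (1 / 2)"
    unfolding E_kernel_def summand by (rule infsumI)
  then show ?thesis by (simp add: strip_kernel_def field_simps)
qed

lemma strip_kernel_0 [simp]: "strip_kernel p l 0 = 0"
  by (simp add: strip_kernel_def)

lemma strip_kernel_DERIV:
  assumes "t \<in> strip" "p > 0"
  shows "(strip_kernel p l has_field_derivative ((sech_sum p (of_real l - t))\<^sup>2 - (sech_sum p (of_real l + t))\<^sup>2) / 4) (at t)"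
proof -
  have 1: "((\<lambda>t. tanh_sum p (of_real l + t)) has_field_derivative ((sech_sum p (of_real l + t))\<^sup>2 - sech_sum_const p) / 2 * 1) (at t)"
    by (rule DERIV_chain2[OF tanh_sum_DERIV]) (use assms in \<open>auto intro!: derivative_eq_intros\<close>)
  have 2: "((\<lambda>t. tanh_sum p (of_real l - t)) has_field_derivative ((sech_sum p (of_real l - t))\<^sup>2 - sech_sum_const p) / 2 * - 1) (at t)"
    by (rule DERIV_chain2[OF tanh_sum_DERIV]) (use assms in \<open>auto intro!: derivative_eq_intros\<close>)
  show ?thesis unfolding strip_kernel_def[abs_def]
    by (rule DERIV_cong[OF DERIV_diff[OF DERIV_const[of "tanh_sum p (of_real l)"] DERIV_cdivide[OF DERIV_add[OF 1 2], of 2]]])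
       (simp add: field_simps)
qed

lemma continuous_tanh_sum: "p > 0 \<Longrightarrow> continuous_on strip (tanh_sum p)"
  by (meson DERIV_continuous continuous_at_imp_continuous_on tanh_sum_DERIV)

lemma continuous_sech_sum: "p > 0 \<Longrightarrow> continuous_on strip (sech_sum p)"
  by (meson DERIV_continuous continuous_at_imp_continuous_on sech_sum_DERIV)

lemma continuous_strip_kernel:
  assumes "p > 0" "continuous_on A f" "continuous_on A g" "\<And>x. x \<in> A \<Longrightarrow> g x \<in> strip"
  shows "continuous_on A (\<lambda>x. strip_kernel p (f x) (g x))"
  unfolding strip_kernel_def
  by (intro continuous_intros continuous_on_compose2[OF continuous_tanh_sum[OF assms(1)]] assms(2,3))
     (use assms(4) in auto)

section \<open>Positivity and the integral of the kernel on the real axis\<close>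

definition tanh_real :: "real \<Rightarrow> real \<Rightarrow> real" where
  "tanh_real p t = Re (tanh_sum p (of_real t))"

definition kernel_real :: "real \<Rightarrow> real \<Rightarrow> real \<Rightarrow> real" where
  "kernel_real p l t = tanh_real p l - (tanh_real p (l + t) + tanh_real p (l - t)) / 2"

lemma tanh_sum_of_real: "tanh_sum p (of_real t) = of_real (tanh_real p t)"
proof -
  have "tanh_sum p (of_real t) \<in> \<real>"
    unfolding Reals_cnj_iff using tanh_sum_cnj[of p "of_real t"] by simp
  then show ?thesis by (simp add: tanh_real_def)
qed

lemma strip_kernel_of_real: "strip_kernel p l (of_real t) = of_real (kernel_real p l t)"
  using tanh_sum_of_real[of p "l + t"] tanh_sum_of_real[of p "l - t"] tanh_sum_of_real[of p l]
  by (simp add: strip_kernel_def kernel_real_def)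

lemma tanh_real_minus: "tanh_real p (- t) = - tanh_real p t"
  by (simp add: tanh_real_def tanh_sum_minus)

context
  fixes p :: real
  assumes p: "p > 0"
begin

lemma tanh_real_period: "tanh_real p (t + p) = tanh_real p t + 2"
  using tanh_sum_period[of "of_real t" p] p by (simp add: tanh_real_def)

lemma sech_real_period: "sech_real p (t + p) = sech_real p t"
  using sech_sum_period[of p "of_real t"] by (simp add: sech_real_def)

lemma tanh_real_DERIV: "(tanh_real p has_real_derivative ((sech_real p t)\<^sup>2 - Re (sech_sum_const p)) / 2) (at t)"
proof -
  have "((\<lambda>x. Re (tanh_sum p (1 * of_real x))) has_real_derivative
      Re (1 * (((sech_sum p (of_real t))\<^sup>2 - sech_sum_const p) / 2))) (at t)"
    by (rule Re_line_DERIV) (simp add: tanh_sum_DERIV p)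
  also have "Re (1 * (((sech_sum p (of_real t))\<^sup>2 - sech_sum_const p) / 2)) = ((sech_real p t)\<^sup>2 - Re (sech_sum_const p)) / 2"
    unfolding sech_sum_of_real of_real_power[symmetric] by simp
  finally show ?thesis by (simp add: tanh_real_def[abs_def])
qed

lemma sech_real_DERIV': "(sech_real p has_real_derivative - (sech_real p t * (tanh_real p t + 1 - tanh_real p (t + p / 2))) / 2) (at t)"
proof -
  have "tanh_gap p (of_real t) = of_real (tanh_real p t + 1 - tanh_real p (t + p / 2))"
    using tanh_sum_of_real[of p "t + p / 2"] by (simp add: tanh_gap_def tanh_sum_of_real)
  then have "- (sech_sum p (of_real t) * tanh_gap p (of_real t)) / 2
    = complex_of_real (- (sech_real p t * (tanh_real p t + 1 - tanh_real p (t + p / 2))) / 2)"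
    by (simp add: sech_sum_of_real)
  with sech_real_DERIV[OF p, of t] show ?thesis by (simp only: Re_complex_of_real)
qed

lemma continuous_sech_real: "continuous_on A (sech_real p)"
  by (intro continuous_at_imp_continuous_on ballI DERIV_isCont[OF sech_real_DERIV'])

lemma continuous_tanh_real: "continuous_on A (tanh_real p)"
  by (intro continuous_at_imp_continuous_on ballI DERIV_isCont[OF tanh_real_DERIV])

lemma kernel_real_DERIV:
  "(kernel_real p l has_real_derivative ((sech_real p (l - t))\<^sup>2 - (sech_real p (l + t))\<^sup>2) / 4) (at t)"
proof -
  have 1: "((\<lambda>t. tanh_real p (l + t)) has_real_derivative ((sech_real p (l + t))\<^sup>2 - Re (sech_sum_const p)) / 2 * 1) (at t)"
    by (rule DERIV_chain2[OF tanh_real_DERIV]) (auto intro!: derivative_eq_intros)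
  have 2: "((\<lambda>t. tanh_real p (l - t)) has_real_derivative ((sech_real p (l - t))\<^sup>2 - Re (sech_sum_const p)) / 2 * - 1) (at t)"
    by (rule DERIV_chain2[OF tanh_real_DERIV]) (auto intro!: derivative_eq_intros)
  show ?thesis unfolding kernel_real_def[abs_def]
    by (rule DERIV_cong[OF DERIV_diff[OF DERIV_const[of "tanh_real p l"] DERIV_cdivide[OF DERIV_add[OF 1 2], of 2]]])
       (simp add: field_simps)
qed

lemma kernel_real_minus: "kernel_real p l (- t) = kernel_real p l t"
  by (simp add: kernel_real_def)

lemma kernel_real_period: "kernel_real p l (t + p) = kernel_real p l t"
  using tanh_real_period[of "l + t"] tanh_real_period[of "l - (t + p)"]
  by (simp add: kernel_real_def algebra_simps)

lemma kernel_real_period_int: "kernel_real p l (t + p * of_int n) = kernel_real p l t"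
proof (induction n rule: int_induct[where k = 0])
  case (step1 i)
  then show ?case
    using kernel_real_period[of l "t + p * of_int i"] by (simp add: algebra_simps)
next
  case (step2 i)
  then show ?case
    using kernel_real_period[of l "t + p * of_int (i - 1)"] by (simp add: algebra_simps)
qed simp

text \<open>The kernel vanishes at \<open>t = 0\<close>, and its derivative compares the squared
  secant sums at \<open>l - s\<close> and \<open>l + s\<close>. The secant sum is even and
  decreasing up to \<open>p / 2\<close>. If \<open>l + s\<close> lies beyond \<open>p / 2\<close> it
  is reflected to \<open>p - (l + s)\<close>, which is still at least
  \<open>\<bar>l - s\<bar>\<close>.\<close>

lemma kernel_real_nonneg_half:
  assumes "0 \<le> l" "l \<le> p / 2" "0 \<le> t" "t \<le> p / 2"
  shows "kernel_real p l t \<ge> 0"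
proof -
  have "kernel_real p l 0 \<le> kernel_real p l t"
  proof (rule DERIV_nonneg_imp_nondecreasing[OF assms(3)], intro exI conjI)
    fix s assume s: "0 \<le> s" "s \<le> t"
    show "(kernel_real p l has_real_derivative ((sech_real p (l - s))\<^sup>2 - (sech_real p (l + s))\<^sup>2) / 4) (at s)"
      by (rule kernel_real_DERIV)
    have abs: "sech_real p (l - s) = sech_real p \<bar>l - s\<bar>"
      using sech_real_minus[of p "l - s"] by (simp add: abs_if)
    have "sech_real p (l + s) \<le> sech_real p (l - s)"
    proof (cases "l + s \<le> p / 2")
      case True
      then show ?thesis unfolding abs using s assms by (intro sech_real_antimono[OF p]) auto
    next
      case False
      have "sech_real p (l + s) = sech_real p (p - (l + s))"
        using sech_real_period[of "- (l + s)"] sech_real_minus[of p "l + s"] by (simp add: algebra_simps)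
      also have "\<dots> \<le> sech_real p \<bar>l - s\<bar>"
        using s assms False by (intro sech_real_antimono[OF p]) auto
      finally show ?thesis unfolding abs .
    qed
    then have "(sech_real p (l + s))\<^sup>2 \<le> (sech_real p (l - s))\<^sup>2"
      using sech_real_pos[OF p, of "l + s"] by (intro power_mono) auto
    then show "0 \<le> ((sech_real p (l - s))\<^sup>2 - (sech_real p (l + s))\<^sup>2) / 4" by simp
  qed
  then show ?thesis by (simp add: kernel_real_def)
qed

lemma kernel_real_nonneg:
  assumes "0 \<le> l" "l \<le> p / 2"
  shows "kernel_real p l t \<ge> 0"
proof -
  \<comment> \<open>The nearest integer to \<open>t / p\<close>, which moves \<open>t\<close> by
    periods into the interval from \<open>- (p / 2)\<close> to \<open>p / 2\<close>.\<close>
  define n where "n = \<lfloor>t / p + 1 / 2\<rfloor>"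
  define s where "s = t - p * of_int n"
  have "of_int n \<le> t / p + 1 / 2" "t / p + 1 / 2 < of_int n + 1"
    unfolding n_def by linarith+
  then have "of_int n * p \<le> (t / p + 1 / 2) * p" "(t / p + 1 / 2) * p < (of_int n + 1) * p"
    using p by (auto intro!: mult_right_mono mult_strict_right_mono)
  moreover have e: "(t / p + 1 / 2) * p = t + p / 2" "(of_int n + 1) * p = of_int n * p + p"
    using p by (simp_all add: field_simps)
  ultimately have "of_int n * p \<le> t + p / 2" "t + p / 2 < of_int n * p + p"
    unfolding e by simp_all
  then have s: "\<bar>s\<bar> \<le> p / 2" unfolding s_def mult.commute[of p] abs_le_iff by linarith
  have "kernel_real p l t = kernel_real p l \<bar>s\<bar>"
    using kernel_real_period_int[of l s n] kernel_real_minus[of l s] by (simp add: s_def abs_if)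
  then show ?thesis using kernel_real_nonneg_half[OF assms, of "\<bar>s\<bar>"] s by simp
qed

text \<open>Differentiation in \<open>t\<close> under the integral leaves an integrand with an
  explicit primitive in \<open>l\<close>. The result is the gap, minus twice the logarithmic
  derivative of the secant sum, and both sides vanish at \<open>t = 0\<close>.\<close>

lemma integral_kernel_real:
  "((\<lambda>l. kernel_real p l t) has_integral (- 2 * ln (sech_real p t / sech_real p 0))) {0..p / 2}"
proof -
  let ?I = "\<lambda>t. integral (cbox 0 (p / 2)) (\<lambda>l. kernel_real p l t)"
  have intg: "(\<lambda>l. kernel_real p l t) integrable_on cbox 0 (p / 2)" for t
    unfolding kernel_real_def
    by (intro integrable_continuous continuous_intros continuous_on_compose2[OF continuous_tanh_real[of UNIV]]) auto
  have deriv: "(?I has_real_derivative tanh_real p t + 1 - tanh_real p (t + p / 2)) (at t)" for t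
  proof -
    have h1: "(?I has_field_derivative integral (cbox 0 (p / 2)) (\<lambda>l. ((sech_real p (l - t))\<^sup>2 - (sech_real p (l + t))\<^sup>2) / 4)) (at t within UNIV)"
    proof (rule leibniz_rule_field_derivative)
      show "continuous_on (UNIV \<times> cbox 0 (p / 2)) (\<lambda>(t, l). ((sech_real p (l - t))\<^sup>2 - (sech_real p (l + t))\<^sup>2) / 4)"
        unfolding case_prod_unfold
        by (intro continuous_intros continuous_on_compose2[OF continuous_sech_real[of UNIV]]) auto
    qed (use kernel_real_DERIV intg in auto)
    have h2: "((\<lambda>l. ((sech_real p (l - t))\<^sup>2 - (sech_real p (l + t))\<^sup>2) / 4) has_integral
       (tanh_real p (p / 2 - t) - tanh_real p (p / 2 + t)) / 2 - (tanh_real p (0 - t) - tanh_real p (0 + t)) / 2) {0..p / 2}"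
    proof (rule fundamental_theorem_of_calculus)
      fix l assume "l \<in> {0..p / 2}"
      have 1: "((\<lambda>l. tanh_real p (l - t)) has_real_derivative ((sech_real p (l - t))\<^sup>2 - Re (sech_sum_const p)) / 2 * 1) (at l)"
        by (rule DERIV_chain2[OF tanh_real_DERIV]) (auto intro!: derivative_eq_intros)
      have 2: "((\<lambda>l. tanh_real p (l + t)) has_real_derivative ((sech_real p (l + t))\<^sup>2 - Re (sech_sum_const p)) / 2 * 1) (at l)"
        by (rule DERIV_chain2[OF tanh_real_DERIV]) (auto intro!: derivative_eq_intros)
      have "((\<lambda>l. (tanh_real p (l - t) - tanh_real p (l + t)) / 2) has_real_derivative ((sech_real p (l - t))\<^sup>2 - (sech_real p (l + t))\<^sup>2) / 4) (at l)"
        by (rule DERIV_cong[OF DERIV_cdivide[OF DERIV_diff[OF 1 2], of 2]]) (simp add: field_simps)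
      then show "((\<lambda>l. (tanh_real p (l - t) - tanh_real p (l + t)) / 2) has_vector_derivative
          ((sech_real p (l - t))\<^sup>2 - (sech_real p (l + t))\<^sup>2) / 4) (at l within {0..p / 2})"
        by (simp add: has_real_derivative_iff_has_vector_derivative has_vector_derivative_at_within)
    qed (use p in simp)
    have h3: "(tanh_real p (p / 2 - t) - tanh_real p (p / 2 + t)) / 2 - (tanh_real p (0 - t) - tanh_real p (0 + t)) / 2
       = tanh_real p t + 1 - tanh_real p (t + p / 2)"
    proof -
      have "tanh_real p (p / 2 - t) = 2 - tanh_real p (t + p / 2)"
        using tanh_real_period[of "- (t + p / 2)"] tanh_real_minus[of p "t + p / 2"] by (simp add: field_simps)
      then show ?thesis by (simp add: tanh_real_minus add.commute field_simps)
    qed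
    show ?thesis using h1 unfolding cbox_interval integral_unique[OF h2] h3 by simp
  qed
  have "?I t + 2 * ln (sech_real p t) = ?I 0 + 2 * ln (sech_real p 0)"
  proof (rule DERIV_isconst_all[where f = "\<lambda>t. ?I t + 2 * ln (sech_real p t)", rule_format])
    fix x
    have nz: "sech_real p x \<noteq> 0" using sech_real_pos[OF p, of x] by simp
    have "((\<lambda>t. ln (sech_real p t)) has_real_derivative - (tanh_real p x + 1 - tanh_real p (x + p / 2)) / 2) (at x)"
      by (rule DERIV_cong[OF DERIV_chain2[OF DERIV_ln_divide[OF sech_real_pos[OF p]] sech_real_DERIV']])
         (use nz in \<open>simp add: field_simps\<close>)
    from DERIV_add[OF deriv[of x] DERIV_cmult[OF this, of 2]]
    show "((\<lambda>t. ?I t + 2 * ln (sech_real p t)) has_real_derivative 0) (at x)"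
      by (rule DERIV_cong) (simp add: field_simps)
  qed
  moreover have "?I 0 = 0" by (simp add: kernel_real_def)
  ultimately have "?I t = - 2 * ln (sech_real p t / sech_real p 0)"
    using sech_real_pos[OF p, of t] sech_real_pos[OF p, of 0] by (simp add: ln_div)
  with integrable_integral[OF intg[of t]] show ?thesis by simp
qed

text \<open>The indices \<open>n\<close> and \<open>- n\<close> are paired. The inequality
  \<open>sech (a + b) + sech (a - b) \<ge> 2 sech a sech b\<close> holds termwise because
  \<open>cosh (a + b) cosh (a - b)\<close> is at most the square of
  \<open>cosh a cosh b\<close>.\<close>

lemma sech_real_ge: "sech_real p 0 / cosh (t / 2) \<le> sech_real p t"
proof -
  have 1: "((\<lambda>n::int. 1 / cosh ((t - p * of_int n) / 2)) has_sum sech_real p t) UNIV"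
    using sech_real_has_sum[OF p, of t]
    by (rule has_sum_reindex_bij_witness[of UNIV uminus uminus UNIV, THEN iffD1, rotated -1]) auto
  have "((\<lambda>n::int. 1 / cosh ((0 + p * of_int n) / 2) * (2 / cosh (t / 2))) has_sum sech_real p 0 * (2 / cosh (t / 2))) UNIV"
    by (rule has_sum_cmult_left[OF sech_real_has_sum[OF p]])
  then have "sech_real p 0 * (2 / cosh (t / 2)) \<le> sech_real p t + sech_real p t"
  proof (rule has_sum_mono[OF _ has_sum_add[OF sech_real_has_sum[OF p, of t] 1]])
    fix n :: int
    define a where "a = t / 2"
    define b where "b = p * of_int n / 2"
    have ca: "cosh a \<ge> 1" "cosh b \<ge> 1" by (rule cosh_real_ge_1)+
    have pos: "cosh (a + b) > 0" "cosh (a - b) > 0" "cosh a > 0" "cosh b > 0" by (rule cosh_real_pos)+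
    have sa: "(sinh a)\<^sup>2 = (cosh a)\<^sup>2 - 1" "(sinh b)\<^sup>2 = (cosh b)\<^sup>2 - 1"
      using cosh_square_eq[of a] cosh_square_eq[of b] by auto
    have prod: "cosh (a + b) * cosh (a - b) = (cosh a)\<^sup>2 + (cosh b)\<^sup>2 - 1"
    proof -
      have "cosh (a + b) * cosh (a - b) = (cosh a)\<^sup>2 * (cosh b)\<^sup>2 - (sinh a)\<^sup>2 * (sinh b)\<^sup>2"
        by (simp add: cosh_add cosh_diff power2_eq_square algebra_simps)
      then show ?thesis unfolding sa by (simp add: algebra_simps)
    qed
    have "0 \<le> ((cosh a)\<^sup>2 - 1) * ((cosh b)\<^sup>2 - 1)"
      using ca by (intro mult_nonneg_nonneg) (simp_all add: one_le_power)
    then have le: "cosh (a + b) * cosh (a - b) \<le> (cosh a * cosh b)\<^sup>2"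
      unfolding prod by (simp add: algebra_simps)
    have "1 / cosh b * (2 / cosh a) = (2 * (cosh a * cosh b)) / (cosh a * cosh b)\<^sup>2"
      using pos by (simp add: power2_eq_square)
    also have "\<dots> \<le> (2 * (cosh a * cosh b)) / (cosh (a + b) * cosh (a - b))"
      using le pos by (intro divide_left_mono) auto
    also have "2 * (cosh a * cosh b) = cosh (a - b) + cosh (a + b)"
      by (simp add: cosh_add cosh_diff)
    also have "(cosh (a - b) + cosh (a + b)) / (cosh (a + b) * cosh (a - b)) = 1 / cosh (a + b) + 1 / cosh (a - b)"
      using pos by (simp add: field_simps)
    finally show "1 / cosh ((0 + p * of_int n) / 2) * (2 / cosh (t / 2)) \<le> 1 / cosh ((t + p * of_int n) / 2) + 1 / cosh ((t - p * of_int n) / 2)"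
      by (simp add: a_def b_def add_divide_distrib diff_divide_distrib)
  qed
  then have "2 * (sech_real p 0 / cosh (t / 2)) \<le> 2 * sech_real p t" by (simp add: mult_ac)
  then show ?thesis by linarith
qed

text \<open>The term \<open>n = 0\<close> is kept exact. The others are bounded by a two-sided
  geometric series without its central term, which vanishes as \<open>p\<close> grows.\<close>

lemma sech_real_le:
  "sech_real p t \<le> 1 / cosh (t / 2) + 2 * exp (\<bar>t\<bar> / 2) * (2 * exp (- (p / 2)) / (1 - exp (- (p / 2))))"
proof -
  let ?f = "\<lambda>n::int. 1 / cosh ((t + p * of_int n) / 2)"
  let ?g = "\<lambda>n::int. exp (- (p * \<bar>real_of_int n\<bar> / 2))"
  let ?W = "2 * exp (\<bar>t\<bar> / 2)"
  have single: "((\<lambda>n. if n = 0 then c else 0) has_sum c) (UNIV :: int set)" for c :: real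
    by (rule has_sum_cong_neutral[THEN iffD1, OF _ _ _ has_sum_finite[of "{0}" "\<lambda>_. c", simplified]]) auto
  have f: "((\<lambda>n. ?f n - (if n = 0 then ?f 0 else 0)) has_sum (sech_real p t - ?f 0)) UNIV"
    by (rule has_sum_diff[OF sech_real_has_sum[OF p] single])
  have g: "((\<lambda>n. ?W * (?g n - (if n = 0 then 1 else 0))) has_sum ?W * ((1 + exp (- (p / 2))) / (1 - exp (- (p / 2))) - 1)) UNIV"
    by (rule has_sum_cmult_right[OF has_sum_diff[OF exp_abs_has_sum[OF p] single]])
  have "sech_real p t - ?f 0 \<le> ?W * ((1 + exp (- (p / 2))) / (1 - exp (- (p / 2))) - 1)"
  proof (rule has_sum_mono[OF f g])
    fix n :: int
    have "?f n \<le> ?W * ?g n"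
    proof -
      have "(complex_of_real t + of_real p * of_int n) / 2 = of_real ((t + p * of_int n) / 2)" by simp
      then have "norm (1 / cosh ((complex_of_real t + of_real p * of_int n) / 2)) = ?f n"
        using cosh_real_pos[of "(t + p * of_int n) / 2"]
        by (simp only: cosh_complex_of_real norm_divide norm_one norm_of_real abs_of_pos)
      then show ?thesis
        using norm_sech_le[OF strip_simps(5)[of t] p, of n] by (simp add: strip_weight_def)
    qed
    then show "?f n - (if n = 0 then ?f 0 else 0) \<le> ?W * (?g n - (if n = 0 then 1 else 0))"
      by auto
  qed
  moreover have "(1 + exp (- (p / 2))) / (1 - exp (- (p / 2))) - 1 = 2 * exp (- (p / 2)) / (1 - exp (- (p / 2)))"
  proof -
    have "exp (- (p / 2)) < 1" using p by simp
    then have "1 - exp (- (p / 2)) \<noteq> 0" by simp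
    then show ?thesis by (simp add: divide_simps)
  qed
  ultimately show ?thesis by simp
qed

end

section \<open>Logarithms of the parametrized functions\<close>

lemma Linf_ball_iff:
  "\<Psi> \<in> Linf_ball a r \<longleftrightarrow> \<Psi> \<in> borel_measurable (lebesgue_on {0<..<a}) \<and> (AE x in lebesgue_on {0<..<a}. \<bar>\<Psi> x\<bar> \<le> r)"
proof
  assume "\<Psi> \<in> Linf_ball a r"
  then have m: "\<Psi> \<in> borel_measurable (lebesgue_on {0<..<a})"
    and e: "esssup (lebesgue_on {0<..<a}) (\<lambda>x. ereal \<bar>\<Psi> x\<bar>) \<le> ereal r"
    by (auto simp: Linf_ball_def)
  have "AE x in lebesgue_on {0<..<a}. \<bar>\<Psi> x\<bar> \<le> r"
    using esssup_AE[of "\<lambda>x. ereal \<bar>\<Psi> x\<bar>" "lebesgue_on {0<..<a}"]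
  proof (rule AE_mp, intro AE_I2 impI)
    fix x assume "ereal \<bar>\<Psi> x\<bar> \<le> esssup (lebesgue_on {0<..<a}) (\<lambda>x. ereal \<bar>\<Psi> x\<bar>)"
    then have "ereal \<bar>\<Psi> x\<bar> \<le> ereal r" using e by (rule order_trans)
    then show "\<bar>\<Psi> x\<bar> \<le> r" by simp
  qed
  with m show "\<Psi> \<in> borel_measurable (lebesgue_on {0<..<a}) \<and> (AE x in lebesgue_on {0<..<a}. \<bar>\<Psi> x\<bar> \<le> r)" ..
next
  assume *: "\<Psi> \<in> borel_measurable (lebesgue_on {0<..<a}) \<and> (AE x in lebesgue_on {0<..<a}. \<bar>\<Psi> x\<bar> \<le> r)"
  then have "esssup (lebesgue_on {0<..<a}) (\<lambda>x. ereal \<bar>\<Psi> x\<bar>) \<le> ereal r"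
    by (intro esssup_I) auto
  with * show "\<Psi> \<in> Linf_ball a r" by (simp add: Linf_ball_def)
qed

lemma finite_measure_interval: "finite_measure (lebesgue_on {0<..<a::real})"
  by (rule finite_measure_lebesgue_on) simp

lemma integrable_interval:
  fixes f :: "real \<Rightarrow> 'b::{banach, second_countable_topology}"
  assumes "f \<in> borel_measurable (lebesgue_on {0<..<a})" "AE x in lebesgue_on {0<..<a}. norm (f x) \<le> B"
  shows "integrable (lebesgue_on {0<..<a}) f"
  using finite_measure.integrable_const_bound[OF finite_measure_interval] assms by blast

lemma measurable_interval_continuous:
  fixes f :: "real \<Rightarrow> 'b::euclidean_space"
  assumes "continuous_on {0<..<a} f"
  shows "f \<in> borel_measurable (lebesgue_on {0<..<a})"
  using assms by (rule continuous_imp_measurable_on_sets_lebesgue) simp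

text \<open>Serves to differentiate under an integral against a function that is only bounded and
  measurable: a second-order Taylor bound for the kernel, uniform in \<open>l\<close>, can simply be
  integrated.\<close>

lemma quadratic_bound_DERIV:
  fixes f :: "complex \<Rightarrow> complex"
  assumes "r > 0" "\<And>w. w \<in> ball z r \<Longrightarrow> norm (f w - f z - D * (w - z)) \<le> C * (norm (w - z))\<^sup>2"
  shows "(f has_field_derivative D) (at z)"
proof -
  have "((\<lambda>w. (f w - f z) / (w - z) - D) \<longlongrightarrow> 0) (at z)"
  proof (rule Lim_null_comparison)
    show "eventually (\<lambda>w. norm ((f w - f z) / (w - z) - D) \<le> C * norm (w - z)) (at z)"
      unfolding eventually_at
    proof (intro exI[of _ r] conjI ballI impI)
      fix w assume w: "w \<noteq> z \<and> dist w z < r"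
      then have nz: "norm (w - z) > 0" and wz: "w - z \<noteq> 0" by auto
      have "norm ((f w - f z) / (w - z) - D) = norm (f w - f z - D * (w - z)) / norm (w - z)"
        using wz by (simp add: norm_divide[symmetric] diff_divide_distrib)
      also have "\<dots> \<le> C * (norm (w - z))\<^sup>2 / norm (w - z)"
        using w by (intro divide_right_mono assms(2)) (auto simp: dist_commute)
      also have "\<dots> = C * norm (w - z)" using nz by (simp add: power2_eq_square)
      finally show "norm ((f w - f z) / (w - z) - D) \<le> C * norm (w - z)" .
    qed (use assms in auto)
    have "((\<lambda>w. C * norm (w - z)) \<longlongrightarrow> C * norm (z - z)) (at z)"
      by (intro tendsto_intros)
    then show "((\<lambda>w. C * norm (w - z)) \<longlongrightarrow> 0) (at z)" by simp
  qed
  then show ?thesis by (simp add: has_field_derivative_iff LIM_zero_iff)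
qed

definition log_param :: "real \<Rightarrow> (real \<Rightarrow> real) \<Rightarrow> complex \<Rightarrow> complex" where
  "log_param p \<Psi> t = (\<integral>l. of_real (\<Psi> l) * strip_kernel p l t \<partial>lebesgue_on {0<..<p / 2})"

lemma csqrt_exp:
  assumes "t \<in> strip"
  shows "csqrt (exp t) = exp (t / 2)"
  using assms by (simp add: csqrt_exp_Ln strip_def)

lemma M_param_exp:
  assumes "t \<in> strip" "p > 0"
  shows "M_param p \<Psi> (exp t) = exp (t / 2 + log_param p \<Psi> t)"
  unfolding M_param_def E_kernel_exp[OF assms] csqrt_exp[OF assms(1)] log_param_def exp_add ..

lemma slit_plane_exp:
  assumes "z \<in> - \<real>\<^sub>\<le>\<^sub>0"
  shows "Ln z \<in> strip" "exp (Ln z) = z" "z \<noteq> 0"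
proof -
  show "z \<noteq> 0" using assms by auto
  then show "exp (Ln z) = z" by simp
  have "\<bar>Im (Ln z)\<bar> \<le> pi" "Im (Ln z) \<noteq> pi"
    using assms \<open>z \<noteq> 0\<close> Im_Ln_le_pi[of z] mpi_less_Im_Ln[of z] Im_Ln_eq_pi[of z]
    by (auto simp: complex_nonpos_Reals_iff)
  moreover have "Im (Ln z) > - pi" using \<open>z \<noteq> 0\<close> by (rule mpi_less_Im_Ln)
  ultimately show "Ln z \<in> strip" by (auto simp: strip_def)
qed

lemma exp_strip: "t \<in> strip \<Longrightarrow> exp t \<in> - \<real>\<^sub>\<le>\<^sub>0"
proof
  assume t: "t \<in> strip" and "exp t \<in> \<real>\<^sub>\<le>\<^sub>0"
  then have "Re (exp t) \<le> 0" "Im (exp t) = 0" by (auto simp: complex_nonpos_Reals_iff)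
  then have s: "sin (Im t) = 0" "cos (Im t) \<le> 0"
    by (auto simp: Re_exp Im_exp mult_le_0_iff)
  have "Im t = 0" 
    using s(1) t sin_zero_iff_int2[of "Im t"]
  proof -
    obtain i :: int where i: "Im t = of_int i * pi" using s(1) sin_zero_iff_int2 by auto
    then have "\<bar>of_int i\<bar> < (1::real)" using t by (simp add: strip_def abs_mult)
    then have "i = 0" by linarith
    then show ?thesis using i by simp
  qed
  then show False using s(2) by simp
qed

text \<open>A contour shift by means of a primitive \<open>G\<close>: the increment of
  \<open>G\<close> over one period, as a function of the base point, has the constant derivative
  \<open>\<kappa>\<close>. The domain is a parameter because products of translates are holomorphic
  on narrower strips only.\<close>

lemma shift_integral_on:
  assumes S: "open S" "convex S" "0 \<in> S" "\<And>z x. z + of_real x \<in> S \<longleftrightarrow> z \<in> S"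
    and hol: "\<Phi> holomorphic_on S" and per: "\<And>z. z \<in> S \<Longrightarrow> \<Phi> (z + of_real p) = \<Phi> z + \<kappa>" and p: "p > 0"
    and w: "w \<in> S"
  shows "integral {- (p / 2)..p / 2} (\<lambda>x. \<Phi> (w + of_real x)) = integral {- (p / 2)..p / 2} (\<lambda>x. \<Phi> (of_real x)) + \<kappa> * w"
proof -
  have half: "z + of_real p / 2 \<in> S \<longleftrightarrow> z \<in> S" "z - of_real p / 2 \<in> S \<longleftrightarrow> z \<in> S" for z
    using S(4)[of z "p / 2"] S(4)[of z "- (p / 2)"] by simp_all
  obtain G where G: "\<And>z. z \<in> S \<Longrightarrow> (G has_field_derivative \<Phi> z) (at z)"
    using holomorphic_convex_primitive'[OF S(2,1) hol]
    by (metis at_within_open S(1))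
  have I: "integral {- (p / 2)..p / 2} (\<lambda>x. \<Phi> (w + of_real x)) = G (w + of_real p / 2) - G (w - of_real p / 2)"
    if "w \<in> S" for w
  proof -
    have "((\<lambda>x. \<Phi> (w + of_real x)) has_integral (G (w + of_real (p / 2)) - G (w + of_real (- (p / 2))))) {- (p / 2)..p / 2}"
    proof (rule fundamental_theorem_of_calculus)
      fix x assume "x \<in> {- (p / 2)..p / 2}"
      have 1: "((\<lambda>x. w + of_real x) has_vector_derivative 1) (at x)"
        by (auto intro!: derivative_eq_intros)
      have "((G \<circ> (\<lambda>x. w + of_real x)) has_vector_derivative (1 * \<Phi> (w + of_real x))) (at x)"
        by (rule field_vector_diff_chain_at[OF 1 G]) (use that S(4) in simp)
      then show "((\<lambda>x. G (w + of_real x)) has_vector_derivative \<Phi> (w + of_real x)) (at x within {- (p / 2)..p / 2})"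
        by (simp add: o_def has_vector_derivative_at_within)
    qed (use p in simp)
    then show ?thesis by (simp add: integral_unique)
  qed
  have "\<exists>C. \<forall>w\<in>S. (G (w + of_real p / 2) - G (w - of_real p / 2)) - \<kappa> * w = C"
  proof (rule has_field_derivative_zero_constant[OF S(2)])
    fix z :: complex assume z: "z \<in> S"
    have 1: "((\<lambda>w. G (w + of_real p / 2)) has_field_derivative \<Phi> (z + of_real p / 2) * 1) (at z)"
      by (rule DERIV_chain2[OF G]) (use z half in \<open>auto intro!: derivative_eq_intros\<close>)
    have 2: "((\<lambda>w. G (w - of_real p / 2)) has_field_derivative \<Phi> (z - of_real p / 2) * 1) (at z)"
      by (rule DERIV_chain2[OF G]) (use z half in \<open>auto intro!: derivative_eq_intros\<close>)
    have 3: "((\<lambda>w. \<kappa> * w) has_field_derivative \<kappa>) (at z)"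
      by (auto intro!: derivative_eq_intros)
    have "\<Phi> (z + of_real p / 2) = \<Phi> (z - of_real p / 2) + \<kappa>"
      using per[of "z - of_real p / 2"] z half by (simp add: half_shift)
    then have "((\<lambda>w. (G (w + of_real p / 2) - G (w - of_real p / 2)) - \<kappa> * w) has_field_derivative 0) (at z)"
      by (intro DERIV_cong[OF DERIV_diff[OF DERIV_diff[OF 1 2] 3]]) simp
    then show "((\<lambda>w. (G (w + of_real p / 2) - G (w - of_real p / 2)) - \<kappa> * w) has_field_derivative 0) (at z within S)"
      by (rule has_field_derivative_at_within)
  qed
  then have "(G (w + of_real p / 2) - G (w - of_real p / 2)) - \<kappa> * w = (G (0 + of_real p / 2) - G (0 - of_real p / 2)) - \<kappa> * 0"
    using w S(3) by metis
  then show "integral {- (p / 2)..p / 2} (\<lambda>x. \<Phi> (w + of_real x)) = integral {- (p / 2)..p / 2} (\<lambda>x. \<Phi> (of_real x)) + \<kappa> * w"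
    unfolding I[OF w] using I[OF S(3)] by (simp add: diff_eq_eq)
qed

lemmas shift_integral = shift_integral_on[OF open_strip convex_strip strip_simps(8) strip_simps(1)]

lemma Im_tanh:
  assumes "cosh z \<noteq> 0"
  shows "Im (tanh z) = sin (Im z) * cos (Im z) / ((sinh (Re z))\<^sup>2 + (cos (Im z))\<^sup>2)"
proof -
  have Re_s: "Re (sinh z) = sinh (Re z) * cos (Im z)" and Im_s: "Im (sinh z) = cosh (Re z) * sin (Im z)"
    by (auto simp: cosh_def sinh_def Re_exp Im_exp field_simps)
  have c: "(cosh (Re z))\<^sup>2 = (sinh (Re z))\<^sup>2 + 1" by (rule cosh_square_eq)
  have sc: "(sin (Im z))\<^sup>2 = 1 - (cos (Im z))\<^sup>2" by (rule sin_squared_eq)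
  have "(cosh (Re z) * cos (Im z))\<^sup>2 + (sinh (Re z) * sin (Im z))\<^sup>2 = (sinh (Re z))\<^sup>2 + (cos (Im z))\<^sup>2"
    unfolding power_mult_distrib c sc by (simp add: algebra_simps)
  moreover have "cosh (Re z) * sin (Im z) * (cosh (Re z) * cos (Im z)) - sinh (Re z) * cos (Im z) * (sinh (Re z) * sin (Im z))
      = sin (Im z) * cos (Im z)"
  proof -
    have "cosh (Re z) * sin (Im z) * (cosh (Re z) * cos (Im z)) - sinh (Re z) * cos (Im z) * (sinh (Re z) * sin (Im z))
      = sin (Im z) * cos (Im z) * ((cosh (Re z))\<^sup>2 - (sinh (Re z))\<^sup>2)"
      by (simp add: algebra_simps power2_eq_square)
    then show ?thesis unfolding c by simp
  qed
  ultimately show ?thesis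
    unfolding tanh_def Im_divide Re_cosh Im_cosh Re_s Im_s by simp
qed

section \<open>Imaginary parts, holomorphy and membership in the class\<close>

context
  fixes p :: real
  assumes p: "p > 0"
begin

lemma Im_tanh_sum_has_sum:
  assumes "z \<in> strip"
  shows "((\<lambda>n::int. sin (Im z / 2) * cos (Im z / 2) / ((sinh ((Re z + p * of_int n) / 2))\<^sup>2 + (cos (Im z / 2))\<^sup>2)) has_sum Im (tanh_sum p z)) UNIV"
proof -
  have "((\<lambda>n::int. Im (tanh ((z + of_real p * of_int n) / 2) - tanh ((0 + of_real p * of_int n) / 2))) has_sum Im (tanh_sum p z - tanh_sum p 0)) UNIV"
    by (rule has_sum_Im[OF tanh_sum_diff]) (use assms p in auto)
  moreover have "Im (tanh ((z + of_real p * of_int n) / 2) - tanh ((0 + of_real p * of_int n) / 2))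
    = sin (Im z / 2) * cos (Im z / 2) / ((sinh ((Re z + p * of_int n) / 2))\<^sup>2 + (cos (Im z / 2))\<^sup>2)" for n :: int
    using Im_tanh[OF cosh_half_shift_nonzero[OF assms, of p n]]
      Im_tanh[OF cosh_half_shift_nonzero[of 0 p n]] by simp
  ultimately show ?thesis by simp
qed

lemma Im_tanh_sum_nonneg:
  assumes "z \<in> strip" "0 \<le> Im z"
  shows "0 \<le> Im (tanh_sum p z)"
proof (rule has_sum_nonneg[OF Im_tanh_sum_has_sum[OF assms(1)]])
  have "0 \<le> sin (Im z / 2)" using assms by (intro sin_ge_zero) (auto simp: strip_def)
  then show "0 \<le> sin (Im z / 2) * cos (Im z / 2) / ((sinh ((Re z + p * of_int n) / 2))\<^sup>2 + (cos (Im z / 2))\<^sup>2)" for n :: int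
    using cos_half_strip[OF assms(1)] by (intro divide_nonneg_nonneg mult_nonneg_nonneg) auto
qed

lemma holomorphic_tanh_sum: "tanh_sum p holomorphic_on strip"
  using p by (auto simp: holomorphic_on_open open_strip intro: tanh_sum_DERIV)

lemma integrable_strip_line:
  fixes f :: "complex \<Rightarrow> complex"
  assumes "continuous_on strip f" "w \<in> strip"
  shows "(\<lambda>x. f (w + of_real x)) integrable_on {a..b}"
  by (intro integrable_continuous_interval continuous_on_compose2[OF assms(1)] continuous_intros) (use assms in auto)

text \<open>Shifting the line from the real axis adds \<open>2 * w\<close> through the quasi-period,
  and on the real axis the integral is real.\<close>

lemma integral_Im_tanh_sum:
  assumes "w \<in> strip"
  shows "((\<lambda>x. Im (tanh_sum p (w + of_real x))) has_integral (2 * Im w)) {- (p / 2)..p / 2}"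
proof -
  let ?J = "{- (p / 2)..p / 2}"
  have "integral ?J (\<lambda>x. tanh_sum p (w + of_real x)) = integral ?J (\<lambda>x. tanh_sum p (of_real x)) + 2 * w"
    by (rule shift_integral[OF holomorphic_tanh_sum _ p assms]) (use tanh_sum_period p in auto)
  moreover have "Im (integral ?J (\<lambda>x. tanh_sum p (of_real x))) = 0"
  proof -
    have "(\<lambda>x. tanh_sum p (of_real x)) integrable_on ?J"
      using integrable_strip_line[OF continuous_tanh_sum[OF p], of 0] by simp
    then have "Im (integral ?J (\<lambda>x. tanh_sum p (of_real x))) = integral ?J (\<lambda>x. Im (tanh_sum p (of_real x)))"
      by (metis has_integral_Im integral_unique integrable_integral)
    then show ?thesis by (simp add: tanh_sum_of_real)
  qed
  ultimately have "Im (integral ?J (\<lambda>x. tanh_sum p (w + of_real x))) = 2 * Im w" by simp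
  then show ?thesis
    using has_integral_Im[OF integrable_integral[OF integrable_strip_line[OF continuous_tanh_sum[OF p] assms]]] by metis
qed

text \<open>Since \<open>tanh_sum\<close> is odd, the imaginary part is half the difference of two
  nonnegative numbers, hence bounded by half their sum.\<close>

lemma Im_strip_kernel_abs_le:
  assumes "t \<in> strip" "0 \<le> Im t"
  shows "\<bar>Im (strip_kernel p l t)\<bar> \<le> (Im (tanh_sum p (t + of_real l)) + Im (tanh_sum p (t + of_real (- l)))) / 2"
proof -
  have "tanh_sum p (of_real l - t) = - tanh_sum p (t + of_real (- l))"
    using tanh_sum_minus[of p "t - of_real l"] by simp
  then have "Im (strip_kernel p l t) = (Im (tanh_sum p (t + of_real (- l))) - Im (tanh_sum p (t + of_real l))) / 2"
    unfolding strip_kernel_def tanh_sum_of_real add.commute[of "of_real l" t]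
    by (simp del: of_real_minus add: add_divide_distrib diff_divide_distrib)
  moreover have "0 \<le> Im (tanh_sum p (t + of_real l))" "0 \<le> Im (tanh_sum p (t + of_real (- l)))"
    by (rule Im_tanh_sum_nonneg; use assms in simp)+
  ultimately show ?thesis by (simp add: abs_le_iff)
qed

text \<open>For \<open>l\<close> in \<open>(0, p / 2)\<close> the translates by \<open>l\<close> and
  \<open>- l\<close> together sweep one full period. Multiplied by the bound 1/2 on
  \<open>\<Psi>\<close>, the value \<open>Im t\<close> is exactly the slack allowed to the
  logarithm.\<close>

lemma integral_Im_bound:
  assumes "t \<in> strip"
  shows "((\<lambda>l. (Im (tanh_sum p (t + of_real l)) + Im (tanh_sum p (t + of_real (- l)))) / 2) has_integral Im t) {0..p / 2}"
proof -
  let ?f = "\<lambda>l. Im (tanh_sum p (t + of_real l))"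
  have intg: "?f integrable_on {a..b}" for a b
    using integrable_strip_line[OF continuous_tanh_sum[OF p] assms, of a b]
    by (metis has_integral_Im integrable_on_def)
  have "integral {- (p / 2)..0} ?f + integral {0..p / 2} ?f = 2 * Im t"
    using Henstock_Kurzweil_Integration.integral_combine[of "- (p / 2)" 0 "p / 2" ?f] intg p
      integral_unique[OF integral_Im_tanh_sum[OF assms]] by simp
  moreover have "((\<lambda>l. ?f (- l)) has_integral integral {- (p / 2)..0} ?f) {0..p / 2}"
    using has_integral_reflect_real[of ?f "integral {- (p / 2)..0} ?f" 0 "- (p / 2)", THEN iffD2, OF integrable_integral[OF intg]]
    by (simp only: minus_zero minus_minus)
  ultimately show ?thesis
    using has_integral_divide[OF has_integral_add[OF integrable_integral[OF intg[of 0 "p / 2"]]], of "\<lambda>l. ?f (- l)" "integral {- (p / 2)..0} ?f" 2]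
    by (simp add: add.commute)
qed

lemma strip_kernel_measurable:
  "t \<in> strip \<Longrightarrow> (\<lambda>l. strip_kernel p l t) \<in> borel_measurable (lebesgue_on {0<..<p / 2})"
  by (intro measurable_interval_continuous continuous_strip_kernel p continuous_intros) auto

lemma strip_kernel_bounded:
  assumes "t \<in> strip"
  shows "\<exists>B. \<forall>l\<in>{0..p / 2}. norm (strip_kernel p l t) \<le> B"
proof -
  have "compact ((\<lambda>l. strip_kernel p l t) ` {0..p / 2})"
    using assms by (intro compact_continuous_image continuous_strip_kernel p continuous_intros) auto
  then show ?thesis by (meson compact_imp_bounded bounded_iff image_eqI)
qed

context
  fixes \<Psi> :: "real \<Rightarrow> real"
  assumes \<Psi>: "\<Psi> \<in> Linf_ball (p / 2) (1 / 2)"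
begin

lemma \<Psi>_facts: "\<Psi> \<in> borel_measurable (lebesgue_on {0<..<p / 2})" "AE l in lebesgue_on {0<..<p / 2}. \<bar>\<Psi> l\<bar> \<le> 1 / 2"
  using \<Psi> by (auto simp: Linf_ball_iff)

lemma integrable_mult_bounded:
  fixes f :: "real \<Rightarrow> complex"
  assumes "f \<in> borel_measurable (lebesgue_on {0<..<p / 2})" "\<And>l. l \<in> {0<..<p / 2} \<Longrightarrow> norm (f l) \<le> B"
  shows "integrable (lebesgue_on {0<..<p / 2}) (\<lambda>l. of_real (\<Psi> l) * f l)"
proof (rule integrable_interval)
  show "(\<lambda>l. of_real (\<Psi> l) * f l) \<in> borel_measurable (lebesgue_on {0<..<p / 2})"
    using \<Psi>_facts(1) assms(1) by measurable
  show "AE l in lebesgue_on {0<..<p / 2}. norm (of_real (\<Psi> l) * f l) \<le> 1 / 2 * B"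
    using \<Psi>_facts(2)
  proof (rule AE_mp, intro AE_I2 impI)
    fix l assume "l \<in> space (lebesgue_on {0<..<p / 2})" "\<bar>\<Psi> l\<bar> \<le> 1 / 2"
    then show "norm (of_real (\<Psi> l) * f l) \<le> 1 / 2 * B"
      unfolding norm_mult norm_of_real using assms(2)[of l] by (intro mult_mono) auto
  qed
qed

lemma log_param_integrable:
  assumes "t \<in> strip"
  shows "integrable (lebesgue_on {0<..<p / 2}) (\<lambda>l. of_real (\<Psi> l) * strip_kernel p l t)"
proof -
  obtain B where B: "\<And>l. l \<in> {0..p / 2} \<Longrightarrow> norm (strip_kernel p l t) \<le> B"
    using strip_kernel_bounded[OF assms] by blast
  show ?thesis
    by (rule integrable_mult_bounded[OF strip_kernel_measurable[OF assms], of B]) (use B in auto)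
qed

lemma log_param_Im_le:
  assumes "t \<in> strip" "0 \<le> Im t"
  shows "\<bar>Im (log_param p \<Psi> t)\<bar> \<le> Im t / 2"
proof -
  let ?M = "lebesgue_on {0<..<p / 2}"
  let ?g = "\<lambda>l. (Im (tanh_sum p (t + of_real l)) + Im (tanh_sum p (t + of_real (- l)))) / 2"
  have cont: "continuous_on A ?g" for A
    by (intro continuous_intros continuous_on_compose2[OF continuous_tanh_sum[OF p]]) (use assms in auto)
  then have "compact (?g ` {0..p / 2})" by (intro compact_continuous_image) auto
  then obtain B where B: "\<And>l. l \<in> {0..p / 2} \<Longrightarrow> norm (?g l) \<le> B"
    by (meson compact_imp_bounded bounded_iff image_eqI)
  have g_int: "integrable ?M ?g"
    by (rule integrable_interval[where B = B], rule measurable_interval_continuous[OF cont]) (use B in \<open>auto intro!: AE_I2\<close>)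
  have "integral\<^sup>L ?M ?g = integral {0<..<p / 2} ?g"
    by (rule lebesgue_integral_eq_integral[OF g_int]) simp
  also have "\<dots> = Im t"
    using integral_unique[OF integral_Im_bound[OF assms(1)]] by (simp add: integral_open_interval_real)
  finally have g_val: "integral\<^sup>L ?M ?g = Im t" .
  have "Im (log_param p \<Psi> t) = (\<integral>l. Im (of_real (\<Psi> l) * strip_kernel p l t) \<partial>?M)"
    unfolding log_param_def by (rule integral_Im[OF log_param_integrable[OF assms(1)], symmetric])
  also have "\<bar>\<dots>\<bar> \<le> (\<integral>l. \<bar>Im (of_real (\<Psi> l) * strip_kernel p l t)\<bar> \<partial>?M)"
    by (rule integral_abs_bound)
  also have "\<dots> \<le> (\<integral>l. 1 / 2 * ?g l \<partial>?M)"
  proof (rule integral_mono_AE)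
    show "integrable ?M (\<lambda>l. \<bar>Im (of_real (\<Psi> l) * strip_kernel p l t)\<bar>)"
      by (rule integrable_abs[OF integrable_Im[OF log_param_integrable[OF assms(1)]]])
    show "integrable ?M (\<lambda>l. 1 / 2 * ?g l)"
      by (rule Bochner_Integration.integrable_mult_right) (rule g_int)
    show "AE l in ?M. \<bar>Im (of_real (\<Psi> l) * strip_kernel p l t)\<bar> \<le> 1 / 2 * ?g l"
      using \<Psi>_facts(2)
    proof (rule AE_mp, intro AE_I2 impI)
      fix l assume "\<bar>\<Psi> l\<bar> \<le> 1 / 2"
      then have "\<bar>\<Psi> l\<bar> * \<bar>Im (strip_kernel p l t)\<bar> \<le> 1 / 2 * ?g l"
        by (intro mult_mono Im_strip_kernel_abs_le assms) auto
      then show "\<bar>Im (of_real (\<Psi> l) * strip_kernel p l t)\<bar> \<le> 1 / 2 * ?g l"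
        by (simp only: Im_complex_of_real Re_complex_of_real times_complex.sel mult_zero_left add_0_right abs_mult)
    qed
  qed
  also have "\<dots> = 1 / 2 * integral\<^sup>L ?M ?g" by (rule integral_mult_right_zero)
  also have "\<dots> = Im t / 2" unfolding g_val by simp
  finally show ?thesis .
qed

lemma log_param_holomorphic: "log_param p \<Psi> holomorphic_on strip"
proof -
  have "\<exists>D. (log_param p \<Psi> has_field_derivative D) (at t)" if t: "t \<in> strip" for t
  proof -
    let ?M = "lebesgue_on {0<..<p / 2}"
    \<comment> \<open>\<open>k1\<close> and \<open>k2\<close> are the first two derivatives of the
      kernel in \<open>t\<close>. A bound for \<open>k2\<close> on the product of the
      \<open>l\<close>-interval and a closed disc yields the Taylor remainder that survives
      integration against \<open>\<Psi>\<close>.\<close>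
    define k1 where "k1 l t = ((sech_sum p (of_real l - t))\<^sup>2 - (sech_sum p (of_real l + t))\<^sup>2) / 4" for l t
    define h where "h z = (sech_sum p z)\<^sup>2 * tanh_gap p z" for z
    define k2 where "k2 l t = (h (of_real l - t) + h (of_real l + t)) / 4" for l t
    have dsq: "((\<lambda>z. (sech_sum p z)\<^sup>2) has_field_derivative - h z) (at z)" if "z \<in> strip" for z
      by (rule DERIV_cong[OF DERIV_power[OF sech_sum_DERIV[OF that p], of 2]]) (simp add: h_def power2_eq_square)
    have k1: "(strip_kernel p l has_field_derivative k1 l t) (at t)" if "t \<in> strip" for l t
      unfolding k1_def by (rule strip_kernel_DERIV[OF that p])
    have k2: "(k1 l has_field_derivative k2 l t) (at t)" if "t \<in> strip" for l t
    proof -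
      have 1: "((\<lambda>t. (sech_sum p (of_real l - t))\<^sup>2) has_field_derivative - h (of_real l - t) * - 1) (at t)"
        by (rule DERIV_chain2[OF dsq]) (use that in \<open>auto intro!: derivative_eq_intros\<close>)
      have 2: "((\<lambda>t. (sech_sum p (of_real l + t))\<^sup>2) has_field_derivative - h (of_real l + t) * 1) (at t)"
        by (rule DERIV_chain2[OF dsq]) (use that in \<open>auto intro!: derivative_eq_intros\<close>)
      show ?thesis unfolding k1_def[abs_def] k2_def
        by (rule DERIV_cong[OF DERIV_cdivide[OF DERIV_diff[OF 1 2], of 4]]) simp
    qed
    have cont_gap: "continuous_on strip (tanh_gap p)"
      by (intro continuous_at_imp_continuous_on ballI DERIV_isCont[OF tanh_gap_DERIV[OF _ p]])
    have cont_h: "continuous_on strip h"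
      unfolding h_def by (intro continuous_intros continuous_sech_sum[OF p] cont_gap)
    obtain r where r: "r > 0" "cball t r \<subseteq> strip"
      using open_contains_cball[of strip] open_strip t by blast
    have cont_k1: "continuous_on {0..p / 2} (\<lambda>l. k1 l t)"
      unfolding k1_def by (intro continuous_intros continuous_on_compose2[OF continuous_sech_sum[OF p]]) (use t in auto)
    have "compact ((\<lambda>l. k1 l t) ` {0..p / 2})"
      by (intro compact_continuous_image cont_k1) auto
    then obtain B1 where B1: "\<And>l. l \<in> {0..p / 2} \<Longrightarrow> norm (k1 l t) \<le> B1"
      by (meson compact_imp_bounded bounded_iff image_eqI)
    have "continuous_on ({0..p / 2} \<times> cball t r) (\<lambda>x. k2 (fst x) (snd x))"
      unfolding k2_def by (intro continuous_intros continuous_on_compose2[OF cont_h]) (use r in auto)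
    then have "compact ((\<lambda>x. k2 (fst x) (snd x)) ` ({0..p / 2} \<times> cball t r))"
      by (intro compact_continuous_image) (auto intro: compact_Times)
    then obtain B2 where B2: "\<And>x. x \<in> {0..p / 2} \<times> cball t r \<Longrightarrow> norm (k2 (fst x) (snd x)) \<le> B2"
      by (meson compact_imp_bounded bounded_iff image_eqI)
    have meas1: "(\<lambda>l. k1 l t) \<in> borel_measurable ?M"
      by (rule measurable_interval_continuous, rule continuous_on_subset[OF cont_k1]) auto
    have int1: "integrable ?M (\<lambda>l. of_real (\<Psi> l) * k1 l t)"
      by (rule integrable_mult_bounded[OF meas1, of B1]) (use B1 in auto)
    have rem: "norm (strip_kernel p l w - strip_kernel p l t - k1 l t * (w - t)) \<le> B2 * (norm (w - t))\<^sup>2"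
      if "w \<in> ball t r" "l \<in> {0..p / 2}" for w l
    proof -
      define f where "f i = (if i = 0 then strip_kernel p l else if i = 1 then k1 l else k2 l)" for i :: nat
      have "norm (f 0 w - (\<Sum>i\<le>1. f i t * (w - t) ^ i / fact i)) \<le> B2 * norm (w - t) ^ Suc 1 / fact 1"
      proof (rule complex_Taylor[of "cball t r"])
        show "(f i has_field_derivative f (Suc i) x) (at x within cball t r)" if "x \<in> cball t r" "i \<le> 1" for i x
        proof -
          have x: "x \<in> strip" using that r by auto
          have "i = 0 \<or> i = 1" using that by auto
          then have "(f i has_field_derivative f (Suc i) x) (at x)"
            using k1[OF x] k2[OF x] by (auto simp: f_def)
          then show ?thesis by (rule has_field_derivative_at_within)
        qed
        show "norm (f (Suc 1) x) \<le> B2" if "x \<in> cball t r" for x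
          using B2[of "(l, x)"] that \<open>l \<in> {0..p / 2}\<close> by (simp add: f_def)
      qed (use that r in auto)
      then show ?thesis by (simp add: f_def power2_eq_square algebra_simps)
    qed
    have "(log_param p \<Psi> has_field_derivative (\<integral>l. of_real (\<Psi> l) * k1 l t \<partial>?M)) (at t)"
    proof (rule quadratic_bound_DERIV[OF r(1)])
      fix w assume w: "w \<in> ball t r"
      then have ws: "w \<in> strip" using r by auto
      let ?g = "\<lambda>l. strip_kernel p l w - strip_kernel p l t - k1 l t * (w - t)"
      have gm: "?g \<in> borel_measurable ?M"
        using strip_kernel_measurable[OF ws] strip_kernel_measurable[OF t] meas1 by measurable
      have gi: "integrable ?M (\<lambda>l. of_real (\<Psi> l) * ?g l)"
        by (rule integrable_mult_bounded[OF gm, of "B2 * (norm (w - t))\<^sup>2"]) (use rem[OF w] in auto)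
      have "log_param p \<Psi> w - log_param p \<Psi> t - (\<integral>l. of_real (\<Psi> l) * k1 l t \<partial>?M) * (w - t)
         = (\<integral>l. of_real (\<Psi> l) * strip_kernel p l w - of_real (\<Psi> l) * strip_kernel p l t - of_real (\<Psi> l) * k1 l t * (w - t) \<partial>?M)"
        unfolding log_param_def
        by (simp add: Bochner_Integration.integral_diff log_param_integrable ws t int1)
      also have "\<dots> = (\<integral>l. of_real (\<Psi> l) * ?g l \<partial>?M)"
        by (intro Bochner_Integration.integral_cong refl) (simp add: algebra_simps)
      also have "norm \<dots> \<le> (\<integral>l. norm (of_real (\<Psi> l) * ?g l) \<partial>?M)"
        by (rule integral_norm_bound)
      also have "\<dots> \<le> (\<integral>l. B2 * (norm (w - t))\<^sup>2 \<partial>?M)"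
      proof (rule integral_mono_AE)
        show "integrable ?M (\<lambda>l. norm (of_real (\<Psi> l) * ?g l))" by (rule integrable_norm[OF gi])
        show "integrable ?M (\<lambda>l. B2 * (norm (w - t))\<^sup>2)"
          by (rule finite_measure.integrable_const[OF finite_measure_interval])
        show "AE l in ?M. norm (of_real (\<Psi> l) * ?g l) \<le> B2 * (norm (w - t))\<^sup>2"
          using \<Psi>_facts(2)
        proof (rule AE_mp, intro AE_I2 impI)
          fix l assume l: "l \<in> space ?M" "\<bar>\<Psi> l\<bar> \<le> 1 / 2"
          have "norm (of_real (\<Psi> l) * ?g l) \<le> 1 * (B2 * (norm (w - t))\<^sup>2)"
            unfolding norm_mult norm_of_real by (rule mult_mono) (use l rem[OF w, of l] in auto)
          then show "norm (of_real (\<Psi> l) * ?g l) \<le> B2 * (norm (w - t))\<^sup>2" by simp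
        qed
      qed
      also have "\<dots> = (measure ?M (space ?M) * B2) * (norm (w - t))\<^sup>2"
        by simp
      finally show "norm (log_param p \<Psi> w - log_param p \<Psi> t - (\<integral>l. of_real (\<Psi> l) * k1 l t \<partial>?M) * (w - t))
        \<le> (measure ?M (space ?M) * B2) * (norm (w - t))\<^sup>2" .
    qed
    then show ?thesis by blast
  qed
  then show ?thesis by (simp add: holomorphic_on_open open_strip)
qed

lemma log_param_of_real:
  "log_param p \<Psi> (of_real x) = of_real (\<integral>l. \<Psi> l * kernel_real p l x \<partial>lebesgue_on {0<..<p / 2})"
  unfolding log_param_def strip_kernel_of_real of_real_mult[symmetric] by (rule integral_complex_of_real)

lemma log_param_0 [simp]: "log_param p \<Psi> 0 = 0"
  by (simp add: log_param_def)

lemma M_param_of_real: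
  assumes "x > 0"
  shows "M_param p \<Psi> (of_real x) = of_real (sqrt x * exp (\<integral>l. \<Psi> l * kernel_real p l (ln x) \<partial>lebesgue_on {0<..<p / 2}))"
proof -
  have x: "of_real x = exp (complex_of_real (ln x))" using assms by (simp add: exp_of_real)
  have "M_param p \<Psi> (of_real x) = exp (of_real (ln x) / 2 + log_param p \<Psi> (of_real (ln x)))"
    unfolding x by (rule M_param_exp) (use p in auto)
  also have "\<dots> = exp (of_real (ln x / 2 + (\<integral>l. \<Psi> l * kernel_real p l (ln x) \<partial>lebesgue_on {0<..<p / 2})))"
    unfolding log_param_of_real by simp
  also have "\<dots> = of_real (exp (ln x / 2) * exp (\<integral>l. \<Psi> l * kernel_real p l (ln x) \<partial>lebesgue_on {0<..<p / 2}))"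
    by (simp only: exp_of_real exp_add)
  also have "exp (ln x / 2) = sqrt x"
    using assms by (simp add: ln_sqrt[symmetric])
  finally show ?thesis .
qed

lemma M_param_in_M_class:
  assumes c: "c > 1" "p = 2 * ln c"
  shows "M_param p \<Psi> \<in> M_class c"
proof -
  have "M_param p \<Psi> analytic_on (- \<real>\<^sub>\<le>\<^sub>0)"
  proof -
    have "(\<lambda>z. exp (Ln z / 2 + log_param p \<Psi> (Ln z))) holomorphic_on (- \<real>\<^sub>\<le>\<^sub>0)"
    proof -
      have "(log_param p \<Psi> \<circ> Ln) holomorphic_on (- \<real>\<^sub>\<le>\<^sub>0)"
        by (rule holomorphic_on_compose_gen[OF _ log_param_holomorphic]) (use slit_plane_exp in \<open>auto intro!: holomorphic_intros\<close>)
      then have 1: "(\<lambda>z. log_param p \<Psi> (Ln z)) holomorphic_on (- \<real>\<^sub>\<le>\<^sub>0)" by (simp add: o_def)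
      show ?thesis by (intro holomorphic_intros 1) auto
    qed
    moreover have "exp (Ln z / 2 + log_param p \<Psi> (Ln z)) = M_param p \<Psi> z" if "z \<in> - \<real>\<^sub>\<le>\<^sub>0" for z
      using M_param_exp[OF slit_plane_exp(1)[OF that] p, of \<Psi>] slit_plane_exp(2)[OF that] by simp
    ultimately have "M_param p \<Psi> holomorphic_on (- \<real>\<^sub>\<le>\<^sub>0)" by (rule holomorphic_transform)
    moreover have "open (- \<real>\<^sub>\<le>\<^sub>0 :: complex set)" by (simp add: open_Compl)
    ultimately show ?thesis by (simp add: analytic_on_open)
  qed
  moreover have "M_param p \<Psi> (of_real x) \<in> \<real>\<^sub>\<ge>\<^sub>0" if "x > 0" for x
    unfolding M_param_of_real[OF that] using that by simp
  moreover have "Im (M_param p \<Psi> z) \<ge> 0" if "Im z > 0" for z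
  proof -
    have z: "z \<in> - \<real>\<^sub>\<le>\<^sub>0" using that by (auto simp: complex_nonpos_Reals_iff)
    note t = slit_plane_exp[OF z]
    have I: "0 < Im (Ln z)" "Im (Ln z) < pi"
      using Im_Ln_pos_lt[OF t(3)] that by auto
    have "M_param p \<Psi> z = exp (Ln z / 2 + log_param p \<Psi> (Ln z))"
      using M_param_exp[OF t(1) p, of \<Psi>] t(2) by simp
    moreover have "\<bar>Im (log_param p \<Psi> (Ln z))\<bar> \<le> Im (Ln z) / 2"
      by (rule log_param_Im_le) (use t I in auto)
    \<comment> \<open>The argument of the function value lies between \<open>0\<close> and
      \<open>Im (Ln z)\<close>, hence below \<open>pi\<close>.\<close>
    then have "0 \<le> sin (Im (Ln z / 2 + log_param p \<Psi> (Ln z)))"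
      using I by (intro sin_ge_zero) (auto simp: abs_le_iff)
    ultimately show ?thesis by (simp add: Im_exp)
  qed
  moreover have "M_param p \<Psi> 1 = 1"
    using M_param_exp[of 0 p \<Psi>] p by simp
  moreover have "of_real x * M_param p \<Psi> (of_real (1 / x)) = M_param p \<Psi> (of_real x)" if "x > 0" for x
  proof -
    have "x * sqrt (1 / x) = sqrt x"
      using that by (simp add: real_sqrt_divide real_div_sqrt)
    then have "x * (sqrt (1 / x) * e) = sqrt x * e" for e
      by (simp only: mult.assoc[symmetric])
    moreover have "1 / x > 0" "ln (1 / x) = - ln x" using that by (simp_all add: ln_div)
    ultimately show ?thesis
      using that by (simp only: M_param_of_real kernel_real_minus[OF p] of_real_mult[symmetric])
  qed
  moreover have "M_param p \<Psi> (of_real (c\<^sup>2 * x)) = of_real c * M_param p \<Psi> (of_real x)" if "x > 0" for x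
  proof -
    have pos: "c\<^sup>2 * x > 0" using that c by simp
    have "ln (c\<^sup>2 * x) = ln x + p" using that c by (simp add: ln_mult ln_realpow)
    moreover have "sqrt (c\<^sup>2 * x) = c * sqrt x" using c by (simp add: real_sqrt_mult)
    ultimately show ?thesis
      unfolding M_param_of_real[OF pos] M_param_of_real[OF that] by (simp only: kernel_real_period[OF p] of_real_mult mult.assoc)
  qed
  ultimately show ?thesis unfolding M_class_def OM_plus_def by blast
qed

end

end

section \<open>Fourier coefficients of the kernel\<close>

lemma integral_reflect:
  fixes f :: "real \<Rightarrow> 'a::euclidean_space"
  shows "integral {- b..- a} (\<lambda>x. f (- x)) = integral {a..b} f"
  by (simp add: integral_def integrable_on_def)

lemma le_sinh:
  assumes "0 \<le> (x::real)"
  shows "x \<le> sinh x"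
proof -
  have "sinh 0 - 0 \<le> sinh x - x"
  proof (rule DERIV_nonneg_imp_nondecreasing[OF assms, where f = "\<lambda>x. sinh x - x"], intro exI conjI)
    fix y :: real
    show "((\<lambda>x. sinh x - x) has_real_derivative cosh y - 1) (at y)"
      by (auto intro!: derivative_eq_intros)
    show "0 \<le> cosh y - 1" using cosh_real_ge_1[of y] by simp
  qed
  then show ?thesis by simp
qed

lemma integral_odd:
  fixes f :: "real \<Rightarrow> 'a::euclidean_space"
  assumes "\<And>x. f (- x) = - f x"
  shows "integral {- b..b} f = 0"
proof -
  have "integral {- b..- (- b)} (\<lambda>x. f (- x)) = integral {- b..b} f"
    by (rule integral_reflect)
  then have "- integral {- b..b} f = integral {- b..b} f"
    by (simp add: assms)
  then have "integral {- b..b} f + integral {- b..b} f = 0"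
    by (metis add.right_inverse)
  then show ?thesis by (simp add: scaleR_2[symmetric])
qed

lemma integral_even_half:
  fixes f :: "real \<Rightarrow> real"
  assumes "\<And>x. f (- x) = f x" "f integrable_on {- b..b}" "b \<ge> 0"
  shows "integral {- b..b} f = 2 * integral {0..b} f"
proof -
  have "integral {- b..0} f + integral {0..b} f = integral {- b..b} f"
    by (rule Henstock_Kurzweil_Integration.integral_combine) (use assms in auto)
  moreover have "integral {- b..- 0} (\<lambda>x. f (- x)) = integral {0..b} f"
    by (rule integral_reflect)
  ultimately show ?thesis by (simp add: assms(1))
qed

context
  fixes p a :: real and k :: nat
  assumes p: "p > 0" and k: "k \<ge> 1"
  defines "a \<equiv> 2 * pi * real k / p"
begin

lemma frequency: "a > 0" "a * (p / 2) = pi * real k" "a * p = 2 * pi * real k"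
  using p k by (simp_all add: a_def)

lemma trig_period:
  fixes z :: complex
  shows "cos (of_real a * (z + of_real p)) = cos (of_real a * z)" "sin (of_real a * (z + of_real p)) = sin (of_real a * z)"
proof -
  have e: "of_real a * (z + of_real p) = of_real a * z + complex_of_real (2 * pi * real k)"
    unfolding distrib_left of_real_mult[symmetric] frequency ..
  have s: "sin (complex_of_real (2 * pi * real k)) = 0" "cos (complex_of_real (2 * pi * real k)) = 1"
  proof -
    have "sin (2 * pi * real k) = 0" "cos (2 * pi * real k) = 1"
      using sin_npi[of "2 * k"] cos_npi[of "2 * k"] by (simp_all add: mult_ac)
    then show "sin (complex_of_real (2 * pi * real k)) = 0" "cos (complex_of_real (2 * pi * real k)) = 1"
      by (simp_all only: sin_of_real cos_of_real of_real_0 of_real_1)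
  qed
  show "cos (of_real a * (z + of_real p)) = cos (of_real a * z)" "sin (of_real a * (z + of_real p)) = sin (of_real a * z)"
    unfolding e cos_add sin_add s by simp_all
qed

text \<open>The products of \<open>\<Phi>\<close> with the entire functions \<open>cos (a z)\<close>
  and \<open>sin (a z)\<close> are again periodic, so their integrals over horizontal lines do not
  depend on the line. The addition formulas turn this into a linear system for the wanted integrals,
  a rotation by a complex angle, which is inverted.\<close>

lemma fourier_shift:
  assumes hol: "\<Phi> holomorphic_on strip" and per: "\<And>z. z \<in> strip \<Longrightarrow> \<Phi> (z + of_real p) = \<Phi> z"
    and w: "w \<in> strip"
  defines "C \<equiv> integral {- (p / 2)..p / 2} (\<lambda>x. \<Phi> (of_real x) * cos (of_real a * of_real x))"
    and "S \<equiv> integral {- (p / 2)..p / 2} (\<lambda>x. \<Phi> (of_real x) * sin (of_real a * of_real x))"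
  shows "integral {- (p / 2)..p / 2} (\<lambda>x. \<Phi> (w + of_real x) * cos (of_real a * of_real x))
       = cos (of_real a * w) * C + sin (of_real a * w) * S" (is "?X = _")
    and "integral {- (p / 2)..p / 2} (\<lambda>x. \<Phi> (w + of_real x) * sin (of_real a * of_real x))
       = cos (of_real a * w) * S - sin (of_real a * w) * C" (is "?Y = _")
proof -
  let ?J = "{- (p / 2)..p / 2}" and ?c = "cos (of_real a * w)" and ?s = "sin (of_real a * w)"
  have cont: "continuous_on strip \<Phi>" using hol by (rule holomorphic_on_imp_continuous_on)
  have Xi: "(\<lambda>x. \<Phi> (w + of_real x) * cos (of_real a * of_real x)) integrable_on ?J"
    by (intro integrable_continuous_interval continuous_intros continuous_on_compose2[OF cont]) (use w in auto)
  have Yi: "(\<lambda>x. \<Phi> (w + of_real x) * sin (of_real a * of_real x)) integrable_on ?J"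
    by (intro integrable_continuous_interval continuous_intros continuous_on_compose2[OF cont]) (use w in auto)
  have c1: "integral ?J (\<lambda>x. \<Phi> (w + of_real x) * cos (of_real a * (w + of_real x))) = C + 0 * w"
    unfolding C_def by (rule shift_integral[where \<Phi> = "\<lambda>z. \<Phi> z * cos (of_real a * z)", OF _ _ p w])
       (auto intro!: holomorphic_intros hol simp: per trig_period)
  have c2: "(\<lambda>x. \<Phi> (w + of_real x) * cos (of_real a * (w + of_real x))) =
      (\<lambda>x. ?c * (\<Phi> (w + of_real x) * cos (of_real a * of_real x)) - ?s * (\<Phi> (w + of_real x) * sin (of_real a * of_real x)))"
    by (simp add: distrib_left cos_add algebra_simps)
  have c3: "((\<lambda>x. ?c * (\<Phi> (w + of_real x) * cos (of_real a * of_real x)) - ?s * (\<Phi> (w + of_real x) * sin (of_real a * of_real x)))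
      has_integral (?c * ?X - ?s * ?Y)) ?J"
    by (intro has_integral_diff has_integral_mult_right integrable_integral Xi Yi)
  have 1: "?c * ?X - ?s * ?Y = C"
    using c1 unfolding c2 integral_unique[OF c3] by simp
  have s1: "integral ?J (\<lambda>x. \<Phi> (w + of_real x) * sin (of_real a * (w + of_real x))) = S + 0 * w"
    unfolding S_def by (rule shift_integral[where \<Phi> = "\<lambda>z. \<Phi> z * sin (of_real a * z)", OF _ _ p w])
       (auto intro!: holomorphic_intros hol simp: per trig_period)
  have s2: "(\<lambda>x. \<Phi> (w + of_real x) * sin (of_real a * (w + of_real x))) =
      (\<lambda>x. ?s * (\<Phi> (w + of_real x) * cos (of_real a * of_real x)) + ?c * (\<Phi> (w + of_real x) * sin (of_real a * of_real x)))"
    by (simp add: distrib_left sin_add algebra_simps)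
  have s3: "((\<lambda>x. ?s * (\<Phi> (w + of_real x) * cos (of_real a * of_real x)) + ?c * (\<Phi> (w + of_real x) * sin (of_real a * of_real x)))
      has_integral (?s * ?X + ?c * ?Y)) ?J"
    by (intro has_integral_add has_integral_mult_right integrable_integral Xi Yi)
  have 2: "?s * ?X + ?c * ?Y = S"
    using s1 unfolding s2 integral_unique[OF s3] by simp
  have cs: "?c * ?c + ?s * ?s = 1"
    using sin_cos_squared_add[of "of_real a * w"] by (simp add: power2_eq_square)
  have alg: "c * (c * X - s * Y) + s * (s * X + c * Y) = (c * c + s * s) * X"
    "c * (s * X + c * Y) - s * (c * X - s * Y) = (c * c + s * s) * Y" for c s X Y :: complex
    by (simp_all add: algebra_simps)
  have "?c * C + ?s * S = (?c * ?c + ?s * ?s) * ?X"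
    unfolding 1[symmetric] 2[symmetric] by (rule alg)
  then show "?X = ?c * C + ?s * S" unfolding cs by simp
  have "?c * S - ?s * C = (?c * ?c + ?s * ?s) * ?Y"
    unfolding 1[symmetric] 2[symmetric] by (rule alg)
  then show "?Y = ?c * S - ?s * C" unfolding cs by simp
qed

text \<open>Removing the linear growth turns the quasi-periodic sum into an odd periodic function,
  which has Fourier coefficients.\<close>

definition saw :: "complex \<Rightarrow> complex" where
  "saw z = tanh_sum p z - 2 / of_real p * z"

definition saw_coeff :: real where
  "saw_coeff = integral {- (p / 2)..p / 2} (\<lambda>x. Re (saw (of_real x)) * sin (a * x))"

lemma saw_holomorphic: "saw holomorphic_on strip"
  unfolding saw_def[abs_def] by (intro holomorphic_intros holomorphic_tanh_sum[OF p])

lemma saw_period: "z \<in> strip \<Longrightarrow> saw (z + of_real p) = saw z"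
  using tanh_sum_period[of z p] p by (simp add: saw_def field_simps)

lemma saw_minus: "saw (- z) = - saw z"
  by (simp add: saw_def tanh_sum_minus)

lemma saw_of_real: "saw (of_real x) = of_real (Re (saw (of_real x)))"
  by (simp add: saw_def tanh_sum_of_real)

lemma integral_of_real_complex:
  fixes f :: "real \<Rightarrow> real"
  shows "f integrable_on A \<Longrightarrow> integral A (\<lambda>x. complex_of_real (f x)) = complex_of_real (integral A f)"
  by (intro integral_unique has_integral_of_real integrable_integral)

lemma saw_fourier:
  "integral {- (p / 2)..p / 2} (\<lambda>x. saw (of_real x) * cos (of_real a * of_real x)) = 0"
  "integral {- (p / 2)..p / 2} (\<lambda>x. saw (of_real x) * sin (of_real a * of_real x)) = of_real saw_coeff"
proof -
  show "integral {- (p / 2)..p / 2} (\<lambda>x. saw (of_real x) * cos (of_real a * of_real x)) = 0"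
    by (rule integral_odd) (simp add: saw_minus)
  have "(\<lambda>x. Re (saw (of_real x)) * sin (a * x)) integrable_on {- (p / 2)..p / 2}"
    by (intro integrable_continuous_interval continuous_intros
        continuous_on_compose2[OF holomorphic_on_imp_continuous_on[OF saw_holomorphic]]) auto
  from integral_of_real_complex[OF this]
  show "integral {- (p / 2)..p / 2} (\<lambda>x. saw (of_real x) * sin (of_real a * of_real x)) = of_real saw_coeff"
    unfolding saw_coeff_def of_real_mult saw_of_real[symmetric] sin_of_real[symmetric] of_real_mult .
qed

lemma saw_shift_cos:
  assumes "w \<in> strip"
  shows "integral {- (p / 2)..p / 2} (\<lambda>x. saw (w + of_real x) * cos (of_real a * of_real x)) = sin (of_real a * w) * of_real saw_coeff"
  using fourier_shift(1)[OF saw_holomorphic saw_period assms] by (simp add: saw_fourier)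

lemma integral_cos_zero: "((\<lambda>x. cos (a * x)) has_integral 0) {- (p / 2)..p / 2}"
proof -
  have "((\<lambda>x. cos (a * x)) has_integral (sin (a * (p / 2)) / a - sin (a * - (p / 2)) / a)) {- (p / 2)..p / 2}"
  proof (rule fundamental_theorem_of_calculus)
    fix x
    have "((\<lambda>x. sin (a * x) / a) has_real_derivative cos (a * x)) (at x)"
      using frequency by (auto intro!: derivative_eq_intros)
    then show "((\<lambda>x. sin (a * x) / a) has_vector_derivative cos (a * x)) (at x within {- (p / 2)..p / 2})"
      by (simp add: has_real_derivative_iff_has_vector_derivative has_vector_derivative_at_within)
  qed (use p in simp)
  moreover have "sin (a * (p / 2)) = 0" "sin (a * - (p / 2)) = 0"
    unfolding mult_minus_right sin_minus frequency by (simp_all add: mult.commute sin_npi)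
  ultimately show ?thesis by simp
qed

lemma kernel_fourier:
  "((\<lambda>t. kernel_real p l t * cos (a * t)) has_integral (- saw_coeff * sin (a * l))) {- (p / 2)..p / 2}"
proof -
  let ?J = "{- (p / 2)..p / 2}"
  let ?N = "\<lambda>x. Re (saw (of_real x))"
  have cont: "continuous_on A ?N" for A
    by (intro continuous_intros continuous_on_compose2[OF holomorphic_on_imp_continuous_on[OF saw_holomorphic]]) auto
  have int1: "(\<lambda>x. ?N (l + x) * cos (a * x)) integrable_on ?J"
    by (intro integrable_continuous_interval continuous_intros continuous_on_compose2[OF cont[of UNIV]]) auto
  have int2: "(\<lambda>x. ?N (l - x) * cos (a * x)) integrable_on ?J"
    by (intro integrable_continuous_interval continuous_intros continuous_on_compose2[OF cont[of UNIV]]) auto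
  have v1: "integral ?J (\<lambda>x. ?N (l + x) * cos (a * x)) = saw_coeff * sin (a * l)"
  proof -
    have "complex_of_real (integral ?J (\<lambda>x. ?N (l + x) * cos (a * x))) = integral ?J (\<lambda>x. saw (of_real l + of_real x) * cos (of_real a * of_real x))"
    proof -
      have "complex_of_real (?N (l + x) * cos (a * x)) = saw (of_real l + of_real x) * cos (of_real a * of_real x)" for x
        using saw_of_real[of "l + x"] cos_of_real[of "a * x", where 'a = complex] by simp
      then show ?thesis using integral_of_real_complex[OF int1] by simp
    qed
    also have "\<dots> = of_real (saw_coeff * sin (a * l))"
      unfolding saw_shift_cos[of "of_real l", simplified] by (simp add: sin_of_real[symmetric])
    finally show ?thesis by (simp only: of_real_eq_iff)
  qed
  have v2: "integral ?J (\<lambda>x. ?N (l - x) * cos (a * x)) = saw_coeff * sin (a * l)"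
  proof -
    have "integral {- (p / 2)..- (- (p / 2))} (\<lambda>x. (\<lambda>x. ?N (l + x) * cos (a * x)) (- x)) = integral ?J (\<lambda>x. ?N (l + x) * cos (a * x))"
      by (rule integral_reflect)
    then show ?thesis using v1 by simp
  qed
  \<comment> \<open>The linear parts of the three sums cancel, so \<open>tanh_real\<close> may be
    replaced by the periodic part.\<close>
  have eq: "kernel_real p l t * cos (a * t) = ?N l * cos (a * t) - (?N (l + t) * cos (a * t) + ?N (l - t) * cos (a * t)) / 2" for t
  proof -
    have K: "kernel_real p l t = ?N l - (?N (l + t) + ?N (l - t)) / 2"
      by (simp add: kernel_real_def tanh_real_def saw_def add_divide_distrib diff_divide_distrib distrib_left right_diff_distrib)
    show ?thesis unfolding K by (simp add: left_diff_distrib distrib_right)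
  qed
  have "((\<lambda>t. ?N l * cos (a * t) - (?N (l + t) * cos (a * t) + ?N (l - t) * cos (a * t)) / 2) has_integral
     (?N l * 0 - (saw_coeff * sin (a * l) + saw_coeff * sin (a * l)) / 2)) ?J"
    by (intro has_integral_diff has_integral_mult_right has_integral_divide has_integral_add integral_cos_zero)
       (use int1 int2 v1 v2 in \<open>auto simp: has_integral_iff\<close>)
  then show ?thesis unfolding eq by simp
qed

lemma sinh_lower:
  assumes "\<bar>y\<bar> \<ge> \<delta>" "\<delta> > 0"
  shows "((1 - exp (- 2 * \<delta>)) / 2)\<^sup>2 * exp (2 * \<bar>y\<bar>) \<le> (sinh (y::real))\<^sup>2"
proof -
  have "exp (- 2 * \<bar>y\<bar>) \<le> exp (- 2 * \<delta>)" using assms by simp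
  then have "exp \<bar>y\<bar> * (1 - exp (- 2 * \<delta>)) \<le> exp \<bar>y\<bar> * (1 - exp (- 2 * \<bar>y\<bar>))"
    by (intro mult_left_mono) auto
  also have "\<dots> = 2 * sinh \<bar>y\<bar>"
    by (simp add: sinh_def right_diff_distrib exp_add[symmetric])
  finally have "(1 - exp (- 2 * \<delta>)) / 2 * exp \<bar>y\<bar> \<le> sinh \<bar>y\<bar>" by (simp add: mult.commute)
  then have "((1 - exp (- 2 * \<delta>)) / 2 * exp \<bar>y\<bar>)\<^sup>2 \<le> (sinh \<bar>y\<bar>)\<^sup>2"
    using assms by (intro power_mono) auto
  moreover have "(exp \<bar>y\<bar>)\<^sup>2 = exp (2 * \<bar>y\<bar>)" by (simp add: power2_eq_square exp_add[symmetric])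
  moreover have "(sinh \<bar>y\<bar>)\<^sup>2 = (sinh y)\<^sup>2" by (simp add: abs_if)
  ultimately show ?thesis by (simp only: power_mult_distrib[of "(1 - exp (- 2 * \<delta>)) / 2"])
qed

text \<open>Near the top of the strip the imaginary part of the sum behaves like a Poisson kernel
  concentrating at the lattice points. The factor \<open>1 - cos (a * x)\<close> vanishes to second
  order at the only such point in the interval, so the product is of the order of
  \<open>sin \<theta>\<close>.\<close>

lemma poisson_tail:
  obtains K where "\<And>x \<theta>. \<bar>x\<bar> \<le> p / 2 \<Longrightarrow> 0 < \<theta> \<Longrightarrow> \<theta> < pi \<Longrightarrow>
     Im (tanh_sum p (\<i> * of_real \<theta> + of_real x)) * (1 - cos (a * x)) \<le> K * sin \<theta>"
proof -
  define q where "q = ((1 - exp (- 2 * (p / 4))) / 2)\<^sup>2"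
  have q: "q > 0" using p by (simp add: q_def)
  define g where "g n = exp (- (p * \<bar>real_of_int n\<bar> / 2))" for n :: int
  have g: "g summable_on UNIV" unfolding g_def by (rule exp_abs_summable[OF p])
  define G where "G = (\<Sum>\<^sub>\<infinity>n. g n)"
  \<comment> \<open>The summand \<open>a\<^sup>2\<close> covers \<open>n = 0\<close>, where
    \<open>1 - cos (a * x)\<close> is at most \<open>2 * a\<^sup>2\<close> times the denominator.
    The rest covers the other \<open>n\<close>, whose denominators grow exponentially because the
    arguments are at distance at least \<open>p / 2\<close> from \<open>0\<close>.\<close>
  define K where "K = a\<^sup>2 + 1 / q * G"
  have "Im (tanh_sum p (\<i> * of_real \<theta> + of_real x)) * (1 - cos (a * x)) \<le> K * sin \<theta>"
    if x: "\<bar>x\<bar> \<le> p / 2" and \<theta>: "0 < \<theta>" "\<theta> < pi" for x \<theta>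
  proof -
    let ?z = "\<i> * of_real \<theta> + of_real x"
    have z: "?z \<in> strip" using \<theta> by (simp add: strip_def)
    have sn: "sin \<theta> > 0" using \<theta> by (intro sin_gt_zero) auto
    have half: "sin (\<theta> / 2) * cos (\<theta> / 2) = sin \<theta> / 2"
      using sin_double[of "\<theta> / 2"] by simp
    have c2: "0 < (cos (\<theta> / 2))\<^sup>2"
      using cos_half_strip[OF z] by simp
    have cs: "0 \<le> 1 - cos (a * x)" "1 - cos (a * x) \<le> 2" using cos_le_one[of "a * x"] cos_ge_minus_one[of "a * x"] by linarith+
    let ?f = "\<lambda>n::int. sin \<theta> / 2 / ((sinh ((x + p * of_int n) / 2))\<^sup>2 + (cos (\<theta> / 2))\<^sup>2)"
    have f: "(?f has_sum Im (tanh_sum p ?z)) UNIV"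
      using Im_tanh_sum_has_sum[OF p z] half by simp
    then have f': "((\<lambda>n. ?f n * (1 - cos (a * x))) has_sum (Im (tanh_sum p ?z) * (1 - cos (a * x)))) UNIV"
      by (rule has_sum_cmult_left)
    have single: "((\<lambda>n. if n = 0 then c else 0) has_sum c) (UNIV :: int set)" for c :: real
      by (rule has_sum_cong_neutral[THEN iffD1, OF _ _ _ has_sum_finite[of "{0}" "\<lambda>_. c", simplified]]) auto
    have sumg: "((\<lambda>n. (if n = 0 then a\<^sup>2 * sin \<theta> else 0) + sin \<theta> / q * g n) has_sum (a\<^sup>2 * sin \<theta> + sin \<theta> / q * G)) UNIV"
      unfolding G_def by (intro has_sum_add single has_sum_cmult_right has_sum_infsum g)
    have "Im (tanh_sum p ?z) * (1 - cos (a * x)) \<le> a\<^sup>2 * sin \<theta> + sin \<theta> / q * G"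
    proof (rule has_sum_mono[OF f' sumg])
      fix n :: int
      have gpos: "0 \<le> sin \<theta> / q * g n" using sn q by (simp add: g_def)
      show "?f n * (1 - cos (a * x)) \<le> (if n = 0 then a\<^sup>2 * sin \<theta> else 0) + sin \<theta> / q * g n"
      proof (cases "n = 0")
        case True
        have "1 - cos (a * x) = 2 * (sin (a * x / 2))\<^sup>2"
          using cos_double_sin[of "a * x / 2"] by simp
        also have "\<dots> \<le> 2 * (a * x / 2)\<^sup>2"
          using abs_sin_x_le_abs_x[of "a * x / 2"] by (simp add: abs_le_square_iff[symmetric])
        also have "\<dots> = 2 * a\<^sup>2 * (x / 2)\<^sup>2" by (simp add: power_mult_distrib power_divide)
        also have "\<dots> \<le> 2 * a\<^sup>2 * (sinh (x / 2))\<^sup>2"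
        proof -
          have "\<bar>x / 2\<bar> \<le> sinh \<bar>x / 2\<bar>"
            by (rule le_sinh) simp
          then have "(x / 2)\<^sup>2 \<le> (sinh (x / 2))\<^sup>2"
            by (simp add: abs_le_square_iff[symmetric] abs_if split: if_splits)
          then show ?thesis by (intro mult_left_mono) auto
        qed
        also have "\<dots> \<le> 2 * a\<^sup>2 * ((sinh (x / 2))\<^sup>2 + (cos (\<theta> / 2))\<^sup>2)"
          by (intro mult_left_mono) auto
        finally have b: "1 - cos (a * x) \<le> 2 * a\<^sup>2 * ((sinh (x / 2))\<^sup>2 + (cos (\<theta> / 2))\<^sup>2)" .
        have pos: "(sinh (x / 2))\<^sup>2 + (cos (\<theta> / 2))\<^sup>2 > 0" using c2 by (simp add: add_nonneg_pos)
        have "?f 0 * (1 - cos (a * x)) \<le> ?f 0 * (2 * a\<^sup>2 * ((sinh (x / 2))\<^sup>2 + (cos (\<theta> / 2))\<^sup>2))"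
          by (rule mult_left_mono[OF b]) (use sn pos in simp)
        also have "\<dots> = a\<^sup>2 * sin \<theta>"
        proof -
          have "s / 2 / E * (2 * b * E) = b * s" if "E > 0" for s b E :: real using that by simp
          from this[OF pos] show ?thesis by simp
        qed
        finally show ?thesis using True gpos by simp
      next
        case False
        then have n1: "\<bar>real_of_int n\<bar> \<ge> 1" by linarith
        let ?y = "(x + p * of_int n) / 2"
        have "p * \<bar>real_of_int n\<bar> \<le> \<bar>x + p * of_int n\<bar> + \<bar>x\<bar>"
          using p abs_triangle_ineq4[of "x + p * of_int n" x] by (simp add: abs_mult)
        moreover have "p * 1 \<le> p * \<bar>real_of_int n\<bar>" using n1 p by (intro mult_left_mono) auto
        ultimately have big: "p * \<bar>real_of_int n\<bar> / 2 \<le> \<bar>x + p * of_int n\<bar>" "p / 2 \<le> \<bar>x + p * of_int n\<bar>"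
          using x by linarith+
        have "q * exp (p * \<bar>real_of_int n\<bar> / 2) \<le> q * exp (2 * \<bar>?y\<bar>)"
          using big q by simp
        also have "\<dots> \<le> (sinh ?y)\<^sup>2"
          unfolding q_def by (rule sinh_lower) (use big p in auto)
        also have "\<dots> \<le> (sinh ?y)\<^sup>2 + (cos (\<theta> / 2))\<^sup>2" by simp
        finally have low: "q * exp (p * \<bar>real_of_int n\<bar> / 2) \<le> (sinh ?y)\<^sup>2 + (cos (\<theta> / 2))\<^sup>2" .
        have lpos: "0 < q * exp (p * \<bar>real_of_int n\<bar> / 2)" using q by simp
        have "?f n * (1 - cos (a * x)) \<le> sin \<theta> / 2 / (q * exp (p * \<bar>real_of_int n\<bar> / 2)) * 2"
          using cs low lpos sn by (intro mult_mono divide_left_mono) auto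
        also have "\<dots> = sin \<theta> / q * g n"
          by (simp add: g_def exp_minus field_simps)
        finally show ?thesis using False by simp
      qed
    qed
    then show ?thesis by (simp add: K_def field_simps)
  qed
  then show ?thesis by (rule that)
qed

text \<open>At height \<open>\<theta>\<close> the imaginary part has total mass
  \<open>2 * \<theta>\<close> and cosine moment \<open>saw_coeff * sinh (a * \<theta>)\<close>. By
  \<open>poisson_tail\<close> the two differ by a multiple of \<open>sin \<theta>\<close>, so they
  agree in the limit \<open>\<theta> \<rightarrow> pi\<close>.\<close>

lemma saw_coeff_value: "saw_coeff * sinh (a * pi) = 2 * pi"
proof -
  let ?J = "{- (p / 2)..p / 2}"
  obtain K where K: "\<And>x \<theta>. \<bar>x\<bar> \<le> p / 2 \<Longrightarrow> 0 < \<theta> \<Longrightarrow> \<theta> < pi \<Longrightarrow>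
     Im (tanh_sum p (\<i> * of_real \<theta> + of_real x)) * (1 - cos (a * x)) \<le> K * sin \<theta>"
    using poisson_tail by blast
  have bound: "\<bar>2 * \<theta> - saw_coeff * sinh (a * \<theta>)\<bar> \<le> K * sin \<theta> * p" if \<theta>: "0 < \<theta>" "\<theta> < pi" for \<theta>
  proof -
    let ?w = "\<i> * complex_of_real \<theta>"
    have w: "?w \<in> strip" using \<theta> by (simp add: strip_def)
    let ?P = "\<lambda>x. Im (tanh_sum p (?w + of_real x))"
    have P: "(?P has_integral 2 * \<theta>) ?J" using integral_Im_tanh_sum[OF p w] by simp
    have "((\<lambda>x. saw (?w + of_real x) * cos (of_real a * of_real x)) has_integral sin (of_real a * ?w) * of_real saw_coeff) ?J"
      unfolding saw_shift_cos[OF w, symmetric]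
      by (intro integrable_integral integrable_continuous_interval continuous_intros
          continuous_on_compose2[OF holomorphic_on_imp_continuous_on[OF saw_holomorphic]]) (use w in auto)
    then have "((\<lambda>x. Im (saw (?w + of_real x) * cos (of_real a * of_real x))) has_integral Im (sin (of_real a * ?w) * of_real saw_coeff)) ?J"
      by (rule has_integral_Im)
    moreover have "Im (saw (?w + of_real x) * cos (of_real a * of_real x)) = ?P x * cos (a * x) - 2 * \<theta> / p * cos (a * x)" for x
    proof -
      have "cos (of_real a * of_real x) = complex_of_real (cos (a * x))" by (simp flip: cos_of_real)
      moreover have "Im (2 / of_real p * (?w + of_real x)) = 2 * \<theta> / p"
        by (simp add: Im_divide power2_eq_square)
      ultimately show ?thesis by (simp add: saw_def algebra_simps)
    qed
    moreover have "sin (of_real a * ?w) = \<i> * of_real (sinh (a * \<theta>))"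
    proof -
      have "sin (\<i> * of_real (a * \<theta>)) = \<i> * of_real (sinh (a * \<theta>))"
        by (simp add: sin_exp_eq sinh_def scaleR_conv_of_real exp_of_real field_simps flip: of_real_mult of_real_minus)
      then show ?thesis by (simp add: mult_ac)
    qed
    ultimately have "((\<lambda>x. ?P x * cos (a * x) - 2 * \<theta> / p * cos (a * x)) has_integral saw_coeff * sinh (a * \<theta>)) ?J"
      by (simp add: mult.commute)
    from has_integral_add[OF this has_integral_mult_right[OF integral_cos_zero, of "2 * \<theta> / p"]]
    have "((\<lambda>x. ?P x * cos (a * x)) has_integral saw_coeff * sinh (a * \<theta>)) ?J" by simp
    from has_integral_diff[OF P this]
    have D: "((\<lambda>x. ?P x * (1 - cos (a * x))) has_integral (2 * \<theta> - saw_coeff * sinh (a * \<theta>))) ?J"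
      by (simp add: algebra_simps)
    have nn: "0 \<le> ?P x * (1 - cos (a * x))" for x
      using Im_tanh_sum_nonneg[OF p, of "?w + of_real x"] w \<theta> by (intro mult_nonneg_nonneg) auto
    have "norm (2 * \<theta> - saw_coeff * sinh (a * \<theta>)) \<le> K * sin \<theta> * measure lborel (cbox (- (p / 2)) (p / 2))"
    proof (rule has_integral_bound)
      have "0 \<le> K * sin \<theta>" using K[of 0 \<theta>] \<theta> p by simp
      then show "0 \<le> K * sin \<theta>" .
      show "((\<lambda>x. ?P x * (1 - cos (a * x))) has_integral (2 * \<theta> - saw_coeff * sinh (a * \<theta>))) (cbox (- (p / 2)) (p / 2))"
        using D by simp
      show "norm (?P x * (1 - cos (a * x))) \<le> K * sin \<theta>" if "x \<in> cbox (- (p / 2)) (p / 2)" for x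
        using nn[of x] K[of x \<theta>] \<theta> that by (auto simp: abs_le_iff)
    qed
    then show ?thesis using p by simp
  qed
  have lim1: "((\<lambda>\<theta>. 2 * \<theta> - saw_coeff * sinh (a * \<theta>)) \<longlongrightarrow> 2 * pi - saw_coeff * sinh (a * pi)) (at_left pi)"
    by (intro tendsto_intros)
  have "((\<lambda>\<theta>. K * sin \<theta> * p) \<longlongrightarrow> K * sin pi * p) (at_left pi)" by (intro tendsto_intros)
  then have lim2: "((\<lambda>\<theta>. K * sin \<theta> * p) \<longlongrightarrow> 0) (at_left pi)" by simp
  have "((\<lambda>\<theta>. 2 * \<theta> - saw_coeff * sinh (a * \<theta>)) \<longlongrightarrow> 0) (at_left pi)"
  proof (rule Lim_null_comparison[OF _ lim2])
    show "eventually (\<lambda>\<theta>. norm (2 * \<theta> - saw_coeff * sinh (a * \<theta>)) \<le> K * sin \<theta> * p) (at_left pi)"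
      using eventually_at_left_real[of 0 pi] by (rule eventually_mono) (use bound in auto)
  qed
  from tendsto_unique[OF _ lim1 this] show ?thesis by simp
qed

end

section \<open>Completeness of cosines and injectivity\<close>

lemma integrable_bounded_mult:
  fixes g f :: "'a \<Rightarrow> real"
  assumes "integrable M g" "f \<in> borel_measurable M" "\<And>x. x \<in> space M \<Longrightarrow> \<bar>f x\<bar> \<le> B"
  shows "integrable M (\<lambda>x. g x * f x)"
proof (rule Bochner_Integration.integrable_bound)
  show "integrable M (\<lambda>x. B * g x)" by (rule Bochner_Integration.integrable_mult_right) (rule assms(1))
  show "(\<lambda>x. g x * f x) \<in> borel_measurable M" using assms by measurable
  show "AE x in M. norm (g x * f x) \<le> norm (B * g x)"
  proof (rule AE_I2)
    fix x assume "x \<in> space M"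
    then have "\<bar>f x\<bar> \<le> \<bar>B\<bar>" using assms(3)[of x] by linarith
    then have "\<bar>g x\<bar> * \<bar>f x\<bar> \<le> \<bar>g x\<bar> * \<bar>B\<bar>" by (rule mult_left_mono) simp
    then show "norm (g x * f x) \<le> norm (B * g x)" by (simp add: abs_mult mult.commute)
  qed
qed

context
  fixes L c :: real and g :: "real \<Rightarrow> real"
  assumes L: "L > 0" and c: "c = pi / L"
    and g: "integrable (lebesgue_on {0<..<L}) g"
    and coeff: "\<And>k::nat. (\<integral>x. g x * cos (real k * (c * x)) \<partial>lebesgue_on {0<..<L}) = 0"
begin

text \<open>The product formula for cosines trades one power of \<open>cos (c * x)\<close> for two
  neighbouring frequencies. Orthogonality to all frequencies thus becomes orthogonality to all
  polynomials in \<open>cos (c * x)\<close>.\<close>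

lemma orthogonal_cos_power: "(\<integral>x. g x * (cos (c * x) ^ n * cos (real k * (c * x))) \<partial>lebesgue_on {0<..<L}) = 0"
proof (induction n arbitrary: k)
  case 0
  then show ?case using coeff by simp
next
  case (Suc n)
  let ?M = "lebesgue_on {0<..<L}"
  have int: "integrable ?M (\<lambda>x. g x * (cos (c * x) ^ n * cos (real k * (c * x))))" for k
  proof (rule integrable_bounded_mult[OF g, where B = 1])
    show "(\<lambda>x. cos (c * x) ^ n * cos (real k * (c * x))) \<in> borel_measurable ?M"
      by (intro measurable_interval_continuous continuous_intros)
    show "\<bar>cos (c * x) ^ n * cos (real k * (c * x))\<bar> \<le> 1" for x
      unfolding abs_mult power_abs
      by (rule mult_le_one) (auto intro: power_le_one)
  qed
  show ?case
  proof (cases k)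
    case 0
    have "(\<lambda>x. g x * (cos (c * x) ^ Suc n * cos (real 0 * (c * x)))) = (\<lambda>x. g x * (cos (c * x) ^ n * cos (real 1 * (c * x))))"
      by (simp add: mult_ac)
    then show ?thesis unfolding 0 using Suc[of 1] by simp
  next
    case (Suc j)
    have "g x * (cos (c * x) ^ Suc n * cos (real (Suc j) * (c * x)))
      = (g x * (cos (c * x) ^ n * cos (real (Suc (Suc j)) * (c * x))) + g x * (cos (c * x) ^ n * cos (real j * (c * x)))) * (1 / 2)" for x
    proof -
      have "cos (real (Suc (Suc j)) * (c * x)) + cos (real j * (c * x)) = 2 * cos (c * x) * cos (real (Suc j) * (c * x))"
      proof -
        have "real (Suc (Suc j)) * (c * x) = real (Suc j) * (c * x) + c * x" "real j * (c * x) = real (Suc j) * (c * x) - c * x"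
          by (simp_all add: algebra_simps)
        then show ?thesis by (simp only: cos_add cos_diff) simp
      qed
      then have "g x * cos (c * x) ^ n * (cos (real (Suc (Suc j)) * (c * x)) + cos (real j * (c * x)))
         = g x * cos (c * x) ^ n * (2 * cos (c * x) * cos (real (Suc j) * (c * x)))" by (simp only:)
      then show ?thesis by (simp add: distrib_left mult_ac)
    qed
    then have "(\<integral>x. g x * (cos (c * x) ^ Suc n * cos (real (Suc j) * (c * x))) \<partial>?M)
      = (\<integral>x. (g x * (cos (c * x) ^ n * cos (real (Suc (Suc j)) * (c * x))) + g x * (cos (c * x) ^ n * cos (real j * (c * x)))) * (1 / 2) \<partial>?M)"
      by (simp only:)
    also have "\<dots> = 0"
      unfolding integral_mult_left_zero Bochner_Integration.integral_add[OF int int] Suc.IH by simp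
    finally show ?thesis unfolding Suc .
  qed
qed

text \<open>On \<open>(0, L)\<close> the substitution \<open>y = cos (c * x)\<close> is injective,
  so a continuous function of \<open>x\<close> becomes a continuous function on
  \<open>{-1..1}\<close>, where polynomials are dense.\<close>

lemma orthogonal_continuous:
  assumes h: "continuous_on UNIV h" "\<And>x. \<bar>h x\<bar> \<le> (1::real)"
  shows "(\<integral>x. g x * h x \<partial>lebesgue_on {0<..<L}) = 0"
proof -
  let ?M = "lebesgue_on {0<..<L}"
  have cpos: "c > 0" using L c by simp
  define H where "H y = h (arccos y / c)" for y
  have H: "continuous_on {-1..1} H"
    unfolding H_def by (intro continuous_on_compose2[OF h(1)] continuous_intros) (use cpos in auto)
  have "\<bar>\<integral>x. g x * h x \<partial>?M\<bar> \<le> e * (\<integral>x. \<bar>g x\<bar> \<partial>?M)" if e: "e > 0" for e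
  proof -
    obtain q where q: "real_polynomial_function q" "\<And>y. y \<in> {-1..1} \<Longrightarrow> \<bar>H y - q y\<bar> < e"
      using Stone_Weierstrass_real_polynomial_function[OF _ H e] by auto
    obtain a n where qs: "q = (\<lambda>y. \<Sum>i\<le>n. a i * y ^ i)"
      using q(1) real_polynomial_function_iff_sum by auto
    have int_pow: "integrable ?M (\<lambda>x. g x * cos (c * x) ^ i)" for i
    proof (rule integrable_bounded_mult[OF g, where B = 1])
      show "(\<lambda>x. cos (c * x) ^ i) \<in> borel_measurable ?M"
        by (intro measurable_interval_continuous continuous_intros)
      show "\<bar>cos (c * x) ^ i\<bar> \<le> 1" for x
        unfolding power_abs by (rule power_le_one) auto
    qed
    have "(\<integral>x. g x * cos (c * x) ^ i \<partial>?M) = 0" for i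
      using orthogonal_cos_power[of i 0] by simp
    moreover have "g x * q (cos (c * x)) = (\<Sum>i\<le>n. a i * (g x * cos (c * x) ^ i))" for x
      unfolding qs sum_distrib_left by (intro sum.cong refl) (simp add: mult_ac)
    ultimately have q0: "(\<integral>x. g x * q (cos (c * x)) \<partial>?M) = 0" and qi: "integrable ?M (\<lambda>x. g x * q (cos (c * x)))"
      using int_pow by (simp_all add: Bochner_Integration.integral_sum)
    have hi: "integrable ?M (\<lambda>x. g x * h x)"
      by (rule integrable_bounded_mult[OF g measurable_interval_continuous[OF continuous_on_subset[OF h(1)]], where B = 1]) (use h in auto)
    have "(\<integral>x. g x * h x \<partial>?M) = (\<integral>x. g x * h x - g x * q (cos (c * x)) \<partial>?M)"
      using Bochner_Integration.integral_diff[OF hi qi] q0 by simp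
    also have "\<bar>\<dots>\<bar> \<le> (\<integral>x. \<bar>g x * h x - g x * q (cos (c * x))\<bar> \<partial>?M)"
      by (rule integral_abs_bound)
    also have "\<dots> \<le> (\<integral>x. e * \<bar>g x\<bar> \<partial>?M)"
    proof (rule integral_mono)
      show "integrable ?M (\<lambda>x. \<bar>g x * h x - g x * q (cos (c * x))\<bar>)"
        by (intro integrable_abs Bochner_Integration.integrable_diff hi qi)
      show "integrable ?M (\<lambda>x. e * \<bar>g x\<bar>)"
        by (rule Bochner_Integration.integrable_mult_right) (rule integrable_abs[OF g])
      fix x assume "x \<in> space ?M"
      then have x: "0 < x" "x < L" by auto
      have "c * x \<le> c * L" using x cpos by (intro mult_left_mono) auto
      also have "c * L = pi" using c L by simp
      finally have "H (cos (c * x)) = h x"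
        using cpos x by (simp add: H_def arccos_cos)
      then have "\<bar>h x - q (cos (c * x))\<bar> \<le> e" using q(2)[of "cos (c * x)"] by force
      then have "\<bar>g x\<bar> * \<bar>h x - q (cos (c * x))\<bar> \<le> \<bar>g x\<bar> * e" by (rule mult_left_mono) simp
      then show "\<bar>g x * h x - g x * q (cos (c * x))\<bar> \<le> e * \<bar>g x\<bar>"
        by (simp only: right_diff_distrib[symmetric] abs_mult mult.commute)
    qed
    also have "\<dots> = e * (\<integral>x. \<bar>g x\<bar> \<partial>?M)" by simp
    finally show ?thesis .
  qed
  note bound = this
  define N where "N = (\<integral>x. \<bar>g x\<bar> \<partial>?M)"
  have N: "N \<ge> 0" unfolding N_def by (rule integral_nonneg_AE) simp
  have "\<bar>\<integral>x. g x * h x \<partial>?M\<bar> \<le> 0 + e" if e: "e > 0" for e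
  proof -
    have "e / (N + 1) > 0" using N e by simp
    from bound[OF this] have "\<bar>\<integral>x. g x * h x \<partial>?M\<bar> \<le> e / (N + 1) * N"
      unfolding N_def .
    also have "\<dots> \<le> e" using N e by (simp add: divide_le_eq)
    finally show ?thesis by simp
  qed
  then have "\<bar>\<integral>x. g x * h x \<partial>?M\<bar> \<le> 0" by (rule field_le_epsilon)
  then show ?thesis by simp
qed

text \<open>Testing \<open>g\<close> against continuous functions that tend to its sign almost
  everywhere shows that its \<open>L\<^sup>1\<close> norm is \<open>0\<close>.\<close>

lemma cos_complete: "AE x in lebesgue_on {0<..<L}. g x = 0"
proof -
  let ?M = "lebesgue_on {0<..<L}"
  have gm: "g \<in> borel_measurable ?M" using g by (rule borel_measurable_integrable)
  then have "(\<lambda>x. sgn (g x)) \<in> borel_measurable ?M" by measurable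
  then have "(\<lambda>x. sgn (g x)) measurable_on {0<..<L}"
    by (subst measurable_on_iff_borel_measurable) auto
  then obtain N s where N: "negligible N" and s: "\<And>n. continuous_on UNIV (s n)"
    and lim: "\<And>x. x \<notin> N \<Longrightarrow> (\<lambda>n. s n x) \<longlonglongrightarrow> (if x \<in> {0<..<L} then sgn (g x) else (0::real))"
    unfolding measurable_on_def by blast
  \<comment> \<open>Truncation keeps the test functions within the bound of
    \<open>orthogonal_continuous\<close> and makes \<open>\<bar>g\<bar>\<close> a dominating
    function; the limit is unaffected, as signs lie in \<open>{-1..1}\<close>.\<close>
  define h where "h n x = max (- 1) (min 1 (s n x))" for n x
  have h: "continuous_on UNIV (h n)" "\<bar>h n x\<bar> \<le> 1" for n x
    unfolding h_def[abs_def] by (intro continuous_intros s) auto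
  have AE_N: "AE x in ?M. x \<notin> N"
  proof -
    have "N \<in> null_sets lebesgue" using N by (simp add: negligible_iff_null_sets)
    then have "AE x in lebesgue. x \<notin> N" by (rule AE_not_in)
    then show ?thesis by (subst AE_restrict_space_iff) (auto elim: eventually_mono)
  qed
  have "(\<lambda>n. \<integral>x. g x * h n x \<partial>?M) \<longlonglongrightarrow> (\<integral>x. g x * sgn (g x) \<partial>?M)"
  proof (rule integral_dominated_convergence)
    show "(\<lambda>x. g x * sgn (g x)) \<in> borel_measurable ?M" using gm by measurable
    show "integrable ?M (\<lambda>x. \<bar>g x\<bar>)" by (rule integrable_abs[OF g])
    show "(\<lambda>x. g x * h n x) \<in> borel_measurable ?M" for n
      by (intro borel_measurable_times gm measurable_interval_continuous continuous_on_subset[OF h(1)]) auto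
    show "AE x in ?M. norm (g x * h n x) \<le> \<bar>g x\<bar>" for n
      using h(2)[of n] by (intro AE_I2) (simp add: abs_mult mult_left_le)
    show "AE x in ?M. (\<lambda>n. g x * h n x) \<longlonglongrightarrow> g x * sgn (g x)"
      using AE_N
    proof (rule AE_mp, intro AE_I2 impI)
      fix x assume x: "x \<in> space ?M" "x \<notin> N"
      then have "(\<lambda>n. s n x) \<longlonglongrightarrow> sgn (g x)" using lim[of x] by simp
      then have "(\<lambda>n. h n x) \<longlonglongrightarrow> max (- 1) (min 1 (sgn (g x)))"
        unfolding h_def by (intro tendsto_intros)
      moreover have "max (- 1) (min 1 (sgn (g x))) = sgn (g x)" by (auto simp: sgn_if)
      ultimately show "(\<lambda>n. g x * h n x) \<longlonglongrightarrow> g x * sgn (g x)" by (intro tendsto_intros) simp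
    qed
  qed
  moreover have "(\<lambda>n. \<integral>x. g x * h n x \<partial>?M) = (\<lambda>n. 0)"
    using orthogonal_continuous[OF h] by simp
  ultimately have "(\<integral>x. g x * sgn (g x) \<partial>?M) = 0"
    by (simp add: LIMSEQ_const_iff)
  moreover have "g x * sgn (g x) = \<bar>g x\<bar>" for x by (simp add: abs_sgn)
  ultimately have "(\<integral>x. \<bar>g x\<bar> \<partial>?M) = 0" by simp
  then have "AE x in ?M. \<bar>g x\<bar> = 0"
    using integral_nonneg_eq_0_iff_AE[OF integrable_abs[OF g]] by simp
  then show ?thesis by simp
qed

end

section \<open>Injectivity of the parametrization\<close>

context
  fixes p :: real
  assumes p: "p > 0"
begin

definition real_param :: "(real \<Rightarrow> real) \<Rightarrow> real \<Rightarrow> real" where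
  "real_param \<Psi> x = (\<integral>l. \<Psi> l * kernel_real p l x \<partial>lebesgue_on {0<..<p / 2})"

text \<open>Continuity gives Borel measurability on the plane, and the identity maps from the
  Lebesgue factors to the Borel factors transport it to the product measure.\<close>

lemma kernel_real_measurable_pair:
  "(\<lambda>x. kernel_real p (fst x) (snd x)) \<in> borel_measurable (lebesgue_on S \<Otimes>\<^sub>M lebesgue_on T)"
proof -
  have "continuous_on UNIV (\<lambda>x. kernel_real p (fst x) (snd x))"
    unfolding kernel_real_def
    by (intro continuous_intros continuous_on_compose2[OF continuous_tanh_real[OF p, of UNIV]]) auto
  then have 1: "(\<lambda>x. kernel_real p (fst x) (snd x)) \<in> borel_measurable (borel \<Otimes>\<^sub>M borel)"
    unfolding borel_prod by (rule borel_measurable_continuous_onI)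
  have id: "(\<lambda>x. x) \<in> borel_measurable (lebesgue_on A)" for A :: "real set"
    by (intro measurable_restrict_space1 measurable_completion) simp
  have "(\<lambda>x. (fst x, snd x)) \<in> (lebesgue_on S \<Otimes>\<^sub>M lebesgue_on T) \<rightarrow>\<^sub>M (borel \<Otimes>\<^sub>M borel)"
    using measurable_compose[OF measurable_fst id[of S]] measurable_compose[OF measurable_snd id[of T]]
    by (intro measurable_Pair) auto
  from measurable_compose[OF this 1] show ?thesis by simp
qed

lemma kernel_real_bounded:
  obtains B where "\<And>l t. l \<in> {0..p / 2} \<Longrightarrow> t \<in> {- (p / 2)..p / 2} \<Longrightarrow> \<bar>kernel_real p l t\<bar> \<le> B"
proof -
  have "continuous_on ({0..p / 2} \<times> {- (p / 2)..p / 2}) (\<lambda>x. kernel_real p (fst x) (snd x))"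
    unfolding kernel_real_def
    by (intro continuous_intros continuous_on_compose2[OF continuous_tanh_real[OF p, of UNIV]]) auto
  then have "compact ((\<lambda>x. kernel_real p (fst x) (snd x)) ` ({0..p / 2} \<times> {- (p / 2)..p / 2}))"
    by (intro compact_continuous_image) (auto intro: compact_Times)
  then obtain B where B: "\<And>x. x \<in> {0..p / 2} \<times> {- (p / 2)..p / 2} \<Longrightarrow> norm (kernel_real p (fst x) (snd x)) \<le> B"
    by (meson compact_imp_bounded bounded_iff image_eqI)
  show ?thesis
  proof (rule that)
    fix l t assume "l \<in> {0..p / 2}" "t \<in> {- (p / 2)..p / 2}"
    then show "\<bar>kernel_real p l t\<bar> \<le> B" using B[of "(l, t)"] by simp
  qed
qed

lemma real_param_fourier:
  assumes \<Psi>: "\<Psi> \<in> Linf_ball (p / 2) (1 / 2)" and k: "k \<ge> (1::nat)"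
  shows "integral {- (p / 2)..p / 2} (\<lambda>t. real_param \<Psi> t * cos (2 * pi * real k / p * t))
    = - saw_coeff p k * (\<integral>l. \<Psi> l * sin (2 * pi * real k / p * l) \<partial>lebesgue_on {0<..<p / 2})"
proof -
  let ?M = "lebesgue_on {0<..<p / 2}" and ?N = "lebesgue_on {- (p / 2)..p / 2}"
  let ?a = "2 * pi * real k / p"
  \<comment> \<open>A representative that satisfies the bound everywhere, so that integrability on
    the product space needs no null sets there.\<close>
  define \<Phi> where "\<Phi> l = max (- (1 / 2)) (min (1 / 2) (\<Psi> l))" for l
  have m: "\<Psi> \<in> borel_measurable ?M" and b: "AE l in ?M. \<bar>\<Psi> l\<bar> \<le> 1 / 2"
    using \<Psi> by (auto simp: Linf_ball_iff)
  have \<Phi>m: "\<Phi> \<in> borel_measurable ?M" unfolding \<Phi>_def[abs_def] using m by measurable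
  have \<Phi>b: "\<bar>\<Phi> l\<bar> \<le> 1 / 2" for l by (auto simp: \<Phi>_def)
  have eq: "AE l in ?M. \<Psi> l = \<Phi> l"
    using b by (rule AE_mp) (auto simp: \<Phi>_def)
  have param_eq: "real_param \<Psi> t = (\<integral>l. \<Phi> l * kernel_real p l t \<partial>?M)" for t
    unfolding real_param_def
  proof (rule integral_cong_AE)
    have "(\<lambda>l. kernel_real p l t) \<in> borel_measurable ?M"
      unfolding kernel_real_def
      by (intro measurable_interval_continuous continuous_intros continuous_on_compose2[OF continuous_tanh_real[OF p, of UNIV]]) auto
    then show "(\<lambda>l. \<Psi> l * kernel_real p l t) \<in> borel_measurable ?M" "(\<lambda>l. \<Phi> l * kernel_real p l t) \<in> borel_measurable ?M"
      using m \<Phi>m by measurable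
    show "AE l in ?M. \<Psi> l * kernel_real p l t = \<Phi> l * kernel_real p l t"
      using eq by (rule AE_mp) auto
  qed
  obtain B where B: "\<And>l t. l \<in> {0..p / 2} \<Longrightarrow> t \<in> {- (p / 2)..p / 2} \<Longrightarrow> \<bar>kernel_real p l t\<bar> \<le> B"
    using kernel_real_bounded by blast
  have finN: "finite_measure ?N" by (rule finite_measure_lebesgue_on) simp
  interpret M: finite_measure ?M by (rule finite_measure_interval)
  interpret N: finite_measure ?N by (rule finN)
  interpret MN: pair_sigma_finite ?M ?N ..
  interpret P: finite_measure "?M \<Otimes>\<^sub>M ?N"
    by (rule finite_measure_pair_measure) unfold_locales
  have int: "integrable (?M \<Otimes>\<^sub>M ?N) (\<lambda>(l, t). \<Phi> l * (kernel_real p l t * cos (?a * t)))"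
  proof (rule P.integrable_const_bound)
    show "AE x in ?M \<Otimes>\<^sub>M ?N. norm (case x of (l, t) \<Rightarrow> \<Phi> l * (kernel_real p l t * cos (?a * t))) \<le> 1 / 2 * (B * 1)"
    proof (rule AE_I2, clarify)
      fix l t assume "(l, t) \<in> space (?M \<Otimes>\<^sub>M ?N)"
      then have lt: "l \<in> {0..p / 2}" "t \<in> {- (p / 2)..p / 2}" by (auto simp: space_pair_measure)
      have "\<bar>\<Phi> l\<bar> * (\<bar>kernel_real p l t\<bar> * \<bar>cos (?a * t)\<bar>) \<le> 1 / 2 * (B * 1)"
        using B[OF lt] \<Phi>b by (intro mult_mono) auto
      then show "norm (\<Phi> l * (kernel_real p l t * cos (?a * t))) \<le> 1 / 2 * (B * 1)"
        by (simp only: real_norm_def abs_mult)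
    qed
    have "(\<lambda>t. cos (?a * t)) \<in> borel_measurable ?N"
      by (rule continuous_imp_measurable_on_sets_lebesgue) (use p in \<open>auto intro!: continuous_intros\<close>)
    from measurable_compose[OF measurable_snd this] measurable_compose[OF measurable_fst \<Phi>m] kernel_real_measurable_pair
    show "(\<lambda>(l, t). \<Phi> l * (kernel_real p l t * cos (?a * t))) \<in> borel_measurable (?M \<Otimes>\<^sub>M ?N)"
      unfolding case_prod_unfold by (intro borel_measurable_times)
  qed
  have inner: "(\<integral>t. \<Phi> l * (kernel_real p l t * cos (?a * t)) \<partial>?N) = \<Phi> l * (- saw_coeff p k * sin (?a * l))" for l
  proof -
    have "(\<lambda>t. kernel_real p l t * cos (?a * t)) \<in> borel_measurable ?N" and c: "continuous_on {- (p / 2)..p / 2} (\<lambda>t. kernel_real p l t * cos (?a * t))"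
      unfolding kernel_real_def using p
      by (auto intro!: continuous_imp_measurable_on_sets_lebesgue continuous_intros continuous_on_compose2[OF continuous_tanh_real[OF p, of UNIV]])
    have "integrable ?N (\<lambda>t. kernel_real p l t * cos (?a * t))"
    proof -
      have "compact ((\<lambda>t. kernel_real p l t * cos (?a * t)) ` {- (p / 2)..p / 2})"
        by (rule compact_continuous_image[OF c]) simp
      then obtain C where "\<And>t. t \<in> {- (p / 2)..p / 2} \<Longrightarrow> norm (kernel_real p l t * cos (?a * t)) \<le> C"
        by (meson compact_imp_bounded bounded_iff image_eqI)
      then show ?thesis
        by (intro N.integrable_const_bound[where B = C] AE_I2 continuous_imp_measurable_on_sets_lebesgue c) auto
    qed
    then have "(\<integral>t. kernel_real p l t * cos (?a * t) \<partial>?N) = integral {- (p / 2)..p / 2} (\<lambda>t. kernel_real p l t * cos (?a * t))"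
      by (rule lebesgue_integral_eq_integral) simp
    also have "\<dots> = - saw_coeff p k * sin (?a * l)"
      by (rule integral_unique[OF kernel_fourier[OF p k]])
    finally show ?thesis by simp
  qed
  have outer: "(\<integral>l. \<Phi> l * (kernel_real p l t * cos (?a * t)) \<partial>?M) = real_param \<Psi> t * cos (?a * t)" for t
    unfolding param_eq mult.assoc[symmetric] by (rule integral_mult_left_zero)
  have "integrable ?N (\<lambda>t. real_param \<Psi> t * cos (?a * t))"
    using MN.integrable_snd[OF int] unfolding outer .
  then have "integral {- (p / 2)..p / 2} (\<lambda>t. real_param \<Psi> t * cos (?a * t)) = (\<integral>t. real_param \<Psi> t * cos (?a * t) \<partial>?N)"
    by (intro lebesgue_integral_eq_integral[symmetric]) auto
  also have "\<dots> = (\<integral>t. (\<integral>l. \<Phi> l * (kernel_real p l t * cos (?a * t)) \<partial>?M) \<partial>?N)"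
    unfolding outer ..
  also have "\<dots> = (\<integral>l. (\<integral>t. \<Phi> l * (kernel_real p l t * cos (?a * t)) \<partial>?N) \<partial>?M)"
    by (rule MN.Fubini_integral[OF int])
  also have "\<dots> = (\<integral>l. - saw_coeff p k * (\<Phi> l * sin (?a * l)) \<partial>?M)"
    unfolding inner by (simp add: mult_ac)
  also have "\<dots> = - saw_coeff p k * (\<integral>l. \<Phi> l * sin (?a * l) \<partial>?M)"
    by (rule integral_mult_right_zero)
  also have "(\<integral>l. \<Phi> l * sin (?a * l) \<partial>?M) = (\<integral>l. \<Psi> l * sin (?a * l) \<partial>?M)"
  proof (rule integral_cong_AE)
    have "(\<lambda>l. sin (?a * l)) \<in> borel_measurable ?M"
      by (intro measurable_interval_continuous continuous_intros)
    then show "(\<lambda>l. \<Phi> l * sin (?a * l)) \<in> borel_measurable ?M" "(\<lambda>l. \<Psi> l * sin (?a * l)) \<in> borel_measurable ?M"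
      using m \<Phi>m by measurable
    show "AE l in ?M. \<Phi> l * sin (?a * l) = \<Psi> l * sin (?a * l)"
      using eq by (rule AE_mp) auto
  qed
  finally show ?thesis .
qed

lemma saw_coeff_nonzero: "k \<ge> (1::nat) \<Longrightarrow> saw_coeff p k \<noteq> 0"
  using saw_coeff_value[OF p, of k] by auto

lemma Linf_ball_integrable:
  assumes "\<Psi> \<in> Linf_ball (p / 2) (1 / 2)"
  shows "integrable (lebesgue_on {0<..<p / 2}) \<Psi>"
  using assms by (intro integrable_interval[where B = "1 / 2"]) (auto simp: Linf_ball_iff)

text \<open>The data are sine coefficients, while completeness is available for cosines. Multiplying
  the difference by \<open>sin (c * l)\<close> makes it orthogonal to all cosines by the product
  formula, and this factor is positive on \<open>(0, p / 2)\<close>.\<close>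

lemma real_param_injective:
  assumes 1: "\<Psi>1 \<in> Linf_ball (p / 2) (1 / 2)" and 2: "\<Psi>2 \<in> Linf_ball (p / 2) (1 / 2)"
    and eq: "\<And>x. real_param \<Psi>1 x = real_param \<Psi>2 x"
  shows "AE l in lebesgue_on {0<..<p / 2}. \<Psi>1 l = \<Psi>2 l"
proof -
  let ?M = "lebesgue_on {0<..<p / 2}"
  define c where "c = 2 * pi / p"
  have c: "c = pi / (p / 2)" by (simp add: c_def)
  have ck: "2 * pi * real k / p * l = real k * (c * l)" for k l by (simp add: c_def)
  have sin_m: "(\<lambda>l. sin (real k * (c * l))) \<in> borel_measurable ?M" for k
    by (intro measurable_interval_continuous continuous_intros)
  have int: "integrable ?M (\<lambda>l. \<Psi> l * sin (real k * (c * l)))" if "\<Psi> \<in> Linf_ball (p / 2) (1 / 2)" for \<Psi> k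
    by (rule integrable_bounded_mult[OF Linf_ball_integrable[OF that] sin_m, where B = 1]) simp
  have zero: "(\<integral>l. (\<Psi>1 l - \<Psi>2 l) * sin (real k * (c * l)) \<partial>?M) = 0" for k
  proof (cases "k = 0")
    case False
    then have k: "k \<ge> 1" by simp
    have "- saw_coeff p k * (\<integral>l. \<Psi>1 l * sin (real k * (c * l)) \<partial>?M) = - saw_coeff p k * (\<integral>l. \<Psi>2 l * sin (real k * (c * l)) \<partial>?M)"
      by (rule trans[OF sym[OF real_param_fourier[OF 1 k, unfolded eq ck]] real_param_fourier[OF 2 k, unfolded ck]])
    then show ?thesis
      using saw_coeff_nonzero[OF k] Bochner_Integration.integral_diff[OF int[OF 1] int[OF 2], of k k]
      by (simp add: left_diff_distrib)
  qed simp
  have dint: "integrable ?M (\<lambda>l. \<Psi>1 l - \<Psi>2 l)"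
    by (intro Bochner_Integration.integrable_diff Linf_ball_integrable 1 2)
  have dint': "integrable ?M (\<lambda>l. (\<Psi>1 l - \<Psi>2 l) * sin (real k * (c * l)))" for k
    by (rule integrable_bounded_mult[OF dint sin_m, where B = 1]) simp
  have "AE l in ?M. (\<Psi>1 l - \<Psi>2 l) * sin (c * l) = 0"
  proof (rule cos_complete[of "p / 2" c])
    show "integrable ?M (\<lambda>l. (\<Psi>1 l - \<Psi>2 l) * sin (c * l))" using dint'[of 1] by simp
    fix k :: nat
    show "(\<integral>l. (\<Psi>1 l - \<Psi>2 l) * sin (c * l) * cos (real k * (c * l)) \<partial>?M) = 0"
    proof (cases k)
      case 0
      then show ?thesis using zero[of 1] by simp
    next
      case (Suc j)
      have "(\<Psi>1 l - \<Psi>2 l) * sin (c * l) * cos (real (Suc j) * (c * l)) =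
        ((\<Psi>1 l - \<Psi>2 l) * sin (real (Suc (Suc j)) * (c * l)) - (\<Psi>1 l - \<Psi>2 l) * sin (real j * (c * l))) * (1 / 2)" for l
      proof -
        have e: "real (Suc (Suc j)) * (c * l) = real (Suc j) * (c * l) + c * l" "real j * (c * l) = real (Suc j) * (c * l) - c * l"
          by (simp_all add: algebra_simps)
        have "sin (real (Suc (Suc j)) * (c * l)) - sin (real j * (c * l)) = 2 * sin (c * l) * cos (real (Suc j) * (c * l))"
          unfolding e by (simp only: sin_add sin_diff) simp
        then have "(\<Psi>1 l - \<Psi>2 l) * (sin (real (Suc (Suc j)) * (c * l)) - sin (real j * (c * l))) = (\<Psi>1 l - \<Psi>2 l) * (2 * sin (c * l) * cos (real (Suc j) * (c * l)))"
          by (simp only:)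
        then show ?thesis by (simp only: right_diff_distrib mult.assoc)
      qed
      then have "(\<integral>l. (\<Psi>1 l - \<Psi>2 l) * sin (c * l) * cos (real (Suc j) * (c * l)) \<partial>?M)
        = (\<integral>l. ((\<Psi>1 l - \<Psi>2 l) * sin (real (Suc (Suc j)) * (c * l)) - (\<Psi>1 l - \<Psi>2 l) * sin (real j * (c * l))) * (1 / 2) \<partial>?M)"
        by (simp only:)
      also have "\<dots> = 0"
        unfolding integral_mult_left_zero Bochner_Integration.integral_diff[OF dint' dint'] zero by simp
      finally show ?thesis unfolding Suc .
    qed
  qed (use p c in auto)
  then show ?thesis
  proof (rule AE_mp, intro AE_I2 impI)
    fix l assume l: "l \<in> space ?M" "(\<Psi>1 l - \<Psi>2 l) * sin (c * l) = 0"
    have "0 < c * l" "c * l < pi"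
      using l p by (auto simp: c_def field_simps)
    then have "sin (c * l) > 0" by (rule sin_gt_zero)
    then show "\<Psi>1 l = \<Psi>2 l" using l by simp
  qed
qed

end

section \<open>Boundary values and surjectivity\<close>

lemma lebesgue_interval_continuous:
  fixes f :: "real \<Rightarrow> real"
  assumes "continuous_on {0..L} f"
  shows "integrable (lebesgue_on {0<..<L}) f" "integral\<^sup>L (lebesgue_on {0<..<L}) f = integral {0..L} f"
proof -
  have "compact (f ` {0..L})" using assms by (rule compact_continuous_image) simp
  then obtain B where B: "\<And>x. x \<in> {0..L} \<Longrightarrow> norm (f x) \<le> B"
    by (meson compact_imp_bounded bounded_iff image_eqI)
  show i: "integrable (lebesgue_on {0<..<L}) f"
    by (rule integrable_interval[where B = B], rule measurable_interval_continuous, rule continuous_on_subset[OF assms])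
       (use B in \<open>auto intro!: AE_I2\<close>)
  show "integral\<^sup>L (lebesgue_on {0<..<L}) f = integral {0..L} f"
    unfolding integral_open_interval_real by (rule lebesgue_integral_eq_integral[OF i]) simp
qed

text \<open>The argument of Riesz and Fischer: the sum of the absolute increments has finite
  integral, so it is finite almost everywhere and the sequence converges there.\<close>

lemma AE_convergent_L1_summable:
  fixes g :: "nat \<Rightarrow> 'a \<Rightarrow> real"
  assumes m: "\<And>n. g n \<in> borel_measurable M"
    and int: "\<And>n. integrable M (\<lambda>x. \<bar>g (Suc n) x - g n x\<bar>)"
    and sum: "summable (\<lambda>n. \<integral>x. \<bar>g (Suc n) x - g n x\<bar> \<partial>M)"
  shows "AE x in M. convergent (\<lambda>n. g n x)"
proof -
  let ?d = "\<lambda>n x. \<bar>g (Suc n) x - g n x\<bar>"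
  have dm: "(\<lambda>x. ennreal (?d n x)) \<in> borel_measurable M" for n
    using m[of "Suc n"] m[of n] by measurable
  have "(\<integral>\<^sup>+x. (\<Sum>n. ennreal (?d n x)) \<partial>M) = (\<Sum>n. \<integral>\<^sup>+x. ennreal (?d n x) \<partial>M)"
    by (rule nn_integral_suminf[OF dm])
  also have "\<dots> = (\<Sum>n. ennreal (\<integral>x. ?d n x \<partial>M))"
    using int by (intro suminf_cong nn_integral_eq_integral) auto
  also have "\<dots> \<noteq> \<infinity>"
    unfolding infinity_ennreal_def by (rule ennreal_suminf_neq_top[OF sum]) simp
  finally have "AE x in M. (\<Sum>n. ennreal (?d n x)) \<noteq> \<infinity>"
    by (rule nn_integral_PInf_AE[rotated]) (rule borel_measurable_suminf_order, rule dm)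
  then show ?thesis
  proof (rule AE_mp, intro AE_I2 impI)
    fix x assume "(\<Sum>n. ennreal (?d n x)) \<noteq> \<infinity>"
    then have "summable (\<lambda>n. ?d n x)" by (intro summable_suminf_not_top) auto
    then have "summable (\<lambda>n. g (Suc n) x - g n x)" by (rule summable_rabs_cancel)
    then have "convergent (\<lambda>m. \<Sum>n<m. g (Suc n) x - g n x)" by (simp add: summable_iff_convergent)
    then have "convergent (\<lambda>m. g m x - g 0 x)" by (simp only: sum_lessThan_telescope[of "\<lambda>n. g n x"])
    then have "convergent (\<lambda>m. g 0 x + (g m x - g 0 x))" by (intro convergent_add convergent_const)
    then show "convergent (\<lambda>n. g n x)" by simp
  qed
qed

section \<open>Boundary values of a bounded-type function on the strip\<close>

context
  fixes p :: real and F :: "complex \<Rightarrow> complex"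
  assumes p: "p > 0"
    and hol: "F holomorphic_on strip" and per: "\<And>t. t \<in> strip \<Longrightarrow> F (t + of_real p) = F t"
    and even: "\<And>t. t \<in> strip \<Longrightarrow> F (- t) = F t" and cnj_F: "\<And>t. t \<in> strip \<Longrightarrow> F (cnj t) = cnj (F t)"
    and F0: "F 0 = 0" and Im_F: "\<And>t. t \<in> strip \<Longrightarrow> 0 \<le> Im t \<Longrightarrow> \<bar>Im (F t)\<bar> \<le> pi / 2"
begin

definition pt :: "real \<Rightarrow> real \<Rightarrow> complex" where
  "pt u x = \<i> * of_real u + of_real x"

lemma pt_strip: "pt u x \<in> strip \<longleftrightarrow> \<bar>u\<bar> < pi"
  by (simp add: pt_def strip_def)

lemma cont_F: "continuous_on strip F"
  using hol by (rule holomorphic_on_imp_continuous_on)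

lemma cont_line: "\<bar>u\<bar> < pi \<Longrightarrow> continuous_on A (\<lambda>x. F (pt u x))"
  by (rule continuous_on_compose2[OF cont_F]) (auto simp: pt_strip, auto simp: pt_def[abs_def] intro!: continuous_intros)

lemma F_pt_minus: "\<bar>u\<bar> < pi \<Longrightarrow> F (pt (- u) x) = cnj (F (pt u x))"
  using cnj_F[of "pt u x"] by (simp add: pt_strip) (simp add: pt_def)

lemma F_of_real: "F (of_real x) = of_real (Re (F (of_real x)))"
proof -
  have "cnj (F (of_real x)) = F (of_real x)" using cnj_F[of "of_real x"] by simp
  then show ?thesis by (metis Reals_cnj_iff of_real_Re)
qed

definition Y :: "real \<Rightarrow> real" where
  "Y u = integral {- (p / 2)..p / 2} (\<lambda>x. (norm (F (pt u x)))\<^sup>2)"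

lemma sq_integral:
  assumes "\<bar>u\<bar> < pi"
  shows "((\<lambda>x. (norm (F (pt u x)))\<^sup>2) has_integral Y u) {- (p / 2)..p / 2}"
  unfolding Y_def by (intro integrable_integral integrable_continuous_interval continuous_intros cont_line assms)

text \<open>
  Shifting the contour shows that the integral of \<open>F (m + d) * F (d - m)\<close> depends on \<open>m\<close> only, so the
  squared \<open>L\<^sup>2\<close> distance between two horizontal lines is a second difference of \<open>Y\<close>.
\<close>

lemma product_shift:
  assumes "\<bar>m\<bar> + \<bar>d\<bar> < pi"
  shows "((\<lambda>x. F (pt (m + d) x) * F (pt (d - m) x)) has_integral of_real (Y m)) {- (p / 2)..p / 2}"
proof -
  let ?J = "{- (p / 2)..p / 2}"
  define S where "S = {z. \<bar>Im z\<bar> < pi - \<bar>m\<bar>}"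
  have S_eq: "S = {z. Im z < pi - \<bar>m\<bar>} \<inter> {z. Im z > - (pi - \<bar>m\<bar>)}" by (auto simp: S_def)
  have S1: "open S" unfolding S_eq by (intro open_Int open_halfspace_Im_lt open_halfspace_Im_gt)
  have S2: "convex S" unfolding S_eq by (intro convex_Int convex_halfspace_Im_lt convex_halfspace_Im_gt)
  have S3: "0 \<in> S" using assms by (simp add: S_def)
  have S4: "z + of_real x \<in> S \<longleftrightarrow> z \<in> S" for z x by (simp add: S_def)
  let ?\<Phi> = "\<lambda>z. F (z + \<i> * of_real m) * F (z - \<i> * of_real m)"
  have in_strip: "z + \<i> * of_real m \<in> strip" "z - \<i> * of_real m \<in> strip" if "z \<in> S" for z
    using that by (auto simp: S_def strip_def)
  have hol1: "(\<lambda>z. F (z + \<i> * of_real m)) holomorphic_on S"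
    by (rule holomorphic_on_compose_gen[of "\<lambda>z. z + \<i> * of_real m" S F strip, OF _ hol, unfolded o_def])
      (use in_strip in \<open>auto intro!: holomorphic_intros\<close>)
  have hol2: "(\<lambda>z. F (z - \<i> * of_real m)) holomorphic_on S"
    by (rule holomorphic_on_compose_gen[of "\<lambda>z. z - \<i> * of_real m" S F strip, OF _ hol, unfolded o_def])
      (use in_strip in \<open>auto intro!: holomorphic_intros\<close>)
  have perP: "?\<Phi> (z + of_real p) = ?\<Phi> z + 0" if "z \<in> S" for z
    using per[OF in_strip(1)[OF that]] per[OF in_strip(2)[OF that]] by (simp add: algebra_simps)
  have d: "\<i> * of_real d \<in> S" using assms by (simp add: S_def)
  have "integral ?J (\<lambda>x. ?\<Phi> (\<i> * of_real d + of_real x)) = integral ?J (\<lambda>x. ?\<Phi> (of_real x)) + 0 * (\<i> * of_real d)"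
    by (rule shift_integral_on[OF S1 S2 S3 S4 holomorphic_on_mult[OF hol1 hol2] perP p d])
  moreover have "(\<lambda>x. ?\<Phi> (\<i> * of_real d + of_real x)) = (\<lambda>x. F (pt (m + d) x) * F (pt (d - m) x))"
    by (simp add: pt_def algebra_simps)
  moreover have "(\<lambda>x. ?\<Phi> (of_real x)) = (\<lambda>x. of_real ((norm (F (pt m x)))\<^sup>2))"
  proof
    fix x
    have "?\<Phi> (of_real x) = F (pt m x) * F (pt (- m) x)" by (simp add: pt_def add.commute)
    also have "\<dots> = of_real ((norm (F (pt m x)))\<^sup>2)"
      using F_pt_minus[of m x] assms by (simp add: complex_norm_square[symmetric])
    finally show "?\<Phi> (of_real x) = of_real ((norm (F (pt m x)))\<^sup>2)" .
  qed
  moreover have "integral ?J (\<lambda>x. complex_of_real ((norm (F (pt m x)))\<^sup>2)) = of_real (Y m)"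
    by (rule integral_unique[OF has_integral_of_real[OF sq_integral]]) (use assms in simp)
  ultimately have "integral ?J (\<lambda>x. F (pt (m + d) x) * F (pt (d - m) x)) = of_real (Y m)" by simp
  moreover have "(\<lambda>x. F (pt (m + d) x) * F (pt (d - m) x)) integrable_on ?J"
    by (intro integrable_continuous_interval continuous_intros cont_line) (use assms in auto)
  ultimately show ?thesis using integrable_integral by metis
qed

lemma distance_square:
  assumes "\<bar>a\<bar> < pi" "\<bar>b\<bar> < pi"
  shows "((\<lambda>x. (norm (F (pt a x) - F (pt b x)))\<^sup>2) has_integral (Y a + Y b - 2 * Y ((a + b) / 2))) {- (p / 2)..p / 2}"
proof -
  \<comment> \<open>Conjugation replaces the height \<open>b\<close> by \<open>- b\<close>. The
    product then has the form of \<open>product_shift\<close> with the half sum of \<open>a\<close>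
    and \<open>b\<close> in the role of \<open>m\<close> and their half difference in the role of
    \<open>d\<close>.\<close>
  have cross: "((\<lambda>x. F (pt a x) * cnj (F (pt b x))) has_integral of_real (Y ((a + b) / 2))) {- (p / 2)..p / 2}"
    if "\<bar>a\<bar> < pi" "\<bar>b\<bar> < pi" for a b
  proof -
    have "\<bar>(a + b) / 2\<bar> + \<bar>(a - b) / 2\<bar> < pi" 
    proof -
      have *: "\<bar>x\<bar> + \<bar>y\<bar> < r" if "x + y < r" "x - y < r" "y - x < r" "- x - y < r" for x y r :: real
        using that by linarith
      have "a < pi" "- a < pi" "b < pi" "- b < pi" using that by simp_all
      moreover have "(a + b) / 2 + (a - b) / 2 = a" "(a + b) / 2 - (a - b) / 2 = b"
        "(a - b) / 2 - (a + b) / 2 = - b" "- ((a + b) / 2) - (a - b) / 2 = - a"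
        by (simp_all add: field_simps)
      ultimately show ?thesis by (intro *) simp_all
    qed
    moreover have "(a + b) / 2 + (a - b) / 2 = a" "(a - b) / 2 - (a + b) / 2 = - b" by (simp_all add: field_simps)
    ultimately show ?thesis
      using product_shift[of "(a + b) / 2" "(a - b) / 2"] F_pt_minus[OF that(2), symmetric] by simp
  qed
  have "((\<lambda>x. (norm (F (pt a x)))\<^sup>2 + (norm (F (pt b x)))\<^sup>2 - Re (F (pt a x) * cnj (F (pt b x))) - Re (F (pt b x) * cnj (F (pt a x))))
     has_integral (Y a + Y b - Re (of_real (Y ((a + b) / 2))) - Re (of_real (Y ((b + a) / 2))))) {- (p / 2)..p / 2}"
    by (intro has_integral_add has_integral_diff has_integral_Re sq_integral cross assms)
  moreover have "(norm (F (pt a x)))\<^sup>2 + (norm (F (pt b x)))\<^sup>2 - Re (F (pt a x) * cnj (F (pt b x))) - Re (F (pt b x) * cnj (F (pt a x)))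
      = (norm (F (pt a x) - F (pt b x)))\<^sup>2" for x
    unfolding cmod_power2 by (simp add: power2_eq_square algebra_simps)
  ultimately show ?thesis by (simp add: add.commute)
qed

lemma Y_midpoint:
  assumes "\<bar>a\<bar> < pi" "\<bar>b\<bar> < pi"
  shows "2 * Y ((a + b) / 2) \<le> Y a + Y b"
  using has_integral_nonneg[OF distance_square[OF assms]] by simp

lemma Y_even: "\<bar>u\<bar> < pi \<Longrightarrow> Y (- u) = Y u"
  unfolding Y_def by (simp add: F_pt_minus)

text \<open>By the shift, the integral of \<open>F\<^sup>2\<close> over any line has real part
  \<open>Y 0\<close>. Moreover \<open>\<bar>F\<bar>\<^sup>2\<close> exceeds the real part of
  \<open>F\<^sup>2\<close> by twice the squared imaginary part, which is bounded by
  hypothesis.\<close>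

lemma Y_bounded:
  assumes "0 \<le> u" "u < pi"
  shows "Y u \<le> Y 0 + 2 * (pi / 2)\<^sup>2 * p"
proof -
  let ?J = "{- (p / 2)..p / 2}"
  have u: "\<bar>u\<bar> < pi" using assms by simp
  have "((\<lambda>x. Re (F (pt (0 + u) x) * F (pt (u - 0) x))) has_integral Re (of_real (Y 0))) ?J"
    by (rule has_integral_Re[OF product_shift]) (use u in simp)
  from has_integral_diff[OF sq_integral[OF u] this]
  have "((\<lambda>x. 2 * (Im (F (pt u x)))\<^sup>2) has_integral (Y u - Y 0)) ?J"
    unfolding cmod_power2 by (simp add: power2_eq_square)
  moreover have "((\<lambda>x. 2 * (pi / 2)\<^sup>2) has_integral (2 * (pi / 2)\<^sup>2 * p)) ?J"
    using has_integral_const_real[of "2 * (pi / 2)\<^sup>2" "- (p / 2)" "p / 2"] p by (simp add: mult.commute)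
  ultimately have "Y u - Y 0 \<le> 2 * (pi / 2)\<^sup>2 * p"
  proof (rule has_integral_le)
    fix x
    have "\<bar>Im (F (pt u x))\<bar> \<le> \<bar>pi / 2\<bar>" using Im_F[of "pt u x"] assms by (simp add: pt_strip) (simp add: pt_def)
    then show "2 * (Im (F (pt u x)))\<^sup>2 \<le> 2 * (pi / 2)\<^sup>2"
      by (simp only: abs_le_square_iff mult_le_cancel_left_pos zero_less_numeral)
  qed
  then show ?thesis by simp
qed

text \<open>On the multiples of \<open>h\<close> midpoint convexity says that increments do not
  decrease. The first one is nonnegative because \<open>0\<close> is the midpoint of
  \<open>h\<close> and \<open>- h\<close> and \<open>Y\<close> is even.\<close>

lemma Y_grid_step:
  assumes "h > 0"
  shows "real (Suc i) * h < pi \<Longrightarrow> Y (real i * h) \<le> Y (real (Suc i) * h)"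
proof (induction i)
  case 0
  then show ?case using Y_midpoint[of h "- h"] Y_even[of h] assms by simp
next
  case (Suc i)
  have "real i * h \<le> real (Suc (Suc i)) * h" "real (Suc i) * h \<le> real (Suc (Suc i)) * h"
    by (rule mult_right_mono; use assms in simp)+
  then have lt: "real i * h < pi" "real (Suc i) * h < pi" "real (Suc (Suc i)) * h < pi"
    using Suc.prems assms by linarith+
  have "0 \<le> real i * h" using assms by simp
  have "2 * Y ((real (Suc (Suc i)) * h + real i * h) / 2) \<le> Y (real (Suc (Suc i)) * h) + Y (real i * h)"
    by (rule Y_midpoint; subst abs_of_nonneg) (use lt assms in \<open>simp_all del: of_nat_Suc\<close>)
  moreover have "(real (Suc (Suc i)) * h + real i * h) / 2 = real (Suc i) * h" by (simp add: field_simps)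
  ultimately show ?case using Suc.IH[OF lt(2)] by simp
qed

lemma Y_grid_mono:
  assumes "h > 0" "i \<le> j" "real j * h < pi"
  shows "Y (real i * h) \<le> Y (real j * h)"
  using assms(2,3)
proof (induction j rule: dec_induct)
  case (step n)
  have "real n * h \<le> real (Suc n) * h" using assms(1) by simp
  then have "real n * h < pi" using step.prems by linarith
  then show ?case using step.IH Y_grid_step[OF assms(1) step.prems] by linarith
qed simp

text \<open>Dyadic heights increasing to \<open>pi\<close>: any two of them and their midpoint are
  multiples of one step, so monotonicity on grids applies to all three.\<close>

definition height :: "nat \<Rightarrow> real" where
  "height j = pi * (1 - 1 / 2 ^ j)"

lemma height: "0 \<le> height j" "height j < pi" "\<bar>height j\<bar> < pi"
proof -
  have "0 < (1::real) / 2 ^ j" "(1::real) / 2 ^ j \<le> 1" by simp_all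
  then have "0 \<le> 1 - 1 / (2::real) ^ j" "1 - 1 / (2::real) ^ j < 1" by linarith+
  then show "0 \<le> height j" "height j < pi"
    unfolding height_def by simp_all
  then show "\<bar>height j\<bar> < pi" by simp
qed

lemma height_distance:
  assumes "i \<le> j"
  shows "Y (height i) \<le> Y (height j)"
    and "((\<lambda>x. (norm (F (pt (height i) x) - F (pt (height j) x)))\<^sup>2) has_integral
            (Y (height i) + Y (height j) - 2 * Y ((height i + height j) / 2))) {- (p / 2)..p / 2}"
    and "Y (height i) + Y (height j) - 2 * Y ((height i + height j) / 2) \<le> Y (height j) - Y (height i)"
proof -
  \<comment> \<open>One dyadic level finer than \<open>height j\<close>, to include the midpoint of
    the two heights.\<close>
  define h where "h = pi / 2 ^ (j + 1)"
  have h: "h > 0" by (simp add: h_def)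
  have le: "(2::nat) ^ (j - i) \<le> 2 ^ j" "(1::nat) \<le> 2 ^ (j - i)" by (simp_all add: power_increasing)
  have rp: "(2::real) ^ (j - i) = 2 ^ j / 2 ^ i" using assms by (simp add: power_diff)
  have i: "height i = real (2 * 2 ^ j - 2 * 2 ^ (j - i)) * h"
  proof -
    have "real (2 * 2 ^ j - 2 * 2 ^ (j - i)) = 2 * 2 ^ j - 2 * (2 ^ j / 2 ^ i)"
      using le rp by (simp add: of_nat_diff)
    then show ?thesis by (simp add: height_def h_def field_simps)
  qed
  have j: "height j = real (2 * 2 ^ j - 2) * h"
  proof -
    have "real (2 * 2 ^ j - 2) = 2 * 2 ^ j - 2" by (simp add: of_nat_diff)
    then show ?thesis by (simp add: height_def h_def field_simps)
  qed
  have mid: "(height i + height j) / 2 = real (2 * 2 ^ j - 2 ^ (j - i) - 1) * h"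
  proof -
    have "2 ^ (j - i) + 1 \<le> (2::nat) * 2 ^ j" using le by linarith
    then have eq: "real (2 * 2 ^ j - 2 ^ (j - i) - 1) = 2 * 2 ^ j - 2 ^ j / 2 ^ i - 1"
      unfolding diff_diff_left using rp by (subst of_nat_diff) simp_all
    show ?thesis unfolding eq height_def h_def by (simp add: field_simps)
  qed
  have jpi: "real (2 * 2 ^ j - 2) * h < pi" using height(2)[of j] j by simp
  have ij: "2 * 2 ^ j - 2 * 2 ^ (j - i) \<le> (2::nat) * 2 ^ j - 2" using le by (intro diff_le_mono2) linarith
  have im: "2 * 2 ^ j - 2 * 2 ^ (j - i) \<le> (2::nat) * 2 ^ j - 2 ^ (j - i) - 1" using le by linarith
  have mpi: "real (2 * 2 ^ j - 2 ^ (j - i) - 1) * h < pi"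
    using height(2)[of i] height(2)[of j] unfolding mid[symmetric] by simp
  show "Y (height i) \<le> Y (height j)"
    unfolding i j by (rule Y_grid_mono[OF h ij jpi])
  have "Y (height i) \<le> Y ((height i + height j) / 2)"
    unfolding mid unfolding i by (rule Y_grid_mono[OF h im mpi])
  then show "Y (height i) + Y (height j) - 2 * Y ((height i + height j) / 2) \<le> Y (height j) - Y (height i)" by simp
  show "((\<lambda>x. (norm (F (pt (height i) x) - F (pt (height j) x)))\<^sup>2) has_integral
            (Y (height i) + Y (height j) - 2 * Y ((height i + height j) / 2))) {- (p / 2)..p / 2}"
    by (rule distance_square; rule height)
qed

text \<open>\<open>Y\<close> increases along the heights and is bounded, so it converges, and gaps
  in \<open>Y\<close> control squared distances. The choice of \<open>r n\<close> is made separately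
  for each \<open>n\<close>, so consecutive heights may come in either order, hence the case
  distinction.\<close>

lemma fast_heights:
  obtains r where "\<And>n. r n \<ge> n"
    "\<And>n. \<exists>I\<le>1 / 4 ^ n. ((\<lambda>x. (norm (F (pt (height (r (Suc n))) x) - F (pt (height (r n)) x)))\<^sup>2) has_integral I) {- (p / 2)..p / 2}"
proof -
  have inc: "incseq (\<lambda>j. Y (height j))" by (intro incseq_SucI height_distance(1)) simp
  obtain L where L: "(\<lambda>j. Y (height j)) \<longlonglongrightarrow> L" "\<And>j. Y (height j) \<le> L"
    using incseq_convergent[OF inc, of "Y 0 + 2 * (pi / 2)\<^sup>2 * p"] Y_bounded height by (metis (no_types, lifting))
  have "\<exists>j\<ge>n. L - Y (height j) \<le> 1 / 4 ^ n" for n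
  proof -
    have "eventually (\<lambda>j. Y (height j) > L - 1 / 4 ^ n) sequentially"
      by (rule order_tendstoD(1)[OF L(1)]) simp
    then have "eventually (\<lambda>j. j \<ge> n \<and> Y (height j) > L - 1 / 4 ^ n) sequentially"
      using eventually_ge_at_top[of n] by eventually_elim simp
    then obtain j where "j \<ge> n" "Y (height j) > L - 1 / 4 ^ n"
      using eventually_happens'[OF sequentially_bot] by blast
    then show ?thesis by (intro exI[of _ j]) simp
  qed
  then obtain r where r: "\<And>n. r n \<ge> n" "\<And>n. L - Y (height (r n)) \<le> 1 / 4 ^ n" by metis
  have "\<exists>I\<le>1 / 4 ^ n. ((\<lambda>x. (norm (F (pt (height (r (Suc n))) x) - F (pt (height (r n)) x)))\<^sup>2) has_integral I) {- (p / 2)..p / 2}" for n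
  proof (cases "r n \<le> r (Suc n)")
    case True
    show ?thesis
    proof (intro exI conjI)
      show "((\<lambda>x. (norm (F (pt (height (r (Suc n))) x) - F (pt (height (r n)) x)))\<^sup>2) has_integral
        (Y (height (r n)) + Y (height (r (Suc n))) - 2 * Y ((height (r n) + height (r (Suc n))) / 2))) {- (p / 2)..p / 2}"
        using height_distance(2)[OF True] by (simp only: norm_minus_commute)
      show "Y (height (r n)) + Y (height (r (Suc n))) - 2 * Y ((height (r n) + height (r (Suc n))) / 2) \<le> 1 / 4 ^ n"
        using height_distance(3)[OF True] r(2)[of n] L(2)[of "r (Suc n)"] by linarith
    qed
  next
    case False
    then have le: "r (Suc n) \<le> r n" by simp
    show ?thesis
    proof (intro exI conjI)
      show "((\<lambda>x. (norm (F (pt (height (r (Suc n))) x) - F (pt (height (r n)) x)))\<^sup>2) has_integral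
        (Y (height (r (Suc n))) + Y (height (r n)) - 2 * Y ((height (r (Suc n)) + height (r n)) / 2))) {- (p / 2)..p / 2}"
        by (rule height_distance(2)[OF le])
      have "(1::real) / 4 ^ Suc n \<le> 1 / 4 ^ n" by (simp add: field_simps)
      then show "Y (height (r (Suc n))) + Y (height (r n)) - 2 * Y ((height (r (Suc n)) + height (r n)) / 2) \<le> 1 / 4 ^ n"
        using height_distance(3)[OF le] r(2)[of "Suc n"] L(2)[of "r n"] by linarith
    qed
  qed
  with r(1) show ?thesis by (rule that)
qed

lemma height_limit:
  assumes "\<And>n. r n \<ge> n"
  shows "(\<lambda>n. height (r n)) \<longlonglongrightarrow> pi"
proof -
  have "(\<lambda>j. (1 / 2) ^ j) \<longlonglongrightarrow> (0::real)" by (rule LIMSEQ_power_zero) (simp add: norm_divide)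
  then have "(\<lambda>j. pi * (1 - (1 / 2) ^ j)) \<longlonglongrightarrow> pi * (1 - 0)" by (intro tendsto_mult tendsto_diff tendsto_const)
  then have "height \<longlonglongrightarrow> pi" by (simp add: height_def[abs_def] power_divide)
  moreover have "filterlim r at_top sequentially"
    by (rule filterlim_at_top_mono[OF filterlim_ident]) (use assms in auto)
  ultimately show ?thesis by (rule filterlim_compose)
qed

text \<open>Evenness kills the sine coefficient on the real axis, so at height \<open>u\<close> only
  the cosine coefficient contributes, with the factor \<open>- \<i> sinh (a * u)\<close>. The
  imaginary part is odd in \<open>x\<close>, which halves the interval.\<close>

lemma Im_fourier:
  assumes k: "k \<ge> (1::nat)" and u: "0 \<le> u" "u < pi"
  defines "a \<equiv> 2 * pi * real k / p"
  shows "integral {0..p / 2} (\<lambda>x. Im (F (pt u x)) * sin (a * x))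
     = - sinh (a * u) * integral {- (p / 2)..p / 2} (\<lambda>x. Re (F (of_real x)) * cos (a * x)) / 2"
proof -
  let ?J = "{- (p / 2)..p / 2}" and ?w = "\<i> * complex_of_real u"
  let ?\<alpha> = "integral ?J (\<lambda>x. Re (F (of_real x)) * cos (a * x))"
  have w: "?w \<in> strip" using u by (simp add: strip_def)
  have uu: "\<bar>u\<bar> < pi" using u by simp
  have S0: "integral ?J (\<lambda>x. F (of_real x) * sin (of_real a * of_real x)) = 0"
    by (rule integral_odd) (simp add: even)
  have C0: "integral ?J (\<lambda>x. F (of_real x) * cos (of_real a * of_real x)) = of_real ?\<alpha>"
  proof -
    have "(\<lambda>x. Re (F (of_real x)) * cos (a * x)) integrable_on ?J"
      by (intro integrable_continuous_interval continuous_intros continuous_on_compose2[OF cont_F]) auto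
    then have "integral ?J (\<lambda>x. complex_of_real (Re (F (of_real x)) * cos (a * x))) = of_real ?\<alpha>"
      by (intro integral_unique has_integral_of_real integrable_integral)
    moreover have "complex_of_real (Re (F (of_real x)) * cos (a * x)) = F (of_real x) * cos (of_real a * of_real x)" for x
      using F_of_real[of x] cos_of_real[of "a * x", where 'a = complex] by simp
    ultimately show ?thesis by simp
  qed
  have sn: "sin (of_real a * ?w) = \<i> * of_real (sinh (a * u))"
  proof -
    have "sin (\<i> * of_real (a * u)) = \<i> * of_real (sinh (a * u))"
      by (simp add: sin_exp_eq sinh_def scaleR_conv_of_real exp_of_real field_simps flip: of_real_mult of_real_minus)
    then show ?thesis by (simp add: mult_ac)
  qed
  have "integral ?J (\<lambda>x. F (?w + of_real x) * sin (of_real a * of_real x)) = - (\<i> * of_real (sinh (a * u))) * of_real ?\<alpha>"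
    using fourier_shift(2)[OF p k hol per w] unfolding a_def[symmetric] S0 C0 sn by simp
  moreover have "(\<lambda>x. F (?w + of_real x) * sin (of_real a * of_real x)) integrable_on ?J"
    by (intro integrable_continuous_interval continuous_intros continuous_on_compose2[OF cont_F]) (use w in auto)
  ultimately have "((\<lambda>x. F (?w + of_real x) * sin (of_real a * of_real x)) has_integral (- (\<i> * of_real (sinh (a * u))) * of_real ?\<alpha>)) ?J"
    unfolding has_integral_iff by (rule conjI[rotated])
  from has_integral_Im[OF this]
  have "((\<lambda>x. Im (F (?w + of_real x) * sin (of_real a * of_real x))) has_integral (- sinh (a * u) * ?\<alpha>)) ?J" by simp
  moreover have "Im (F (?w + of_real x) * sin (of_real a * of_real x)) = Im (F (pt u x)) * sin (a * x)" for x
    using sin_of_real[of "a * x", where 'a = complex] by (simp add: pt_def flip: of_real_mult)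
  ultimately have J: "((\<lambda>x. Im (F (pt u x)) * sin (a * x)) has_integral (- sinh (a * u) * ?\<alpha>)) ?J" by simp
  have odd: "Im (F (pt u (- x))) = - Im (F (pt u x))" for x
  proof -
    have "pt u (- x) = - pt (- u) x" by (simp add: pt_def)
    then have "F (pt u (- x)) = cnj (F (pt u x))"
      using even[of "pt (- u) x"] F_pt_minus[OF uu, of x] uu by (simp add: pt_strip)
    then show ?thesis by simp
  qed
  have "integral ?J (\<lambda>x. Im (F (pt u x)) * sin (a * x)) = 2 * integral {0..p / 2} (\<lambda>x. Im (F (pt u x)) * sin (a * x))"
    by (rule integral_even_half) (use J p odd in auto)
  then show ?thesis using integral_unique[OF J] by simp
qed

text \<open>Along the fast heights the imaginary parts, divided by \<open>pi\<close>, converge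
  almost everywhere. Bounded convergence carries the coefficients of \<open>Im_fourier\<close> up to
  the edge.\<close>

lemma boundary_function:
  obtains \<Psi> where "\<Psi> \<in> Linf_ball (p / 2) (1 / 2)"
    "\<And>k. k \<ge> (1::nat) \<Longrightarrow> (\<integral>l. \<Psi> l * sin (2 * pi * real k / p * l) \<partial>lebesgue_on {0<..<p / 2})
       = - sinh (2 * pi * real k / p * pi) * integral {- (p / 2)..p / 2} (\<lambda>x. Re (F (of_real x)) * cos (2 * pi * real k / p * x)) / (2 * pi)"
proof -
  let ?M = "lebesgue_on {0<..<p / 2}" and ?J = "{- (p / 2)..p / 2}"
  obtain r where r: "\<And>n. r n \<ge> n" and rI: "\<And>n. \<exists>I\<le>1 / 4 ^ n. ((\<lambda>x. (norm (F (pt (height (r (Suc n))) x) - F (pt (height (r n)) x)))\<^sup>2) has_integral I) ?J"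
    by (rule fast_heights[OF that])
  define g where "g n x = Im (F (pt (height (r n)) x)) / pi" for n x
  have gcont: "continuous_on A (g n)" for A n
    unfolding g_def[abs_def] by (intro continuous_intros cont_line height) simp
  have gm: "g n \<in> borel_measurable ?M" for n by (rule measurable_interval_continuous[OF gcont])
  have gb: "\<bar>g n x\<bar> \<le> 1 / 2" for n x
  proof -
    have "\<bar>Im (F (pt (height (r n)) x))\<bar> \<le> pi / 2"
      using height[of "r n"] by (intro Im_F) (simp_all add: pt_strip, simp add: pt_def)
    then show ?thesis by (simp add: g_def abs_div field_simps)
  qed
  let ?d = "\<lambda>n x. \<bar>g (Suc n) x - g n x\<bar>"
  have dcont: "continuous_on A (?d n)" for A n by (intro continuous_intros gcont)
  have dint: "integrable ?M (?d n)" for n by (rule lebesgue_interval_continuous(1)[OF dcont])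
  have dle: "(\<integral>x. ?d n x \<partial>?M) \<le> (p + 1) / 2 * (1 / 2) ^ n" for n
  proof -
    let ?v = "\<lambda>x. norm (F (pt (height (r (Suc n))) x) - F (pt (height (r n)) x))"
    obtain I where I: "I \<le> 1 / 4 ^ n" "((\<lambda>x. (?v x)\<^sup>2) has_integral I) ?J" using rI by blast
    have "((\<lambda>x. ((1 / 2) ^ n + 2 ^ n * (?v x)\<^sup>2) / 2) has_integral ((1 / 2) ^ n * p + 2 ^ n * I) / 2) ?J"
    proof -
      have "((\<lambda>x. (1 / 2 :: real) ^ n) has_integral ((1 / 2) ^ n * p)) ?J"
        using has_integral_const_real[of "(1 / 2 :: real) ^ n" "- (p / 2)" "p / 2"] p by (simp add: mult.commute)
      then show ?thesis by (intro has_integral_divide has_integral_add has_integral_mult_right I(2))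
    qed
    note up = this
    have pw: "?d n x \<le> ((1 / 2) ^ n + 2 ^ n * (?v x)\<^sup>2) / 2" for x
    proof -
      have "\<bar>Im (F (pt (height (r (Suc n))) x) - F (pt (height (r n)) x))\<bar> \<le> ?v x" by (rule abs_Im_le_cmod)
      then have "?d n x \<le> ?v x / pi"
        unfolding g_def diff_divide_distrib[symmetric] by (simp add: abs_div divide_right_mono)
      also have "\<dots> \<le> ?v x" using pi_gt3 mult_left_mono[of 1 pi "?v x"] by (simp add: divide_le_eq)
      \<comment> \<open>The weighted inequality between arithmetic and geometric mean: these weights
        turn a squared distance of order \<open>1 / 4 ^ n\<close> into an \<open>L\<^sup>1\<close>
        distance of order \<open>1 / 2 ^ n\<close>, which is summable.\<close>
      also have "\<dots> \<le> ((1 / 2) ^ n + 2 ^ n * (?v x)\<^sup>2) / 2"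
      proof -
        have "0 \<le> (1 / 2) ^ n * (1 - 2 ^ n * ?v x)\<^sup>2" by simp
        also have "\<dots> = (1 / 2) ^ n - 2 * ?v x + 2 ^ n * (?v x)\<^sup>2"
          by (simp add: power2_eq_square power_divide field_simps)
        finally show ?thesis by simp
      qed
      finally show ?thesis .
    qed
    have "(\<integral>x. ?d n x \<partial>?M) = integral {0..p / 2} (?d n)"
      by (rule lebesgue_interval_continuous(2)[OF dcont])
    also have "\<dots> \<le> integral ?J (?d n)"
      by (rule integral_subset_le) (use p dcont in \<open>auto intro!: integrable_continuous_interval\<close>)
    also have "\<dots> \<le> ((1 / 2) ^ n * p + 2 ^ n * I) / 2"
      by (rule has_integral_le[OF integrable_integral[OF integrable_continuous_interval[OF dcont]] up]) (rule pw)
    also have "\<dots> \<le> ((1 / 2) ^ n * p + 2 ^ n * (1 / 4 ^ n)) / 2"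
      using I(1) by (intro divide_right_mono add_left_mono mult_left_mono) auto
    also have "2 ^ n * (1 / 4 ^ n) = (1 / 2 :: real) ^ n"
      by (simp add: power_divide[symmetric] power_mult_distrib[symmetric])
    finally show ?thesis by (simp add: field_simps)
  qed
  have "summable (\<lambda>n. \<integral>x. ?d n x \<partial>?M)"
  proof (rule summable_comparison_test')
    show "summable (\<lambda>n. (p + 1) / 2 * (1 / 2 :: real) ^ n)"
      by (intro summable_mult summable_geometric) simp
    show "norm (\<integral>x. ?d n x \<partial>?M) \<le> (p + 1) / 2 * (1 / 2) ^ n" for n
      using dle[of n] by (simp add: integral_nonneg_AE)
  qed
  then have conv: "AE x in ?M. convergent (\<lambda>n. g n x)"
    by (rule AE_convergent_L1_summable[where g = g, OF gm dint])
  define \<Psi> where "\<Psi> x = lim (\<lambda>n. g n x)" for x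
  have \<Psi>m: "\<Psi> \<in> borel_measurable ?M"
    unfolding \<Psi>_def[abs_def] by (rule borel_measurable_lim_metric[OF gm])
  have \<Psi>lim: "AE x in ?M. (\<lambda>n. g n x) \<longlonglongrightarrow> \<Psi> x"
    using conv by (rule AE_mp) (auto simp: \<Psi>_def convergent_LIMSEQ_iff)
  have "AE x in ?M. \<bar>\<Psi> x\<bar> \<le> 1 / 2"
    using \<Psi>lim
  proof (rule AE_mp, intro AE_I2 impI)
    fix x assume "(\<lambda>n. g n x) \<longlonglongrightarrow> \<Psi> x"
    then have "(\<lambda>n. \<bar>g n x\<bar>) \<longlonglongrightarrow> \<bar>\<Psi> x\<bar>" by (rule tendsto_rabs)
    then show "\<bar>\<Psi> x\<bar> \<le> 1 / 2" by (rule LIMSEQ_le_const2) (use gb in auto)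
  qed
  with \<Psi>m have ball: "\<Psi> \<in> Linf_ball (p / 2) (1 / 2)" by (simp add: Linf_ball_iff)
  show ?thesis
  proof (rule that[OF ball])
    fix k :: nat assume k: "k \<ge> 1"
    define a where "a = 2 * pi * real k / p"
    define \<alpha> where "\<alpha> = integral ?J (\<lambda>x. Re (F (of_real x)) * cos (a * x))"
    have sm: "(\<lambda>l. sin (a * l)) \<in> borel_measurable ?M"
      by (intro measurable_interval_continuous continuous_intros)
    have "(\<lambda>n. \<integral>l. g n l * sin (a * l) \<partial>?M) \<longlonglongrightarrow> (\<integral>l. \<Psi> l * sin (a * l) \<partial>?M)"
    proof (rule integral_dominated_convergence)
      show "(\<lambda>l. \<Psi> l * sin (a * l)) \<in> borel_measurable ?M" using \<Psi>m sm by measurable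
      show "(\<lambda>l. g n l * sin (a * l)) \<in> borel_measurable ?M" for n using gm[of n] sm by measurable
      show "integrable ?M (\<lambda>l. 1 / 2 :: real)" by (rule finite_measure.integrable_const[OF finite_measure_interval])
      show "AE l in ?M. norm (g n l * sin (a * l)) \<le> 1 / 2" for n
      proof (rule AE_I2)
        fix l
        have "\<bar>g n l\<bar> * \<bar>sin (a * l)\<bar> \<le> 1 / 2 * 1" by (rule mult_mono) (use gb in auto)
        then show "norm (g n l * sin (a * l)) \<le> 1 / 2" by (simp add: abs_mult)
      qed
      show "AE l in ?M. (\<lambda>n. g n l * sin (a * l)) \<longlonglongrightarrow> \<Psi> l * sin (a * l)"
        using \<Psi>lim by (rule AE_mp) (auto intro!: AE_I2 tendsto_intros)
    qed
    moreover have "(\<integral>l. g n l * sin (a * l) \<partial>?M) = - sinh (a * height (r n)) * \<alpha> / (2 * pi)" for n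
    proof -
      have "(\<integral>l. g n l * sin (a * l) \<partial>?M) = integral {0..p / 2} (\<lambda>l. g n l * sin (a * l))"
        by (rule lebesgue_interval_continuous(2)) (intro continuous_intros gcont)
      also have "\<dots> = integral {0..p / 2} (\<lambda>l. 1 / pi * (Im (F (pt (height (r n)) l)) * sin (a * l)))"
        by (simp add: g_def)
      also have "\<dots> = 1 / pi * integral {0..p / 2} (\<lambda>l. Im (F (pt (height (r n)) l)) * sin (a * l))"
        by (rule integral_mult_right)
      also have "\<dots> = - sinh (a * height (r n)) * \<alpha> / (2 * pi)"
        unfolding a_def Im_fourier[OF k height(1,2)] unfolding \<alpha>_def a_def by simp
      finally show ?thesis .
    qed
    moreover have "(\<lambda>n. - sinh (a * height (r n)) * \<alpha> / (2 * pi)) \<longlonglongrightarrow> - sinh (a * pi) * \<alpha> / (2 * pi)"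
      by (intro tendsto_intros height_limit r) simp
    ultimately have "(\<integral>l. \<Psi> l * sin (a * l) \<partial>?M) = - sinh (a * pi) * \<alpha> / (2 * pi)"
      using LIMSEQ_unique by simp
    then show "(\<integral>l. \<Psi> l * sin (2 * pi * real k / p * l) \<partial>?M)
       = - sinh (2 * pi * real k / p * pi) * integral ?J (\<lambda>x. Re (F (of_real x)) * cos (2 * pi * real k / p * x)) / (2 * pi)"
      unfolding a_def \<alpha>_def .
  qed
qed

text \<open>The factor \<open>sinh (a * pi)\<close> from the boundary function cancels against
  \<open>saw_coeff_value\<close>, so \<open>F\<close> and the parametrized logarithm have equal
  cosine coefficients of positive order. On \<open>(0, p / 2)\<close> they then differ by a
  constant, which is \<open>0\<close> since both vanish at \<open>0\<close>; the identity theorem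
  extends this to the strip.\<close>

lemma log_param_surjective: "\<exists>\<Psi>\<in>Linf_ball (p / 2) (1 / 2). \<forall>t\<in>strip. F t = log_param p \<Psi> t"
proof -
  let ?M = "lebesgue_on {0<..<p / 2}" and ?J = "{- (p / 2)..p / 2}"
  obtain \<Psi> where \<Psi>: "\<Psi> \<in> Linf_ball (p / 2) (1 / 2)"
    and coeff: "\<And>k. k \<ge> (1::nat) \<Longrightarrow> (\<integral>l. \<Psi> l * sin (2 * pi * real k / p * l) \<partial>?M)
       = - sinh (2 * pi * real k / p * pi) * integral ?J (\<lambda>x. Re (F (of_real x)) * cos (2 * pi * real k / p * x)) / (2 * pi)"
    by (rule boundary_function[OF that])
  have lp: "log_param p \<Psi> (of_real x) = of_real (real_param p \<Psi> x)" for x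
    using log_param_of_real[OF p \<Psi>] by (simp add: real_param_def[OF p])
  have cont_rp: "continuous_on A (real_param p \<Psi>)" for A
  proof -
    have "continuous_on A (\<lambda>x. Re (log_param p \<Psi> (of_real x)))"
      by (intro continuous_intros continuous_on_compose2[OF holomorphic_on_imp_continuous_on[OF log_param_holomorphic[OF p \<Psi>]]]) auto
    then show ?thesis unfolding lp by simp
  qed
  have cont_FR: "continuous_on A (\<lambda>x. Re (F (of_real x)))" for A
    by (intro continuous_intros continuous_on_compose2[OF cont_F]) auto
  define u where "u x = Re (F (of_real x)) - real_param p \<Psi> x" for x
  have cont_u: "continuous_on A u" for A unfolding u_def[abs_def] by (intro continuous_intros cont_FR cont_rp)
  have u_even: "u (- x) = u x" for x
    using even[of "of_real x"] by (simp add: u_def real_param_def[OF p] kernel_real_minus[OF p])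
  define c where "c = 2 * pi / p"
  have ck: "2 * pi * real k / p * x = real k * (c * x)" for k x by (simp add: c_def)
  have u0: "integral {0..p / 2} (\<lambda>x. u x * cos (real k * (c * x))) = 0" if k: "k \<ge> 1" for k
  proof -
    let ?a = "2 * pi * real k / p"
    let ?\<alpha> = "integral ?J (\<lambda>x. Re (F (of_real x)) * cos (?a * x))"
    have "integral ?J (\<lambda>x. real_param p \<Psi> x * cos (?a * x)) = (saw_coeff p k * sinh (?a * pi)) * ?\<alpha> / (2 * pi)"
      unfolding real_param_fourier[OF p \<Psi> k] coeff[OF k] by simp
    also have "\<dots> = ?\<alpha>" unfolding saw_coeff_value[OF p k] by simp
    finally have "integral ?J (\<lambda>x. Re (F (of_real x)) * cos (?a * x)) - integral ?J (\<lambda>x. real_param p \<Psi> x * cos (?a * x)) = 0" by simp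
    moreover have "(\<lambda>x. Re (F (of_real x)) * cos (?a * x)) integrable_on ?J" "(\<lambda>x. real_param p \<Psi> x * cos (?a * x)) integrable_on ?J"
      by (intro integrable_continuous_interval continuous_on_mult cont_FR cont_rp continuous_on_cos continuous_on_mult_left continuous_on_id)+
    ultimately have "integral ?J (\<lambda>x. Re (F (of_real x)) * cos (?a * x) - real_param p \<Psi> x * cos (?a * x)) = 0"
      by (simp only: Henstock_Kurzweil_Integration.integral_diff)
    then have "integral ?J (\<lambda>x. u x * cos (?a * x)) = 0" by (simp add: u_def left_diff_distrib)
    moreover have "integral ?J (\<lambda>x. u x * cos (?a * x)) = 2 * integral {0..p / 2} (\<lambda>x. u x * cos (?a * x))"
    proof (rule integral_even_half)
      show "(\<lambda>x. u x * cos (?a * x)) integrable_on ?J"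
        by (intro integrable_continuous_interval continuous_on_mult cont_u continuous_on_cos continuous_on_mult_left continuous_on_id)
    qed (use p u_even in auto)
    ultimately show ?thesis by (simp only: ck)
  qed
  \<comment> \<open>The coefficient of order \<open>0\<close> has not been compared. Subtracting the
    mean makes it vanish, so that completeness applies.\<close>
  define \<mu> where "\<mu> = integral {0..p / 2} u / (p / 2)"
  have gcont: "continuous_on A (\<lambda>x. u x - \<mu>)" for A by (intro continuous_intros cont_u)
  have "AE x in ?M. u x - \<mu> = 0"
  proof (rule cos_complete[of "p / 2" c])
    show "integrable ?M (\<lambda>x. u x - \<mu>)" by (rule lebesgue_interval_continuous(1)[OF gcont])
    fix k :: nat
    have "(\<integral>x. (u x - \<mu>) * cos (real k * (c * x)) \<partial>?M) = integral {0..p / 2} (\<lambda>x. (u x - \<mu>) * cos (real k * (c * x)))"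
      by (rule lebesgue_interval_continuous(2)) (intro continuous_intros cont_u)
    also have "\<dots> = integral {0..p / 2} (\<lambda>x. u x * cos (real k * (c * x))) - \<mu> * integral {0..p / 2} (\<lambda>x. cos (real k * (c * x)))"
    proof -
      have "((\<lambda>x. u x * cos (real k * (c * x)) - \<mu> * cos (real k * (c * x))) has_integral
        integral {0..p / 2} (\<lambda>x. u x * cos (real k * (c * x))) - \<mu> * integral {0..p / 2} (\<lambda>x. cos (real k * (c * x)))) {0..p / 2}"
        by (intro has_integral_diff has_integral_mult_right integrable_integral integrable_continuous_interval continuous_intros cont_u)
      then show ?thesis by (simp add: left_diff_distrib integral_unique)
    qed
    also have "\<dots> = 0"
    proof (cases "k = 0")
      case True
      then show ?thesis using p by (simp add: \<mu>_def)
    next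
      case False
      then have k: "k \<ge> 1" by simp
      have "integral ?J (\<lambda>x. cos (real k * (c * x))) = 2 * integral {0..p / 2} (\<lambda>x. cos (real k * (c * x)))"
        by (rule integral_even_half) (use p in \<open>auto intro!: integrable_continuous_interval continuous_intros\<close>)
      moreover have "integral ?J (\<lambda>x. cos (real k * (c * x))) = 0"
        using integral_unique[OF integral_cos_zero[OF p k]] unfolding ck .
      ultimately show ?thesis using u0[OF k] by simp
    qed
    finally show "(\<integral>x. (u x - \<mu>) * cos (real k * (c * x)) \<partial>?M) = 0" .
  qed (use p in \<open>auto simp: c_def\<close>)
  \<comment> \<open>Passing through the integral of a nonnegative continuous function improves
    equality almost everywhere to equality at every point.\<close>
  then have "(\<integral>x. \<bar>u x - \<mu>\<bar> \<partial>?M) = 0"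
    by (intro integral_eq_zero_AE) (auto elim: eventually_mono)
  then have "integral {0..p / 2} (\<lambda>x. \<bar>u x - \<mu>\<bar>) = 0"
    using lebesgue_interval_continuous(2)[of "p / 2" "\<lambda>x. \<bar>u x - \<mu>\<bar>"] gcont by (simp add: continuous_on_rabs)
  then have hi: "((\<lambda>x. \<bar>u x - \<mu>\<bar>) has_integral 0) (cbox 0 (p / 2))"
    using integrable_integral[OF integrable_continuous_interval[OF continuous_on_rabs[OF gcont]]] by (metis cbox_interval)
  have u_const: "u x = \<mu>" if "x \<in> {0..p / 2}" for x
  proof -
    have "\<bar>u x - \<mu>\<bar> = 0"
      by (rule has_integral_0_cbox_imp_0[OF continuous_on_rabs[OF gcont] _ hi]) (use p that in auto)
    then show ?thesis by simp
  qed
  have "u 0 = 0" by (simp add: u_def F0 real_param_def[OF p] kernel_real_def)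
  then have "\<mu> = 0" using u_const[of 0] p by simp
  then have eq: "Re (F (of_real x)) = real_param p \<Psi> x" if "0 < x" "x < p / 2" for x
    using u_const[of x] that by (simp add: u_def)
  have "F t = log_param p \<Psi> t" if "t \<in> strip" for t
  proof (rule strip_identity[OF hol log_param_holomorphic[OF p \<Psi>], where \<delta> = "p / 2"])
    show "F (of_real x) = log_param p \<Psi> (of_real x)" if "0 < x" "x < p / 2" for x
      by (rule trans[OF F_of_real]) (simp only: lp eq[OF that])
  qed (use p that in auto)
  with \<Psi> show ?thesis by blast
qed

end

section \<open>From the function class to functions on the strip\<close>

lemma slit_plane_topology: "open (- \<real>\<^sub>\<le>\<^sub>0 :: complex set)" "connected (- \<real>\<^sub>\<le>\<^sub>0 :: complex set)"
proof -
  show "open (- \<real>\<^sub>\<le>\<^sub>0 :: complex set)" by (simp add: open_Compl)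
  have "- \<real>\<^sub>\<le>\<^sub>0 = exp ` strip"
    using exp_strip slit_plane_exp(1,2) by (auto intro!: image_eqI[where x = "Ln _"] simp: rev_image_eqI) 
  then show "connected (- \<real>\<^sub>\<le>\<^sub>0 :: complex set)"
    by (simp add: connected_continuous_image convex_connected[OF convex_strip] continuous_intros)
qed

lemma strip_holomorphic_cnj:
  assumes "f holomorphic_on strip"
  shows "(\<lambda>t. cnj (f (cnj t))) holomorphic_on strip"
proof -
  have "cnj ` strip = strip"
  proof
    show "strip \<subseteq> cnj ` strip" by (rule subsetI, rule image_eqI[where x = "cnj _"]) (auto simp: strip_def)
  qed (auto simp: strip_def)
  then show ?thesis
    using holomorphic_on_compose_cnj_cnj[of f strip] assms open_strip by (simp add: o_def)
qed

lemma strip_holomorphic_compose: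
  assumes "f holomorphic_on strip" "g holomorphic_on strip" "\<And>t. t \<in> strip \<Longrightarrow> g t \<in> strip"
  shows "(\<lambda>t. f (g t)) holomorphic_on strip"
  by (rule holomorphic_on_compose_gen[OF assms(2,1), unfolded o_def]) (use assms(3) in auto)

context
  fixes c p :: real and f :: "complex \<Rightarrow> complex"
  assumes c: "c > 1" and p_def: "p = 2 * ln c" and f: "f \<in> M_class c"
begin

lemma M_class_holomorphic: "f holomorphic_on (- \<real>\<^sub>\<le>\<^sub>0)"
  using f by (auto simp: M_class_def OM_plus_def intro: analytic_imp_holomorphic)

definition ray_value :: "real \<Rightarrow> real" where
  "ray_value x = Re (f (of_real x))"

lemma M_class_of_real:
  assumes "x > 0"
  shows "f (of_real x) = of_real (ray_value x)" "ray_value x \<ge> 0"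
  using f assms by (auto simp: M_class_def OM_plus_def ray_value_def complex_nonneg_Reals_iff complex_eq_iff)

lemma ray_value_one: "ray_value 1 = 1"
  using f by (simp add: M_class_def ray_value_def)

lemma ray_value_inverse:
  assumes "x > 0"
  shows "x * ray_value (1 / x) = ray_value x"
proof -
  have "of_real x * f (of_real (1 / x)) = f (of_real x)" using f assms by (simp add: M_class_def)
  then have "complex_of_real (x * ray_value (1 / x)) = of_real (ray_value x)"
    using M_class_of_real(1)[OF assms] M_class_of_real(1)[of "1 / x"] assms by simp
  then show ?thesis by (simp only: of_real_eq_iff)
qed

lemma ray_value_scale:
  assumes "x > 0"
  shows "ray_value (exp p * x) = c * ray_value x"
proof -
  have e: "exp p = c\<^sup>2" using c by (simp add: p_def exp_double)
  have pos: "c\<^sup>2 * x > 0" using c assms by simp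
  have "f (of_real (c\<^sup>2 * x)) = of_real c * f (of_real x)" using f assms by (simp add: M_class_def)
  then have "complex_of_real (ray_value (c\<^sup>2 * x)) = of_real (c * ray_value x)"
    unfolding M_class_of_real(1)[OF pos] M_class_of_real(1)[OF assms] by simp
  then show ?thesis unfolding e by (simp only: of_real_eq_iff)
qed

lemma M_class_not_constant: "\<not> f constant_on (- \<real>\<^sub>\<le>\<^sub>0)"
proof
  assume "f constant_on (- \<real>\<^sub>\<le>\<^sub>0)"
  moreover have "complex_of_real (exp p * 1) \<in> - \<real>\<^sub>\<le>\<^sub>0" "complex_of_real 1 \<in> - \<real>\<^sub>\<le>\<^sub>0"
    by (simp_all add: complex_nonpos_Reals_iff)
  ultimately have "f (of_real (exp p * 1)) = f (of_real 1)" unfolding constant_on_def by metis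
  then have "ray_value (exp p * 1) = ray_value 1" unfolding ray_value_def by simp
  then show False using ray_value_scale[of 1] ray_value_one c by simp
qed

lemma M_class_open_image: "open U \<Longrightarrow> U \<subseteq> - \<real>\<^sub>\<le>\<^sub>0 \<Longrightarrow> open (f ` U)"
  by (rule open_mapping_thm[OF M_class_holomorphic slit_plane_topology _ _ M_class_not_constant])

text \<open>By the open mapping theorem a value on the real axis would bring values with negative
  imaginary part along.\<close>

lemma Im_M_class_pos:
  assumes "Im z > 0"
  shows "Im (f z) > 0"
proof (rule ccontr)
  let ?U = "{z. Im z > 0}"
  assume "\<not> Im (f z) > 0"
  have "open (f ` ?U)"
    by (rule M_class_open_image) (auto simp: open_halfspace_Im_gt complex_nonpos_Reals_iff)
  moreover have "f z \<in> f ` ?U" using assms by simp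
  ultimately obtain e where e: "e > 0" "cball (f z) e \<subseteq> f ` ?U" using open_contains_cball by metis
  have "f z - \<i> * of_real e \<in> cball (f z) e" using e(1) by (simp add: dist_norm norm_mult)
  then have "f z - \<i> * of_real e \<in> f ` ?U" using e(2) by (rule set_mp[rotated])
  then obtain w where "Im w > 0" "f w = f z - \<i> * of_real e" by auto
  moreover have "Im (f w) \<ge> 0" if "Im w > 0" for w using f that by (simp add: M_class_def OM_plus_def)
  ultimately show False using \<open>\<not> Im (f z) > 0\<close> e(1) by force
qed

lemma holomorphic_M_class_exp: "(\<lambda>t. f (exp t)) holomorphic_on strip"
  by (rule holomorphic_on_compose_gen[OF _ M_class_holomorphic, unfolded o_def])
     (use exp_strip in \<open>auto intro!: holomorphic_intros\<close>)

lemma M_class_exp_of_real: "f (exp (of_real x)) = of_real (ray_value (exp x))"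
  using M_class_of_real(1)[of "exp x"] by (simp add: exp_of_real)

text \<open>The reflection principle: \<open>f\<close> is real on the positive axis, and the
  identity theorem is applied in exponential coordinates.\<close>

lemma M_class_cnj:
  assumes "z \<in> - \<real>\<^sub>\<le>\<^sub>0"
  shows "f (cnj z) = cnj (f z)"
proof -
  have "cnj (f (exp (cnj t))) = f (exp t)" if "t \<in> strip" for t
  proof (rule strip_identity[OF strip_holomorphic_cnj[OF holomorphic_M_class_exp] holomorphic_M_class_exp zero_less_one _ that])
    fix x :: real
    show "cnj (f (exp (cnj (of_real x)))) = f (exp (of_real x))" by (simp add: M_class_exp_of_real)
  qed
  from this[of "Ln z"] have "cnj (f (cnj z)) = f z"
    using slit_plane_exp(1,2)[OF assms] by (simp flip: exp_cnj)
  then show ?thesis by (metis complex_cnj_cnj)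
qed

lemma Im_M_class_nonzero:
  assumes "z \<in> - \<real>\<^sub>\<le>\<^sub>0" "Im z \<noteq> 0"
  shows "Im (f z) \<noteq> 0"
proof (cases "Im z > 0")
  case False
  then have "Im (f (cnj z)) > 0" using assms(2) by (intro Im_M_class_pos) simp
  then show ?thesis using M_class_cnj[OF assms(1)] by simp
qed (use Im_M_class_pos in force)

text \<open>A zero would, by openness of the image, force negative real values. But \<open>f\<close>
  is nonreal off the axis and nonnegative on it.\<close>

lemma ray_value_pos:
  assumes x: "x > 0"
  shows "ray_value x > 0"
proof (rule ccontr)
  assume "\<not> ray_value x > 0"
  then have r0: "ray_value x = 0" using M_class_of_real(2)[OF x] by simp
  have "open (f ` (- \<real>\<^sub>\<le>\<^sub>0))" by (rule M_class_open_image[OF slit_plane_topology(1)]) simp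
  moreover have "0 \<in> f ` (- \<real>\<^sub>\<le>\<^sub>0)"
    using M_class_of_real(1)[OF x] r0 x by (intro image_eqI[of _ _ "of_real x"]) simp_all
  ultimately obtain e where e: "e > 0" "cball 0 e \<subseteq> f ` (- \<real>\<^sub>\<le>\<^sub>0)" using open_contains_cball by metis
  have "- complex_of_real e \<in> cball 0 e" using e(1) by simp
  then have "- complex_of_real e \<in> f ` (- \<real>\<^sub>\<le>\<^sub>0)" using e(2) by (rule set_mp[rotated])
  then obtain w where w: "w \<in> - \<real>\<^sub>\<le>\<^sub>0" "f w = - of_real e" by (metis imageE)
  then have "Im w = 0" using Im_M_class_nonzero[OF w(1)] by force
  then have "w = of_real (Re w)" "Re w > 0" using w(1) by (auto simp: complex_eq_iff complex_nonpos_Reals_iff)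
  then have "Re (f w) \<ge> 0" using M_class_of_real(2)[of "Re w"] by (simp add: ray_value_def)
  then show False using w(2) e(1) by simp
qed

text \<open>Makes the principal logarithm of \<open>f\<close> holomorphic on the whole slit
  plane.\<close>

lemma M_class_slit:
  assumes "z \<in> - \<real>\<^sub>\<le>\<^sub>0"
  shows "f z \<in> - \<real>\<^sub>\<le>\<^sub>0"
proof (cases "Im z = 0")
  case True
  then have z: "z = of_real (Re z)" "Re z > 0" using assms by (auto simp: complex_eq_iff complex_nonpos_Reals_iff)
  then have "f z = of_real (ray_value (Re z))" "ray_value (Re z) > 0" using M_class_of_real(1) ray_value_pos by metis+
  then show ?thesis by (simp add: complex_nonpos_Reals_iff)
next
  case False
  then show ?thesis using Im_M_class_nonzero[OF assms] by (simp add: complex_nonpos_Reals_iff)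
qed

definition log_ratio :: "complex \<Rightarrow> complex" where
  "log_ratio t = Ln (f (exp t)) - t / 2"

lemma holomorphic_log_ratio: "log_ratio holomorphic_on strip"
proof -
  have "(\<lambda>t. Ln (f (exp t))) holomorphic_on strip"
    by (rule holomorphic_on_compose_gen[OF holomorphic_M_class_exp, unfolded o_def, where t = "- \<real>\<^sub>\<le>\<^sub>0"])
       (use M_class_slit[OF exp_strip] in \<open>auto intro!: holomorphic_on_Ln\<close>)
  then show ?thesis unfolding log_ratio_def[abs_def] by (rule holomorphic_on_diff) (auto intro!: holomorphic_intros)
qed

lemma log_ratio_of_real: "log_ratio (of_real x) = of_real (ln (ray_value (exp x)) - x / 2)"
  unfolding log_ratio_def M_class_exp_of_real using ray_value_pos[of "exp x"] by (simp add: Ln_of_real)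

lemma log_ratio_period:
  assumes "t \<in> strip"
  shows "log_ratio (t + of_real p) = log_ratio t"
proof (rule strip_identity[OF _ holomorphic_log_ratio zero_less_one _ assms])
  show "(\<lambda>t. log_ratio (t + of_real p)) holomorphic_on strip"
    by (rule strip_holomorphic_compose[OF holomorphic_log_ratio]) (auto intro!: holomorphic_intros simp: strip_simps)
  fix x :: real
  have "ray_value (exp (x + p)) = c * ray_value (exp x)" using ray_value_scale[of "exp x"] by (simp add: exp_add mult.commute)
  then have "ln (ray_value (exp (x + p))) = ln c + ln (ray_value (exp x))" using c ray_value_pos[of "exp x"] by (simp add: ln_mult)
  then have "log_ratio (of_real (x + p)) = log_ratio (of_real x)" unfolding log_ratio_of_real p_def by (simp add: add_divide_distrib)
  then show "log_ratio (of_real x + of_real p) = log_ratio (of_real x)" by simp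
qed

lemma log_ratio_minus:
  assumes "t \<in> strip"
  shows "log_ratio (- t) = log_ratio t"
proof (rule strip_identity[OF _ holomorphic_log_ratio zero_less_one _ assms])
  show "(\<lambda>t. log_ratio (- t)) holomorphic_on strip"
    by (rule strip_holomorphic_compose[OF holomorphic_log_ratio]) (auto intro!: holomorphic_intros simp: strip_simps)
  fix x :: real
  have "ray_value (exp x) = exp x * ray_value (exp (- x))" using ray_value_inverse[of "exp x"] by (simp add: exp_minus inverse_eq_divide)
  then have "ln (ray_value (exp x)) = x + ln (ray_value (exp (- x)))" using ray_value_pos[of "exp (- x)"] by (simp add: ln_mult)
  then have "log_ratio (of_real (- x)) = log_ratio (of_real x)" unfolding log_ratio_of_real by simp
  then show "log_ratio (- of_real x) = log_ratio (of_real x)" by simp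
qed

lemma log_ratio_cnj:
  assumes "t \<in> strip"
  shows "log_ratio (cnj t) = cnj (log_ratio t)"
proof -
  have "cnj (log_ratio (cnj t)) = log_ratio t"
    by (rule strip_identity[OF strip_holomorphic_cnj[OF holomorphic_log_ratio] holomorphic_log_ratio zero_less_one _ assms])
       (simp only: complex_cnj_complex_of_real log_ratio_of_real)
  then show ?thesis by (metis complex_cnj_cnj)
qed

text \<open>The lower bound holds because \<open>f\<close> maps the upper half plane into itself, so
  \<open>Ln (f (exp t))\<close> has positive imaginary part. The upper bound is the lower bound at
  \<open>- cnj t\<close>, where evenness and conjugation symmetry reverse the sign of the imaginary
  part.\<close>

lemma Im_log_ratio_le:
  assumes "t \<in> strip" "0 \<le> Im t"
  shows "\<bar>Im (log_ratio t)\<bar> \<le> pi / 2"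
proof -
  have ge: "- (Im s / 2) \<le> Im (log_ratio s)" if s: "s \<in> strip" "0 \<le> Im s" for s
  proof (cases "Im s = 0")
    case True
    then have "of_real (Re s) = s" by (simp add: complex_eq_iff)
    then have "Im (log_ratio s) = 0" using log_ratio_of_real[of "Re s"] by (metis Im_complex_of_real)
    then show ?thesis using True by simp
  next
    case False
    then have "Im (exp s) > 0" using s by (simp add: Im_exp strip_def sin_gt_zero)
    then have "Im (f (exp s)) > 0" by (rule Im_M_class_pos)
    then have "0 < Im (Ln (f (exp s)))"
      by (subst Im_Ln_pos_lt_imp) auto
    then show ?thesis by (simp add: log_ratio_def)
  qed
  have s: "- cnj t \<in> strip" "0 \<le> Im (- cnj t)" "cnj t \<in> strip" using assms by (auto simp: strip_def)
  have "log_ratio (- cnj t) = cnj (log_ratio t)" using log_ratio_minus[OF s(3)] log_ratio_cnj[OF assms(1)] by simp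
  then have "Im (log_ratio t) \<le> Im t / 2" using ge[OF s(1,2)] by simp
  moreover have "Im t < pi" using assms by (simp add: strip_def)
  ultimately show ?thesis using ge[OF assms] by (simp add: abs_le_iff)
qed

lemma M_param_surjective: "\<exists>\<Psi>\<in>Linf_ball (p / 2) (1 / 2). \<forall>z\<in>- \<real>\<^sub>\<le>\<^sub>0. f z = M_param p \<Psi> z"
proof -
  have p: "p > 0" using c by (simp add: p_def)
  have F0: "log_ratio 0 = 0" using log_ratio_of_real[of 0] ray_value_one by simp
  obtain \<Psi> where \<Psi>: "\<Psi> \<in> Linf_ball (p / 2) (1 / 2)" "\<forall>t\<in>strip. log_ratio t = log_param p \<Psi> t"
    using log_param_surjective[OF p holomorphic_log_ratio log_ratio_period log_ratio_minus log_ratio_cnj F0 Im_log_ratio_le] by blast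
  have "f z = M_param p \<Psi> z" if z: "z \<in> - \<real>\<^sub>\<le>\<^sub>0" for z
  proof -
    note Ln = slit_plane_exp[OF z]
    have "M_param p \<Psi> (exp (Ln z)) = exp (Ln z / 2 + log_ratio (Ln z))"
      using M_param_exp[OF Ln(1) p] \<Psi>(2) Ln(1) by simp
    also have "\<dots> = exp (Ln (f z))" unfolding log_ratio_def Ln(2) by simp
    also have "\<dots> = f z" using M_class_slit[OF z] by (intro exp_Ln) auto
    finally show ?thesis unfolding Ln(2) ..
  qed
  with \<Psi>(1) show ?thesis by blast
qed

end

section \<open>Extremal functions\<close>

context
  fixes p :: real
  assumes p: "p > 0"
begin

lemma kernel_real_integrable:
  assumes \<Psi>: "\<Psi> \<in> Linf_ball (p / 2) (1 / 2)"
  shows "integrable (lebesgue_on {0<..<p / 2}) (\<lambda>l. \<Psi> l * kernel_real p l t)"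
proof -
  have "integrable (lebesgue_on {0<..<p / 2}) (\<lambda>l. complex_of_real (\<Psi> l) * strip_kernel p l (of_real t))"
    by (rule log_param_integrable[OF p \<Psi>]) simp
  then have "integrable (lebesgue_on {0<..<p / 2}) (\<lambda>l. complex_of_real (\<Psi> l * kernel_real p l t))"
    by (simp add: strip_kernel_of_real)
  then show ?thesis by (simp only: complex_of_real_integrable_eq)
qed

lemma M_param_real_param:
  assumes "\<Psi> \<in> Linf_ball (p / 2) (1 / 2)" "x > 0"
  shows "M_param p \<Psi> (of_real x) = of_real (sqrt x * exp (real_param p \<Psi> (ln x)))"
  unfolding M_param_of_real[OF p assms] real_param_def[OF p] ..

lemma M_param_mono:
  assumes 1: "\<Psi>1 \<in> Linf_ball (p / 2) (1 / 2)" and 2: "\<Psi>2 \<in> Linf_ball (p / 2) (1 / 2)"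
    and le: "AE l in lebesgue_on {0<..<p / 2}. \<Psi>1 l \<le> \<Psi>2 l" and x: "x > 0"
  shows "Re (M_param p \<Psi>1 (of_real x)) \<le> Re (M_param p \<Psi>2 (of_real x))"
proof -
  have "real_param p \<Psi>1 (ln x) \<le> real_param p \<Psi>2 (ln x)"
    unfolding real_param_def[OF p]
  proof (rule integral_mono_AE[OF kernel_real_integrable[OF 1] kernel_real_integrable[OF 2]])
    show "AE l in lebesgue_on {0<..<p / 2}. \<Psi>1 l * kernel_real p l (ln x) \<le> \<Psi>2 l * kernel_real p l (ln x)"
      using le
      by (rule AE_mp) (auto intro!: AE_I2 mult_right_mono kernel_real_nonneg[OF p])
  qed
  then show ?thesis
    unfolding M_param_real_param[OF 1 x] M_param_real_param[OF 2 x] using x by (simp add: mult_left_mono)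
qed

lemma M_param_cong_AE:
  assumes 1: "\<Psi>1 \<in> Linf_ball (p / 2) (1 / 2)" and 2: "\<Psi>2 \<in> Linf_ball (p / 2) (1 / 2)"
    and eq: "AE l in lebesgue_on {0<..<p / 2}. \<Psi>1 l = \<Psi>2 l" and z: "z \<in> - \<real>\<^sub>\<le>\<^sub>0"
  shows "M_param p \<Psi>1 z = M_param p \<Psi>2 z"
proof -
  note Ln = slit_plane_exp[OF z]
  have "log_param p \<Psi>1 (Ln z) = log_param p \<Psi>2 (Ln z)"
    unfolding log_param_def
  proof (rule integral_cong_AE)
    show "AE l in lebesgue_on {0<..<p / 2}. of_real (\<Psi>1 l) * strip_kernel p l (Ln z) = of_real (\<Psi>2 l) * strip_kernel p l (Ln z)"
      using eq by (rule AE_mp) (auto intro!: AE_I2)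
  qed (rule borel_measurable_integrable[OF log_param_integrable[OF p 1 Ln(1)]]
        borel_measurable_integrable[OF log_param_integrable[OF p 2 Ln(1)]])+
  then have "M_param p \<Psi>1 (exp (Ln z)) = M_param p \<Psi>2 (exp (Ln z))"
    using M_param_exp[OF Ln(1) p] by simp
  then show ?thesis unfolding Ln(2) .
qed

lemma M_param_eq_iff:
  assumes 1: "\<Psi>1 \<in> Linf_ball (p / 2) (1 / 2)" and 2: "\<Psi>2 \<in> Linf_ball (p / 2) (1 / 2)"
  shows "(\<forall>z\<in>- \<real>\<^sub>\<le>\<^sub>0. M_param p \<Psi>1 z = M_param p \<Psi>2 z) \<longleftrightarrow> (AE l in lebesgue_on {0<..<p / 2}. \<Psi>1 l = \<Psi>2 l)"
proof
  assume eq: "\<forall>z\<in>- \<real>\<^sub>\<le>\<^sub>0. M_param p \<Psi>1 z = M_param p \<Psi>2 z"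
  have "real_param p \<Psi>1 t = real_param p \<Psi>2 t" for t
  proof -
    have "M_param p \<Psi>1 (of_real (exp t)) = M_param p \<Psi>2 (of_real (exp t))"
      using eq by (simp add: complex_nonpos_Reals_iff)
    then show ?thesis
      unfolding M_param_real_param[OF 1 exp_gt_zero] M_param_real_param[OF 2 exp_gt_zero] of_real_eq_iff by simp
  qed
  then show "AE l in lebesgue_on {0<..<p / 2}. \<Psi>1 l = \<Psi>2 l" by (rule real_param_injective[OF p 1 2])
next
  assume "AE l in lebesgue_on {0<..<p / 2}. \<Psi>1 l = \<Psi>2 l"
  then show "\<forall>z\<in>- \<real>\<^sub>\<le>\<^sub>0. M_param p \<Psi>1 z = M_param p \<Psi>2 z" using M_param_cong_AE[OF 1 2] by blast
qed

lemma const_Linf_ball: "\<bar>r\<bar> \<le> 1 / 2 \<Longrightarrow> (\<lambda>_. r) \<in> Linf_ball (p / 2) (1 / 2)"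
  by (simp add: Linf_ball_iff)

lemma f_min_M_param: "f_min p = M_param p (\<lambda>_. - (1 / 2))"
  and f_max_M_param: "f_max p = M_param p (\<lambda>_. 1 / 2)"
  by (simp_all add: fun_eq_iff f_min_def f_max_def M_param_def)

lemma real_param_const: "real_param p (\<lambda>_. r) t = - 2 * r * ln (sech_real p t / sech_real p 0)"
proof -
  have "continuous_on {0..p / 2} (\<lambda>l. kernel_real p l t)"
    unfolding kernel_real_def
    by (intro continuous_intros continuous_on_compose2[OF continuous_tanh_real[OF p, of UNIV]]) auto
  from lebesgue_interval_continuous(2)[OF this]
  have "(\<integral>l. kernel_real p l t \<partial>lebesgue_on {0<..<p / 2}) = - 2 * ln (sech_real p t / sech_real p 0)"
    using integral_unique[OF integral_kernel_real[OF p, of t]] by simp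
  then show ?thesis unfolding real_param_def[OF p] by simp
qed

lemma f_min_of_real:
  assumes "x > 0"
  shows "f_min p (of_real x) = of_real (sqrt x * (sech_real p (ln x) / sech_real p 0))"
proof -
  have "(\<lambda>_. - (1 / 2)) \<in> Linf_ball (p / 2) (1 / 2)" by (rule const_Linf_ball) simp
  from M_param_real_param[OF this assms] show ?thesis
    unfolding f_min_M_param real_param_const using sech_real_pos[OF p] by simp
qed

lemma f_max_of_real:
  assumes "x > 0"
  shows "f_max p (of_real x) = of_real (sqrt x * (sech_real p 0 / sech_real p (ln x)))"
proof -
  have "(\<lambda>_. 1 / 2) \<in> Linf_ball (p / 2) (1 / 2)" by (rule const_Linf_ball) simp
  from M_param_real_param[OF this assms] show ?thesis
    unfolding f_max_M_param real_param_const using sech_real_pos[OF p] by (simp add: exp_minus)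
qed

lemma f_max_eq:
  assumes "x > 0"
  shows "f_max p (of_real x) = of_real x / f_min p (of_real x)"
proof -
  have "sqrt x * (sech_real p 0 / sech_real p (ln x)) = x / (sqrt x * (sech_real p (ln x) / sech_real p 0))"
    using assms sech_real_pos[OF p, of 0] sech_real_pos[OF p, of "ln x"] real_sqrt_mult_self[of x]
    by (simp add: field_simps)
  then show ?thesis unfolding f_max_of_real[OF assms] f_min_of_real[OF assms] by simp
qed

lemma M_param_bounds:
  assumes \<Psi>: "\<Psi> \<in> Linf_ball (p / 2) (1 / 2)" and x: "x > 0"
  shows "Re (f_min p (of_real x)) \<le> Re (M_param p \<Psi> (of_real x))"
    and "Re (M_param p \<Psi> (of_real x)) \<le> Re (f_max p (of_real x))"
proof -
  have AE: "AE l in lebesgue_on {0<..<p / 2}. \<bar>\<Psi> l\<bar> \<le> 1 / 2" using \<Psi> by (simp add: Linf_ball_iff)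
  show "Re (f_min p (of_real x)) \<le> Re (M_param p \<Psi> (of_real x))" unfolding f_min_M_param
    by (rule M_param_mono[OF const_Linf_ball \<Psi> _ x]) (use AE in \<open>auto elim!: eventually_mono\<close>)
  show "Re (M_param p \<Psi> (of_real x)) \<le> Re (f_max p (of_real x))" unfolding f_max_M_param
    by (rule M_param_mono[OF \<Psi> const_Linf_ball _ x]) (use AE in \<open>auto elim!: eventually_mono\<close>)
qed

lemma sech_real_zero_ge: "1 \<le> sech_real p 0"
proof -
  have "(\<Sum>n\<in>{0::int}. 1 / cosh ((0 + p * of_int n) / 2)) \<le> sech_real p 0"
    by (rule has_sum_mono_neutral[OF has_sum_finite sech_real_has_sum[OF p]]) auto
  then show ?thesis by simp
qed

lemma f_min_elliptic:
  assumes m: "0 < m" "m < 1" "4 * pi * elliptic_K m / elliptic_K' m = p" and x: "x > 0"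
  shows "f_min p (of_real x) = of_real (sqrt x / (sqrt m + 1) *
             (jacobi_dn (elliptic_K' m * ln x / pi) m + sqrt m * jacobi_cn (elliptic_K' m * ln x / pi) m))"
    and "f_max p (of_real x) = of_real ((sqrt m + 1) * sqrt x /
             (jacobi_dn (elliptic_K' m * ln x / pi) m + sqrt m * jacobi_cn (elliptic_K' m * ln x / pi) m))"
proof -
  obtain m' where m': "0 < m'" "m' < 1" "4 * pi * elliptic_K m' / elliptic_K' m' = p"
    and s': "\<forall>t. sech_real p t = elliptic_K' m' / pi * (jacobi_dn (elliptic_K' m' * t / pi) m' + sqrt m' * jacobi_cn (elliptic_K' m' * t / pi) m')"
    using sech_real_elliptic[OF p] by metis
  \<comment> \<open>The Jacobi form comes with a parameter of its own; uniqueness of the solution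
    identifies it with the given \<open>m\<close>.\<close>
  have "m' = m" by (rule elliptic_nome_unique[OF m'(1,2) m(1,2)]) (simp only: m m')
  note s = s'[unfolded this, rule_format]
  have s0: "sech_real p 0 = elliptic_K' m / pi * (1 + sqrt m)"
    using s[of 0] m(1,2) by (simp add: jacobi_cn_0 jacobi_dn_0)
  have K: "elliptic_K' m > 0" unfolding elliptic_K'_def by (rule elliptic_K_pos) (use m in auto)
  let ?j = "jacobi_dn (elliptic_K' m * ln x / pi) m + sqrt m * jacobi_cn (elliptic_K' m * ln x / pi) m"
  have eq: "sech_real p (ln x) / sech_real p 0 = ?j / (sqrt m + 1)"
    unfolding s[of "ln x"] s0 using K by (simp add: add.commute)
  show "f_min p (of_real x) = of_real (sqrt x / (sqrt m + 1) * ?j)"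
    unfolding f_min_of_real[OF x] eq by simp
  have "sech_real p 0 / sech_real p (ln x) = inverse (?j / (sqrt m + 1))" unfolding eq[symmetric] by simp
  then show "f_max p (of_real x) = of_real ((sqrt m + 1) * sqrt x / ?j)"
    unfolding f_max_of_real[OF x] by (simp add: mult.commute)
qed

lemma elliptic_nome_exists_unique: "\<exists>!m. 0 < m \<and> m < 1 \<and> 4 * pi * elliptic_K m / elliptic_K' m = p"
proof -
  obtain m where m: "0 < m" "m < 1" "4 * pi * elliptic_K m / elliptic_K' m = p"
    by (rule sech_real_elliptic[OF p])
  show ?thesis
  proof (rule ex1I[of _ m])
    fix m' assume m': "0 < m' \<and> m' < 1 \<and> 4 * pi * elliptic_K m' / elliptic_K' m' = p"
    show "m' = m" by (rule elliptic_nome_unique) (simp_all only: m m')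
  qed (use m in simp)
qed

text \<open>The single term \<open>n = 0\<close> of the secant sum corresponds to the harmonic mean
  of \<open>1\<close> and \<open>x\<close>, the infimum over all classes.\<close>

lemma sqrt_div_cosh:
  assumes "x > 0"
  shows "sqrt x * (1 / cosh (ln x / 2)) = 2 * x / (1 + x)"
proof -
  have e: "exp (ln x / 2) = sqrt x"
    using exp_ln[of "sqrt x"] assms unfolding ln_sqrt[OF less_imp_le[OF assms]] by simp
  have "cosh (ln x / 2) = (sqrt x + 1 / sqrt x) / 2"
    unfolding cosh_field_def exp_minus e by (simp add: inverse_eq_divide)
  also have "\<dots> = (x + 1) / (2 * sqrt x)" using assms by (simp add: field_simps)
  finally have c: "cosh (ln x / 2) = (x + 1) / (2 * sqrt x)" .
  show ?thesis unfolding c using assms by (simp add: add.commute)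
qed

lemma f_min_ge:
  assumes x: "x > 0"
  shows "2 * x / (1 + x) \<le> Re (f_min p (of_real x))"
proof -
  have "1 / cosh (ln x / 2) \<le> sech_real p (ln x) / sech_real p 0"
    using sech_real_ge[OF p, of "ln x"] sech_real_pos[OF p, of 0] by (simp add: field_simps)
  then have "sqrt x * (1 / cosh (ln x / 2)) \<le> sqrt x * (sech_real p (ln x) / sech_real p 0)"
    using x by (intro mult_left_mono) auto
  then show ?thesis unfolding f_min_of_real[OF x] sqrt_div_cosh[OF x] by simp
qed

lemma Re_f_max:
  assumes x: "x > 0"
  shows "Re (f_max p (of_real x)) = x / Re (f_min p (of_real x))"
  unfolding f_max_eq[OF x] f_min_of_real[OF x] of_real_divide[symmetric] by (simp only: Re_complex_of_real)

lemma f_max_le: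
  assumes x: "x > 0"
  shows "Re (f_max p (of_real x)) \<le> (1 + x) / 2"
proof -
  have "x / Re (f_min p (of_real x)) \<le> x / (2 * x / (1 + x))"
    by (rule divide_left_mono[OF f_min_ge[OF x]]) (use x f_min_ge[OF x] in \<open>auto intro!: mult_pos_pos divide_pos_pos intro: less_le_trans[rotated]\<close>)
  then show ?thesis unfolding Re_f_max[OF x] using x by simp
qed

lemma f_min_le:
  assumes x: "x > 0"
  shows "Re (f_min p (of_real x)) \<le> 2 * x / (1 + x) + sqrt x * (2 * exp (\<bar>ln x\<bar> / 2) * (2 * exp (- (p / 2)) / (1 - exp (- (p / 2)))))"
proof -
  have "sech_real p (ln x) / sech_real p 0 \<le> sech_real p (ln x)"
    using sech_real_zero_ge sech_real_pos[OF p, of "ln x"] by (simp add: divide_le_eq mult_le_cancel_left1)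
  also note sech_real_le[OF p, of "ln x"]
  finally have "sqrt x * (sech_real p (ln x) / sech_real p 0) \<le> sqrt x * (1 / cosh (ln x / 2) + 2 * exp (\<bar>ln x\<bar> / 2) * (2 * exp (- (p / 2)) / (1 - exp (- (p / 2)))))"
    using x by (intro mult_left_mono) auto
  then show ?thesis unfolding f_min_of_real[OF x] distrib_left sqrt_div_cosh[OF x] by simp
qed

end

section \<open>The limit of long periods and the union of all classes\<close>

lemma f_min_tendsto:
  assumes x: "x > 0"
  shows "(\<lambda>n. Re (f_min (2 * real (Suc n)) (of_real x))) \<longlonglongrightarrow> 2 * x / (1 + x)"
proof -
  \<comment> \<open>The upper bound \<open>f_min_le\<close> as a function of
    \<open>q = exp (- (p / 2))\<close>. The periods \<open>2 * real (Suc n)\<close> belong to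
    \<open>c = exp (real (Suc n))\<close>, so \<open>q\<close> tends to \<open>0\<close>; the
    successor keeps \<open>c\<close> above 1.\<close>
  let ?C = "\<lambda>q. 2 * x / (1 + x) + sqrt x * (2 * exp (\<bar>ln x\<bar> / 2) * (2 * q / (1 - q)))"
  have q: "(\<lambda>n. exp (- real (Suc n))) \<longlonglongrightarrow> 0"
    by (rule filterlim_compose[OF exp_at_bot]) (simp add: filterlim_uminus_at_bot filterlim_real_sequentially filterlim_sequentially_Suc[of real] del: of_nat_Suc)
  have "(\<lambda>n. ?C (exp (- real (Suc n)))) \<longlonglongrightarrow> ?C 0"
    by (intro tendsto_intros q) simp
  then have lim: "(\<lambda>n. ?C (exp (- real (Suc n)))) \<longlonglongrightarrow> 2 * x / (1 + x)" by simp
  have "\<forall>\<^sub>F n in sequentially. Re (f_min (2 * real (Suc n)) (of_real x)) \<le> ?C (exp (- real (Suc n)))"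
  proof (intro always_eventually allI)
    fix n
    have "2 * real (Suc n) / 2 = real (Suc n)" by simp
    then show "Re (f_min (2 * real (Suc n)) (of_real x)) \<le> ?C (exp (- real (Suc n)))"
      using f_min_le[of "2 * real (Suc n)" x, OF _ x] by (simp only:)
  qed
  moreover have "\<forall>\<^sub>F n in sequentially. 2 * x / (1 + x) \<le> Re (f_min (2 * real (Suc n)) (of_real x))"
    using f_min_ge[OF _ x] by (intro always_eventually allI) simp
  ultimately show ?thesis by (rule tendsto_sandwich[OF _ _ tendsto_const lim, rotated])
qed

lemma f_min_M_class: "f_min (2 * ln c) \<in> M_class c"
  and f_max_M_class: "f_max (2 * ln c) \<in> M_class c" if c: "c > 1"
proof -
  have p: "2 * ln c > 0" using c by simp
  show "f_min (2 * ln c) \<in> M_class c" "f_max (2 * ln c) \<in> M_class c"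
    unfolding f_min_M_param[OF p] f_max_M_param[OF p]
    by (rule M_param_in_M_class[OF p const_Linf_ball[OF p] c refl]; simp)+
qed

lemma M_class_bounds:
  assumes c: "c > 1" and f: "f \<in> M_class c" and x: "x > 0"
  shows "Re (f_min (2 * ln c) (of_real x)) \<le> Re (f (of_real x))" "Re (f (of_real x)) \<le> Re (f_max (2 * ln c) (of_real x))"
proof -
  have p: "2 * ln c > 0" using c by simp
  obtain \<Psi> where \<Psi>: "\<Psi> \<in> Linf_ball (2 * ln c / 2) (1 / 2)" "\<forall>z\<in>- \<real>\<^sub>\<le>\<^sub>0. f z = M_param (2 * ln c) \<Psi> z"
    using M_param_surjective[OF c refl f] by blast
  have "f (of_real x) = M_param (2 * ln c) \<Psi> (of_real x)"
    using \<Psi>(2) x by (simp add: complex_nonpos_Reals_iff)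
  then show "Re (f_min (2 * ln c) (of_real x)) \<le> Re (f (of_real x))" "Re (f (of_real x)) \<le> Re (f_max (2 * ln c) (of_real x))"
    using M_param_bounds[OF p \<Psi>(1) x] by simp_all
qed

text \<open>Reading the scaling law backwards replaces \<open>c\<close> by its reciprocal, which
  reduces the union over all scalars to those above 1.\<close>

lemma M_class_inverse:
  assumes c: "c > 0" and f: "f \<in> M_class c"
  shows "f \<in> M_class (1 / c)"
proof -
  have "f (of_real ((1 / c)\<^sup>2 * x)) = of_real (1 / c) * f (of_real x)" if "x > 0" for x
  proof -
    have scale: "\<forall>y>0. f (of_real (c\<^sup>2 * y)) = of_real c * f (of_real y)" using f unfolding M_class_def by blast
    have "f (of_real (c\<^sup>2 * ((1 / c)\<^sup>2 * x))) = of_real c * f (of_real ((1 / c)\<^sup>2 * x))"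
      by (rule scale[rule_format]) (use c that in simp)
    moreover have "c\<^sup>2 * ((1 / c)\<^sup>2 * x) = x" using c by (simp add: power_divide)
    ultimately show ?thesis using c by (simp only: of_real_divide of_real_1) (simp add: field_simps)
  qed
  then show ?thesis using f by (simp only: M_class_def mem_Collect_eq) blast
qed

lemma M_all_bounds:
  assumes f: "f \<in> M_all" and x: "x > 0"
  shows "2 * x / (1 + x) \<le> Re (f (of_real x))" "Re (f (of_real x)) \<le> (1 + x) / 2"
proof -
  obtain c where "c > 1" "f \<in> M_class c"
  proof -
    from f obtain c where c: "c > 0" "c \<noteq> 1" "f \<in> M_class c" by (auto simp: M_all_def)
    show ?thesis
    proof (cases "c > 1")
      case False
      then have "1 / c > 1" using c by simp
      then show ?thesis using that M_class_inverse[OF c(1,3)] by blast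
    qed (use c that in blast)
  qed
  note b = M_class_bounds[OF this x]
  have p: "2 * ln c > 0" using \<open>c > 1\<close> by simp
  show "2 * x / (1 + x) \<le> Re (f (of_real x))" "Re (f (of_real x)) \<le> (1 + x) / 2"
    using b f_min_ge[OF p x] f_max_le[OF p x] by linarith+
qed

lemma extremal_M_all: "f_min (2 * real (Suc n)) \<in> M_all" "f_max (2 * real (Suc n)) \<in> M_all"
proof -
  have "exp (real (Suc n)) > 1" by simp
  from f_min_M_class[OF this] f_max_M_class[OF this]
  show "f_min (2 * real (Suc n)) \<in> M_all" "f_max (2 * real (Suc n)) \<in> M_all"
    unfolding M_all_def using \<open>exp (real (Suc n)) > 1\<close> by (auto intro!: bexI[of _ "exp (real (Suc n))"])
qed

lemma INF_M_all:
  assumes x: "x > 0"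
  shows "(INF f\<in>M_all. ereal (Re (f (of_real x)))) = ereal (2 * x / (1 + x))"
proof (rule antisym)
  show "(INF f\<in>M_all. ereal (Re (f (of_real x)))) \<le> ereal (2 * x / (1 + x))"
  proof (rule LIMSEQ_le_const)
    show "(\<lambda>n. ereal (Re (f_min (2 * real (Suc n)) (of_real x)))) \<longlonglongrightarrow> ereal (2 * x / (1 + x))"
      using f_min_tendsto[OF x] by (simp only: lim_ereal)
  qed (intro exI allI impI INF_lower extremal_M_all)
qed (use M_all_bounds(1)[OF _ x] in \<open>auto intro!: INF_greatest\<close>)

lemma SUP_M_all:
  assumes x: "x > 0"
  shows "(SUP f\<in>M_all. ereal (Re (f (of_real x)))) = ereal ((1 + x) / 2)"
proof (rule antisym)
  have eq: "Re (f_max (2 * real (Suc n)) (of_real x)) = x / Re (f_min (2 * real (Suc n)) (of_real x))" for n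
    by (rule Re_f_max[OF _ x]) simp
  have "(\<lambda>n. x / Re (f_min (2 * real (Suc n)) (of_real x))) \<longlonglongrightarrow> x / (2 * x / (1 + x))"
    by (intro tendsto_divide tendsto_const f_min_tendsto x) (use x in simp)
  then have "(\<lambda>n. Re (f_max (2 * real (Suc n)) (of_real x))) \<longlonglongrightarrow> (1 + x) / 2"
    unfolding eq using x by simp
  then have lim: "(\<lambda>n. ereal (Re (f_max (2 * real (Suc n)) (of_real x)))) \<longlonglongrightarrow> ereal ((1 + x) / 2)"
    by (simp only: lim_ereal)
  show "ereal ((1 + x) / 2) \<le> (SUP f\<in>M_all. ereal (Re (f (of_real x))))"
    by (rule LIMSEQ_le_const2[OF lim]) (intro exI allI impI SUP_upper extremal_M_all)
qed (use M_all_bounds(2)[OF _ x] in \<open>auto intro!: SUP_least\<close>)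

theorem theorem19:
  fixes c p :: real
  assumes "c > 1" and "p = 2 * ln c"
  shows
    "(\<forall>\<Psi> \<in> Linf_ball (p / 2) (1 / 2). M_param p \<Psi> \<in> M_class c) \<and>
     (\<forall>f \<in> M_class c. \<exists>\<Psi> \<in> Linf_ball (p / 2) (1 / 2). \<forall>z \<in> - \<real>\<^sub>\<le>\<^sub>0. f z = M_param p \<Psi> z) \<and>
     (\<forall>\<Psi>1 \<in> Linf_ball (p / 2) (1 / 2). \<forall>\<Psi>2 \<in> Linf_ball (p / 2) (1 / 2).
        (\<forall>z \<in> - \<real>\<^sub>\<le>\<^sub>0. M_param p \<Psi>1 z = M_param p \<Psi>2 z) \<longleftrightarrow>
        (AE l in lebesgue_on {0<..<p / 2}. \<Psi>1 l = \<Psi>2 l)) \<and>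
     (\<forall>\<Psi>1 \<in> Linf_ball (p / 2) (1 / 2). \<forall>\<Psi>2 \<in> Linf_ball (p / 2) (1 / 2).
        (AE l in lebesgue_on {0<..<p / 2}. \<Psi>1 l \<le> \<Psi>2 l) \<longrightarrow>
        (\<forall>x::real. x > 0 \<longrightarrow> Re (M_param p \<Psi>1 (of_real x)) \<le> Re (M_param p \<Psi>2 (of_real x)))) \<and>
     (\<forall>f \<in> M_class c. \<forall>x::real. x > 0 \<longrightarrow>
        Re (f_min p (of_real x)) \<le> Re (f (of_real x)) \<and>
        Re (f (of_real x)) \<le> Re (f_max p (of_real x))) \<and>
     f_min p \<in> M_class c \<and> f_max p \<in> M_class c \<and>
     (\<exists>!m::real. 0 < m \<and> m < 1 \<and> 4 * pi * elliptic_K m / elliptic_K' m = p) \<and>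
     (\<forall>m::real. 0 < m \<and> m < 1 \<and> 4 * pi * elliptic_K m / elliptic_K' m = p \<longrightarrow>
        (\<forall>x::real. x > 0 \<longrightarrow>
           f_min p (of_real x) = of_real (sqrt x / (sqrt m + 1) *
             (jacobi_dn (elliptic_K' m * ln x / pi) m +
              sqrt m * jacobi_cn (elliptic_K' m * ln x / pi) m)) \<and>
           f_max p (of_real x) = of_real x / f_min p (of_real x) \<and>
           f_max p (of_real x) = of_real ((sqrt m + 1) * sqrt x /
             (jacobi_dn (elliptic_K' m * ln x / pi) m +
              sqrt m * jacobi_cn (elliptic_K' m * ln x / pi) m)))) \<and>
     (\<forall>x::real. x > 0 \<longrightarrow>
        (INF f \<in> M_all. ereal (Re (f (of_real x)))) = ereal (2 * x / (1 + x)) \<and>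
        (SUP f \<in> M_all. ereal (Re (f (of_real x)))) = ereal ((1 + x) / 2))"
proof -
  have p: "p > 0" using assms by simp
  show ?thesis
  proof (intro conjI)
    show "\<forall>\<Psi> \<in> Linf_ball (p / 2) (1 / 2). M_param p \<Psi> \<in> M_class c"
      using M_param_in_M_class[OF p _ assms] by blast
    show "\<forall>f \<in> M_class c. \<exists>\<Psi> \<in> Linf_ball (p / 2) (1 / 2). \<forall>z \<in> - \<real>\<^sub>\<le>\<^sub>0. f z = M_param p \<Psi> z"
      using M_param_surjective[OF assms] by blast
    show "\<exists>!m::real. 0 < m \<and> m < 1 \<and> 4 * pi * elliptic_K m / elliptic_K' m = p"
      by (rule elliptic_nome_exists_unique[OF p])
  qed (use M_param_eq_iff[OF p] M_param_mono[OF p] M_class_bounds[OF assms(1), folded assms(2)]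
      f_min_M_class[OF assms(1), folded assms(2)] f_max_M_class[OF assms(1), folded assms(2)]
      f_min_elliptic[OF p] f_max_eq[OF p] INF_M_all SUP_M_all in blast)+
qed

end
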